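(* Consider the PDE-ODE loop (see context for the data) $$\frac{d\bar x}{dt}(t)=\tilde F(\bar x(t),v[t],u(t)),\quad t\ge0,$$ $$\frac{\partial v}{\partial t}(t,z)+c\frac{\partial v}{\partial z}(t,z)=a(z)v(t,z)+g(z,\bar x(t))+\sum_{i=1}^{N_1}b_i(z)v(t,z_i)+\sum_{i=1}^{N_2}\beta_i(z)\int_0^1\gamma_i(s)v(t,s)ds,\quad (t,z)\in\mathbb{R}_+\times[0,1],$$ $$v(t,0)=0,\quad t\ge0,$$ with initial condition $v[0]=v_0$, $\bar x(0)=\bar x_0$. Call $(v_0,\bar x_0)\in C^1([0,1])\times\mathbb{R}^{\bar n}$ compatible if $v_0(0)=0$ and $cv_0'(0)=g(0,\bar x_0)+\sum_{i=1}^{N_1}b_i(0)v_0(z_i)+\sum_{i=1}^{N_2}\beta_i(0)\int_0^1\gamma_i(s)v_0(s)ds$. Suppose the following. (1) $\tilde F:\mathbb{R}^{\bar n}\times C^0([0,1])\times\mathbb{R}^m\to\mathbb{R}^{\bar n}$ is continuous, $g\in C^1([0,1]\times\mathbb{R}^{\bar n};\mathbb{R})$, $\tilde F(0,0,0)=0$, $g(z,0)=0$ for all $z\in[0,1]$, and there is a constant $L>0$ such that $|\tilde F(x,v,u)-\tilde F(y,w,u)|\le L\|v-w\|_\infty+L|x-y|$ and $\max_{0\le z\le1}|g(z,x)-g(z,y)|\le L|x-y|$ for all $v,w\in C^0([0,1])$, $x,y\in\mathbb{R}^{\bar n}$, $u\in\mathbb{R}^m$. (2) There exists a constant $G>0$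 such that for every compatible $(v_0,\bar x_0)$ there exist $\bar x\in C^0([-r,0];\mathbb{R}^{\bar n})$, $\eta\in C^0([-r,0];\mathbb{R}^{N_1})$, $\lambda\in C^0([-r,0];\mathbb{R}^{N_2})$ with $\bar x(0)=\bar x_0$, $\eta_i(0)=v_0(z_i)$ ($i=1,\ldots,N_1$), $\lambda_i(0)=\int_0^1\gamma_i(z)v_0(z)dz$ ($i=1,\ldots,N_2$) and $\|\bar x\|+\|\eta\|+\|\lambda\|\le G(\|v_0\|_\infty+\|v_0'\|_\infty+|\bar x_0|)$ that satisfy $$v_0(s)=\int_{-rs}^0\frac{C(s)}{C(cp+s)}\,\bar g(cp+s,\bar x(p),\eta(p),\lambda(p))\,dp\quad\text{for all }s\in[0,1].$$ (3) There exists a constant $L>0$ such that $\max_{0\le z\le1}\left|\frac{\partial g}{\partial z}(z,x)-\frac{\partial g}{\partial z}(z,y)\right|\le L|x-y|$ for all $x,y\in\mathbb{R}^{\bar n}$. (4) The system $\dot z(t)=F(z_t,y(t),u(t))$, $\hat x_t=\Psi(z_t)$, with $z(t)\in\mathbb{R}^l$, is a Robust Exponential Observer (REO) for the delay system $\dot x=f(x_t,u,d)$, $y=h(x_t)+\xi$ with $U=\mathbb{R}^m$, $D=\{0\}$, where $f$, $h$ are the mappings defined in the context. (5) For every bounded $S\subset C^0([-r,0];\mathbb{R}^l)\times\mathbb{R}^m$ there exists a constant $L_S\ge0$ such that $|R(\Psi(z),u,0)-R(\Psi(\bar z),u,0)|\le L_S\|z-\bar z\|$ for all $(z,u),(\bar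 z,u)\in S$, where $R$ is the mapping defined in the context. Then there exist constants $\delta,P,\omega>0$ and a function $\bar a\in K_\infty$ such that for every sampling sequence $\{\tau_i\}_{i=0}^\infty$ with $\tau_0=0$, $\lim(\tau_i)=+\infty$, $0<\tau_{i+1}-\tau_i\le\delta$ for $i=0,1,\ldots$, for every compatible $(v_0,\bar x_0)\in C^1([0,1])\times\mathbb{R}^{\bar n}$, every $z_0\in C^0([-r,0];\mathbb{R}^l)$, $u\in C^0(\mathbb{R}_+;\mathbb{R}^m)$ and $\xi\in L^\infty_{loc}(\mathbb{R}_+;\mathbb{R}^k)$, the solution $(\bar x(t),v[t],z(t),w(t))$ of the PDE-ODE loop together with $$\dot z(t)=F(z_t,w(t),u(t)),\ t\ge 0;\qquad \dot w(t)=R(\Psi(z_t),u(t),0),\ t\in[\tau_i,\tau_{i+1});\qquad \hat x_t=\Psi(z_t),\ t\ge 0;$$ $$w_j(\tau_i)=\xi_j(\tau_i)+q_j^T\bar x(\tau_i)+\sum_{l=1}^{N_1}\bar b_{j,l}v(\tau_i,z_l)+\sum_{l=1}^{N_2}\bar\beta_{j,l}\int_0^1\gamma_l(s)v(\tau_i,s)ds,\quad j=1,\ldots,k,\ i=0,1,\ldots;$$ $$\hat v(t,z)=\int_{t-rz}^t\frac{C(z)}{C(z-c(t-p))}\,\bar g(z-c(t-p),\hat x(p))\,dp,\quad t\ge0,\ z\in[0,1],$$ with initial condition $(\bar x_0,v_0,z_0)$, corresponding to inputs $u,\xi$, exists for all $t\ge0$ and satisfies for all $t\ge 0$ $$|\bar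 x(t)-H\hat x(t)|+\|v[t]-\hat v[t]\|_\infty\le\exp(-\omega t)\,\bar a\left(\|v_0\|_\infty+\|v_0'\|_\infty+|\bar x_0|+\|z_0\|\right)+P\sup_{0\le s\le t}\left(|\xi(s)|\exp(-\omega(t-s))\right),$$ where $H\in\mathbb{R}^{\bar n\times n}$ is the matrix for which $\bar x=H(\bar x^T,\eta^T,\lambda^T)^T$ for all $\bar x\in\mathbb{R}^{\bar n}$, $\eta\in\mathbb{R}^{N_1}$, $\lambda\in\mathbb{R}^{N_2}$. Moreover, if the $K_\infty$ function associated with the REO (the function $a_0$ in the context) is linear, then $\bar a$ is linear.
   Context: Notation. $|\cdot|$ is the Euclidean norm; for $x\in C^0([-r,0];\mathbb{R}^n)$, $\|x\|:=\max_{\theta\in[-r,0]}|x(\theta)|$; for $v\in C^0([0,1])$, $\|v\|_\infty=\sup_{0\le z\le1}|v(z)|$; $v[t]$ denotes the profile $z\mapsto v(t,z)$. For continuous $x$, $x_t(\theta)=x(t+\theta)$, $\theta\in[-r,0]$. For the observer output, $\hat x(p)$ with $p\in[t-r,t]$ stands for $\hat x_t(p-t)$; in particular $\hat x(t)=\hat x_t(0)$. $K$: increasing continuous $\rho:\mathbb{R}_+\to\mathbb{R}_+$ with $\rho(0)=0$; $K_\infty$: those $\rho\in K$ with $\rho(s)\to+\infty$ as $s\to+\infty$. $L^\infty_{loc}(\mathbb{R}_+;D)$: Lebesgue measurable, locally bounded mappings into $D$; suprema are actual suprema. The signal $w$ is reset at each $\tau_i$ and evolves by its differential equation on $[\tau_i,\tau_{i+1})$.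 Data. $c>0$ is a constant, $r=c^{-1}$; $z_i\in(0,1]$ ($i=1,\ldots,N_1$); $a\in C^0([0,1])$, $b_i\in C^1([0,1])$ ($i=1,\ldots,N_1$), $\gamma_i\in C^0([0,1])$, $\beta_i\in C^1([0,1])$ ($i=1,\ldots,N_2$); $q_j\in\mathbb{R}^{\bar n}$, $\bar b_{j,i}\in\mathbb{R}$, $\bar\beta_{j,i}\in\mathbb{R}$ ($j=1,\ldots,k$) are constants. The states are $\bar x(t)\in\mathbb{R}^{\bar n}$ and $v(t,z)\in\mathbb{R}$, and for continuous $u$ and compatible initial data the solution satisfies $v\in C^1(\mathbb{R}_+\times[0,1])$, $\bar x\in C^1(\mathbb{R}_+;\mathbb{R}^{\bar n})$. Associated delay system. Put $n=\bar n+N_1+N_2$, $x=(\bar x,\eta,\lambda)\in\mathbb{R}^{\bar n}\times\mathbb{R}^{N_1}\times\mathbb{R}^{N_2}=\mathbb{R}^n$, and define $$C(z)=\exp\left(r\int_0^za(s)ds\right),\qquad \bar g(z,x)=\bar g(z,\bar x,\eta,\lambda)=g(z,\bar x)+\sum_{i=1}^{N_1}b_i(z)\eta_i+\sum_{i=1}^{N_2}\beta_i(z)\lambda_i,$$ $$\tilde g(z,x)=\tilde g(z,\bar x,\eta,\lambda)=a(z)g(z,\bar x)-c\frac{\partial g}{\partial z}(z,\bar x)+\sum_{j=1}^{N_1}\tilde b_j(z)\eta_j+\sum_{j=1}^{N_2}\tilde\beta_j(z)\lambda_j,$$ with $\tilde b_j=ab_j-cb_j'$, $\tilde\beta_j=a\beta_j-c\beta_j'$.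 For $x=(\bar x,\eta,\lambda)\in C^0([-r,0];\mathbb{R}^n)$, $u\in\mathbb{R}^m$, $d\in D=\{0\}\subset\mathbb{R}^{\bar n}$, define $f(x,u,d)=(f_1(x,u,d),f_2(x),f_3(x))$ by $$f_1(x,u,d)=\tilde F(\bar x(0),v,u)+d,\quad v(z)=\int_{-rz}^0\frac{C(z)}{C(cp+z)}\bar g(cp+z,x(p))dp,\ z\in[0,1],$$ $$f_{2,i}(x)=\bar g(z_i,x(0))-C(z_i)\bar g(0,x(-rz_i))+\int_{-rz_i}^0\frac{C(z_i)}{C(z_i+cp)}\tilde g(z_i+cp,x(p))dp,\quad i=1,\ldots,N_1,$$ $$f_{3,i}(x)=\int_0^1\gamma_i(z)\left(\bar g(z,x(0))-C(z)\bar g(0,x(-rz))\right)dz+\int_0^1\int_{-rz}^0\frac{\gamma_i(z)C(z)}{C(z+cp)}\tilde g(z+cp,x(p))dp\,dz,\quad i=1,\ldots,N_2,$$ and $h(x)=(h_1(x),\ldots,h_k(x))^T$, $R(x,u,d)=(R_1(x,u,d),\ldots,R_k(x,u,d))^T$ by $$h_j(x)=q_j^T\bar x(0)+\sum_{i=1}^{N_1}\bar b_{j,i}\eta_i(0)+\sum_{i=1}^{N_2}\bar\beta_{j,i}\lambda_i(0),\qquad R_j(x,u,d)=q_j^Tf_1(x,u,d)+\sum_{i=1}^{N_1}\bar b_{j,i}f_{2,i}(x)+\sum_{i=1}^{N_2}\bar\beta_{j,i}f_{3,i}(x).$$ Robust Exponential Observer (REO). Let $F:C^0([-r,0];\mathbb{R}^l)\times\mathbb{R}^k\times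 U\to\mathbb{R}^l$ and $\Psi:C^0([-r,0];\mathbb{R}^l)\to C^0([-r,0];\mathbb{R}^n)$ be continuous with $F(0,0,0)=0$, $\Psi(0)=0$, and suppose that for every bounded $\Omega\subset C^0([-r,0];\mathbb{R}^l)\times\mathbb{R}^k\times U$ the set $F(\Omega)$ is bounded and there is $L_\Omega\ge0$ with $(z(0)-\bar z(0))^T(F(z,y,u)-F(\bar z,y,u))\le L_\Omega\|z-\bar z\|^2$ for all $(z,y,u),(\bar z,y,u)\in\Omega$. The system $\dot z=F(z_t,y,u)$, $\hat x_t=\Psi(z_t)$ is called an REO for the system $\dot x=f(x_t,u,d)$, $y=h(x_t)+\xi$ if there exist constants $\gamma,\sigma>0$ and functions $g_0\in K$, $a_0\in K_\infty$ such that for every $(x_0,z_0)\in C^0([-r,0];\mathbb{R}^n)\times C^0([-r,0];\mathbb{R}^l)$, $u\in L^\infty_{loc}(\mathbb{R}_+;U)$, $d\in L^\infty_{loc}(\mathbb{R}_+;D)$, $\xi\in L^\infty_{loc}(\mathbb{R}_+;\mathbb{R}^k)$, the solution $(x(t),z(t))$ of $\dot x=f(x_t,u,d)$, $\dot z=F(z_t,h(x_t)+\xi,u)$, $\hat x_t=\Psi(z_t)$ with initial condition $(x_0,z_0)$ exists for all $t\ge0$ and satisfies, for all $t\ge 0$, $$\|\hat x_t-x_t\|\le\exp(-\sigma t)a_0(\|x_0\|+\|z_0\|)+\gamma\sup_{0\le s\le t}\left(|\xi(s)|\exp(-\sigma(t-s))\right)+\sup_{0\le s\le t}\left(g_0(|d(s)|)\right).$$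 *)

theory Defs
  imports "HOL-Analysis.Analysis"
begin

section \<open>Function spaces and comparison functions\<close>

text \<open>The space C^0(S) with the supremum metric, for compact S. Its elements are extensional, that
  is, undefined outside S, so that profiles and histories are written \<open>\<lambda>\<theta>\<in>S. \<dots>\<close>.\<close>

abbreviation C0m :: "real set \<Rightarrow> (real \<Rightarrow> 'a::euclidean_space) metric" where
  "C0m S \<equiv> cfunspace (top_of_set S) euclidean_metric"

abbreviation C0 :: "real set \<Rightarrow> (real \<Rightarrow> 'a::euclidean_space) set" where
  "C0 S \<equiv> mspace (C0m S)"

abbreviation C0top :: "real set \<Rightarrow> (real \<Rightarrow> 'a::euclidean_space) topology" where
  "C0top S \<equiv> mtopology_of (C0m S)"

definition supnorm :: "real set \<Rightarrow> (real \<Rightarrow> 'a::real_normed_vector) \<Rightarrow> real" where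
  "supnorm S x = (SUP \<theta>\<in>S. norm (x \<theta>))"

text \<open>Continuously differentiable on S, with one-sided derivatives at the boundary of S; the library
  notion \<^const>\<open>C1_differentiable_on\<close> needs two-sided derivatives and a real argument. It is used
  for sets S on which the derivative within S is unique.\<close>

definition C1_on :: "'a::real_normed_vector set \<Rightarrow> ('a \<Rightarrow> 'b::real_normed_vector) \<Rightarrow> bool" where
  "C1_on S f \<longleftrightarrow> (\<exists>f' :: 'a \<Rightarrow> 'a \<Rightarrow>\<^sub>L 'b.
     (\<forall>x\<in>S. (f has_derivative blinfun_apply (f' x)) (at x within S)) \<and> continuous_on S f')"

abbreviation deriv01 :: "(real \<Rightarrow> real) \<Rightarrow> real \<Rightarrow> real" where
  "deriv01 v z \<equiv> vector_derivative v (at z within {0..1})"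

definition class_K :: "(real \<Rightarrow> real) set" where
  "class_K = {\<rho>. continuous_on {0..} \<rho> \<and> strict_mono_on {0..} \<rho> \<and> \<rho> 0 = 0}"

definition class_Kinf :: "(real \<Rightarrow> real) set" where
  "class_Kinf = {\<rho>\<in>class_K. filterlim \<rho> at_top at_top}"

definition Linf_loc :: "'a::euclidean_space set \<Rightarrow> (real \<Rightarrow> 'a) set" where
  "Linf_loc D = {u. u \<in> borel_measurable (lebesgue_on {0..}) \<and> u ` {0..} \<subseteq> D \<and>
     (\<forall>T\<ge>0. bounded (u ` {0..T}))}"

section \<open>Delay systems and robust exponential observers\<close>

definition hist :: "real \<Rightarrow> (real \<Rightarrow> 'a) \<Rightarrow> real \<Rightarrow> (real \<Rightarrow> 'a)" where
  "hist r x t = (\<lambda>\<theta>\<in>{-r..0}. x (t + \<theta>))"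

text \<open>Caratheodory solutions on the time interval I (either \<open>{0..<T}\<close> or \<open>{0..}\<close>) of
  x'(t) = rhs(t, x_t) with initial history x0: the integral equation says that x is locally
  absolutely continuous on I and that the equation holds for almost every t.\<close>

definition delay_solution ::
  "real \<Rightarrow> real set \<Rightarrow> (real \<Rightarrow> 'a::euclidean_space) \<Rightarrow> (real \<Rightarrow> (real \<Rightarrow> 'a) \<Rightarrow> 'a) \<Rightarrow> (real \<Rightarrow> 'a) \<Rightarrow> bool"
where
  "delay_solution r I x0 rhs x \<longleftrightarrow>
     continuous_on ({-r..0} \<union> I) x \<and> (\<forall>\<theta>\<in>{-r..0}. x \<theta> = x0 \<theta>) \<and>
     (\<forall>t\<in>I. (\<lambda>s. rhs s (hist r x s)) absolutely_integrable_on {0..t} \<and>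
            x t = x0 0 + integral {0..t} (\<lambda>s. rhs s (hist r x s)))"

text \<open>Standing regularity of an observer z' = F(z_t, y, u), output Psi(z_t).\<close>

definition observer_maps ::
  "real \<Rightarrow> 'u::euclidean_space set \<Rightarrow>
   ((real \<Rightarrow> 'z::euclidean_space) \<Rightarrow> 'y::euclidean_space \<Rightarrow> 'u \<Rightarrow> 'z) \<Rightarrow>
   ((real \<Rightarrow> 'z) \<Rightarrow> (real \<Rightarrow> 'x::euclidean_space)) \<Rightarrow> bool"
where
  "observer_maps r U F \<Psi> \<longleftrightarrow>
     continuous_map (prod_topology (C0top {-r..0}) (prod_topology euclidean (top_of_set U)))
       euclidean (\<lambda>(z, y, u). F z y u) \<and>
     continuous_map (C0top {-r..0}) (C0top {-r..0}) \<Psi> \<and>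
     F (\<lambda>\<theta>\<in>{-r..0}. 0) 0 0 = 0 \<and> \<Psi> (\<lambda>\<theta>\<in>{-r..0}. 0) = (\<lambda>\<theta>\<in>{-r..0}. 0) \<and>
     (\<forall>\<Omega> \<subseteq> C0 {-r..0} \<times> UNIV \<times> U.
        bounded ((\<lambda>(z, y, u). (supnorm {-r..0} z, y, u)) ` \<Omega>) \<longrightarrow>
        bounded ((\<lambda>(z, y, u). F z y u) ` \<Omega>) \<and>
        (\<exists>L\<ge>0. \<forall>z z' y u. (z, y, u) \<in> \<Omega> \<and> (z', y, u) \<in> \<Omega> \<longrightarrow>
           (z 0 - z' 0) \<bullet> (F z y u - F z' y u) \<le> L * (supnorm {-r..0} (\<lambda>\<theta>. z \<theta> - z' \<theta>))\<^sup>2))"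

text \<open>The observer is an REO, with constants \<open>\<gamma>\<close>, \<open>\<sigma>\<close> and functions g0, a0, for
  x' = f(x_t, u, d), y = h(x_t) + \<open>\<xi>\<close>.\<close>

definition REO ::
  "real \<Rightarrow> 'u::euclidean_space set \<Rightarrow> 'd::euclidean_space set \<Rightarrow>
   ((real \<Rightarrow> 'x::euclidean_space) \<Rightarrow> 'u \<Rightarrow> 'd \<Rightarrow> 'x) \<Rightarrow> ((real \<Rightarrow> 'x) \<Rightarrow> 'y::euclidean_space) \<Rightarrow>
   ((real \<Rightarrow> 'z::euclidean_space) \<Rightarrow> 'y \<Rightarrow> 'u \<Rightarrow> 'z) \<Rightarrow> ((real \<Rightarrow> 'z) \<Rightarrow> (real \<Rightarrow> 'x)) \<Rightarrow>
   real \<Rightarrow> real \<Rightarrow> (real \<Rightarrow> real) \<Rightarrow> (real \<Rightarrow> real) \<Rightarrow> bool"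
where
  "REO r U D f h F \<Psi> \<gamma> \<sigma> g0 a0 \<longleftrightarrow>
     observer_maps r U F \<Psi> \<and> \<gamma> > 0 \<and> \<sigma> > 0 \<and> g0 \<in> class_K \<and> a0 \<in> class_Kinf \<and>
     (\<forall>x0\<in>C0 {-r..0}. \<forall>z0\<in>C0 {-r..0}. \<forall>u\<in>Linf_loc U. \<forall>d\<in>Linf_loc D. \<forall>\<xi>\<in>Linf_loc UNIV.
        let sol = (\<lambda>x z.
              delay_solution r {0..} x0 (\<lambda>t \<phi>. f \<phi> (u t) (d t)) x \<and>
              delay_solution r {0..} z0 (\<lambda>t \<phi>. F \<phi> (h (hist r x t) + \<xi> t) (u t)) z)
        in (\<exists>x z. sol x z) \<and>
           (\<forall>x z. sol x z \<longrightarrow> (\<forall>t\<ge>0.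
              supnorm {-r..0} (\<lambda>\<theta>. \<Psi> (hist r z t) \<theta> - hist r x t \<theta>)
              \<le> exp (- \<sigma> * t) * a0 (supnorm {-r..0} x0 + supnorm {-r..0} z0)
                + \<gamma> * (SUP s\<in>{0..t}. norm (\<xi> s) * exp (- \<sigma> * (t - s)))
                + (SUP s\<in>{0..t}. g0 (norm (d s))))))"

section \<open>The PDE-ODE loop and its delay system\<close>

text \<open>The families indexed by 1..N1 and 1..N2 are functions on nat, of which only these indices are
  used, so N1 = 0 or N2 = 0 is allowed. The space R^n with n = dim xbar + N1 + N2 is \<open>real ^ 'n\<close>;
  the bijection \<open>lab\<close> from the labels to the index type says which coordinate is which entry of
  (xbar, eta, lambda).\<close>

record ('b::finite, 'm::finite, 'k::finite, 'n::finite) pde_ode =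
  speed :: real
  Ftil :: "real ^ 'b \<Rightarrow> (real \<Rightarrow> real) \<Rightarrow> real ^ 'm \<Rightarrow> real ^ 'b"
  acoef :: "real \<Rightarrow> real"
  gsrc :: "real \<Rightarrow> real ^ 'b \<Rightarrow> real"
  N1 :: nat
  N2 :: nat
  zpt :: "nat \<Rightarrow> real"
  bcoef :: "nat \<Rightarrow> real \<Rightarrow> real"
  betacoef :: "nat \<Rightarrow> real \<Rightarrow> real"
  gammaker :: "nat \<Rightarrow> real \<Rightarrow> real"
  qvec :: "'k \<Rightarrow> real ^ 'b"
  bbar :: "'k \<Rightarrow> nat \<Rightarrow> real"
  betabar :: "'k \<Rightarrow> nat \<Rightarrow> real"
  lab :: "'b + nat + nat \<Rightarrow> 'n"

definition labels :: "('b::finite, 'm::finite, 'k::finite, 'n::finite) pde_ode \<Rightarrow> ('b + nat + nat) set" where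
  "labels S = UNIV <+> {1..N1 S} <+> {1..N2 S}"

definition admissible_data :: "('b::finite, 'm::finite, 'k::finite, 'n::finite) pde_ode \<Rightarrow> bool" where
  "admissible_data S \<longleftrightarrow> speed S > 0 \<and> continuous_on {0..1} (acoef S) \<and>
     (\<forall>i\<in>{1..N1 S}. zpt S i \<in> {0<..1} \<and> C1_on {0..1} (bcoef S i)) \<and>
     (\<forall>i\<in>{1..N2 S}. continuous_on {0..1} (gammaker S i) \<and> C1_on {0..1} (betacoef S i)) \<and>
     bij_betw (lab S) (labels S) UNIV"

definition delay :: "('b::finite, 'm::finite, 'k::finite, 'n::finite) pde_ode \<Rightarrow> real" where
  "delay S = inverse (speed S)"

definition xbar_of :: "('b::finite, 'm::finite, 'k::finite, 'n::finite) pde_ode \<Rightarrow> real ^ 'n \<Rightarrow> real ^ 'b" where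
  "xbar_of S x = (\<chi> i. x $ lab S (Inl i))"

definition eta_of :: "('b::finite, 'm::finite, 'k::finite, 'n::finite) pde_ode \<Rightarrow> real ^ 'n \<Rightarrow> nat \<Rightarrow> real" where
  "eta_of S x i = x $ lab S (Inr (Inl i))"

definition lambda_of :: "('b::finite, 'm::finite, 'k::finite, 'n::finite) pde_ode \<Rightarrow> real ^ 'n \<Rightarrow> nat \<Rightarrow> real" where
  "lambda_of S x i = x $ lab S (Inr (Inr i))"

definition tuple ::
  "('b::finite, 'm::finite, 'k::finite, 'n::finite) pde_ode \<Rightarrow>
   real ^ 'b \<Rightarrow> (nat \<Rightarrow> real) \<Rightarrow> (nat \<Rightarrow> real) \<Rightarrow> real ^ 'n" where
  "tuple S xb \<eta> \<mu> = (\<chi> j. case inv_into (labels S) (lab S) j of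
     Inl i \<Rightarrow> xb $ i | Inr (Inl i) \<Rightarrow> \<eta> i | Inr (Inr i) \<Rightarrow> \<mu> i)"

definition Cw :: "('b::finite, 'm::finite, 'k::finite, 'n::finite) pde_ode \<Rightarrow> real \<Rightarrow> real" where
  "Cw S z = exp (delay S * integral {0..z} (acoef S))"

definition gbar :: "('b::finite, 'm::finite, 'k::finite, 'n::finite) pde_ode \<Rightarrow> real \<Rightarrow> real ^ 'n \<Rightarrow> real" where
  "gbar S z x = gsrc S z (xbar_of S x) + (\<Sum>i=1..N1 S. bcoef S i z * eta_of S x i)
     + (\<Sum>i=1..N2 S. betacoef S i z * lambda_of S x i)"

definition gtil :: "('b::finite, 'm::finite, 'k::finite, 'n::finite) pde_ode \<Rightarrow> real \<Rightarrow> real ^ 'n \<Rightarrow> real" where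
  "gtil S z x = acoef S z * gsrc S z (xbar_of S x)
     - speed S * deriv01 (\<lambda>y. gsrc S y (xbar_of S x)) z
     + (\<Sum>j=1..N1 S. (acoef S z * bcoef S j z - speed S * deriv01 (bcoef S j) z) * eta_of S x j)
     + (\<Sum>j=1..N2 S. (acoef S z * betacoef S j z - speed S * deriv01 (betacoef S j) z) * lambda_of S x j)"

definition profile :: "('b::finite, 'm::finite, 'k::finite, 'n::finite) pde_ode \<Rightarrow> (real \<Rightarrow> real ^ 'n) \<Rightarrow> real \<Rightarrow> real" where
  "profile S x z = integral {- delay S * z..0}
     (\<lambda>p. Cw S z / Cw S (speed S * p + z) * gbar S (speed S * p + z) (x p))"

definition f1 ::
  "('b::finite, 'm::finite, 'k::finite, 'n::finite) pde_ode \<Rightarrow>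
   (real \<Rightarrow> real ^ 'n) \<Rightarrow> real ^ 'm \<Rightarrow> real ^ 'b \<Rightarrow> real ^ 'b" where
  "f1 S x u d = Ftil S (xbar_of S (x 0)) (\<lambda>z\<in>{0..1}. profile S x z) u + d"

definition f2 :: "('b::finite, 'm::finite, 'k::finite, 'n::finite) pde_ode \<Rightarrow> (real \<Rightarrow> real ^ 'n) \<Rightarrow> nat \<Rightarrow> real" where
  "f2 S x i = gbar S (zpt S i) (x 0) - Cw S (zpt S i) * gbar S 0 (x (- delay S * zpt S i))
     + integral {- delay S * zpt S i..0} (\<lambda>p. Cw S (zpt S i) / Cw S (zpt S i + speed S * p)
         * gtil S (zpt S i + speed S * p) (x p))"

definition f3 :: "('b::finite, 'm::finite, 'k::finite, 'n::finite) pde_ode \<Rightarrow> (real \<Rightarrow> real ^ 'n) \<Rightarrow> nat \<Rightarrow> real" where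
  "f3 S x i =
     integral {0..1} (\<lambda>z. gammaker S i z * (gbar S z (x 0) - Cw S z * gbar S 0 (x (- delay S * z))))
     + integral {0..1} (\<lambda>z. integral {- delay S * z..0}
         (\<lambda>p. gammaker S i z * Cw S z / Cw S (z + speed S * p) * gtil S (z + speed S * p) (x p)))"

definition ffun ::
  "('b::finite, 'm::finite, 'k::finite, 'n::finite) pde_ode \<Rightarrow>
   (real \<Rightarrow> real ^ 'n) \<Rightarrow> real ^ 'm \<Rightarrow> real ^ 'b \<Rightarrow> real ^ 'n" where
  "ffun S x u d = tuple S (f1 S x u d) (f2 S x) (f3 S x)"

definition hfun :: "('b::finite, 'm::finite, 'k::finite, 'n::finite) pde_ode \<Rightarrow> (real \<Rightarrow> real ^ 'n) \<Rightarrow> real ^ 'k" where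
  "hfun S x = (\<chi> j. qvec S j \<bullet> xbar_of S (x 0) + (\<Sum>i=1..N1 S. bbar S j i * eta_of S (x 0) i)
     + (\<Sum>i=1..N2 S. betabar S j i * lambda_of S (x 0) i))"

definition Rfun ::
  "('b::finite, 'm::finite, 'k::finite, 'n::finite) pde_ode \<Rightarrow>
   (real \<Rightarrow> real ^ 'n) \<Rightarrow> real ^ 'm \<Rightarrow> real ^ 'b \<Rightarrow> real ^ 'k" where
  "Rfun S x u d = (\<chi> j. qvec S j \<bullet> f1 S x u d + (\<Sum>i=1..N1 S. bbar S j i * f2 S x i)
     + (\<Sum>i=1..N2 S. betabar S j i * f3 S x i))"

section \<open>Compatible data, solutions and sampled-data observer\<close>

definition compatible ::
  "('b::finite, 'm::finite, 'k::finite, 'n::finite) pde_ode \<Rightarrow> (real \<Rightarrow> real) \<Rightarrow> real ^ 'b \<Rightarrow> bool" where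
  "compatible S v0 xb0 \<longleftrightarrow> C1_on {0..1} v0 \<and> v0 0 = 0 \<and>
     speed S * deriv01 v0 0 = gsrc S 0 xb0 + (\<Sum>i=1..N1 S. bcoef S i 0 * v0 (zpt S i))
       + (\<Sum>i=1..N2 S. betacoef S i 0 * integral {0..1} (\<lambda>s. gammaker S i s * v0 s))"

text \<open>Classical solutions on the time interval I of the PDE-ODE loop.\<close>

definition loop_solution ::
  "('b::finite, 'm::finite, 'k::finite, 'n::finite) pde_ode \<Rightarrow> real set \<Rightarrow>
   (real \<Rightarrow> real) \<Rightarrow> real ^ 'b \<Rightarrow> (real \<Rightarrow> real ^ 'm) \<Rightarrow>
   (real \<Rightarrow> real ^ 'b) \<Rightarrow> (real \<Rightarrow> real \<Rightarrow> real) \<Rightarrow> bool" where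
  "loop_solution S I v0 xb0 u xb v \<longleftrightarrow>
     C1_on I xb \<and> C1_on (I \<times> {0..1}) (\<lambda>(t, z). v t z) \<and>
     xb 0 = xb0 \<and> (\<forall>z\<in>{0..1}. v 0 z = v0 z) \<and>
     (\<forall>t\<in>I. (xb has_vector_derivative Ftil S (xb t) (\<lambda>z\<in>{0..1}. v t z) (u t)) (at t within I)) \<and>
     (\<forall>t\<in>I. \<forall>z\<in>{0..1}.
        vector_derivative (\<lambda>s. v s z) (at t within I) + speed S * deriv01 (v t) z
        = acoef S z * v t z + gsrc S z (xb t) + (\<Sum>i=1..N1 S. bcoef S i z * v t (zpt S i))
          + (\<Sum>i=1..N2 S. betacoef S i z * integral {0..1} (\<lambda>s. gammaker S i s * v t s))) \<and>
     (\<forall>t\<in>I. v t 0 = 0)"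

text \<open>Solutions on I of the loop together with the sampled-data observer. At a sampling time the
  derivative of w is one-sided, since w jumps there.\<close>

definition sampled_solution ::
  "('b::finite, 'm::finite, 'k::finite, 'n::finite) pde_ode \<Rightarrow>
   ((real \<Rightarrow> real ^ 'l::finite) \<Rightarrow> real ^ 'k \<Rightarrow> real ^ 'm \<Rightarrow> real ^ 'l) \<Rightarrow>
   ((real \<Rightarrow> real ^ 'l) \<Rightarrow> (real \<Rightarrow> real ^ 'n)) \<Rightarrow> real set \<Rightarrow> (nat \<Rightarrow> real) \<Rightarrow>
   (real \<Rightarrow> real) \<Rightarrow> real ^ 'b \<Rightarrow> (real \<Rightarrow> real ^ 'l) \<Rightarrow> (real \<Rightarrow> real ^ 'm) \<Rightarrow> (real \<Rightarrow> real ^ 'k) \<Rightarrow>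
   (real \<Rightarrow> real ^ 'b) \<Rightarrow> (real \<Rightarrow> real \<Rightarrow> real) \<Rightarrow> (real \<Rightarrow> real ^ 'l) \<Rightarrow> (real \<Rightarrow> real ^ 'k) \<Rightarrow> bool" where
  "sampled_solution S F \<Psi> I \<tau> v0 xb0 z0 u \<xi> xb v z w \<longleftrightarrow>
     loop_solution S I v0 xb0 u xb v \<and>
     delay_solution (delay S) I z0 (\<lambda>t \<phi>. F \<phi> (w t) (u t)) z \<and>
     (\<forall>i. \<forall>t \<in> {\<tau> i..<\<tau> (Suc i)} \<inter> I.
        (w has_vector_derivative Rfun S (\<Psi> (hist (delay S) z t)) (u t) 0)
          (at t within {\<tau> i..<\<tau> (Suc i)} \<inter> I)) \<and>
     (\<forall>i. \<tau> i \<in> I \<longrightarrow> (\<forall>j. w (\<tau> i) $ j = \<xi> (\<tau> i) $ j + qvec S j \<bullet> xb (\<tau> i)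
        + (\<Sum>m=1..N1 S. bbar S j m * v (\<tau> i) (zpt S m))
        + (\<Sum>m=1..N2 S. betabar S j m * integral {0..1} (\<lambda>s. gammaker S m s * v (\<tau> i) s))))"

text \<open>In the estimate of v the value xhat(p), for p in [t - r, t], is read off the current output
  Psi(z_t) and not off Psi(z_p).\<close>

definition vhat ::
  "('b::finite, 'm::finite, 'k::finite, 'n::finite) pde_ode \<Rightarrow>
   ((real \<Rightarrow> real ^ 'l::finite) \<Rightarrow> (real \<Rightarrow> real ^ 'n)) \<Rightarrow> (real \<Rightarrow> real ^ 'l) \<Rightarrow> real \<Rightarrow> real \<Rightarrow> real" where
  "vhat S \<Psi> z t y = integral {t - delay S * y..t}
     (\<lambda>p. Cw S y / Cw S (y - speed S * (t - p))
        * gbar S (y - speed S * (t - p)) (\<Psi> (hist (delay S) z t) (p - t)))"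

end

theory Submission imports Defs "HOL-Complex_Analysis.Great_Picard" begin

text \<open>The transport equation is solved along its characteristics. Dividing the profile by the weight
  \<open>C\<close> removes the term \<open>a v\<close>, so that \<open>v / C\<close> only collects the source \<open>gbar / C\<close> along the line
  \<open>z - c t = const\<close>; such a line enters at \<open>z = 0\<close> with value zero at most \<open>r = 1 / c\<close> time units ago.
  Put \<open>x = (xbar, v(z_i), \<integral> \<gamma>_i v)\<close>. Then \<open>v[t]\<close> is the profile generated by the history \<open>x_t\<close>, and
  differentiating it in time shows that x solves the delay equation \<open>x' = f(x_t, u)\<close>. At \<open>t = 0\<close> the
  missing past is supplied by the assumed history of the initial data. Conversely the profile of any
  trajectory of the delay equation is continuously differentiable and solves the transport equation. So
  the loop may be replaced by the delay equation (\<open>loop_solution_imp_delay_solution\<close>,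
  \<open>delay_solution_imp_loop_solution\<close>). Its right-hand side is Lipschitz in the history
  (\<open>ffun_Lipschitz\<close>), and its output is a linear function \<open>M x(t)\<close> of the present state.

  For this delay equation every locally bounded signal w may be fed to the observer, because
  \<open>\<xi> = w - M x\<close> is an admissible measurement error. The observer property then bounds the estimation
  error by a decaying term plus \<open>\<gamma>\<close> times the supremum of \<open>|w - M x|\<close> with weight
  \<open>exp (- \<sigma> (t - s))\<close> (\<open>observer_error_bound\<close>). Between two samples w has the rate \<open>M f(\<Psi>(z_t), u)\<close>
  while \<open>M x\<close> has the rate \<open>M f(x_t, u)\<close>; the two rates differ by at most a constant \<open>LR\<close> times the
  estimation error. Integrating from the last sampling time, which is at most \<open>\<delta>\<close> ago, bounds the
  weighted error of w by \<open>exp \<sigma>\<close> times the weighted supremum of \<open>\<xi>\<close>, a decaying term, and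
  \<open>\<delta> LR \<gamma> exp \<sigma>\<close> times itself. If this factor is at most \<open>1 / 2\<close> the last term is absorbed, and the
  decay rate \<open>\<sigma>\<close> survives (\<open>predictor_estimate\<close>). The profile is a Lipschitz function of the history,
  so the same bound holds for \<open>v - vhat\<close>.

  Existence of the coupled solution needs a compactness argument, because F is merely continuous in
  the measurement. On one sampling interval w is a fixed point of \<open>w(t) = w(T) + \<integral> G w\<close>, where \<open>G w\<close>
  depends causally on w through the observer trajectory. If the integral stops a little before t,
  the equation is solved step by step (\<open>delayed_predictor_exists\<close>). The small-gain argument bounds
  these approximations uniformly (\<open>predictor_bound\<close>), Arzela-Ascoli provides a limit, and the limit solves
  the equation because the observer trajectory depends continuously on its input
  (\<open>observer_stability\<close>), a consequence of the one-sided Lipschitz condition. The same bound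
  prevents blow-up on a bounded interval, which makes every solution on \<open>[0, T)\<close> extendable.\<close>

section \<open>Continuous histories and parameter integrals\<close>

\<comment> \<open>\<open>C0\<close> abbreviates the carrier of \<open>cfunspace\<close>; it should stay folded for the simplifier and be entered through \<open>C0_iff\<close> only.\<close>
declare mspace_cfunspace [simp del]

lemma C0_iff: "f \<in> C0 {a..b} \<longleftrightarrow> f \<in> extensional {a..b} \<and> continuous_on {a..b} f"
proof -
  have "Metric_space.mbounded UNIV dist (f ` {a..b})" if "continuous_on {a..b} f"
    using compact_imp_bounded[OF compact_continuous_image[OF that]] by simp
  then show ?thesis
    by (auto simp: mspace_cfunspace Pi_iff continuous_map_in_subtopology)
qed

lemma restrict_in_C0:
  assumes "continuous_on {a..b} f" shows "restrict f {a..b} \<in> C0 {a..b}"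
  using assms by (auto simp: C0_iff intro: continuous_on_eq)

lemma hist_in_C0:
  assumes "continuous_on {t - r..t} x" shows "hist r x t \<in> C0 {-r..0}"
  unfolding hist_def
  by (intro restrict_in_C0 continuous_on_compose2[OF assms] continuous_intros) auto

lemma bdd_above_supnorm:
  fixes f :: "real \<Rightarrow> 'a::real_normed_vector"
  assumes "continuous_on {a..b} f" shows "bdd_above ((\<lambda>x. norm (f x)) ` {a..b})"
  using compact_imp_bounded[OF compact_continuous_image[OF continuous_on_norm[OF assms] compact_Icc]]
  by (rule bounded_imp_bdd_above)

lemma norm_le_supnorm:
  fixes f :: "real \<Rightarrow> 'a::real_normed_vector"
  assumes "continuous_on {a..b} f" "x \<in> {a..b}" shows "norm (f x) \<le> supnorm {a..b} f"
  unfolding supnorm_def by (rule cSUP_upper[OF assms(2) bdd_above_supnorm[OF assms(1)]])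

lemma supnorm_le:
  assumes "a \<le> b" "\<And>x. x \<in> {a..b} \<Longrightarrow> norm (f x) \<le> B" shows "supnorm {a..b} f \<le> B"
  unfolding supnorm_def by (rule cSUP_least) (use assms in auto)

lemma supnorm_nonneg:
  assumes "a \<le> b" "continuous_on {a..b} f" shows "0 \<le> supnorm {a..b} f"
  using norm_le_supnorm[OF assms(2), of a] assms(1) by (smt (verit) atLeastAtMost_iff norm_ge_zero)

lemma C0_diff_le_supnorm:
  assumes "f \<in> C0 {a..b}" "g \<in> C0 {a..b}" "x \<in> {a..b}"
  shows "norm (f x - g x) \<le> supnorm {a..b} (\<lambda>x. f x - g x)"
  using norm_le_supnorm[of a b "\<lambda>x. f x - g x" x] assms by (auto simp: C0_iff intro: continuous_intros)

lemma C0_diff_supnorm_nonneg: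
  assumes "a \<le> b" "f \<in> C0 {a..b}" "g \<in> C0 {a..b}"
  shows "0 \<le> supnorm {a..b} (\<lambda>x. f x - g x)"
  using assms by (intro supnorm_nonneg) (auto simp: C0_iff intro: continuous_intros)

lemma mdist_C0:
  assumes "a \<le> b" "f \<in> C0 {a..b}" "g \<in> C0 {a..b}"
  shows "mdist (C0m {a..b}) f g = supnorm {a..b} (\<lambda>x. f x - g x)"
proof -
  have eq: "mdist (C0m {a..b}) f g \<le> B \<longleftrightarrow> (\<forall>x\<in>{a..b}. norm (f x - g x) \<le> B)" for B
    using cfunspace_mdist_le[OF assms(2,3), of B] assms(1) by (auto simp: dist_norm)
  show ?thesis
  proof (rule antisym)
    show "mdist (C0m {a..b}) f g \<le> supnorm {a..b} (\<lambda>x. f x - g x)"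
      unfolding eq using C0_diff_le_supnorm[OF assms(2,3)] by blast
    show "supnorm {a..b} (\<lambda>x. f x - g x) \<le> mdist (C0m {a..b}) f g"
      using eq[of "mdist (C0m {a..b}) f g"] by (intro supnorm_le assms) auto
  qed
qed

text \<open>Compactness of the second factor turns joint continuity into continuity in the supremum norm.\<close>

lemma continuous_map_C0_curry:
  assumes "a \<le> b" and cont: "continuous_on (J \<times> {a..b}) (\<lambda>(t, y). V t y)"
  shows "continuous_map (top_of_set J) (C0top {a..b}) (\<lambda>t. \<lambda>y\<in>{a..b}. V t y)"
proof -
  interpret C: Metric_space "C0 {a..b}" "mdist (C0m {a..b})"
    by simp
  have mem: "(\<lambda>y\<in>{a..b}. V t y) \<in> C0 {a..b}" if "t \<in> J" for t
    by (intro restrict_in_C0 continuous_on_compose2[OF cont, of _ "\<lambda>y. (t, y)", simplified])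
       (use that in \<open>auto intro!: continuous_intros\<close>)
  have *: "continuous_map (top_of_set J) C.mtopology (\<lambda>t. \<lambda>y\<in>{a..b}. V t y)"
    unfolding C.continuous_map_to_metric
  proof (intro ballI allI impI)
    fix t and e :: real assume t: "t \<in> topspace (top_of_set J)" and e: "e > 0"
    then have tJ: "t \<in> J" by simp
    have e2: "e / 2 > 0" using e by simp
    obtain X where X: "t \<in> X" "open X"
      and X': "\<forall>s\<in>X \<inter> J. \<forall>y\<in>{a..b}. dist (case (s, y) of (t, y) \<Rightarrow> V t y) (case (t, y) of (t, y) \<Rightarrow> V t y) \<le> e/2"
      by (rule continuous_on_prod_compactE[OF cont compact_Icc tJ e2])
    note X3 = X'[unfolded prod.case]
    show "\<exists>U. openin (top_of_set J) U \<and> t \<in> U \<and>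
        (\<forall>s\<in>U. (\<lambda>y\<in>{a..b}. V s y) \<in> C.mball (\<lambda>y\<in>{a..b}. V t y) e)"
    proof (intro exI conjI ballI)
      show "openin (top_of_set J) (J \<inter> X)" using X(2) by (auto simp: openin_open)
      show "t \<in> J \<inter> X" using X tJ by auto
      fix s assume s: "s \<in> J \<inter> X"
      have "mdist (C0m {a..b}) (\<lambda>y\<in>{a..b}. V t y) (\<lambda>y\<in>{a..b}. V s y) \<le> e/2"
        unfolding mdist_C0[OF assms(1) mem[OF tJ] mem[of s, OF IntD1[OF s]]]
        using X3 s by (intro supnorm_le assms) (auto simp: dist_norm norm_minus_commute)
      then show "(\<lambda>y\<in>{a..b}. V s y) \<in> C.mball (\<lambda>y\<in>{a..b}. V t y) e"
        using mem[OF tJ] mem[of s] s e by (auto simp: C.in_mball)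
    qed
  qed
  then show ?thesis by (simp add: mtopology_of_def)
qed

lemma continuous_map_hist:
  assumes "0 \<le> r" "continuous_on J x" "\<And>t. t \<in> I \<Longrightarrow> {t - r..t} \<subseteq> J"
  shows "continuous_map (top_of_set I) (C0top {-r..0}) (hist r x)"
proof -
  have "continuous_on (I \<times> {-r..0}) (\<lambda>(t, \<theta>). x (t + \<theta>))"
    unfolding split_beta
  proof (rule continuous_on_compose2[OF assms(2)])
    show "continuous_on (I \<times> {- r..0}) (\<lambda>p. fst p + snd p)" by (intro continuous_intros)
    show "(\<lambda>p. fst p + snd p) ` (I \<times> {- r..0}) \<subseteq> J"
    proof clarsimp
      fix t \<theta> assume "t \<in> I" "- r \<le> \<theta>" "\<theta> \<le> 0"
      then show "t + \<theta> \<in> J" using assms(3)[of t] by (auto intro!: subsetD[OF assms(3)[of t]])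
    qed
  qed
  from continuous_map_C0_curry[OF _ this] show ?thesis using assms(1) by (simp add: hist_def[abs_def])
qed

text \<open>The topology of \<open>C0\<close> is metric, with the distance of \<open>mdist_C0\<close>; this is sequential continuity in the
  form in which it is used against Lipschitz bounds.\<close>

lemma continuous_map_C0_dist:
  assumes ab: "a \<le> b" and c: "continuous_map (top_of_set J) (C0top {a..b}) \<Phi>" and s: "s \<in> J"
  shows "((\<lambda>t. supnorm {a..b} (\<lambda>y. \<Phi> t y - \<Phi> s y)) \<longlongrightarrow> 0) (at s within J)"
proof -
  interpret C: Metric_space "C0 {a..b}" "mdist (C0m {a..b})"
    by simp
  have c': "continuous_map (top_of_set J) C.mtopology \<Phi>" using c by (simp add: mtopology_of_def)
  have mem: "\<Phi> t \<in> C0 {a..b}" if "t \<in> J" for t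
    using c' that by (auto simp: continuous_map_def)
  show ?thesis
  proof (rule tendstoI)
    fix e :: real assume "e > 0"
    with c' s obtain U where U: "openin (top_of_set J) U" "s \<in> U" "\<And>t. t \<in> U \<Longrightarrow> \<Phi> t \<in> C.mball (\<Phi> s) e"
      unfolding C.continuous_map_to_metric by (metis topspace_euclidean_subtopology)
    then obtain W where W: "open W" "U = J \<inter> W" by (auto simp: openin_open)
    have "\<forall>\<^sub>F t in at s within J. t \<in> W \<and> t \<in> J"
      using W U(2) by (auto simp: eventually_at_topological)
    then show "\<forall>\<^sub>F t in at s within J. dist (supnorm {a..b} (\<lambda>y. \<Phi> t y - \<Phi> s y)) 0 < e"
    proof eventually_elim
      case (elim t)
      then have "mdist (C0m {a..b}) (\<Phi> t) (\<Phi> s) < e" using U(3)[of t] W by (auto simp: C.in_mball C.commute)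
      then show ?case using mdist_C0[OF ab mem mem, of t s] elim s C0_diff_supnorm_nonneg[OF ab mem mem, of t s]
        by (simp add: abs_of_nonneg)
    qed
  qed
qed

text \<open>A change of the argument \<open>\<Phi> t\<close> is controlled by the Lipschitz bound, which is uniform in the second
  argument, and a change of \<open>u t\<close> by the continuity of G at the fixed function \<open>\<Phi> s\<close>.\<close>

lemma Lipschitz_along_curve_continuous:
  fixes G :: "(real \<Rightarrow> 'a::euclidean_space) \<Rightarrow> 'b::topological_space \<Rightarrow> 'c::real_normed_vector"
  assumes ab: "a \<le> b" and c: "continuous_map (top_of_set J) (C0top {a..b}) \<Phi>"
    and L: "\<And>\<phi> \<psi> u. \<phi> \<in> C0 {a..b} \<Longrightarrow> \<psi> \<in> C0 {a..b} \<Longrightarrow>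
        norm (G \<phi> u - G \<psi> u) \<le> L * supnorm {a..b} (\<lambda>y. \<phi> y - \<psi> y)"
    and G: "\<And>\<phi>. \<phi> \<in> C0 {a..b} \<Longrightarrow> continuous_on UNIV (G \<phi>)" and u: "continuous_on J u"
  shows "continuous_on J (\<lambda>t. G (\<Phi> t) (u t))"
  unfolding continuous_on_def
proof
  fix s assume s: "s \<in> J"
  have mem: "\<Phi> t \<in> C0 {a..b}" if "t \<in> J" for t
    using c that by (auto simp: continuous_map_def)
  have 1: "((\<lambda>t. G (\<Phi> s) (u t)) \<longlongrightarrow> G (\<Phi> s) (u s)) (at s within J)"
    using continuous_on_compose2[OF G[OF mem[OF s]] u] s by (auto simp: continuous_on_def)
  have 2: "((\<lambda>t. G (\<Phi> t) (u t) - G (\<Phi> s) (u t)) \<longlongrightarrow> 0) (at s within J)"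
  proof (rule Lim_null_comparison)
    show "((\<lambda>t. L * supnorm {a..b} (\<lambda>y. \<Phi> t y - \<Phi> s y)) \<longlongrightarrow> 0) (at s within J)"
      using tendsto_mult_right_zero[OF continuous_map_C0_dist[OF ab c s]] by simp
    show "\<forall>\<^sub>F t in at s within J. norm (G (\<Phi> t) (u t) - G (\<Phi> s) (u t))
        \<le> L * supnorm {a..b} (\<lambda>y. \<Phi> t y - \<Phi> s y)"
      using L mem s by (auto simp: eventually_at_topological)
  qed
  show "((\<lambda>t. G (\<Phi> t) (u t)) \<longlongrightarrow> G (\<Phi> s) (u s)) (at s within J)"
    using tendsto_add[OF 2 1] by simp
qed

lemma integral_rescale:
  fixes g :: "real \<Rightarrow> 'a::euclidean_space"
  assumes "\<alpha> \<le> \<beta>" "continuous_on {\<alpha>..\<beta>} g"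
  shows "integral {\<alpha>..\<beta>} g = (\<beta> - \<alpha>) *\<^sub>R integral {0..1} (\<lambda>\<theta>. g (\<alpha> + \<theta> * (\<beta> - \<alpha>)))"
proof (cases "\<alpha> = \<beta>")
  case False
  then have lt: "\<alpha> < \<beta>" using assms by simp
  have "(g has_integral integral {\<alpha>..\<beta>} g) (cbox \<alpha> \<beta>)"
    using integrable_continuous_real[OF assms(2)] by (simp add: integrable_integral)
  from has_integral_affinity[OF this, of "\<beta> - \<alpha>" \<alpha>] lt
  have h: "((\<lambda>x. g ((\<beta> - \<alpha>) * x + \<alpha>)) has_integral (1 / (\<beta> - \<alpha>)) *\<^sub>R integral {\<alpha>..\<beta>} g)
      ((\<lambda>x. (1/(\<beta> - \<alpha>)) * x + - ((1/(\<beta> - \<alpha>)) * \<alpha>)) ` {\<alpha>..\<beta>})"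
    by simp
  have "(\<lambda>x. (1/(\<beta> - \<alpha>)) * x + - ((1/(\<beta> - \<alpha>)) * \<alpha>)) ` {\<alpha>..\<beta>} = {0..1}"
  proof -
    have "(1/(\<beta> - \<alpha>)) * \<beta> + - ((1/(\<beta> - \<alpha>)) * \<alpha>) = 1"
      using lt by (simp add: divide_simps)
    then show ?thesis using lt by (subst image_affinity_atLeastAtMost) auto
  qed
  with h have "integral {0..1} (\<lambda>x. g ((\<beta> - \<alpha>) * x + \<alpha>)) = (1 / (\<beta> - \<alpha>)) *\<^sub>R integral {\<alpha>..\<beta>} g"
    by (metis integral_unique)
  then show ?thesis using lt by (simp add: algebra_simps)
qed simp

text \<open>After rescaling to \<open>[0, 1]\<close> the limits of integration become parameters of the integrand.\<close>

lemma continuous_on_integral_bounds: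
  fixes f :: "'p::topological_space \<Rightarrow> real \<Rightarrow> 'a::euclidean_space"
  assumes a: "continuous_on P a" and b: "continuous_on P b" and le: "\<And>p. p \<in> P \<Longrightarrow> a p \<le> b p"
    and f: "continuous_on {(p, s). p \<in> P \<and> a p \<le> s \<and> s \<le> b p} (\<lambda>(p, s). f p s)"
  shows "continuous_on P (\<lambda>p. integral {a p..b p} (f p))"
proof -
  have "continuous_on (P \<times> cbox 0 1) (\<lambda>(p, \<theta>). f p (a p + \<theta> * (b p - a p)))"
    unfolding split_beta
  proof (rule continuous_on_compose2[OF f[unfolded split_beta], of _ "\<lambda>(p, \<theta>). (p, a p + \<theta> * (b p - a p))",
        unfolded split_beta fst_conv snd_conv])
    show "continuous_on (P \<times> cbox 0 1) (\<lambda>p. (fst p, a (fst p) + snd p * (b (fst p) - a (fst p))))"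
      by (intro continuous_intros continuous_on_compose2[OF a] continuous_on_compose2[OF b]) auto
    have "a p + \<theta> * (b p - a p) \<le> b p" if "p \<in> P" "0 \<le> \<theta>" "\<theta> \<le> 1" for p \<theta>
      using mult_right_mono[of \<theta> 1 "b p - a p"] le that by auto
    then show "(\<lambda>p. (fst p, a (fst p) + snd p * (b (fst p) - a (fst p)))) ` (P \<times> cbox 0 1)
        \<subseteq> {p. fst p \<in> P \<and> a (fst p) \<le> snd p \<and> snd p \<le> b (fst p)}"
      using le by auto
  qed
  from integral_continuous_on_param[OF this]
  have "continuous_on P (\<lambda>p. (b p - a p) *\<^sub>R integral {0..1} (\<lambda>\<theta>. f p (a p + \<theta> * (b p - a p))))"
    using a b by (auto intro: continuous_intros)
  moreover have "(b p - a p) *\<^sub>R integral {0..1} (\<lambda>\<theta>. f p (a p + \<theta> * (b p - a p))) = integral {a p..b p} (f p)"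
    if "p \<in> P" for p
  proof (rule integral_rescale[symmetric])
    show "a p \<le> b p" using le that .
    show "continuous_on {a p..b p} (f p)"
      by (rule continuous_on_compose2[OF f, of "{a p..b p}" "\<lambda>s. (p, s)", unfolded prod.case])
        (use that in \<open>auto intro: continuous_on_Pair continuous_on_const continuous_on_id\<close>)
  qed
  ultimately show ?thesis by (rule continuous_on_eq)
qed

section \<open>Growth estimates and uniqueness for delay equations\<close>

lemma norm_integral_le:
  fixes f :: "real \<Rightarrow> 'a::euclidean_space"
  assumes "f integrable_on {s..t}" "s \<le> t" "\<And>x. x \<in> {s..t} \<Longrightarrow> norm (f x) \<le> B"
  shows "norm (integral {s..t} f) \<le> B * (t - s)"
proof -
  have "0 \<le> B" using assms(3)[of s] assms(2) by (auto intro: order_trans[OF norm_ge_zero])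
  from has_integral_bound_real[OF this finite.emptyI integrable_integral[OF assms(1)]] assms
  show ?thesis by simp
qed

lemma zero_derivative_if_quadratic:
  fixes \<Phi> :: "real \<Rightarrow> real"
  assumes "\<And>s t. s \<in> {0..T} \<Longrightarrow> t \<in> {0..T} \<Longrightarrow> \<bar>\<Phi> t - \<Phi> s\<bar> \<le> C * (t - s)\<^sup>2" and t: "t \<in> {0..T}"
  shows "\<Phi> t = \<Phi> 0"
proof -
  have "(\<Phi> has_derivative (\<lambda>h. 0)) (at s within {0..T})" if s: "s \<in> {0..T}" for s
    unfolding has_derivative_within
  proof (rule conjI[OF bounded_linear_zero], rule Lim_null_comparison)
    show "((\<lambda>t. \<bar>C\<bar> * \<bar>t - s\<bar>) \<longlongrightarrow> 0) (at s within {0..T})"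
      by (rule tendsto_mult_right_zero[OF tendsto_rabs_zero[OF LIM_zero[OF tendsto_ident_at]]])
    show "\<forall>\<^sub>F y in at s within {0..T}. norm ((1 / norm (y - s)) *\<^sub>R (\<Phi> y - (\<Phi> s + 0))) \<le> \<bar>C\<bar> * \<bar>y - s\<bar>"
      unfolding eventually_at_topological
    proof (intro exI[of _ UNIV] conjI ballI impI)
      fix y assume y: "y \<noteq> s" "y \<in> {0..T}"
      have "\<bar>\<Phi> y - \<Phi> s\<bar> \<le> \<bar>C\<bar> * \<bar>y - s\<bar> * \<bar>y - s\<bar>"
      proof -
        have "\<bar>C\<bar> * \<bar>y - s\<bar> * \<bar>y - s\<bar> = \<bar>C\<bar> * (y - s)\<^sup>2" by (simp add: power2_eq_square mult.assoc)
        then show ?thesis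
          using assms(1)[OF s y(2)] mult_right_mono[OF abs_ge_self[of C] zero_le_power2[of "y - s"]]
          unfolding \<open>\<bar>C\<bar> * \<bar>y - s\<bar> * \<bar>y - s\<bar> = \<bar>C\<bar> * (y - s)\<^sup>2\<close> by linarith
      qed
      then show "norm ((1 / norm (y - s)) *\<^sub>R (\<Phi> y - (\<Phi> s + 0))) \<le> \<bar>C\<bar> * \<bar>y - s\<bar>"
        using y by (simp add: pos_divide_le_eq)
    qed auto
  qed
  then have "\<exists>c. \<forall>x\<in>{0..T}. \<Phi> x = c" by (intro has_derivative_zero_constant) auto
  then show ?thesis using t by auto
qed

text \<open>The identity \<open>(d\<^sup>2)' = 2 d d'\<close> in integrated form for a Lipschitz d whose derivative exists only almost
  everywhere. The difference of the two sides has increments of the order \<open>(t - s)\<^sup>2\<close>, because d varies by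
  at most \<open>B (t - s)\<close> on \<open>[s, t]\<close>; so it is constant.\<close>

lemma inner_indefinite_integral:
  fixes g :: "real \<Rightarrow> 'a::euclidean_space"
  assumes g: "g absolutely_integrable_on {0..T}" and B: "\<And>s. s \<in> {0..T} \<Longrightarrow> norm (g s) \<le> B"
    and d: "\<And>t. t \<in> {0..T} \<Longrightarrow> d t = integral {0..t} g" and T: "0 \<le> T"
  shows "(\<lambda>s. d s \<bullet> g s) integrable_on {0..T}"
    and "t \<in> {0..T} \<Longrightarrow> d t \<bullet> d t = 2 * integral {0..t} (\<lambda>s. d s \<bullet> g s)"
proof -
  have gi: "g integrable_on {0..T}" using g by (rule set_lebesgue_integral_eq_integral)
  have gi': "g integrable_on {s..t}" if "0 \<le> s" "t \<le> T" for s t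
    by (rule integrable_on_subinterval[OF gi]) (use that in auto)
  have cont: "continuous_on {0..T} d"
    by (rule continuous_on_eq[OF indefinite_integral_continuous_1[OF gi]]) (simp add: d)
  have bd: "bounded (d ` {0..T})" using compact_continuous_image[OF cont compact_Icc] compact_imp_bounded by blast
  have "(\<lambda>s. d s \<bullet> g s) absolutely_integrable_on {0..T}"
    by (rule absolutely_integrable_bounded_measurable_product[OF iffD2[OF bilinear_conv_bounded_bilinear bounded_bilinear_inner]
          continuous_imp_measurable_on_sets_lebesgue[OF cont] _ bd g]) auto
  then show int: "(\<lambda>s. d s \<bullet> g s) integrable_on {0..T}" by (rule set_lebesgue_integral_eq_integral)
  have int': "(\<lambda>s. d s \<bullet> g s) integrable_on {s..t}" if "0 \<le> s" "t \<le> T" for s t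
    by (rule integrable_on_subinterval[OF int]) (use that in auto)
  have B0: "B \<ge> 0" using B[of 0] T by (smt (verit) atLeastAtMost_iff norm_ge_zero)
  have inc: "d t - d s = integral {s..t} g" if "0 \<le> s" "s \<le> t" "t \<le> T" for s t
    using Henstock_Kurzweil_Integration.integral_combine[of 0 s t g] gi'[of 0 t] that d[of s] d[of t]
    by (auto simp: diff_eq_eq add.commute)
  have lip: "norm (d t - d s) \<le> B * (t - s)" if st: "0 \<le> s" "s \<le> t" "t \<le> T" for s t
  proof -
    have "norm (integral {s..t} g) \<le> B * (t - s)"
      using st B by (intro norm_integral_le gi') auto
    then show ?thesis using inc st by simp
  qed
  define \<Phi> where "\<Phi> t = d t \<bullet> d t - 2 * integral {0..t} (\<lambda>s. d s \<bullet> g s)" for t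
  have q: "\<bar>\<Phi> t - \<Phi> s\<bar> \<le> (2 * B\<^sup>2) * (t - s)\<^sup>2" if st: "0 \<le> s" "s \<le> t" "t \<le> T" for s t
  proof -
    have "d t \<bullet> d t - d s \<bullet> d s = integral {s..t} (\<lambda>\<tau>. (d t + d s) \<bullet> g \<tau>)"
    proof -
      have "d t \<bullet> d t - d s \<bullet> d s = (d t + d s) \<bullet> (d t - d s)" by (simp add: algebra_simps inner_commute)
      then show ?thesis using inc[OF st] integral_linear[OF gi'[OF st(1,3)] bounded_linear_inner_right[of "d t + d s"]]
        by (simp add: o_def)
    qed
    moreover have "integral {0..t} (\<lambda>s. d s \<bullet> g s) - integral {0..s} (\<lambda>s. d s \<bullet> g s) = integral {s..t} (\<lambda>s. d s \<bullet> g s)"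
      using Henstock_Kurzweil_Integration.integral_combine[of 0 s t "\<lambda>s. d s \<bullet> g s"] int'[of 0 t] st by auto
    moreover have i1: "(\<lambda>\<tau>. (d t + d s) \<bullet> g \<tau>) integrable_on {s..t}"
      using integrable_linear[OF gi'[OF st(1,3)] bounded_linear_inner_right[of "d t + d s"]] by (simp add: o_def)
    moreover have i2: "(\<lambda>\<tau>. 2 * (d \<tau> \<bullet> g \<tau>)) integrable_on {s..t}"
      using integrable_on_cmult_left[OF int'[OF st(1,3)], of 2] by simp
    ultimately have "\<Phi> t - \<Phi> s = integral {s..t} (\<lambda>\<tau>. (d t + d s) \<bullet> g \<tau>) - integral {s..t} (\<lambda>\<tau>. 2 * (d \<tau> \<bullet> g \<tau>))"
      unfolding \<Phi>_def by simp
    also have "\<dots> = integral {s..t} (\<lambda>\<tau>. (d t + d s) \<bullet> g \<tau> - 2 * (d \<tau> \<bullet> g \<tau>))"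
      by (rule Henstock_Kurzweil_Integration.integral_diff[symmetric, OF i1 i2])
    finally have eq: "\<Phi> t - \<Phi> s = integral {s..t} (\<lambda>\<tau>. (d t + d s) \<bullet> g \<tau> - 2 * (d \<tau> \<bullet> g \<tau>))" .
    have "norm (integral {s..t} (\<lambda>\<tau>. (d t + d s) \<bullet> g \<tau> - 2 * (d \<tau> \<bullet> g \<tau>))) \<le> (2 * B\<^sup>2 * (t - s)) * (t - s)"
    proof (rule norm_integral_le)
      show "(\<lambda>\<tau>. (d t + d s) \<bullet> g \<tau> - 2 * (d \<tau> \<bullet> g \<tau>)) integrable_on {s..t}" 
        by (intro Henstock_Kurzweil_Integration.integrable_diff i1 i2)
      fix \<tau> assume \<tau>: "\<tau> \<in> {s..t}"
      have "norm ((d t - d \<tau>) + (d s - d \<tau>)) \<le> B * (t - \<tau>) + B * (\<tau> - s)"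
        using lip[of \<tau> t] lip[of s \<tau>] \<tau> st by (intro norm_triangle_mono) (auto simp: norm_minus_commute)
      also have "\<dots> \<le> 2 * B * (t - s)" using B0 st by (simp add: algebra_simps mult_left_mono)
      finally have "norm ((d t - d \<tau>) + (d s - d \<tau>)) \<le> 2 * B * (t - s)" .
      then have "\<bar>((d t - d \<tau>) + (d s - d \<tau>)) \<bullet> g \<tau>\<bar> \<le> (2 * B * (t - s)) * B"
        using B[of \<tau>] \<tau> st B0 by (intro order_trans[OF Cauchy_Schwarz_ineq2] mult_mono) auto
      then show "norm ((d t + d s) \<bullet> g \<tau> - 2 * (d \<tau> \<bullet> g \<tau>)) \<le> 2 * B\<^sup>2 * (t - s)"
        by (simp add: inner_diff_left inner_add_left power2_eq_square algebra_simps)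
    qed (use st in auto)
    then show ?thesis using eq by (simp add: power2_eq_square mult.assoc)
  qed
  have "\<Phi> t = \<Phi> 0" if "t \<in> {0..T}"
  proof (rule zero_derivative_if_quadratic[OF _ that])
    fix s t assume "s \<in> {0..T}" "t \<in> {0..T}"
    then show "\<bar>\<Phi> t - \<Phi> s\<bar> \<le> (2 * B\<^sup>2) * (t - s)\<^sup>2"
      using q[of s t] q[of t s] by (cases "s \<le> t") (auto simp: abs_minus_commute power2_commute)
  qed
  then show "d t \<bullet> d t = 2 * integral {0..t} (\<lambda>s. d s \<bullet> g s)" if "t \<in> {0..T}"
    using that T d[of 0] by (auto simp: \<Phi>_def)
qed

text \<open>Gronwall's inequality in the form of a contraction: an integral estimate maps the bound
  \<open>N exp (\<mu> t)\<close> to \<open>(K + N / 2) exp (\<mu> t)\<close> once \<open>\<mu>\<close> is large. Since q is continuous the optimal N is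
  attained, and \<open>N \<le> K + N / 2\<close> bounds it.\<close>

lemma weighted_sup_bound:
  fixes q :: "real \<Rightarrow> real"
  assumes q: "continuous_on {0..T} q" and T: "0 \<le> T" and K: "0 \<le> K"
    and step: "\<And>N. 0 \<le> N \<Longrightarrow> (\<And>s. s \<in> {0..T} \<Longrightarrow> q s \<le> N * exp (\<mu> * s)) \<Longrightarrow>
        (\<And>t. t \<in> {0..T} \<Longrightarrow> q t \<le> (K + N / 2) * exp (\<mu> * t))"
    and t: "t \<in> {0..T}"
  shows "q t \<le> 2 * K * exp (\<mu> * t)"
proof -
  have "continuous_on {0..T} (\<lambda>s. q s * exp (- \<mu> * s))" by (intro continuous_intros q)
  from continuous_attains_sup[OF compact_Icc _ this] T
  obtain m where m: "m \<in> {0..T}" "\<And>s. s \<in> {0..T} \<Longrightarrow> q s * exp (- \<mu> * s) \<le> q m * exp (- \<mu> * m)" by auto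
  have ex: "q s \<le> N * exp (\<mu> * s) \<longleftrightarrow> q s * exp (- \<mu> * s) \<le> N" for s N
    by (simp add: exp_minus field_simps)
  define N where "N = max 0 (q m * exp (- \<mu> * m))"
  have "q s \<le> N * exp (\<mu> * s)" if "s \<in> {0..T}" for s
    using m(2)[OF that] unfolding ex N_def by auto
  then have "q m * exp (- \<mu> * m) \<le> K + N / 2" using step[of N m] m(1) unfolding ex by (auto simp: N_def)
  then have "N \<le> 2 * K" using K unfolding N_def by auto
  then show ?thesis using m(2)[OF t] unfolding ex N_def by auto
qed

lemma integral_exp_le:
  fixes \<mu> t :: real
  assumes "0 < \<mu>" "0 \<le> t"
  shows "(\<lambda>s. exp (\<mu> * s)) integrable_on {0..t}" "integral {0..t} (\<lambda>s. exp (\<mu> * s)) \<le> exp (\<mu> * t) / \<mu>"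
proof -
  have "((\<lambda>s. exp (\<mu> * s)) has_integral (exp (\<mu> * t) / \<mu> - exp (\<mu> * 0) / \<mu>)) {0..t}"
    using assms by (intro fundamental_theorem_of_calculus[where f = "\<lambda>s. exp (\<mu> * s) / \<mu>"])
      (auto intro!: derivative_eq_intros simp flip: has_real_derivative_iff_has_vector_derivative)
  then show "(\<lambda>s. exp (\<mu> * s)) integrable_on {0..t}" "integral {0..t} (\<lambda>s. exp (\<mu> * s)) \<le> exp (\<mu> * t) / \<mu>"
    using assms by (auto simp: has_integral_iff)
qed

text \<open>Two solutions share their past, so on \<open>[0, t]\<close> the history at time s differs by at most the supremum of
  the difference up to s, and \<open>weighted_sup_bound\<close> applies with \<open>K = 0\<close>.\<close>

lemma delay_solution_unique:
  assumes r: "0 \<le> r" and I: "\<And>t. t \<in> I \<Longrightarrow> 0 \<le> t \<and> {0..t} \<subseteq> I"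
    and x: "delay_solution r I x0 rhs x" and y: "delay_solution r I x0 rhs y"
    and Lip: "\<And>t \<phi> \<psi>. t \<in> I \<Longrightarrow> \<phi> \<in> C0 {-r..0} \<Longrightarrow> \<psi> \<in> C0 {-r..0} \<Longrightarrow>
        norm (rhs t \<phi> - rhs t \<psi>) \<le> L * supnorm {-r..0} (\<lambda>\<theta>. \<phi> \<theta> - \<psi> \<theta>)"
    and t: "t \<in> {-r..0} \<union> I"
  shows "x t = y t"
proof (cases "t \<in> I")
  case False then show ?thesis using x y t by (auto simp: delay_solution_def)
next
  case True
  note tI = True
  then have t0: "0 \<le> t" and sub: "{0..t} \<subseteq> I" using I by auto
  \<comment> \<open>Integrating \<open>L N exp (\<mu> s)\<close> costs the factor \<open>L / \<mu>\<close>, which is at most \<open>1 / 2\<close>.\<close>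
  define \<mu> where "\<mu> = 2 * \<bar>L\<bar> + 1"
  have sub': "{-r..t} \<subseteq> {-r..0} \<union> I" 
  proof
    fix s assume s: "s \<in> {-r..t}"
    show "s \<in> {-r..0} \<union> I" using s sub by (cases "s \<le> 0") auto
  qed
  have cx: "continuous_on {-r..t} x" and cy: "continuous_on {-r..t} y"
    using x y continuous_on_subset[OF _ sub'] by (auto simp: delay_solution_def)
  have hC: "hist r x s \<in> C0 {-r..0}" "hist r y s \<in> C0 {-r..0}" if "s \<in> {0..t}" for s
    using that by (auto intro!: hist_in_C0 continuous_on_subset[OF cx] continuous_on_subset[OF cy])
  have "norm (x t - y t) \<le> 2 * 0 * exp (\<mu> * t)"
  proof (rule weighted_sup_bound[where q = "\<lambda>s. norm (x s - y s)" and T = t])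
    show "continuous_on {0..t} (\<lambda>s. norm (x s - y s))"
      using r by (intro continuous_intros continuous_on_subset[OF cx] continuous_on_subset[OF cy]) auto
    fix N s assume N: "0 \<le> N" "\<And>s. s \<in> {0..t} \<Longrightarrow> norm (x s - y s) \<le> N * exp (\<mu> * s)" and s: "s \<in> {0..t}"
    have sI: "s \<in> I" using s sub by auto
    have b: "norm (rhs \<tau> (hist r x \<tau>) - rhs \<tau> (hist r y \<tau>)) \<le> \<bar>L\<bar> * N * exp (\<mu> * \<tau>)" if \<tau>: "\<tau> \<in> {0..s}" for \<tau>
    proof -
      have "supnorm {-r..0} (\<lambda>\<theta>. hist r x \<tau> \<theta> - hist r y \<tau> \<theta>) \<le> N * exp (\<mu> * \<tau>)"
      proof (rule supnorm_le)
        fix \<theta> assume \<theta>: "\<theta> \<in> {-r..0}"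
        show "norm (hist r x \<tau> \<theta> - hist r y \<tau> \<theta>) \<le> N * exp (\<mu> * \<tau>)"
        proof (cases "\<tau> + \<theta> \<ge> 0")
          case True
          then have "norm (x (\<tau> + \<theta>) - y (\<tau> + \<theta>)) \<le> N * exp (\<mu> * (\<tau> + \<theta>))" using N(2)[of "\<tau> + \<theta>"] \<tau> \<theta> s by auto
          also have "\<dots> \<le> N * exp (\<mu> * \<tau>)" using N(1) \<theta> by (intro mult_left_mono) (auto simp: \<mu>_def mult_left_mono)
          finally show ?thesis using \<theta> by (simp add: hist_def)
        next
          case False
          then have "x (\<tau> + \<theta>) = y (\<tau> + \<theta>)" using x y \<tau> \<theta> by (auto simp: delay_solution_def)
          then show ?thesis using N \<theta> by (simp add: hist_def)
        qed
      qed (use r in simp)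
      then have le: "L * supnorm {-r..0} (\<lambda>\<theta>. hist r x \<tau> \<theta> - hist r y \<tau> \<theta>) \<le> \<bar>L\<bar> * (N * exp (\<mu> * \<tau>))"
        using C0_diff_supnorm_nonneg[OF _ hC(1)[of \<tau>] hC(2)[of \<tau>]] r \<tau> s 
        by (intro mult_mono) auto
      have "\<tau> \<in> I" "\<tau> \<in> {0..t}" using \<tau> s sub by auto
      from order_trans[OF Lip[OF this(1) hC[OF this(2)]] le] show ?thesis by (simp add: mult.assoc)
    qed
    have ix: "(\<lambda>\<tau>. rhs \<tau> (hist r x \<tau>)) integrable_on {0..s}" "(\<lambda>\<tau>. rhs \<tau> (hist r y \<tau>)) integrable_on {0..s}"
      using x y sI by (auto simp: delay_solution_def intro: set_lebesgue_integral_eq_integral)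
    have "x s - y s = integral {0..s} (\<lambda>\<tau>. rhs \<tau> (hist r x \<tau>) - rhs \<tau> (hist r y \<tau>))"
      using x y sI ix by (auto simp: delay_solution_def Henstock_Kurzweil_Integration.integral_diff)
    also have "norm \<dots> \<le> integral {0..s} (\<lambda>\<tau>. \<bar>L\<bar> * N * exp (\<mu> * \<tau>))"
    proof (intro integral_norm_bound_integral Henstock_Kurzweil_Integration.integrable_diff ix b)
      show "(\<lambda>\<tau>. \<bar>L\<bar> * N * exp (\<mu> * \<tau>)) integrable_on {0..s}"
        using integrable_on_cmult_left[OF integral_exp_le(1)[of \<mu> s], of "\<bar>L\<bar> * N"] s by (simp add: \<mu>_def)
    qed
    also have "\<dots> \<le> \<bar>L\<bar> * N * (exp (\<mu> * s) / \<mu>)"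
    proof -
      have "integral {0..s} (\<lambda>s. exp (\<mu> * s)) \<le> exp (\<mu> * s) / \<mu>"
        using integral_exp_le(2)[of \<mu> s] s by (simp add: \<mu>_def)
      from mult_left_mono[OF this, of "\<bar>L\<bar> * N"] N(1) show ?thesis by simp
    qed
    also have "\<dots> = (\<bar>L\<bar> / \<mu>) * (N * exp (\<mu> * s))" by simp
    also have "\<dots> \<le> 1 / 2 * (N * exp (\<mu> * s))"
      using N(1) by (intro mult_right_mono) (auto simp: \<mu>_def field_simps)
    finally show "norm (x s - y s) \<le> (0 + N / 2) * exp (\<mu> * s)" by simp
  qed (use t0 in auto)
  then show ?thesis by simp
qed

section \<open>Locally bounded signals\<close>

lemma Linf_continuous:
  assumes "continuous_on {0..} g" shows "g \<in> Linf_loc UNIV"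
  unfolding Linf_loc_def
proof (intro CollectI conjI allI impI)
  show "g \<in> borel_measurable (lebesgue_on {0..})"
    by (rule continuous_imp_measurable_on_sets_lebesgue[OF assms]) auto
  show "bounded (g ` {0..T})" for T
    by (intro compact_imp_bounded compact_continuous_image continuous_on_subset[OF assms]) auto
qed auto

lemma Linf_norm_bound:
  assumes "w \<in> Linf_loc UNIV" obtains B where "0 \<le> B" "\<And>t. t \<in> {0..T} \<Longrightarrow> norm (w t) \<le> B"
proof (cases "T \<ge> 0")
  case True
  then have "bounded (w ` {0..T})" using assms by (auto simp: Linf_loc_def)
  then obtain B where "B > 0" "\<forall>x\<in>w ` {0..T}. norm x \<le> B" unfolding bounded_pos by blast
  then show ?thesis by (intro that[of B]) auto
qed (auto intro: that[of 0])

lemma Linf_diff: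
  assumes "v \<in> Linf_loc UNIV" "w \<in> Linf_loc UNIV" shows "(\<lambda>t. v t - w t) \<in> Linf_loc UNIV"
  using assms by (auto simp: Linf_loc_def intro: bounded_minus_comp)

lemma Linf_cut:
  assumes "v \<in> Linf_loc UNIV" "w \<in> Linf_loc UNIV" shows "(\<lambda>t. if t < T then v t else w t) \<in> Linf_loc UNIV"
  unfolding Linf_loc_def
proof (intro CollectI conjI allI impI)
  have "{t \<in> space (lebesgue_on {0..}). t < T} = {0..} \<inter> {..<T}"
    by (auto simp: space_restrict_space)
  also have "\<dots> \<in> sets (lebesgue_on {0..})" by (simp add: sets_restrict_space)
  finally have "{t \<in> space (lebesgue_on {0..}). t < T} \<in> sets (lebesgue_on {0..})" .
  then show "(\<lambda>t. if t < T then v t else w t) \<in> borel_measurable (lebesgue_on {0..})"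
    using assms by (intro measurable_If) (auto simp: Linf_loc_def)
  fix S :: real assume "S \<ge> 0"
  then have "bounded (v ` {0..S} \<union> w ` {0..S})" using assms by (auto simp: Linf_loc_def)
  then show "bounded ((\<lambda>t. if t < T then v t else w t) ` {0..S})" by (rule bounded_subset) auto
qed auto

text \<open>The sampling times tend to infinity, so a bounded interval meets finitely many pieces.\<close>

lemma Linf_piecewise:
  assumes \<tau>: "\<tau> 0 = 0" "\<And>i::nat. \<tau> i < \<tau> (Suc i)" "filterlim \<tau> at_top sequentially"
    and v: "\<And>i. v i \<in> Linf_loc UNIV" "\<And>i t. \<tau> i \<le> t \<Longrightarrow> t < \<tau> (Suc i) \<Longrightarrow> w t = v i t"
  shows "w \<in> Linf_loc UNIV"
proof -
  have mono: "\<tau> i \<le> \<tau> j" if "i \<le> j" for i j 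
    using lift_Suc_mono_le[of \<tau>, OF less_imp_le[OF \<tau>(2)] that] .
  have ex: "\<exists>i<N. \<tau> i \<le> t \<and> t < \<tau> (Suc i)" if "0 \<le> t" "t < \<tau> N" for t N
    using that(2)
  proof (induction N)
    case 0 then show ?case using that \<tau> by simp
  next
    case (Suc N) then show ?case by (cases "t < \<tau> N") (auto intro: less_SucI)
  qed
  have ev: "\<exists>N. t < \<tau> N" for t
    using \<tau>(3) by (auto simp: filterlim_at_top_dense eventually_sequentially)
  show ?thesis unfolding Linf_loc_def
  proof (intro CollectI conjI allI impI)
    show "w \<in> borel_measurable (lebesgue_on {0..})"
    proof (rule measurable_piecewise_restrict2[where A = "\<lambda>i. {\<tau> i..<\<tau> (Suc i)}"])
      show "{\<tau> i..<\<tau> (Suc i)} \<in> sets (lebesgue_on {0..})" for i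
        using mono[of 0 i] \<tau>(1) by (auto simp: sets_restrict_space image_iff intro!: bexI[of _ "{\<tau> i..<\<tau> (Suc i)}"])
      show "space (lebesgue_on {0..}) = (\<Union>i. {\<tau> i..<\<tau> (Suc i)})"
      proof -
        have "0 \<le> t" if "\<tau> i \<le> t" for i t using mono[of 0 i] \<tau>(1) that by simp
        moreover have "\<exists>i. \<tau> i \<le> t \<and> t < \<tau> (Suc i)" if "0 \<le> t" for t
          using ev[of t] ex[OF that] by blast
        ultimately show ?thesis by (auto simp: set_eq_iff)
      qed
      show "\<exists>h\<in>borel_measurable (lebesgue_on {0..}). \<forall>x\<in>{\<tau> i..<\<tau> (Suc i)}. w x = h x" for i
        using v by (intro bexI[of _ "v i"]) (auto simp: Linf_loc_def)
    qed
    fix T :: real assume T: "T \<ge> 0"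
    obtain N where N: "T < \<tau> N" using ev by blast
    have "w ` {0..T} \<subseteq> (\<Union>i<N. v i ` {0..T})"
    proof
      fix a assume "a \<in> w ` {0..T}"
      then obtain t where t: "0 \<le> t" "t \<le> T" "a = w t" by auto
      from ex[of t N] t N obtain i where "i < N" "\<tau> i \<le> t" "t < \<tau> (Suc i)" by auto
      then show "a \<in> (\<Union>i<N. v i ` {0..T})" using v(2)[of i t] t by force
    qed
    moreover have "bounded (\<Union>i<N. v i ` {0..T})"
      using v(1) T by (auto simp: Linf_loc_def)
    ultimately show "bounded (w ` {0..T})" by (rule bounded_subset[rotated])
  qed auto
qed

lemma sampling_interval_exists:
  assumes \<tau>: "\<tau> 0 = 0" "filterlim \<tau> at_top sequentially" and t: "0 \<le> t"
  shows "\<exists>i::nat. \<tau> i \<le> t \<and> t < (\<tau> (Suc i) :: real)"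
proof -
  obtain N where N: "t < \<tau> N"
    using \<tau>(2) by (auto simp: filterlim_at_top_dense eventually_sequentially)
  show ?thesis using N
  proof (induction N)
    case 0 then show ?case using \<tau> t by simp
  next
    case (Suc N) then show ?case by (cases "t < \<tau> N") (auto simp: not_less)
  qed
qed

lemma delay_solution_subset:
  assumes "delay_solution r I x0 rhs x" "J \<subseteq> I" shows "delay_solution r J x0 rhs x"
proof -
  have "{-r..0} \<union> J \<subseteq> {-r..0} \<union> I" using assms(2) by blast
  then show ?thesis using assms continuous_on_subset by (fastforce simp: delay_solution_def)
qed

lemma delay_solution_cong:
  assumes "delay_solution r I x0 rhs x" and I: "\<And>t. t \<in> I \<Longrightarrow> {0..t} \<subseteq> I" and r: "0 \<le> r"
    and I0: "\<And>t. t \<in> I \<Longrightarrow> 0 \<le> t"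
    and eq: "\<And>t. t \<in> {-r..0} \<union> I \<Longrightarrow> y t = x t" "\<And>t. t \<in> I \<Longrightarrow> rhs' t (hist r x t) = rhs t (hist r x t)"
  shows "delay_solution r I x0 rhs' y"
proof -
  have h: "hist r y t = hist r x t" if "t \<in> I" for t
  proof -
    have "t + \<theta> \<in> {-r..0} \<union> I" if \<theta>: "\<theta> \<in> {-r..0}" for \<theta>
      using I[OF \<open>t \<in> I\<close>] \<theta> I0[OF \<open>t \<in> I\<close>] by (cases "t + \<theta> \<le> 0") auto
    then show ?thesis using eq(1) by (auto simp: hist_def)
  qed
  have i: "rhs' s (hist r y s) = rhs s (hist r x s)" if "t \<in> I" "s \<in> {0..t}" for s t
    using h[of s] eq(2)[of s] I[OF that(1)] that(2) by auto
  show ?thesis unfolding delay_solution_def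
  proof (intro conjI ballI)
    show "continuous_on ({-r..0} \<union> I) y"
      using assms(1) eq(1) by (intro continuous_on_eq[of _ x y]) (auto simp: delay_solution_def)
    show "y \<theta> = x0 \<theta>" if "\<theta> \<in> {-r..0}" for \<theta> using assms(1) eq(1) that by (auto simp: delay_solution_def)
    fix t assume t: "t \<in> I"
    have "(\<lambda>s. rhs s (hist r x s)) absolutely_integrable_on {0..t}" using assms(1) t by (auto simp: delay_solution_def)
    then show "(\<lambda>s. rhs' s (hist r y s)) absolutely_integrable_on {0..t}"
      by (rule absolutely_integrable_spike[OF _ negligible_empty]) (use i t in auto)
    have "integral {0..t} (\<lambda>s. rhs' s (hist r y s)) = integral {0..t} (\<lambda>s. rhs s (hist r x s))"
      using i[OF t] by (intro Henstock_Kurzweil_Integration.integral_cong) auto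
    then show "y t = x0 0 + integral {0..t} (\<lambda>s. rhs' s (hist r y s))"
      using assms(1) t eq(1)[of t] by (auto simp: delay_solution_def)
  qed
qed

lemma integral_split:
  fixes g :: "real \<Rightarrow> 'a::euclidean_space"
  assumes "continuous_on {0..} g" "0 \<le> a" "a \<le> b" "b \<le> c"
  shows "integral {a..c} g = integral {a..b} g + integral {b..c} g"
  using assms by (intro Henstock_Kurzweil_Integration.integral_combine[symmetric]
      integrable_continuous_real continuous_on_subset[OF assms(1)]) auto

lemma integral_linear_image:
  fixes g :: "real \<Rightarrow> 'a::euclidean_space" and M :: "'a \<Rightarrow> 'b::euclidean_space"
  assumes "bounded_linear M" "g integrable_on A"
  shows "integral A (\<lambda>s. M (g s)) = M (integral A g)"
  using integral_linear[OF assms(2,1)] by (simp add: o_def)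

section \<open>Observers fed by an arbitrary signal\<close>

text \<open>A plant \<open>x' = f(x_t, u, d)\<close> whose output \<open>M x(t)\<close> is linear in the present state, together with an
  observer; the disturbance d takes only the value 0. The number \<open>M (f (\<Psi> z) u 0)\<close> is the rate of the
  output as predicted from the estimate \<open>\<Psi> z\<close>.\<close>

locale observed_delay_system =
  fixes r :: real and f :: "(real \<Rightarrow> 'x::euclidean_space) \<Rightarrow> 'u::euclidean_space \<Rightarrow> 'd::euclidean_space \<Rightarrow> 'x"
    and M :: "'x \<Rightarrow> 'y::euclidean_space"
    and F :: "(real \<Rightarrow> 'z::euclidean_space) \<Rightarrow> 'y \<Rightarrow> 'u \<Rightarrow> 'z" and \<Psi> :: "(real \<Rightarrow> 'z) \<Rightarrow> (real \<Rightarrow> 'x)"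
    and \<gamma> \<sigma> :: real and g0 a0 :: "real \<Rightarrow> real" and Lf :: real
  assumes r: "0 \<le> r"
    and REO: "REO r UNIV {0} f (\<lambda>\<phi>. M (\<phi> 0)) F \<Psi> \<gamma> \<sigma> g0 a0"
    and M: "bounded_linear M"
    and f_Lip: "\<And>\<phi> \<psi> u. \<phi> \<in> C0 {-r..0} \<Longrightarrow> \<psi> \<in> C0 {-r..0} \<Longrightarrow>
        norm (f \<phi> u 0 - f \<psi> u 0) \<le> Lf * supnorm {-r..0} (\<lambda>\<theta>. \<phi> \<theta> - \<psi> \<theta>)"
    and f_cont: "\<And>\<phi>. \<phi> \<in> C0 {-r..0} \<Longrightarrow> continuous_on UNIV (\<lambda>u. f \<phi> u 0)"
    and RPsi_Lip: "\<And>B. B \<subseteq> C0 {-r..0} \<times> UNIV \<Longrightarrow> bounded ((\<lambda>(z, u). (supnorm {-r..0} z, u)) ` B) \<Longrightarrow>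
        \<exists>L\<ge>0. \<forall>z z' u. (z, u) \<in> B \<and> (z', u) \<in> B \<longrightarrow>
          norm (M (f (\<Psi> z) u 0) - M (f (\<Psi> z') u 0)) \<le> L * supnorm {-r..0} (\<lambda>\<theta>. z \<theta> - z' \<theta>)"
begin

lemma maps: "observer_maps r UNIV F \<Psi>" and \<gamma>: "\<gamma> > 0" and \<sigma>: "\<sigma> > 0" and g0: "g0 \<in> class_K" and a0: "a0 \<in> class_Kinf"
  using REO by (auto simp: REO_def)

lemma Psi_C0: "\<phi> \<in> C0 {-r..0} \<Longrightarrow> \<Psi> \<phi> \<in> C0 {-r..0}"
  using maps by (auto simp: observer_maps_def continuous_map_def)

text \<open>A Lipschitz constant of the output rate. The summand 1 makes it positive, because the admissible
  sampling period is proportional to \<open>1 / LR\<close>.\<close>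

definition LR :: real where "LR = onorm M * \<bar>Lf\<bar> + 1"

lemma LR_pos: "LR > 0"
  using onorm_pos_le[OF M] by (simp add: LR_def add_nonneg_pos)

lemma R_Lip:
  assumes "\<phi> \<in> C0 {-r..0}" "\<psi> \<in> C0 {-r..0}"
  shows "norm (M (f \<phi> u 0) - M (f \<psi> u 0)) \<le> LR * supnorm {-r..0} (\<lambda>\<theta>. \<phi> \<theta> - \<psi> \<theta>)"
proof -
  let ?s = "supnorm {-r..0} (\<lambda>\<theta>. \<phi> \<theta> - \<psi> \<theta>)"
  have s: "0 \<le> ?s" using C0_diff_supnorm_nonneg[OF _ assms] r by simp
  have "norm (M (f \<phi> u 0) - M (f \<psi> u 0)) \<le> onorm M * norm (f \<phi> u 0 - f \<psi> u 0)"
    using onorm[OF M, of "f \<phi> u 0 - f \<psi> u 0"] by (simp add: bounded_linear.linear[OF M] linear_diff)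
  also have "\<dots> \<le> onorm M * (\<bar>Lf\<bar> * ?s)"
    using f_Lip[OF assms, of u] mult_right_mono[OF abs_ge_self[of Lf] s]
    by (intro mult_left_mono onorm_pos_le M) auto
  also have "\<dots> \<le> LR * ?s" using s by (simp add: LR_def algebra_simps)
  finally show ?thesis .
qed

lemma continuous_map_hist_C0:
  assumes "continuous_on ({-r..0} \<union> I) x" "\<And>t. t \<in> I \<Longrightarrow> 0 \<le> t \<and> {0..t} \<subseteq> I"
  shows "continuous_map (top_of_set I) (C0top {-r..0}) (hist r x)"
proof (rule continuous_map_hist[OF r assms(1)])
  fix t assume t: "t \<in> I"
  show "{t - r..t} \<subseteq> {-r..0} \<union> I"
  proof
    fix s assume "s \<in> {t - r..t}" then show "s \<in> {-r..0} \<union> I" using assms(2)[OF t] by (cases "s \<le> 0") auto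
  qed
qed

lemma hist_mem_C0:
  assumes "continuous_on ({-r..0} \<union> I) x" "\<And>t. t \<in> I \<Longrightarrow> 0 \<le> t \<and> {0..t} \<subseteq> I" "t \<in> I"
  shows "hist r x t \<in> C0 {-r..0}"
  using continuous_map_hist_C0[OF assms(1,2)] assms(3) by (auto simp: continuous_map_def)

lemma hist_zero [simp]: "hist r x t 0 = x t"
  using r by (simp add: hist_def)

lemma f_along_continuous:
  assumes "continuous_on ({-r..0} \<union> I) x" "\<And>t. t \<in> I \<Longrightarrow> 0 \<le> t \<and> {0..t} \<subseteq> I" "continuous_on I u"
  shows "continuous_on I (\<lambda>t. f (hist r x t) (u t) 0)"
  by (rule Lipschitz_along_curve_continuous[OF _ continuous_map_hist_C0[OF assms(1,2)] f_Lip f_cont assms(3)])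
     (use r in auto)

lemma RPsi_along_continuous:
  assumes "continuous_on ({-r..0} \<union> I) z" "\<And>t. t \<in> I \<Longrightarrow> 0 \<le> t \<and> {0..t} \<subseteq> I" "continuous_on I u"
  shows "continuous_on I (\<lambda>t. M (f (\<Psi> (hist r z t)) (u t) 0))"
proof -
  have "continuous_map (C0top {-r..0}) (C0top {-r..0}) \<Psi>" using maps by (simp add: observer_maps_def)
  from continuous_map_compose[OF continuous_map_hist_C0[OF assms(1,2)] this]
  have c: "continuous_map (top_of_set I) (C0top {-r..0}) (\<Psi> \<circ> hist r z)" by simp
  have "continuous_on I (\<lambda>t. f ((\<Psi> \<circ> hist r z) t) (u t) 0)"
    by (rule Lipschitz_along_curve_continuous[OF _ c f_Lip f_cont assms(3)]) (use r in auto)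
  from bounded_linear.continuous_on[OF M this] show ?thesis by simp
qed

lemma zero_history_C0: "(\<lambda>\<theta>\<in>{-r..0}. 0) \<in> C0 {-r..0}"
  by (intro restrict_in_C0 continuous_on_const)

lemma supnorm_zero: "supnorm {-r..0} (\<lambda>\<theta>\<in>{-r..0}. 0 :: 'v::euclidean_space) = 0"
  using r supnorm_le[of "-r" 0 "\<lambda>\<theta>\<in>{-r..0}. 0 :: 'v" 0] supnorm_nonneg[of "-r" 0 "\<lambda>\<theta>\<in>{-r..0}. 0 :: 'v"]
    zero_history_C0[where 'a='v] by (auto simp: C0_iff)

lemma zero_signal: "(\<lambda>t. 0) \<in> Linf_loc D" if "0 \<in> D"
  using that by (auto simp: Linf_loc_def image_constant_conv)

text \<open>For \<open>d = 0\<close> the last term of the observer estimate is \<open>g0 0 = 0\<close>.\<close>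

lemma REO_along:
  assumes u: "continuous_on {0..} u" and x0: "x0 \<in> C0 {-r..0}" and z0: "z0 \<in> C0 {-r..0}" and \<xi>: "\<xi> \<in> Linf_loc UNIV"
  shows "\<exists>x z. delay_solution r {0..} x0 (\<lambda>t \<phi>. f \<phi> (u t) 0) x \<and>
              delay_solution r {0..} z0 (\<lambda>t \<phi>. F \<phi> (M (hist r x t 0) + \<xi> t) (u t)) z"
    and "delay_solution r {0..} x0 (\<lambda>t \<phi>. f \<phi> (u t) 0) x \<Longrightarrow>
         delay_solution r {0..} z0 (\<lambda>t \<phi>. F \<phi> (M (hist r x t 0) + \<xi> t) (u t)) z \<Longrightarrow> 0 \<le> t \<Longrightarrow>
         supnorm {-r..0} (\<lambda>\<theta>. \<Psi> (hist r z t) \<theta> - hist r x t \<theta>)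
         \<le> exp (- \<sigma> * t) * a0 (supnorm {-r..0} x0 + supnorm {-r..0} z0)
           + \<gamma> * (SUP s\<in>{0..t}. norm (\<xi> s) * exp (- \<sigma> * (t - s)))"
proof -
  have d: "(\<lambda>t. 0) \<in> Linf_loc {0::'d}" by (rule zero_signal) simp
  have "\<forall>x0\<in>C0 {-r..0}. \<forall>z0\<in>C0 {-r..0}. \<forall>u\<in>Linf_loc UNIV. \<forall>d\<in>Linf_loc {0}. \<forall>\<xi>\<in>Linf_loc UNIV.
        (\<exists>x z. delay_solution r {0..} x0 (\<lambda>t \<phi>. f \<phi> (u t) (d t)) x \<and>
              delay_solution r {0..} z0 (\<lambda>t \<phi>. F \<phi> (M (hist r x t 0) + \<xi> t) (u t)) z) \<and>
        (\<forall>x z. delay_solution r {0..} x0 (\<lambda>t \<phi>. f \<phi> (u t) (d t)) x \<and>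
              delay_solution r {0..} z0 (\<lambda>t \<phi>. F \<phi> (M (hist r x t 0) + \<xi> t) (u t)) z \<longrightarrow>
          (\<forall>t\<ge>0. supnorm {-r..0} (\<lambda>\<theta>. \<Psi> (hist r z t) \<theta> - hist r x t \<theta>)
              \<le> exp (- \<sigma> * t) * a0 (supnorm {-r..0} x0 + supnorm {-r..0} z0)
                + \<gamma> * (SUP s\<in>{0..t}. norm (\<xi> s) * exp (- \<sigma> * (t - s)))
                + (SUP s\<in>{0..t}. g0 (norm (d s)))))"
    using REO unfolding REO_def Let_def by (elim conjE)
  from this[THEN bspec, OF x0, THEN bspec, OF z0, THEN bspec, OF Linf_continuous[OF u], THEN bspec, OF d, THEN bspec, OF \<xi>]
  have *: "\<exists>x z. delay_solution r {0..} x0 (\<lambda>t \<phi>. f \<phi> (u t) 0) x \<and>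
              delay_solution r {0..} z0 (\<lambda>t \<phi>. F \<phi> (M (hist r x t 0) + \<xi> t) (u t)) z"
    and **: "\<And>x z t. delay_solution r {0..} x0 (\<lambda>t \<phi>. f \<phi> (u t) 0) x \<Longrightarrow>
              delay_solution r {0..} z0 (\<lambda>t \<phi>. F \<phi> (M (hist r x t 0) + \<xi> t) (u t)) z \<Longrightarrow> 0 \<le> t \<Longrightarrow>
          supnorm {-r..0} (\<lambda>\<theta>. \<Psi> (hist r z t) \<theta> - hist r x t \<theta>)
              \<le> exp (- \<sigma> * t) * a0 (supnorm {-r..0} x0 + supnorm {-r..0} z0)
                + \<gamma> * (SUP s\<in>{0..t}. norm (\<xi> s) * exp (- \<sigma> * (t - s)))
                + (SUP s\<in>{0..t}. g0 (norm (0::'d)))"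
    by blast+
  show "\<exists>x z. delay_solution r {0..} x0 (\<lambda>t \<phi>. f \<phi> (u t) 0) x \<and>
              delay_solution r {0..} z0 (\<lambda>t \<phi>. F \<phi> (M (hist r x t 0) + \<xi> t) (u t)) z" by (rule *)
  assume h: "delay_solution r {0..} x0 (\<lambda>t \<phi>. f \<phi> (u t) 0) x"
    "delay_solution r {0..} z0 (\<lambda>t \<phi>. F \<phi> (M (hist r x t 0) + \<xi> t) (u t)) z" "0 \<le> t"
  then have "(SUP s\<in>{0..t}. g0 (norm (0::'d))) = 0" using g0 by (simp add: class_K_def)
  then show "supnorm {-r..0} (\<lambda>\<theta>. \<Psi> (hist r z t) \<theta> - hist r x t \<theta>)
         \<le> exp (- \<sigma> * t) * a0 (supnorm {-r..0} x0 + supnorm {-r..0} z0)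
           + \<gamma> * (SUP s\<in>{0..t}. norm (\<xi> s) * exp (- \<sigma> * (t - s)))"
    using **[OF h] by linarith
qed

lemma plant_solution_exists:
  assumes u: "continuous_on {0..} u" and x0: "x0 \<in> C0 {-r..0}"
  obtains x where "delay_solution r {0..} x0 (\<lambda>t \<phi>. f \<phi> (u t) 0) x"
  using REO_along(1)[OF u x0 zero_history_C0 zero_signal[OF UNIV_I]] by blast

lemma plant_solution_unique:
  assumes "delay_solution r I x0 (\<lambda>t \<phi>. f \<phi> (u t) 0) x" "delay_solution r I x0 (\<lambda>t \<phi>. f \<phi> (u t) 0) y"
    "\<And>t. t \<in> I \<Longrightarrow> 0 \<le> t \<and> {0..t} \<subseteq> I" "t \<in> {-r..0} \<union> I"
  shows "x t = y t"
  by (rule delay_solution_unique[OF r assms(3,1,2) f_Lip assms(4)])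

lemma output_Linf:
  assumes "delay_solution r {0..} x0 rhs x" shows "(\<lambda>t. M (x t)) \<in> Linf_loc UNIV"
proof (intro Linf_continuous bounded_linear.continuous_on[OF M])
  have "continuous_on ({-r..0} \<union> {0..}) x" using assms by (simp add: delay_solution_def)
  then show "continuous_on {0..} x" by (rule continuous_on_subset) auto
qed

text \<open>The observer receives \<open>M x + \<xi>\<close>. With the choice \<open>\<xi> = w - M x\<close>, for any trajectory x of the plant, it
  receives w; a solution of the coupled system then contains a solution of the observer equation.\<close>

lemma observer_solution_exists:
  assumes u: "continuous_on {0..} u" and z0: "z0 \<in> C0 {-r..0}" and w: "w \<in> Linf_loc UNIV"
  obtains z where "delay_solution r {0..} z0 (\<lambda>t \<phi>. F \<phi> (w t) (u t)) z"
proof -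
  obtain x where x: "delay_solution r {0..} (\<lambda>\<theta>\<in>{-r..0}. 0) (\<lambda>t \<phi>. f \<phi> (u t) 0) x"
    using plant_solution_exists[OF u zero_history_C0] .
  have \<xi>: "(\<lambda>t. w t - M (x t)) \<in> Linf_loc UNIV" using Linf_diff[OF w output_Linf[OF x]] .
  obtain x' z where x': "delay_solution r {0..} (\<lambda>\<theta>\<in>{-r..0}. 0) (\<lambda>t \<phi>. f \<phi> (u t) 0) x'"
    and z: "delay_solution r {0..} z0 (\<lambda>t \<phi>. F \<phi> (M (hist r x' t 0) + (w t - M (x t))) (u t)) z"
    using REO_along(1)[OF u zero_history_C0 z0 \<xi>] by blast
  have "x' t = x t" if "t \<ge> 0" for t
    using plant_solution_unique[OF x' x, of t] that by auto
  then have "delay_solution r {0..} z0 (\<lambda>t \<phi>. F \<phi> (w t) (u t)) z"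
    by (intro delay_solution_cong[OF z]) (use r in auto)
  then show ?thesis by (rule that)
qed

text \<open>The same choice of \<open>\<xi>\<close> turns the observer estimate into an estimate in terms of \<open>w - M x\<close>.\<close>

lemma observer_error_bound:
  assumes u: "continuous_on {0..} u" and x0: "x0 \<in> C0 {-r..0}" and z0: "z0 \<in> C0 {-r..0}"
    and w: "w \<in> Linf_loc UNIV" and x: "delay_solution r {0..} x0 (\<lambda>t \<phi>. f \<phi> (u t) 0) x"
    and z: "delay_solution r {0..} z0 (\<lambda>t \<phi>. F \<phi> (w t) (u t)) z" and t: "0 \<le> t"
  shows "supnorm {-r..0} (\<lambda>\<theta>. \<Psi> (hist r z t) \<theta> - hist r x t \<theta>)
    \<le> exp (- \<sigma> * t) * a0 (supnorm {-r..0} x0 + supnorm {-r..0} z0)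
      + \<gamma> * (SUP s\<in>{0..t}. norm (w s - M (x s)) * exp (- \<sigma> * (t - s)))"
proof -
  have \<xi>: "(\<lambda>t. w t - M (x t)) \<in> Linf_loc UNIV" using Linf_diff[OF w output_Linf[OF x]] .
  have z': "delay_solution r {0..} z0 (\<lambda>t \<phi>. F \<phi> (M (hist r x t 0) + (w t - M (x t))) (u t)) z"
    using z by simp
  show ?thesis by (rule REO_along(2)[OF u x0 z0 \<xi> x z' t])
qed

text \<open>The boundedness and one-sided Lipschitz conditions on the set of all arguments bounded by B.\<close>

lemma observer_field_bounds:
  assumes "0 \<le> B"
  shows "\<exists>L BF. 0 \<le> L \<and>
    (\<forall>\<phi> y v. \<phi> \<in> C0 {-r..0} \<and> supnorm {-r..0} \<phi> \<le> B \<and> norm y \<le> B \<and> norm v \<le> B \<longrightarrow> norm (F \<phi> y v) \<le> BF) \<and>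
    (\<forall>\<phi> \<psi> y v. \<phi> \<in> C0 {-r..0} \<and> \<psi> \<in> C0 {-r..0} \<and> supnorm {-r..0} \<phi> \<le> B \<and> supnorm {-r..0} \<psi> \<le> B \<and>
       norm y \<le> B \<and> norm v \<le> B \<longrightarrow>
       (\<phi> 0 - \<psi> 0) \<bullet> (F \<phi> y v - F \<psi> y v) \<le> L * (supnorm {-r..0} (\<lambda>\<theta>. \<phi> \<theta> - \<psi> \<theta>))\<^sup>2)"
proof -
  define \<Omega> where "\<Omega> = {(\<phi>, y, v) | \<phi> y v. (\<phi> :: real \<Rightarrow> 'z) \<in> C0 {-r..0} \<and> supnorm {-r..0} \<phi> \<le> B \<and> norm (y::'y) \<le> B \<and> norm (v::'u) \<le> B}"
  have "(\<lambda>(z, y, u). (supnorm {-r..0} z, y, u)) ` \<Omega> \<subseteq> cball 0 B \<times> cball 0 B \<times> cball 0 B"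
    using r by (auto simp: \<Omega>_def C0_iff abs_of_nonneg supnorm_nonneg)
  then have "bounded ((\<lambda>(z, y, u). (supnorm {-r..0} z, y, u)) ` \<Omega>)"
    by (rule bounded_subset[rotated]) (intro bounded_Times bounded_cball)
  moreover have "\<Omega> \<subseteq> C0 {-r..0} \<times> UNIV \<times> UNIV" by (auto simp: \<Omega>_def)
  ultimately have b: "bounded ((\<lambda>(z, y, u). F z y u) ` \<Omega>)" and
    l: "\<exists>L\<ge>0. \<forall>z z' y u. (z, y, u) \<in> \<Omega> \<and> (z', y, u) \<in> \<Omega> \<longrightarrow>
           (z 0 - z' 0) \<bullet> (F z y u - F z' y u) \<le> L * (supnorm {-r..0} (\<lambda>\<theta>. z \<theta> - z' \<theta>))\<^sup>2"
    using maps unfolding observer_maps_def by blast+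
  from b obtain BF where BF: "\<forall>a\<in>(\<lambda>(z, y, u). F z y u) ` \<Omega>. norm a \<le> BF" unfolding bounded_iff by blast
  from l obtain L where L: "0 \<le> L" "\<And>z z' y u. (z, y, u) \<in> \<Omega> \<Longrightarrow> (z', y, u) \<in> \<Omega> \<Longrightarrow>
           (z 0 - z' 0) \<bullet> (F z y u - F z' y u) \<le> L * (supnorm {-r..0} (\<lambda>\<theta>. z \<theta> - z' \<theta>))\<^sup>2" by blast
  have "norm (F \<phi> y v) \<le> BF" if "\<phi> \<in> C0 {-r..0}" "supnorm {-r..0} \<phi> \<le> B" "norm y \<le> B" "norm v \<le> B" for \<phi> y v
    using BF that by (force simp: \<Omega>_def)
  moreover have "(\<phi> 0 - \<psi> 0) \<bullet> (F \<phi> y v - F \<psi> y v) \<le> L * (supnorm {-r..0} (\<lambda>\<theta>. \<phi> \<theta> - \<psi> \<theta>))\<^sup>2"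
    if "\<phi> \<in> C0 {-r..0}" "\<psi> \<in> C0 {-r..0}" "supnorm {-r..0} \<phi> \<le> B" "supnorm {-r..0} \<psi> \<le> B" "norm y \<le> B" "norm v \<le> B"
    for \<phi> \<psi> y v
    using that by (intro L(2)) (auto simp: \<Omega>_def)
  ultimately show ?thesis using L(1) by (intro exI[of _ L] exI[of _ BF]) simp
qed

lemma supnorm_hist_le:
  assumes "\<And>s. s \<in> {-r..t} \<Longrightarrow> norm (x s) \<le> B" "0 \<le> t"
  shows "supnorm {-r..0} (hist r x t) \<le> B"
  by (rule supnorm_le) (use r assms in \<open>auto simp: hist_def\<close>)

lemma supnorm_hist_diff_le:
  assumes "\<And>s. s \<in> {-r..t} \<Longrightarrow> norm (x s - y s) \<le> B" "0 \<le> t"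
  shows "supnorm {-r..0} (\<lambda>\<theta>. hist r x t \<theta> - hist r y t \<theta>) \<le> B"
  by (rule supnorm_le) (use r assms in \<open>auto simp: hist_def\<close>)

text \<open>Along a fixed trajectory the observer field is jointly continuous in time and measurement; on compact
  sets it is therefore uniformly continuous, which is how a small change of the measurement is controlled.\<close>

lemma field_measurement_continuous:
  assumes z: "continuous_on {-r..T} z" and u: "continuous_on {0..T} u" and T: "0 \<le> T"
  shows "continuous_on ({0..T} \<times> UNIV) (\<lambda>(s, y). F (hist r z s) y (u s))"
proof -
  have "{-r..0} \<union> {0..T} = {-r..T}" using r T by auto
  then have h: "continuous_map (top_of_set {0..T}) (C0top {-r..0}) (hist r z)"
    using z by (intro continuous_map_hist_C0) auto
  let ?D = "top_of_set ({0..T} \<times> (UNIV :: 'y set))"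
  have fst: "continuous_map ?D (top_of_set {0..T}) fst"
    by (auto simp: continuous_map_in_subtopology intro: continuous_on_fst continuous_on_id)
  have "continuous_map ?D (prod_topology (C0top {-r..0}) (prod_topology euclidean euclidean))
      (\<lambda>p. (hist r z (fst p), snd p, u (fst p)))"
  proof (intro continuous_map_pairedI)
    show "continuous_map ?D (C0top {-r..0}) (\<lambda>p. hist r z (fst p))"
      using continuous_map_compose[OF fst h] by (simp add: o_def)
    show "continuous_map ?D euclidean (\<lambda>p. u (fst p))"
      using continuous_map_compose[OF fst, of euclidean u] u by (simp add: o_def)
    show "continuous_map ?D euclidean snd" by (simp add: continuous_on_snd continuous_on_id)
  qed
  moreover have "continuous_map (prod_topology (C0top {-r..0}) (prod_topology euclidean euclidean)) euclidean (\<lambda>(z, y, u). F z y u)"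
    using maps by (simp add: observer_maps_def)
  ultimately have "continuous_map ?D euclidean ((\<lambda>(z, y, u). F z y u) \<circ> (\<lambda>p. (hist r z (fst p), snd p, u (fst p))))"
    by (rule continuous_map_compose)
  then show ?thesis by (simp add: o_def split_beta)
qed

end

section \<open>Continuous dependence of the observer on its input\<close>

context observed_delay_system begin

text \<open>Let \<open>d = z' - z\<close>. Half the derivative of \<open>|d|\<^sup>2\<close> is the inner product of d with the difference of the
  observer fields, which splits into two parts. Changing the history while keeping the measurement \<open>w'\<close>
  costs at most \<open>L\<close> times the squared supremum norm of the past of d, by the one-sided Lipschitz
  condition. Changing the measurement along the fixed trajectory z costs little, by uniform continuity.
  Gronwall's inequality keeps d small as long as \<open>z'\<close> stays in the bounded set on which these estimates
  hold, and a first-exit argument shows that it never leaves this set.\<close>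

lemma observer_stability:
  assumes u: "continuous_on {0..T} u" and T: "0 \<le> T" and e: "0 < e"
    and z: "delay_solution r {0..T} z0 (\<lambda>t \<phi>. F \<phi> (w t) (u t)) z"
    and w: "\<And>t. t \<in> {0..T} \<Longrightarrow> norm (w t) \<le> Bw"
  shows "\<exists>\<kappa>>0. \<forall>w' z' t. delay_solution r {0..T} z0 (\<lambda>t \<phi>. F \<phi> (w' t) (u t)) z' \<and>
       (\<forall>s\<in>{0..T}. norm (w' s - w s) \<le> \<kappa>) \<and> t \<in> {-r..T} \<longrightarrow> norm (z' t - z t) \<le> e"
proof -
  \<comment> \<open>As long as \<open>|d| \<le> e1 \<le> 1\<close>, the perturbed trajectory is bounded by \<open>Bz + 1 \<le> B\<close>.\<close>
  define e1 where "e1 = min e 1"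
  have e1: "0 < e1" "e1 \<le> e" "e1 \<le> 1" using e by (auto simp: e1_def)
  have un: "{-r..0} \<union> {0..T} = {-r..T}" using r T by auto
  have czT: "continuous_on {-r..T} z" using z un by (simp add: delay_solution_def)
  have "bounded (z ` {-r..T})" by (intro compact_imp_bounded compact_continuous_image czT) auto
  then obtain Bz where Bz: "\<And>t. t \<in> {-r..T} \<Longrightarrow> norm (z t) \<le> Bz" unfolding bounded_iff by blast
  have "bounded (u ` {0..T})" by (intro compact_imp_bounded compact_continuous_image u) auto
  then obtain Bu where Bu: "\<And>t. t \<in> {0..T} \<Longrightarrow> norm (u t) \<le> Bu" unfolding bounded_iff by blast
  define B where "B = max (Bz + 1) (max (Bw + 1) Bu)"
  have B: "Bz + 1 \<le> B" "Bw + 1 \<le> B" "Bu \<le> B" by (auto simp: B_def)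
  have "0 \<le> B" using order_trans[OF norm_ge_zero Bu[of 0]] B(3) T by simp
  from observer_field_bounds[OF this] obtain L BF where L: "0 \<le> L" and
    BF': "\<forall>\<phi> y v. \<phi> \<in> C0 {-r..0} \<and> supnorm {-r..0} \<phi> \<le> B \<and> norm y \<le> B \<and> norm v \<le> B \<longrightarrow> norm (F \<phi> y v) \<le> BF" and
    os': "\<forall>\<phi> \<psi> y v. \<phi> \<in> C0 {-r..0} \<and> \<psi> \<in> C0 {-r..0} \<and> supnorm {-r..0} \<phi> \<le> B \<and> supnorm {-r..0} \<psi> \<le> B \<and>
       norm y \<le> B \<and> norm v \<le> B \<longrightarrow>
       (\<phi> 0 - \<psi> 0) \<bullet> (F \<phi> y v - F \<psi> y v) \<le> L * (supnorm {-r..0} (\<lambda>\<theta>. \<phi> \<theta> - \<psi> \<theta>))\<^sup>2"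
    by (elim exE conjE)
  note BF = BF'[rule_format, OF conjI, OF _ conjI, OF _ _ conjI]
  note one_sided = os'[rule_format, OF conjI, OF _ conjI, OF _ _ conjI, OF _ _ _ conjI, OF _ _ _ _ conjI]
  \<comment> \<open>\<open>|d|\<^sup>2\<close> grows at rate \<open>2 L\<close>, and \<open>2 L / \<mu> \<le> 1 / 2\<close>.\<close>
  define \<mu> where "\<mu> = 4 * L + 1"
  have \<mu>: "\<mu> > 0" using L by (simp add: \<mu>_def)
  \<comment> \<open>A change \<open>\<kappa>0\<close> of the field yields \<open>|d|\<^sup>2 \<le> 4 \<kappa>0 T exp (\<mu> T)\<close>, which must stay below \<open>e1\<^sup>2 / 2\<close>; the use of \<open>T + 1\<close> covers \<open>T = 0\<close>.\<close>
  define \<kappa>0 where "\<kappa>0 = e1\<^sup>2 / (8 * (T + 1) * exp (\<mu> * T))"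
  have \<kappa>0: "\<kappa>0 > 0" using e1 T by (simp add: \<kappa>0_def)
  have "uniformly_continuous_on ({0..T} \<times> cball 0 B) (\<lambda>(s, y). F (hist r z s) y (u s))"
    by (rule compact_uniformly_continuous[OF continuous_on_subset[OF field_measurement_continuous[OF czT u T]]])
       (auto intro: compact_Times)
  then obtain dd where dd: "dd > 0" and dd': "\<forall>p\<in>{0..T} \<times> cball 0 B. \<forall>q\<in>{0..T} \<times> cball 0 B. dist q p < dd \<longrightarrow>
      dist (case q of (s, y) \<Rightarrow> F (hist r z s) y (u s)) (case p of (s, y) \<Rightarrow> F (hist r z s) y (u s)) < \<kappa>0"
    unfolding uniformly_continuous_on_def using \<kappa>0 by (elim allE impE exE conjE)
  define \<kappa> where "\<kappa> = min 1 (dd / 2)"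
  have \<kappa>: "\<kappa> > 0" "\<kappa> \<le> 1" "\<kappa> < dd" using dd by (auto simp: \<kappa>_def)
  have meas: "norm (F (hist r z s) y' (u s) - F (hist r z s) y (u s)) \<le> \<kappa>0"
    if "s \<in> {0..T}" "norm y \<le> B" "norm y' \<le> B" "norm (y' - y) \<le> \<kappa>" for s y y'
  proof -
    have "dist (s, y') (s, y) < dd" using that \<kappa> by (simp add: dist_Pair_Pair dist_norm)
    with dd'[rule_format, of "(s, y)" "(s, y')"] that show ?thesis by (simp add: dist_norm)
  qed
  show ?thesis
  proof (intro exI[of _ \<kappa>] conjI \<kappa>(1) allI impI, elim conjE)
    fix w' z' t
    assume z': "delay_solution r {0..T} z0 (\<lambda>t \<phi>. F \<phi> (w' t) (u t)) z'"
      and close': "\<forall>s\<in>{0..T}. norm (w' s - w s) \<le> \<kappa>" and t: "t \<in> {-r..T}"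
    note close = close'[rule_format]
    have cz'T: "continuous_on {-r..T} z'" using z' un by (simp add: delay_solution_def)
    have w': "norm (w' s) \<le> B" if "s \<in> {0..T}" for s
      using norm_triangle_ineq[of "w' s - w s" "w s"] close[OF that] w[OF that] \<kappa> B by simp
    define d where "d s = z' s - z s" for s
    define g where "g s = F (hist r z' s) (w' s) (u s) - F (hist r z s) (w s) (u s)" for s
    have ai: "(\<lambda>s. F (hist r z' s) (w' s) (u s)) absolutely_integrable_on {0..t}"
       "(\<lambda>s. F (hist r z s) (w s) (u s)) absolutely_integrable_on {0..t}" if "t \<in> {0..T}" for t
      using z z' that by (auto simp: delay_solution_def)
    have gai: "g absolutely_integrable_on {0..t}" if "t \<in> {0..T}" for t
      unfolding g_def[abs_def] using set_integral_diff(1)[OF ai[OF that]] .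
    have d_int: "d t = integral {0..t} g" if "t \<in> {0..T}" for t
      using z z' that Henstock_Kurzweil_Integration.integral_diff[OF ai[OF that, THEN set_lebesgue_integral_eq_integral(1)]]
      by (simp add: d_def g_def[abs_def] delay_solution_def)
    have d_past: "d s = 0" if "s \<in> {-r..0}" for s using z z' that by (auto simp: d_def delay_solution_def)
    have cd: "continuous_on {-r..T} d" unfolding d_def[abs_def] by (intro continuous_intros czT cz'T)
    \<comment> \<open>A bound \<open>e1\<close> up to time t improves itself to the strictly smaller \<open>e1 / sqrt 2\<close>.\<close>
    have small: "(norm (d t))\<^sup>2 \<le> e1\<^sup>2 / 2" if t: "t \<in> {0..T}" and le: "\<And>s. s \<in> {0..t} \<Longrightarrow> norm (d s) \<le> e1" for t
    proof -
      have le': "norm (d s) \<le> e1" if "s \<in> {-r..t}" for s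
        using le[of s] d_past[of s] that e1 by (cases "s \<le> 0") auto
      have hC: "hist r z s \<in> C0 {-r..0}" "hist r z' s \<in> C0 {-r..0}" if "s \<in> {0..t}" for s
        using that t by (auto intro!: hist_in_C0 continuous_on_subset[OF czT] continuous_on_subset[OF cz'T])
      have hB: "supnorm {-r..0} (hist r z s) \<le> B" "supnorm {-r..0} (hist r z' s) \<le> B" if s: "s \<in> {0..t}" for s
      proof -
        have "norm (z a) \<le> B" if "a \<in> {-r..s}" for a using Bz[of a] B that s t by auto
        then show "supnorm {-r..0} (hist r z s) \<le> B" using s by (intro supnorm_hist_le) auto
        have "norm (z' a) \<le> B" if "a \<in> {-r..s}" for a
        proof -
          have "norm (z' a) \<le> norm (d a) + norm (z a)" using norm_triangle_ineq[of "d a" "z a"] by (simp add: d_def)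
          also have "\<dots> \<le> e1 + Bz" using le'[of a] Bz[of a] that s t by (intro add_mono) auto
          finally show ?thesis using e1 B by simp
        qed
        then show "supnorm {-r..0} (hist r z' s) \<le> B" using s by (intro supnorm_hist_le) auto
      qed
      have wB: "norm (w s) \<le> B" "norm (w' s) \<le> B" "norm (u s) \<le> B" if "s \<in> {0..t}" for s
        using w[of s] w'[of s] Bu[of s] B that t by auto
      have gB: "norm (g s) \<le> 2 * BF" if s: "s \<in> {0..t}" for s
        using norm_triangle_ineq4[of "F (hist r z' s) (w' s) (u s)" "F (hist r z s) (w s) (u s)"]
          BF[OF hC(1)[OF s] hB(1)[OF s] wB(1)[OF s] wB(3)[OF s]] BF[OF hC(2)[OF s] hB(2)[OF s] wB(2)[OF s] wB(3)[OF s]]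
        unfolding g_def by linarith
      have pt: "d s \<bullet> g s \<le> L * (supnorm {-r..0} (\<lambda>\<theta>. hist r z' s \<theta> - hist r z s \<theta>))\<^sup>2 + \<kappa>0" if s: "s \<in> {0..t}" for s
      proof -
        have "d s \<bullet> g s = d s \<bullet> (F (hist r z' s) (w' s) (u s) - F (hist r z s) (w' s) (u s))
            + d s \<bullet> (F (hist r z s) (w' s) (u s) - F (hist r z s) (w s) (u s))"
          by (simp add: g_def inner_diff_right)
        moreover have "d s \<bullet> (F (hist r z' s) (w' s) (u s) - F (hist r z s) (w' s) (u s))
            \<le> L * (supnorm {-r..0} (\<lambda>\<theta>. hist r z' s \<theta> - hist r z s \<theta>))\<^sup>2"
          using one_sided[OF hC(2)[OF s] hC(1)[OF s] hB(2)[OF s] hB(1)[OF s] wB(2)[OF s] wB(3)[OF s]] by (simp add: d_def)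
        moreover have "d s \<bullet> (F (hist r z s) (w' s) (u s) - F (hist r z s) (w s) (u s)) \<le> 1 * \<kappa>0"
          using le[OF s] e1 meas[of s "w s" "w' s"] wB[OF s] close[of s] s t
          by (intro order_trans[OF norm_cauchy_schwarz] mult_mono) auto
        ultimately show ?thesis by linarith
      qed
      have t0: "0 \<le> t" using t by simp
      have gai_t: "g absolutely_integrable_on {0..t}" using gai[OF t] .
      have d_int_t: "d s = integral {0..s} g" if "s \<in> {0..t}" for s using d_int[of s] that t by auto
      have inner1: "(\<lambda>s. d s \<bullet> g s) integrable_on {0..t}"
        by (rule inner_indefinite_integral(1)[OF gai_t gB d_int_t t0])
      have inner2: "d s \<bullet> d s = 2 * integral {0..s} (\<lambda>s. d s \<bullet> g s)" if s: "s \<in> {0..t}" for s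
        by (rule inner_indefinite_integral(2)[OF gai_t gB d_int_t t0 s])
      have "(norm (d t))\<^sup>2 \<le> 2 * (2 * \<kappa>0 * T) * exp (\<mu> * t)"
      proof (rule weighted_sup_bound[where q = "\<lambda>s. (norm (d s))\<^sup>2" and T = t])
        show "continuous_on {0..t} (\<lambda>s. (norm (d s))\<^sup>2)"
          using r t by (intro continuous_intros continuous_on_subset[OF cd]) auto
        fix N s assume N: "0 \<le> N" "\<And>s. s \<in> {0..t} \<Longrightarrow> (norm (d s))\<^sup>2 \<le> N * exp (\<mu> * s)" and s: "s \<in> {0..t}"
        have b: "d \<tau> \<bullet> g \<tau> \<le> L * N * exp (\<mu> * \<tau>) + \<kappa>0" if \<tau>: "\<tau> \<in> {0..s}" for \<tau>
        proof -
          have "supnorm {-r..0} (\<lambda>\<theta>. hist r z' \<tau> \<theta> - hist r z \<tau> \<theta>) \<le> sqrt (N * exp (\<mu> * \<tau>))"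
          proof (rule supnorm_hist_diff_le)
            fix a assume a: "a \<in> {-r..\<tau>}"
            show "norm (z' a - z a) \<le> sqrt (N * exp (\<mu> * \<tau>))"
            proof (cases "a \<le> 0")
              case True then show ?thesis using d_past[of a] a N by (simp add: d_def)
            next
              case False
              have "(norm (d a))\<^sup>2 \<le> N * exp (\<mu> * a)" using N(2)[of a] False a \<tau> s by auto
              also have "\<dots> \<le> N * exp (\<mu> * \<tau>)" using a N(1) \<mu> by (intro mult_left_mono) auto
              finally have "norm (d a) \<le> sqrt (N * exp (\<mu> * \<tau>))" by (simp add: real_le_rsqrt)
              then show ?thesis by (simp add: d_def)
            qed
          qed (use \<tau> in auto)
          moreover have "0 \<le> supnorm {-r..0} (\<lambda>\<theta>. hist r z' \<tau> \<theta> - hist r z \<tau> \<theta>)"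
            using C0_diff_supnorm_nonneg[OF _ hC(2)[of \<tau>] hC(1)[of \<tau>]] r \<tau> s by auto
          ultimately have "(supnorm {-r..0} (\<lambda>\<theta>. hist r z' \<tau> \<theta> - hist r z \<tau> \<theta>))\<^sup>2 \<le> (sqrt (N * exp (\<mu> * \<tau>)))\<^sup>2"
            by (rule power_mono)
          then have "(supnorm {-r..0} (\<lambda>\<theta>. hist r z' \<tau> \<theta> - hist r z \<tau> \<theta>))\<^sup>2 \<le> N * exp (\<mu> * \<tau>)"
            using N(1) by simp
          from mult_left_mono[OF this L] show ?thesis using pt[of \<tau>] \<tau> s by (auto simp: mult.assoc)
        qed
        have ie: "(\<lambda>\<tau>. exp (\<mu> * \<tau>)) integrable_on {0..s}" "integral {0..s} (\<lambda>\<tau>. exp (\<mu> * \<tau>)) \<le> exp (\<mu> * s) / \<mu>"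
          using integral_exp_le[OF \<mu>, of s] s by auto
        have ie': "(\<lambda>\<tau>. L * N * exp (\<mu> * \<tau>)) integrable_on {0..s}"
          using integrable_on_cmult_left[OF ie(1), of "L * N"] by simp
        have "(norm (d s))\<^sup>2 = 2 * integral {0..s} (\<lambda>\<tau>. d \<tau> \<bullet> g \<tau>)"
          using inner2[OF s] by (simp add: power2_norm_eq_inner)
        also have "integral {0..s} (\<lambda>\<tau>. d \<tau> \<bullet> g \<tau>) \<le> integral {0..s} (\<lambda>\<tau>. L * N * exp (\<mu> * \<tau>) + \<kappa>0)"
          using b s by (intro integral_le Henstock_Kurzweil_Integration.integrable_add ie' integrable_on_subinterval[OF inner1]) auto
        also have "\<dots> = L * N * integral {0..s} (\<lambda>\<tau>. exp (\<mu> * \<tau>)) + \<kappa>0 * s"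
          using s by (subst Henstock_Kurzweil_Integration.integral_add[OF ie']) auto
        also have "2 * \<dots> \<le> 2 * (L * N * (exp (\<mu> * s) / \<mu>) + \<kappa>0 * s)"
          using ie(2) L N(1) by (intro mult_left_mono add_right_mono) auto
        also have "\<dots> = (2 * L / \<mu>) * (N * exp (\<mu> * s)) + 2 * \<kappa>0 * s" by (simp add: algebra_simps)
        also have "\<dots> \<le> 1 / 2 * (N * exp (\<mu> * s)) + 2 * \<kappa>0 * T * exp (\<mu> * s)"
        proof (rule add_mono)
          show "2 * L / \<mu> * (N * exp (\<mu> * s)) \<le> 1 / 2 * (N * exp (\<mu> * s))"
            using N(1) L by (intro mult_right_mono) (auto simp: \<mu>_def divide_simps)
          have "2 * \<kappa>0 * s * 1 \<le> 2 * \<kappa>0 * T * exp (\<mu> * s)"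
            using s t \<kappa>0 \<mu> by (intro mult_mono) auto
          then show "2 * \<kappa>0 * s \<le> 2 * \<kappa>0 * T * exp (\<mu> * s)" by simp
        qed
        finally show "(norm (d s))\<^sup>2 \<le> (2 * \<kappa>0 * T + N / 2) * exp (\<mu> * s)" by (simp add: algebra_simps)
      qed (use t T \<kappa>0 in auto)
      also have "\<dots> \<le> 4 * \<kappa>0 * (T + 1) * exp (\<mu> * T)"
      proof -
        have "(4 * \<kappa>0 * T) * exp (\<mu> * t) \<le> (4 * \<kappa>0 * (T + 1)) * exp (\<mu> * T)"
          using t T \<kappa>0 \<mu> by (intro mult_mono) auto
        then show ?thesis by (simp add: algebra_simps)
      qed
      also have "\<dots> = e1\<^sup>2 / 2"
      proof -
        define m where "m = (T + 1) * exp (\<mu> * T)"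
        have "m \<noteq> 0" using T by (simp add: m_def)
        moreover have "4 * \<kappa>0 * (T + 1) * exp (\<mu> * T) = 4 * (e1\<^sup>2 / (8 * m)) * m"
          unfolding \<kappa>0_def m_def mult.assoc ..
        ultimately show ?thesis by simp
      qed
      finally show ?thesis .
    qed
    have all: "norm (d t) < e1" if t: "t \<in> {0..T}" for t
    proof (rule ccontr)
      assume "\<not> norm (d t) < e1"
      have nd: "continuous_on {a..b} (\<lambda>s. norm (d s))" if "0 \<le> a" "b \<le> T" for a b
        using that r by (intro continuous_intros continuous_on_subset[OF cd]) auto
      \<comment> \<open>At the first time m with \<open>|d m| = e1\<close> the improved bound is contradicted.\<close>
      define A where "A = {s \<in> {0..T}. norm (d s) = e1}"
      have A_ex: "\<exists>s\<in>A. s \<le> a" if "a \<in> {0..T}" "e1 \<le> norm (d a)" for a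
      proof -
        have "\<exists>s\<ge>0. s \<le> a \<and> norm (d s) = e1"
          using that d_past[of 0] r e1 by (intro IVT' nd) auto
        then show ?thesis using that by (auto simp: A_def)
      qed
      have "closed A"
        unfolding A_def by (intro continuous_closed_preimage_constant nd) (use T in auto)
      moreover have "bounded A" by (rule bounded_subset[of "{0..T}"]) (auto simp: A_def)
      ultimately have "compact A" by (simp add: compact_eq_bounded_closed)
      moreover have "A \<noteq> {}" using A_ex[OF t] \<open>\<not> norm (d t) < e1\<close> by auto
      ultimately have "\<exists>m\<in>A. \<forall>s\<in>A. m \<le> s" by (rule compact_attains_inf)
      then obtain m where m: "m \<in> A" "\<And>s. s \<in> A \<Longrightarrow> m \<le> s" by blast
      have "norm (d s) \<le> e1" if "s \<in> {0..m}" for s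
      proof (rule ccontr)
        assume c: "\<not> norm (d s) \<le> e1"
        have "s \<in> {0..T}" using that m(1) by (auto simp: A_def)
        from A_ex[OF this] c obtain s' where "s' \<in> A" "s' \<le> s" by auto
        then have "s = m" using m(2)[of s'] that by auto
        then show False using c m(1) by (simp add: A_def)
      qed
      then have "(norm (d m))\<^sup>2 \<le> e1\<^sup>2 / 2" using m(1) by (intro small) (auto simp: A_def)
      then show False using m(1) e1 by (simp add: A_def)
    qed
    show "norm (z' t - z t) \<le> e"
      using all[of t] d_past[of t] t e1 by (cases "t \<le> 0") (auto simp: d_def)
  qed
qed

text \<open>Stability for equal inputs, with an arbitrarily small tolerance.\<close>

lemma observer_solution_unique:
  assumes u: "continuous_on {0..T} u" and T: "0 \<le> T"
    and z: "delay_solution r {0..T} z0 (\<lambda>t \<phi>. F \<phi> (w t) (u t)) z"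
    and z': "delay_solution r {0..T} z0 (\<lambda>t \<phi>. F \<phi> (w' t) (u t)) z'"
    and w: "\<And>t. t \<in> {0..T} \<Longrightarrow> norm (w t) \<le> Bw" and eq: "\<And>t. t \<in> {0..T} \<Longrightarrow> w' t = w t"
    and t: "t \<in> {-r..T}"
  shows "z' t = z t"
proof -
  have "norm (z' t - z t) \<le> 0 + e" if e: "e > 0" for e
  proof -
    have "\<exists>\<kappa>>0. \<forall>w' z' t. delay_solution r {0..T} z0 (\<lambda>t \<phi>. F \<phi> (w' t) (u t)) z' \<and>
       (\<forall>s\<in>{0..T}. norm (w' s - w s) \<le> \<kappa>) \<and> t \<in> {-r..T} \<longrightarrow> norm (z' t - z t) \<le> e"
      by (rule observer_stability[OF u T e z w])
    then obtain \<kappa> where "\<kappa> > 0" and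
      "\<forall>w' z' t. delay_solution r {0..T} z0 (\<lambda>t \<phi>. F \<phi> (w' t) (u t)) z' \<and>
       (\<forall>s\<in>{0..T}. norm (w' s - w s) \<le> \<kappa>) \<and> t \<in> {-r..T} \<longrightarrow> norm (z' t - z t) \<le> e" by (elim exE conjE)
    from this(2)[rule_format, of w' z' t] this(1) eq z' t show ?thesis by auto
  qed
  then have "norm (z' t - z t) \<le> 0" by (rule field_le_epsilon)
  then show ?thesis by simp
qed

end

section \<open>The output rate predicted by the observer\<close>

locale driven_observer = observed_delay_system r f M F \<Psi> \<gamma> \<sigma> g0 a0 Lf
  for r and f :: "(real \<Rightarrow> 'x::euclidean_space) \<Rightarrow> 'u::euclidean_space \<Rightarrow> 'd::euclidean_space \<Rightarrow> 'x"
    and M :: "'x \<Rightarrow> 'y::euclidean_space" and F :: "(real \<Rightarrow> 'z::euclidean_space) \<Rightarrow> 'y \<Rightarrow> 'u \<Rightarrow> 'z"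
    and \<Psi> \<gamma> \<sigma> g0 a0 Lf +
  fixes z0 :: "real \<Rightarrow> 'z" and u :: "real \<Rightarrow> 'u"
  assumes z0: "z0 \<in> C0 {-r..0}" and u: "continuous_on {0..} u"
begin

text \<open>By uniqueness the observer trajectory is a functional of its input signal, which moreover is causal
  (\<open>Z_causal\<close>). \<open>G w\<close> is the output rate predicted along it.\<close>

definition Z :: "(real \<Rightarrow> 'y) \<Rightarrow> real \<Rightarrow> 'z" where
  "Z w = (SOME z. delay_solution r {0..} z0 (\<lambda>t \<phi>. F \<phi> (w t) (u t)) z)"

definition G :: "(real \<Rightarrow> 'y) \<Rightarrow> real \<Rightarrow> 'y" where
  "G w s = M (f (\<Psi> (hist r (Z w) s)) (u s) 0)"

lemma Z_solution:
  assumes "w \<in> Linf_loc UNIV" shows "delay_solution r {0..} z0 (\<lambda>t \<phi>. F \<phi> (w t) (u t)) (Z w)"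
proof -
  obtain z where "delay_solution r {0..} z0 (\<lambda>t \<phi>. F \<phi> (w t) (u t)) z"
    using observer_solution_exists[OF u z0 assms] .
  from someI[of "delay_solution r {0..} z0 (\<lambda>t \<phi>. F \<phi> (w t) (u t))", OF this]
  show ?thesis by (simp add: Z_def)
qed

lemma Z_solution_upto:
  assumes "w \<in> Linf_loc UNIV" shows "delay_solution r {0..T} z0 (\<lambda>t \<phi>. F \<phi> (w t) (u t)) (Z w)"
  by (rule delay_solution_subset[OF Z_solution[OF assms]]) auto

lemma u_upto: "continuous_on {0..T} u"
  by (rule continuous_on_subset[OF u]) auto

lemma Z_unique:
  assumes "w \<in> Linf_loc UNIV" "0 \<le> T" "delay_solution r {0..T} z0 (\<lambda>t \<phi>. F \<phi> (w' t) (u t)) z'"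
    "\<And>t. t \<in> {0..T} \<Longrightarrow> w' t = w t" "t \<in> {-r..T}"
  shows "z' t = Z w t"
proof -
  obtain B where "\<And>t. t \<in> {0..T} \<Longrightarrow> norm (w t) \<le> B" using Linf_norm_bound[OF assms(1)] by metis
  from observer_solution_unique[OF u_upto assms(2) Z_solution_upto[OF assms(1)] assms(3) this assms(4,5)]
  show ?thesis by simp
qed

lemma Z_continuous:
  assumes "w \<in> Linf_loc UNIV" shows "continuous_on ({-r..0} \<union> {0..}) (Z w)"
  using Z_solution[OF assms] by (simp add: delay_solution_def)

text \<open>At \<open>t = T\<close> the inputs may already differ; the trajectories still agree there because they are continuous.\<close>

lemma Z_causal:
  assumes w: "w \<in> Linf_loc UNIV" "w' \<in> Linf_loc UNIV" and eq: "\<And>t. 0 \<le> t \<Longrightarrow> t < T \<Longrightarrow> w' t = w t"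
    and t: "t \<in> {-r..T}"
  shows "Z w' t = Z w t"
proof -
  have *: "Z w' t = Z w t" if "-r \<le> t" "t < T" for t
  proof -
    have "Z w' t = Z w t" if "0 \<le> t"
      using Z_unique[OF w(1) that Z_solution_upto[OF w(2)], of t] eq \<open>t < T\<close> \<open>-r \<le> t\<close> that by auto
    moreover have "Z w' t = Z w t" if "t \<le> 0"
      using Z_solution[OF w(1)] Z_solution[OF w(2)] that \<open>-r \<le> t\<close> by (auto simp: delay_solution_def)
    ultimately show ?thesis by linarith
  qed
  show ?thesis
  proof (cases "t < T \<or> t \<le> 0")
    case True
    then show ?thesis using * t Z_solution[OF w(1)] Z_solution[OF w(2)] by (auto simp: delay_solution_def)
  next
    case False
    then have tT: "t = T" "0 < T" using t by auto
    have sub: "{0..T} \<subseteq> {-r..0} \<union> {0..}" by auto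
    have lim: "((\<lambda>s. Z v s) \<longlongrightarrow> Z v T) (at T within {0..<T})" if "v \<in> Linf_loc UNIV" for v
    proof -
      have "(Z v \<longlongrightarrow> Z v T) (at T within {0..T})"
        using continuous_on_subset[OF Z_continuous[OF that] sub] tT by (auto simp: continuous_on_def)
      then show ?thesis by (rule tendsto_within_subset) auto
    qed
    have "((\<lambda>s. Z w s) \<longlongrightarrow> Z w' T) (at T within {0..<T})"
      by (rule Lim_transform_eventually[OF lim[OF w(2)]]) (use * r in \<open>auto simp: eventually_at_topological\<close>)
    moreover have "at T within {0..<T} \<noteq> bot"
      using tT by (simp add: trivial_limit_within islimpt_in_closure closure_atLeastLessThan)
    ultimately show ?thesis using tendsto_unique[OF _ _ lim[OF w(1)]] tT by blast
  qed
qed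

lemma hist_Z_causal:
  assumes w: "w \<in> Linf_loc UNIV" "w' \<in> Linf_loc UNIV" and eq: "\<And>t. 0 \<le> t \<Longrightarrow> t < T \<Longrightarrow> w' t = w t"
    and t: "t \<in> {0..T}"
  shows "hist r (Z w') t = hist r (Z w) t"
  unfolding hist_def using t by (intro restrict_ext Z_causal[OF w eq]) auto

lemma G_causal:
  assumes w: "w \<in> Linf_loc UNIV" "w' \<in> Linf_loc UNIV" and eq: "\<And>t. 0 \<le> t \<Longrightarrow> t < T \<Longrightarrow> w' t = w t"
    and t: "t \<in> {0..T}"
  shows "G w' t = G w t"
  unfolding G_def by (subst hist_Z_causal[OF w eq t]) auto

lemma G_continuous:
  assumes "w \<in> Linf_loc UNIV" shows "continuous_on {0..} (G w)"
  unfolding G_def[abs_def] by (rule RPsi_along_continuous[OF Z_continuous[OF assms] _ u]) auto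

lemma G_integrable:
  assumes "w \<in> Linf_loc UNIV" "0 \<le> a" shows "G w integrable_on {a..b}"
  by (rule integrable_continuous_real[OF continuous_on_subset[OF G_continuous[OF assms(1)]]]) (use assms(2) in auto)

text \<open>A trajectory of the plant started from the zero history. Its output does not depend on the predictor,
  so the deviation of w from it measures how far the predictor drifts.\<close>

definition xref :: "real \<Rightarrow> 'x" where
  "xref = (SOME x. delay_solution r {0..} (\<lambda>\<theta>\<in>{-r..0}. 0) (\<lambda>t \<phi>. f \<phi> (u t) 0) x)"

lemma xref: "delay_solution r {0..} (\<lambda>\<theta>\<in>{-r..0}. 0) (\<lambda>t \<phi>. f \<phi> (u t) 0) xref"
proof -
  obtain x where "delay_solution r {0..} (\<lambda>\<theta>\<in>{-r..0}. 0) (\<lambda>t \<phi>. f \<phi> (u t) 0) x"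
    using plant_solution_exists[OF u zero_history_C0] .
  from someI[of "delay_solution r {0..} (\<lambda>\<theta>\<in>{-r..0}. 0) (\<lambda>t \<phi>. f \<phi> (u t) 0)", OF this]
  show ?thesis by (simp add: xref_def)
qed

lemma output_integral:
  assumes x: "delay_solution r {0..} x0 (\<lambda>t \<phi>. f \<phi> (u t) 0) x" and st: "0 \<le> s" "s \<le> t"
  shows "M (x t) = M (x s) + integral {s..t} (\<lambda>\<tau>. M (f (hist r x \<tau>) (u \<tau>) 0))"
proof -
  have "continuous_on ({-r..0} \<union> {0..}) x" using x by (simp add: delay_solution_def)
  then have c: "continuous_on {0..} (\<lambda>\<tau>. f (hist r x \<tau>) (u \<tau>) 0)" by (rule f_along_continuous) (use u in auto)
  have xt: "x t = x0 0 + integral {0..t} (\<lambda>\<tau>. f (hist r x \<tau>) (u \<tau>) 0)" if "0 \<le> t" for t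
    using x that by (simp add: delay_solution_def)
  have "x t = x s + integral {s..t} (\<lambda>\<tau>. f (hist r x \<tau>) (u \<tau>) 0)"
    using xt[of s] xt[of t] integral_split[OF c, of 0 s t] st by simp
  moreover have "(\<lambda>\<tau>. f (hist r x \<tau>) (u \<tau>) 0) integrable_on {s..t}"
    by (rule integrable_continuous_real[OF continuous_on_subset[OF c]]) (use st in auto)
  ultimately show ?thesis
    by (simp add: integral_linear_image[OF M] linear_add[OF bounded_linear.linear[OF M]])
qed

lemma output_rate_continuous:
  assumes x: "delay_solution r {0..} x0 (\<lambda>t \<phi>. f \<phi> (u t) 0) x"
  shows "continuous_on {0..} (\<lambda>\<tau>. M (f (hist r x \<tau>) (u \<tau>) 0))"
proof -
  have "continuous_on ({-r..0} \<union> {0..}) x" using x by (simp add: delay_solution_def)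
  then have c: "continuous_on {0..} (\<lambda>\<tau>. f (hist r x \<tau>) (u \<tau>) 0)" by (rule f_along_continuous) (use u in auto)
  show ?thesis by (rule bounded_linear.continuous_on[OF M c])
qed

lemma hist_Z_C0: "w \<in> Linf_loc UNIV \<Longrightarrow> 0 \<le> t \<Longrightarrow> hist r (Z w) t \<in> C0 {-r..0}"
  by (rule hist_mem_C0[OF Z_continuous]) auto

lemma hist_plant_C0:
  assumes "delay_solution r {0..} x0 rhs x" "0 \<le> t" shows "hist r x t \<in> C0 {-r..0}"
  using assms by (intro hist_mem_C0[of "{0..}"]) (auto simp: delay_solution_def)

lemma a0_nonneg: "0 \<le> s \<Longrightarrow> 0 \<le> a0 s"
  using a0 by (auto simp: class_Kinf_def class_K_def strict_mono_on_def less_eq_real_def)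
    (metis atLeast_iff less_eq_real_def)

text \<open>The true and the predicted output rate are values of one Lipschitz function, at \<open>x_t\<close> and at its
  estimate; the observer estimate bounds the distance of the two.\<close>

lemma G_near_output_rate:
  assumes w: "w \<in> Linf_loc UNIV" and x0: "x0 \<in> C0 {-r..0}" and x: "delay_solution r {0..} x0 (\<lambda>t \<phi>. f \<phi> (u t) 0) x"
    and N: "\<And>s. s \<in> {0..t} \<Longrightarrow> norm (w s - M (x s)) * exp (- \<sigma> * (t - s)) \<le> N" and t: "0 \<le> t"
  shows "norm (G w t - M (f (hist r x t) (u t) 0))
    \<le> LR * (exp (- \<sigma> * t) * a0 (supnorm {-r..0} x0 + supnorm {-r..0} z0) + \<gamma> * N)"
proof -
  have "(SUP s\<in>{0..t}. norm (w s - M (x s)) * exp (- \<sigma> * (t - s))) \<le> N"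
    by (rule cSUP_least) (use t N in auto)
  then have "supnorm {-r..0} (\<lambda>\<theta>. \<Psi> (hist r (Z w) t) \<theta> - hist r x t \<theta>)
      \<le> exp (- \<sigma> * t) * a0 (supnorm {-r..0} x0 + supnorm {-r..0} z0) + \<gamma> * N"
    using observer_error_bound[OF u x0 z0 w x Z_solution[OF w] t] \<gamma> by (smt (verit) mult_left_mono)
  from mult_left_mono[OF this, of LR] LR_pos
  show ?thesis
    using R_Lip[OF Psi_C0[OF hist_Z_C0[OF w t]] hist_plant_C0[OF x t], of "u t"] unfolding G_def by linarith
qed

text \<open>The deviation \<open>e = w - M xref\<close> satisfies \<open>sup |e| \<le> c + (T1 - T) LR \<gamma> sup |e|\<close> with a constant c, and
  the gain condition absorbs the last term. The constant serves all delays \<open>\<epsilon>\<close> in \<open>[0, 1]\<close> and all end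
  points \<open>T'\<close>: positive delays occur in the approximations of the predictor, \<open>\<epsilon> = 0\<close> with varying \<open>T'\<close> in
  the exclusion of blow-up.\<close>

lemma predictor_bound:
  assumes wh: "wh \<in> Linf_loc UNIV" and T: "0 \<le> T" "T \<le> T1" and gain: "(T1 - T) * LR * \<gamma> \<le> 1 / 2"
  shows "\<exists>K. \<forall>\<epsilon> T' w. 0 \<le> \<epsilon> \<and> \<epsilon> \<le> 1 \<and> T \<le> T' \<and> T' \<le> T1 \<and> w \<in> Linf_loc UNIV \<and>
      (\<forall>t. 0 \<le> t \<and> t < T \<longrightarrow> w t = wh t) \<and>
      (\<forall>t\<in>{T..T'}. w t = wT + integral {T..max T (t - \<epsilon>)} (G w)) \<longrightarrow>
      (\<forall>t\<in>{0..T'}. norm (w t) \<le> K \<and> norm (G w t) \<le> K)"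
proof -
  define A where "A = a0 (supnorm {-r..0} (\<lambda>\<theta>\<in>{-r..0}. 0 :: 'x) + supnorm {-r..0} z0)"
  have "0 \<le> supnorm {-r..0} z0" using z0 r by (intro supnorm_nonneg) (auto simp: C0_iff)
  then have A: "0 \<le> A" unfolding A_def supnorm_zero by (intro a0_nonneg) simp
  define y where "y t = M (xref t)" for t
  define q where "q t = M (f (hist r xref t) (u t) 0)" for t
  have cq: "continuous_on {0..} q" unfolding q_def[abs_def] by (rule output_rate_continuous[OF xref])
  have qi: "q integrable_on {a..b}" if "0 \<le> a" for a b
    by (rule integrable_continuous_real[OF continuous_on_subset[OF cq]]) (use that in auto)
  have T10: "0 \<le> T1" using T by simp
  obtain By where By: "0 \<le> By" "\<And>t. t \<in> {0..T1} \<Longrightarrow> norm (y t) \<le> By"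
    using Linf_norm_bound[OF output_Linf[OF xref], of T1] unfolding y_def by metis
  obtain Bq where Bq: "0 \<le> Bq" "\<And>t. t \<in> {0..T1} \<Longrightarrow> norm (q t) \<le> Bq"
    using Linf_norm_bound[OF Linf_continuous[OF cq], of T1] by metis
  obtain Bh where Bh: "0 \<le> Bh" "\<And>t. t \<in> {0..T1} \<Longrightarrow> norm (wh t) \<le> Bh"
    using Linf_norm_bound[OF wh, of T1] by metis
  define c where "c = Bh + By + norm wT + (T1 - T) * (LR * A) + Bq"
  define K where "K = 2 * c + By + Bq + LR * (A + \<gamma> * (2 * c))"
  have c0: "0 \<le> c" using Bh By Bq A LR_pos T unfolding c_def by simp
  show ?thesis
  proof (intro exI[of _ K] allI impI ballI, elim conjE)
    fix \<epsilon> T' w t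
    assume \<epsilon>: "0 \<le> \<epsilon>" "\<epsilon> \<le> 1" and T': "T \<le> T'" "T' \<le> T1" and w: "w \<in> Linf_loc UNIV"
      and past: "\<forall>t. 0 \<le> t \<and> t < T \<longrightarrow> w t = wh t"
      and eqn: "\<forall>t\<in>{T..T'}. w t = wT + integral {T..max T (t - \<epsilon>)} (G w)" and t: "t \<in> {0..T'}"
    define e where "e t = w t - y t" for t
    define N where "N = (SUP s\<in>{0..T'}. norm (e s))"
    have "e \<in> Linf_loc UNIV" unfolding e_def[abs_def] y_def using Linf_diff[OF w output_Linf[OF xref]] .
    then obtain Be where "\<And>s. s \<in> {0..T'} \<Longrightarrow> norm (e s) \<le> Be" using Linf_norm_bound by metis
    then have N: "norm (e s) \<le> N" if "s \<in> {0..T'}" for s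
      unfolding N_def using that by (intro cSUP_upper bdd_aboveI2)
    have N0: "0 \<le> N" using order_trans[OF norm_ge_zero N[of 0]] T T' by simp
    have near: "norm (G w s - q s) \<le> LR * (A + \<gamma> * N)" if s: "s \<in> {0..T'}" for s
    proof -
      have "norm (w \<tau> - M (xref \<tau>)) * exp (- \<sigma> * (s - \<tau>)) \<le> N" if "\<tau> \<in> {0..s}" for \<tau>
      proof -
        have "norm (w \<tau> - M (xref \<tau>)) * exp (- \<sigma> * (s - \<tau>)) \<le> N * 1"
          using N[of \<tau>] that s \<sigma> N0 by (intro mult_mono) (auto simp: e_def y_def)
        then show ?thesis by simp
      qed
      then have "norm (G w s - q s) \<le> LR * (exp (- \<sigma> * s) * A + \<gamma> * N)"
        unfolding q_def A_def using s by (intro G_near_output_rate[OF w zero_history_C0 xref]) auto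
      also have "\<dots> \<le> LR * (A + \<gamma> * N)"
        using A LR_pos \<sigma> s by (intro mult_left_mono add_right_mono) (auto intro: mult_left_le_one_le)
      finally show ?thesis .
    qed
    have main: "norm (e t) \<le> c + N / 2" if t: "t \<in> {0..T'}" for t
    proof (cases "t < T")
      case True
      then have "norm (e t) \<le> Bh + By"
        using past t Bh(2)[of t] By(2)[of t] T' norm_triangle_ineq4[of "w t" "y t"] unfolding e_def by auto
      moreover have "0 \<le> norm wT" "0 \<le> (T1 - T) * (LR * A)" using A LR_pos T by auto
      ultimately show ?thesis using N0 Bq(1) unfolding c_def by linarith
    next
      case False
      \<comment> \<open>The plant output is integrated up to t, the predictor only up to m; the missing piece has length at most 1.\<close>
      define m where "m = max T (t - \<epsilon>)"
      have m: "T \<le> m" "m \<le> t" "t - m \<le> 1" using \<epsilon> False by (auto simp: m_def)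
      have "y t = y T + integral {T..t} q"
        unfolding y_def q_def[abs_def] using False T by (intro output_integral[OF xref]) auto
      also have "integral {T..t} q = integral {T..m} q + integral {m..t} q"
        using integral_split[OF cq T(1) m(1,2)] .
      finally have yt: "y t = y T + (integral {T..m} q + integral {m..t} q)" .
      have wt: "w t = wT + integral {T..m} (G w)" using eqn t False by (simp add: m_def)
      have diff: "integral {T..m} (G w) - integral {T..m} q = integral {T..m} (\<lambda>s. G w s - q s)"
        by (rule Henstock_Kurzweil_Integration.integral_diff[symmetric]) (use G_integrable[OF w] qi T in auto)
      have n1: "norm (integral {T..m} (\<lambda>s. G w s - q s)) \<le> (LR * (A + \<gamma> * N)) * (m - T)"
        using m t T by (intro norm_integral_le near Henstock_Kurzweil_Integration.integrable_diff G_integrable w qi) auto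
      have n2: "norm (integral {m..t} q) \<le> Bq * (t - m)"
        using m t T T' by (intro norm_integral_le qi Bq) auto
      have "(LR * (A + \<gamma> * N)) * (m - T) \<le> (LR * (A + \<gamma> * N)) * (T1 - T)"
        using m t T' LR_pos A N0 \<gamma> by (intro mult_left_mono) auto
      also have "\<dots> = (T1 - T) * (LR * A) + ((T1 - T) * LR * \<gamma>) * N" by (simp add: algebra_simps)
      also have "\<dots> \<le> (T1 - T) * (LR * A) + 1 / 2 * N"
        using gain N0 by (intro add_left_mono mult_right_mono) auto
      finally have n1': "norm (integral {T..m} (\<lambda>s. G w s - q s)) \<le> (T1 - T) * (LR * A) + N / 2" using n1 by linarith
      have n2': "norm (integral {m..t} q) \<le> Bq" using n2 mult_left_mono[OF m(3) Bq(1)] by linarith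
      have "e t = wT + - y T + integral {T..m} (\<lambda>s. G w s - q s) + - integral {m..t} q"
        unfolding e_def wt yt diff[symmetric] by simp
      also have "norm \<dots> \<le> norm wT + norm (y T) + ((T1 - T) * (LR * A) + N / 2) + Bq"
        using n1' n2' by (intro norm_triangle_mono) auto
      also have "\<dots> \<le> c + N / 2" using By(2)[of T] T Bh(1) by (simp add: c_def)
      finally show ?thesis .
    qed
    have "N \<le> c + N / 2" unfolding N_def[of] using main T T' by (intro cSUP_least) (auto simp: N_def)
    then have N2: "N \<le> 2 * c" by simp
    have tT1: "t \<in> {0..T1}" using t T' by auto
    have pos: "0 \<le> LR * (A + \<gamma> * (2 * c))" using LR_pos A \<gamma> c0 by simp
    have "norm (w t) \<le> norm (e t) + norm (y t)"
      using norm_triangle_ineq[of "e t" "y t"] by (simp add: e_def)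
    also have "\<dots> \<le> 2 * c + By" using N[OF t] N2 By(2)[OF tT1] by linarith
    finally have 1: "norm (w t) \<le> 2 * c + By" .
    have "LR * (A + \<gamma> * N) \<le> LR * (A + \<gamma> * (2 * c))"
      using N2 LR_pos \<gamma> by (intro mult_left_mono add_left_mono) auto
    then have 2: "norm (G w t) \<le> LR * (A + \<gamma> * (2 * c)) + Bq"
      using norm_triangle_ineq[of "G w t - q t" "q t"] near[OF t] Bq(2)[OF tT1] by simp
    show "norm (w t) \<le> K \<and> norm (G w t) \<le> K"
      using 1 2 Bq(1) By(1) pos c0 unfolding K_def by linarith
  qed
qed

end

section \<open>The predictor on one sampling interval\<close>

context driven_observer begin

text \<open>The value at time t only involves \<open>G w\<close> up to \<open>t - \<epsilon>\<close>, hence by causality only w up to \<open>t - \<epsilon>\<close>. Iterating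
  the right-hand side therefore becomes stationary on \<open>[0, T + n \<epsilon>)\<close> after n iterations.\<close>

lemma delayed_predictor_exists:
  assumes wh: "wh \<in> Linf_loc UNIV" and T: "0 \<le> T" "T \<le> T1" and \<epsilon>: "0 < \<epsilon>"
  shows "\<exists>w. w \<in> Linf_loc UNIV \<and> (\<forall>t. 0 \<le> t \<and> t < T \<longrightarrow> w t = wh t) \<and>
    (\<forall>t\<in>{T..T1}. w t = wT + integral {T..max T (t - \<epsilon>)} (G w))"
proof -
  \<comment> \<open>Freezing the integral after \<open>T1\<close> keeps the iterates bounded signals on the half-line.\<close>
  define step where "step w t = (if t < T then wh t else wT + integral {T..max T (min t T1 - \<epsilon>)} (G w))" for w t
  have step_Linf: "step w \<in> Linf_loc UNIV" if w: "w \<in> Linf_loc UNIV" for w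
  proof -
    have "continuous_on {T..max T T1} (\<lambda>t. integral {T..t} (G w))"
      by (rule indefinite_integral_continuous_1[OF G_integrable[OF w T(1)]])
    then have "continuous_on {0..} (\<lambda>t. integral {T..max T (min t T1 - \<epsilon>)} (G w))"
      by (rule continuous_on_compose2) (use \<epsilon> in \<open>auto intro!: continuous_intros\<close>)
    then show ?thesis unfolding step_def[abs_def]
      by (intro Linf_cut wh Linf_continuous continuous_intros)
  qed
  define W where "W n = (step ^^ n) wh" for n
  have W_Linf: "W n \<in> Linf_loc UNIV" for n
    by (induction n) (auto simp: W_def wh step_Linf)
  have W_Suc: "W (Suc n) = step (W n)" for n by (simp add: W_def)
  have agree: "W (Suc n) t = W n t" if "0 \<le> t" "t < T + n * \<epsilon>" for n t
    using that
  proof (induction n arbitrary: t)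
    case 0 then show ?case by (simp add: W_Suc step_def) (simp add: W_def)
  next
    case (Suc n)
    show ?case
    proof (cases "t < T")
      case True then show ?thesis by (simp add: W_Suc step_def)
    next
      case False
      have "integral {T..max T (min t T1 - \<epsilon>)} (G (W (Suc n))) = integral {T..max T (min t T1 - \<epsilon>)} (G (W n))"
      proof (rule Henstock_Kurzweil_Integration.integral_cong)
        fix s assume s: "s \<in> {T..max T (min t T1 - \<epsilon>)}"
        have "s \<le> T + n * \<epsilon>" using s Suc.prems \<epsilon> by (auto simp: algebra_simps max_def min_def split: if_splits)
        then show "G (W (Suc n)) s = G (W n) s"
          using s T by (intro G_causal[OF W_Linf W_Linf Suc.IH, of "T + n * \<epsilon>"]) auto
      qed
      then have "step (W (Suc n)) t = step (W n) t" using False by (simp add: step_def)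
      then show ?thesis by (simp only: W_Suc)
    qed
  qed
  obtain n where n: "T1 - T < real n * \<epsilon>" using reals_Archimedean3[OF \<epsilon>] by blast
  show ?thesis
  proof (intro exI[of _ "W n"] conjI allI impI ballI, rule W_Linf)
    have eq: "W n t = step (W n) t" if "0 \<le> t" "t \<le> T1" for t
      using agree[of t n] that n by (simp add: W_Suc)
    show "W n t = wh t" if "0 \<le> t \<and> t < T" for t using eq[of t] that T by (simp add: step_def)
    show "W n t = wT + integral {T..max T (t - \<epsilon>)} (G (W n))" if t: "t \<in> {T..T1}" for t
    proof -
      have "W n t = step (W n) t" using t T by (intro eq) auto
      also have "\<dots> = wT + integral {T..max T (t - \<epsilon>)} (G (W n))" using t by (simp add: step_def min_absorb1)
      finally show ?thesis .
    qed
  qed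
qed

text \<open>Tonelli's proof of Peano's theorem. The delayed approximations are bounded with a common Lipschitz
  constant, so a subsequence converges uniformly on \<open>[T, T1]\<close>. Stability of the observer and the local
  Lipschitz condition on the predicted rate carry the convergence over to \<open>G\<close>, and the limit solves the
  equation with \<open>\<epsilon> = 0\<close>.\<close>

lemma predictor_exists:
  assumes wh: "wh \<in> Linf_loc UNIV" and T: "0 \<le> T" "T \<le> T1" and gain: "(T1 - T) * LR * \<gamma> \<le> 1 / 2"
  shows "\<exists>w. w \<in> Linf_loc UNIV \<and> (\<forall>t. 0 \<le> t \<and> t < T \<longrightarrow> w t = wh t) \<and>
    (\<forall>t\<in>{T..T1}. w t = wT + integral {T..t} (G w))"
proof -
  have T10: "0 \<le> T1" using T by simp
  define \<epsilon> where "\<epsilon> n = inverse (real (Suc n))" for n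
  have \<epsilon>: "0 < \<epsilon> n" "\<epsilon> n \<le> 1" for n by (auto simp: \<epsilon>_def inverse_le_1_iff)
  have "\<forall>n. \<exists>w. w \<in> Linf_loc UNIV \<and> (\<forall>t. 0 \<le> t \<and> t < T \<longrightarrow> w t = wh t) \<and>
    (\<forall>t\<in>{T..T1}. w t = wT + integral {T..max T (t - \<epsilon> n)} (G w))"
    using delayed_predictor_exists[OF wh T \<epsilon>(1)] by blast
  then obtain W where W: "\<forall>n. W n \<in> Linf_loc UNIV \<and> (\<forall>t. 0 \<le> t \<and> t < T \<longrightarrow> W n t = wh t) \<and>
    (\<forall>t\<in>{T..T1}. W n t = wT + integral {T..max T (t - \<epsilon> n)} (G (W n)))" by (rule choice[THEN exE])
  then have W_Linf: "W n \<in> Linf_loc UNIV" and W_past: "\<And>t. 0 \<le> t \<Longrightarrow> t < T \<Longrightarrow> W n t = wh t"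
    and W_eq: "\<And>t. t \<in> {T..T1} \<Longrightarrow> W n t = wT + integral {T..max T (t - \<epsilon> n)} (G (W n))" for n by auto
  from predictor_bound[OF wh T gain, of wT] obtain K where
    K: "\<forall>\<epsilon> T' w. 0 \<le> \<epsilon> \<and> \<epsilon> \<le> 1 \<and> T \<le> T' \<and> T' \<le> T1 \<and> w \<in> Linf_loc UNIV \<and>
      (\<forall>t. 0 \<le> t \<and> t < T \<longrightarrow> w t = wh t) \<and>
      (\<forall>t\<in>{T..T'}. w t = wT + integral {T..max T (t - \<epsilon>)} (G w)) \<longrightarrow>
      (\<forall>t\<in>{0..T'}. norm (w t) \<le> K \<and> norm (G w t) \<le> K)" by (rule exE)
  have bd: "norm (W n t) \<le> K" "norm (G (W n) t) \<le> K" if "t \<in> {0..T1}" for n t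
    using K[rule_format, of "\<epsilon> n" T1 "W n" t] \<epsilon>[of n] T W[rule_format, of n] that by auto
  have K0: "0 \<le> K" using order_trans[OF norm_ge_zero bd(1)[of 0]] T10 by simp
  have lip: "norm (W n s - W n t) \<le> K * \<bar>s - t\<bar>" if "s \<in> {T..T1}" "t \<in> {T..T1}" for n s t
  proof -
    have aux: "norm (W n s - W n t) \<le> K * (s - t)" if st: "t \<le> s" "T \<le> t" "s \<le> T1" for s t
    proof -
      define a b where "a = max T (t - \<epsilon> n)" and "b = max T (s - \<epsilon> n)"
      have ab: "T \<le> a" "a \<le> b" "b - a \<le> s - t" "b \<le> T1" using st \<epsilon>[of n] by (auto simp: a_def b_def)
      have "W n s - W n t = integral {T..b} (G (W n)) - integral {T..a} (G (W n))"
        using W_eq[of s n] W_eq[of t n] st by (simp add: a_def b_def)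
      also have "\<dots> = integral {a..b} (G (W n))"
        using integral_split[OF G_continuous[OF W_Linf] T(1) ab(1,2), of n] by simp
      also have "norm \<dots> \<le> K * (b - a)"
        using ab T by (intro norm_integral_le G_integrable W_Linf bd) auto
      also have "\<dots> \<le> K * (s - t)" using ab K0 by (intro mult_left_mono) auto
      finally show ?thesis .
    qed
    show ?thesis using aux[of s t] aux[of t s] that by (cases "t \<le> s") (auto simp: norm_minus_commute)
  qed
  have "\<exists>g k. continuous_on {T..T1} g \<and> strict_mono (k :: nat \<Rightarrow> nat) \<and>
      (\<forall>e>0. \<exists>N. \<forall>n x. n \<ge> N \<and> x \<in> {T..T1} \<longrightarrow> norm (W (k n) x - g x) < e)"
  proof (rule Arzela_Ascoli[of "{T..T1}" W K])
    show "compact {T..T1}" by simp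
    show "norm (W n x) \<le> K" if "x \<in> {T..T1}" for n x using that T by (intro bd) auto
    fix x e :: real assume x: "x \<in> {T..T1}" and e: "0 < e"
    show "\<exists>d. 0 < d \<and> (\<forall>n y. y \<in> {T..T1} \<and> norm (x - y) < d \<longrightarrow> norm (W n x - W n y) < e)"
    proof (intro exI[of _ "e / (K + 1)"] conjI allI impI)
      show "0 < e / (K + 1)" using e K0 by simp
      fix n y assume y: "y \<in> {T..T1} \<and> norm (x - y) < e / (K + 1)"
      have "norm (W n x - W n y) \<le> K * \<bar>x - y\<bar>" using y x by (intro lip) auto
      also have "\<dots> \<le> (K + 1) * \<bar>x - y\<bar>" by (intro mult_right_mono) auto
      also have "\<dots> < e" using y K0 by (simp add: pos_less_divide_eq mult.commute)
      finally show "norm (W n x - W n y) < e" .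
    qed
  qed blast
  then obtain g k where g: "continuous_on {T..T1} g" and k: "strict_mono (k :: nat \<Rightarrow> nat)"
    and conv: "\<forall>e>0. \<exists>N. \<forall>n x. n \<ge> N \<and> x \<in> {T..T1} \<longrightarrow> norm (W (k n) x - g x) < e" by (elim exE conjE)
  \<comment> \<open>Clamping the argument of g makes it continuous on the half-line.\<close>
  define w where "w t = (if t < T then wh t else g (max T (min t T1)))" for t
  have w_Linf: "w \<in> Linf_loc UNIV"
  proof -
    have "continuous_on {0..} (\<lambda>t. g (max T (min t T1)))"
      by (rule continuous_on_compose2[OF g]) (use T in \<open>auto intro!: continuous_intros\<close>)
    then show ?thesis unfolding w_def[abs_def] by (intro Linf_cut wh Linf_continuous)
  qed
  have w_near: "norm (W (k n) s - w s) < e" if "\<forall>x. x \<in> {T..T1} \<longrightarrow> norm (W (k n) x - g x) < e" "s \<in> {0..T1}" "0 < e" for n s e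
    using that W_past[of s "k n"] by (cases "s < T") (auto simp: w_def)
  have cw: "norm (w t - (wT + integral {T..t} (G w))) \<le> 0 + \<eta>" if t: "t \<in> {T..T1}" and \<eta>: "0 < \<eta>" for t \<eta>
  proof -
    obtain Bw where Bw: "\<And>t. t \<in> {0..T1} \<Longrightarrow> norm (w t) \<le> Bw" using Linf_norm_bound[OF w_Linf] by metis
    have cZ: "continuous_on {-r..T1} (Z w)" by (rule continuous_on_subset[OF Z_continuous[OF w_Linf]]) auto
    have "bounded (Z w ` {-r..T1})" by (intro compact_imp_bounded compact_continuous_image cZ) auto
    then obtain Bz where Bz: "\<And>t. t \<in> {-r..T1} \<Longrightarrow> norm (Z w t) \<le> Bz" unfolding bounded_iff by blast
    obtain Bu where Bu: "\<And>t. t \<in> {0..T1} \<Longrightarrow> norm (u t) \<le> Bu" using Linf_norm_bound[OF Linf_continuous[OF u]] by metis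
    obtain BG where BG: "0 \<le> BG" "\<And>t. t \<in> {0..T1} \<Longrightarrow> norm (G w t) \<le> BG"
      using Linf_norm_bound[OF Linf_continuous[OF G_continuous[OF w_Linf]]] by metis
    \<comment> \<open>The trajectories of w and of a good approximation both lie in B, where the predicted rate is Lipschitz.\<close>
    define B where "B = {(\<phi>, v). \<phi> \<in> C0 {-r..0} \<and> supnorm {-r..0} (\<phi> :: real \<Rightarrow> 'z) \<le> Bz + 1 \<and> norm (v :: 'u) \<le> Bu}"
    have "(\<lambda>(z, u). (supnorm {-r..0} z, u)) ` B \<subseteq> {0..Bz + 1} \<times> cball 0 Bu"
      using r by (auto simp: B_def C0_iff supnorm_nonneg)
    then have "bounded ((\<lambda>(z, u). (supnorm {-r..0} z, u)) ` B)"
      by (rule bounded_subset[rotated]) (intro bounded_Times bounded_cball bounded_closed_interval)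
    moreover have "B \<subseteq> C0 {-r..0} \<times> UNIV" by (auto simp: B_def)
    ultimately obtain L where L: "0 \<le> L" and L': "\<forall>z z' u. (z, u) \<in> B \<and> (z', u) \<in> B \<longrightarrow>
          norm (M (f (\<Psi> z) u 0) - M (f (\<Psi> z') u 0)) \<le> L * supnorm {-r..0} (\<lambda>\<theta>. z \<theta> - z' \<theta>)"
      using RPsi_Lip[of B] by blast
    \<comment> \<open>One summand for each error: of w against its approximation, of the rates on \<open>[T, m]\<close>, and of the integral over \<open>[m, t]\<close>, which has length at most e.\<close>
    define c where "c = 1 + L * (T1 - T) + BG"
    have c: "1 \<le> c" using L T BG by (simp add: c_def)
    define e where "e = min 1 (\<eta> / c)"
    have e: "0 < e" "e \<le> 1" "e * c \<le> \<eta>" using \<eta> c by (auto simp: e_def min_def field_simps)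
    from observer_stability[OF u_upto T10 e(1) Z_solution_upto[OF w_Linf], of Bw] Bw
    obtain \<kappa> where \<kappa>: "0 < \<kappa>" and \<kappa>': "\<forall>w' z' t. delay_solution r {0..T1} z0 (\<lambda>t \<phi>. F \<phi> (w' t) (u t)) z' \<and>
       (\<forall>s\<in>{0..T1}. norm (w' s - w s) \<le> \<kappa>) \<and> t \<in> {-r..T1} \<longrightarrow> norm (z' t - Z w t) \<le> e" by blast
    obtain N1 where N1: "\<forall>n x. n \<ge> N1 \<and> x \<in> {T..T1} \<longrightarrow> norm (W (k n) x - g x) < min \<kappa> e"
      using conv[rule_format, of "min \<kappa> e"] \<kappa> e(1) by auto
    obtain N2 where N2: "inverse (real (Suc N2)) < e" using reals_Archimedean[OF e(1)] by blast
    define n where "n = max N1 N2"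
    have "N2 \<le> k n" using seq_suble[OF k, of n] by (simp add: n_def)
    then have \<epsilon>n: "\<epsilon> (k n) \<le> e" using N2 by (simp add: \<epsilon>_def) (smt (verit) inverse_le_imp_le inverse_positive_iff_positive le_imp_inverse_le of_nat_0_le_iff of_nat_mono)
    have near: "norm (W (k n) s - w s) < min \<kappa> e" if "s \<in> {0..T1}" for s
      using N1 that \<kappa> e(1) by (intro w_near) (auto simp: n_def)
    have Znear: "norm (Z (W (k n)) s - Z w s) \<le> e" if "s \<in> {-r..T1}" for s
      using \<kappa>'[rule_format, of "W (k n)" "Z (W (k n))" s] Z_solution_upto[OF W_Linf] near that by (auto simp: less_imp_le)
    have Gnear: "norm (G (W (k n)) s - G w s) \<le> L * e" if s: "s \<in> {0..T1}" for s
    proof -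
      have "norm (Z (W (k n)) \<tau>) \<le> Bz + 1" if "\<tau> \<in> {-r..s}" for \<tau>
        using Znear[of \<tau>] Bz[of \<tau>] norm_triangle_ineq[of "Z (W (k n)) \<tau> - Z w \<tau>" "Z w \<tau>"] e that s by auto
      then have h1: "supnorm {-r..0} (hist r (Z (W (k n))) s) \<le> Bz + 1" using s by (intro supnorm_hist_le) auto
      have "norm (Z w \<tau>) \<le> Bz + 1" if "\<tau> \<in> {-r..s}" for \<tau> using Bz[of \<tau>] that s by auto
      then have h2: "supnorm {-r..0} (hist r (Z w) s) \<le> Bz + 1" using s by (intro supnorm_hist_le) auto
      have "(hist r (Z (W (k n))) s, u s) \<in> B" "(hist r (Z w) s, u s) \<in> B"
        using h1 h2 s Bu[of s] hist_Z_C0[OF W_Linf] hist_Z_C0[OF w_Linf] by (auto simp: B_def)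
      then have "norm (G (W (k n)) s - G w s) \<le> L * supnorm {-r..0} (\<lambda>\<theta>. hist r (Z (W (k n))) s \<theta> - hist r (Z w) s \<theta>)"
        using L' unfolding G_def by blast
      also have "\<dots> \<le> L * e"
        using s Znear by (intro mult_left_mono supnorm_hist_diff_le L) auto
      finally show ?thesis .
    qed
    define m where "m = max T (t - \<epsilon> (k n))"
    have m: "T \<le> m" "m \<le> t" "t - m \<le> e" using \<epsilon>[of "k n"] \<epsilon>n t by (auto simp: m_def)
    have i1: "norm (integral {T..m} (\<lambda>s. G (W (k n)) s - G w s)) \<le> (L * e) * (m - T)"
      using m t T by (intro norm_integral_le Henstock_Kurzweil_Integration.integrable_diff G_integrable W_Linf w_Linf Gnear) auto
    have "(L * e) * (m - T) \<le> (L * e) * (T1 - T)" using m t L e by (intro mult_left_mono) auto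
    with i1 have i1': "norm (integral {T..m} (\<lambda>s. G (W (k n)) s - G w s)) \<le> (L * e) * (T1 - T)" by linarith
    have i2: "norm (integral {m..t} (G w)) \<le> BG * (t - m)"
      using m t T by (intro norm_integral_le G_integrable w_Linf BG) auto
    have i2': "norm (integral {m..t} (G w)) \<le> BG * e" using i2 mult_left_mono[OF m(3) BG(1)] by linarith
    have i3: "norm (w t - W (k n) t) \<le> e" using near[of t] t T by (simp add: norm_minus_commute)
    have diff: "integral {T..m} (\<lambda>s. G (W (k n)) s - G w s) = integral {T..m} (G (W (k n))) - integral {T..m} (G w)"
      using T by (intro Henstock_Kurzweil_Integration.integral_diff G_integrable W_Linf w_Linf) auto
    have "w t - (wT + integral {T..t} (G w))
        = (w t - W (k n) t) + integral {T..m} (\<lambda>s. G (W (k n)) s - G w s) + - integral {m..t} (G w)"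
      unfolding diff using W_eq[OF t, of "k n"] integral_split[OF G_continuous[OF w_Linf] T(1) m(1,2)] by (simp add: m_def[symmetric])
    also have "norm \<dots> \<le> e + (L * e) * (T1 - T) + BG * e"
      using i1' i2' i3 by (intro norm_triangle_mono) auto
    also have "\<dots> = e * c" by (simp add: c_def algebra_simps)
    finally show ?thesis using e by simp
  qed
  have "w t = wT + integral {T..t} (G w)" if "t \<in> {T..T1}" for t
    using field_le_epsilon[OF cw[OF that]] by simp
  moreover have "w t = wh t" if "t < T" for t using that by (simp add: w_def)
  ultimately show ?thesis using w_Linf by blast
qed

end

section \<open>The sampled predictor on the half-line\<close>

lemma Linf_cut_closed:
  assumes "v \<in> Linf_loc UNIV" "w \<in> Linf_loc UNIV" shows "(\<lambda>t. if t \<le> T then v t else w t) \<in> Linf_loc UNIV"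
  unfolding Linf_loc_def
proof (intro CollectI conjI allI impI)
  have "{t \<in> space (lebesgue_on {0..}). t \<le> T} = {0..} \<inter> {..T}"
    by (auto simp: space_restrict_space)
  also have "\<dots> \<in> sets (lebesgue_on {0..})" by (simp add: sets_restrict_space)
  finally have "{t \<in> space (lebesgue_on {0..}). t \<le> T} \<in> sets (lebesgue_on {0..})" .
  then show "(\<lambda>t. if t \<le> T then v t else w t) \<in> borel_measurable (lebesgue_on {0..})"
    using assms by (intro measurable_If) (auto simp: Linf_loc_def)
  fix S :: real assume "S \<ge> 0"
  then have "bounded (v ` {0..S} \<union> w ` {0..S})" using assms by (auto simp: Linf_loc_def)
  then show "bounded ((\<lambda>t. if t \<le> T then v t else w t) ` {0..S})" by (rule bounded_subset) auto
qed auto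

definition sampling_sequence :: "real \<Rightarrow> (nat \<Rightarrow> real) \<Rightarrow> bool" where
  "sampling_sequence \<delta> \<tau> \<longleftrightarrow> \<tau> 0 = 0 \<and> filterlim \<tau> at_top sequentially \<and>
     (\<forall>i. 0 < \<tau> (Suc i) - \<tau> i \<and> \<tau> (Suc i) - \<tau> i \<le> \<delta>)"

context
  fixes \<delta> \<tau> assumes samp: "sampling_sequence \<delta> \<tau>"
begin

lemma sampling_basic: "\<tau> 0 = 0" "\<tau> i < \<tau> (Suc i)" "filterlim \<tau> at_top sequentially" "\<tau> (Suc i) - \<tau> i \<le> \<delta>"
  using samp by (auto simp: sampling_sequence_def algebra_simps)

lemma sampling_mono: "i \<le> j \<Longrightarrow> \<tau> i \<le> \<tau> j"
  using lift_Suc_mono_le[of \<tau>] sampling_basic(2) less_imp_le by blast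

lemma sampling_nonneg: "0 \<le> \<tau> i"
  using sampling_mono[of 0 i] sampling_basic(1) by simp

lemma sampling_index_le: "\<tau> i \<le> t \<Longrightarrow> t < \<tau> (Suc j) \<Longrightarrow> i \<le> j"
  using sampling_mono[of "Suc j" i] by (cases "i \<le> j") auto

lemma sampling_left_interval: "0 < T \<Longrightarrow> \<exists>i. \<tau> i < T \<and> T \<le> \<tau> (Suc i)"
proof -
  assume T: "0 < T"
  obtain N where N: "T < \<tau> N"
    using sampling_basic(3) by (auto simp: filterlim_at_top_dense eventually_sequentially)
  then have "T \<le> \<tau> N" by simp
  then show ?thesis
  proof (induction N)
    case 0 then show ?case using sampling_basic(1) T by simp
  next
    case (Suc N) then show ?case by (cases "T \<le> \<tau> N") (auto simp: not_le)
  qed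
qed

end

context driven_observer begin

text \<open>The observer coupled with the sampled predictor, for arbitrary reset values \<open>y i\<close>.\<close>

definition predictor_solution :: "real set \<Rightarrow> (nat \<Rightarrow> real) \<Rightarrow> (nat \<Rightarrow> 'y) \<Rightarrow> (real \<Rightarrow> 'z) \<Rightarrow> (real \<Rightarrow> 'y) \<Rightarrow> bool" where
  "predictor_solution I \<tau> y z w \<longleftrightarrow>
     delay_solution r I z0 (\<lambda>t \<phi>. F \<phi> (w t) (u t)) z \<and>
     (\<forall>i. \<forall>t \<in> {\<tau> i..<\<tau> (Suc i)} \<inter> I.
        (w has_vector_derivative M (f (\<Psi> (hist r z t)) (u t) 0)) (at t within {\<tau> i..<\<tau> (Suc i)} \<inter> I)) \<and>
     (\<forall>i. \<tau> i \<in> I \<longrightarrow> w (\<tau> i) = y i)"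

lemma predictor_solution_integral:
  assumes ps: "predictor_solution I \<tau> y z w" and I: "\<And>t. t \<in> I \<Longrightarrow> 0 \<le> t \<and> {0..t} \<subseteq> I"
    and t: "t \<in> I" "0 \<le> \<tau> i" "\<tau> i \<le> t" "t < \<tau> (Suc i)"
  shows "w t = y i + integral {\<tau> i..t} (\<lambda>s. M (f (\<Psi> (hist r z s)) (u s) 0))"
proof -
  have sub: "{\<tau> i..t} \<subseteq> {\<tau> i..<\<tau> (Suc i)} \<inter> I" using I[OF t(1)] t by auto
  have "((\<lambda>s. M (f (\<Psi> (hist r z s)) (u s) 0)) has_integral w t - w (\<tau> i)) {\<tau> i..t}"
  proof (rule fundamental_theorem_of_calculus[OF t(3)])
    fix s assume "s \<in> {\<tau> i..t}"
    then have "s \<in> {\<tau> i..<\<tau> (Suc i)} \<inter> I" using sub by blast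
    with ps have "(w has_vector_derivative M (f (\<Psi> (hist r z s)) (u s) 0)) (at s within {\<tau> i..<\<tau> (Suc i)} \<inter> I)"
      by (simp add: predictor_solution_def)
    then show "(w has_vector_derivative M (f (\<Psi> (hist r z s)) (u s) 0)) (at s within {\<tau> i..t})"
      by (rule has_vector_derivative_within_subset[OF _ sub])
  qed
  moreover have "w (\<tau> i) = y i" using ps sub t by (auto simp: predictor_solution_def)
  ultimately show ?thesis by (simp add: has_integral_iff)
qed

text \<open>A solution on an interval becomes an admissible input signal when it is cut off after a time T in
  that interval; the functionals \<open>Z\<close> and \<open>G\<close> are then available for it.\<close>

lemma predictor_solution_truncate:
  assumes samp: "sampling_sequence \<delta> \<tau>"
    and ps: "predictor_solution I \<tau> y z w" and I: "\<And>t. t \<in> I \<Longrightarrow> 0 \<le> t \<and> {0..t} \<subseteq> I"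
    and T: "T \<in> I"
  defines "wT \<equiv> (\<lambda>t. if t \<le> T then w t else 0)"
  shows "wT \<in> Linf_loc UNIV" and "t \<in> {-r..T} \<Longrightarrow> z t = Z wT t"
    and "\<tau> i \<le> t \<Longrightarrow> t < \<tau> (Suc i) \<Longrightarrow> t \<le> T \<Longrightarrow> w t = y i + integral {\<tau> i..t} (G wT)"
proof -
  have T0: "0 \<le> T" using I[OF T] by simp
  have zs: "delay_solution r {0..T} z0 (\<lambda>t \<phi>. F \<phi> (w t) (u t)) z"
    using ps I[OF T] by (auto simp: predictor_solution_def intro: delay_solution_subset)
  then have "continuous_on ({-r..0} \<union> {0..T}) z" by (simp add: delay_solution_def)
  then have cg: "continuous_on {0..T} (\<lambda>s. M (f (\<Psi> (hist r z s)) (u s) 0))" (is "continuous_on _ ?g")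
    by (rule RPsi_along_continuous) (auto intro: u_upto)
  have "\<exists>v\<in>Linf_loc UNIV. \<forall>t. \<tau> i \<le> t \<and> t < \<tau> (Suc i) \<longrightarrow> wT t = v t" for i
  proof (cases "\<tau> i \<le> T")
    case False
    then show ?thesis by (intro bexI[of _ "\<lambda>t. 0"]) (auto simp: wT_def intro: zero_signal)
  next
    case True
    have \<tau>0: "0 \<le> \<tau> i" by (rule sampling_nonneg[OF samp])
    have "?g integrable_on {\<tau> i..T}"
      by (rule integrable_continuous_real[OF continuous_on_subset[OF cg]]) (use \<tau>0 in auto)
    then have "continuous_on {\<tau> i..T} (\<lambda>t. integral {\<tau> i..t} ?g)" by (rule indefinite_integral_continuous_1)
    then have "continuous_on {0..} (\<lambda>t. integral {\<tau> i..max (\<tau> i) (min t T)} ?g)"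
      by (rule continuous_on_compose2) (use True in \<open>auto intro!: continuous_intros\<close>)
    then have "(\<lambda>t. y i + integral {\<tau> i..max (\<tau> i) (min t T)} ?g) \<in> Linf_loc UNIV"
      by (intro Linf_continuous continuous_intros)
    then have "(\<lambda>t. if t \<le> T then y i + integral {\<tau> i..max (\<tau> i) (min t T)} ?g else 0) \<in> Linf_loc UNIV"
      by (intro Linf_cut_closed zero_signal) auto
    moreover have "wT t = (if t \<le> T then y i + integral {\<tau> i..max (\<tau> i) (min t T)} ?g else 0)"
      if t: "\<tau> i \<le> t \<and> t < \<tau> (Suc i)" for t
    proof (cases "t \<le> T")
      case True
      then have "t \<in> I" using I[OF T] t \<tau>0 by auto
      from predictor_solution_integral[OF ps I this \<tau>0] t True show ?thesis
        by (simp add: wT_def min_absorb1 max_absorb2)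
    qed (simp add: wT_def)
    ultimately show ?thesis by (intro bexI[rotated]) auto
  qed
  then have "\<forall>i. \<exists>v. v \<in> Linf_loc UNIV \<and> (\<forall>t. \<tau> i \<le> t \<and> t < \<tau> (Suc i) \<longrightarrow> wT t = v t)" by blast
  from choice[OF this] obtain v where
    v: "\<forall>i. v i \<in> Linf_loc UNIV \<and> (\<forall>t. \<tau> i \<le> t \<and> t < \<tau> (Suc i) \<longrightarrow> wT t = v i t)" by (rule exE)
  show Linf: "wT \<in> Linf_loc UNIV"
    by (rule Linf_piecewise[where v = v, OF sampling_basic(1-3)[OF samp]]) (use v in auto)
  show zZ: "z t = Z wT t" if "t \<in> {-r..T}" for t
    by (rule Z_unique[OF Linf T0 zs _ that]) (simp add: wT_def)
  show "w t = y i + integral {\<tau> i..t} (G wT)" if t: "\<tau> i \<le> t" "t < \<tau> (Suc i)" "t \<le> T" for i t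
  proof -
    have \<tau>0: "0 \<le> \<tau> i" by (rule sampling_nonneg[OF samp])
    have "t \<in> I" using I[OF T] t \<tau>0 by auto
    from predictor_solution_integral[OF ps I this \<tau>0 t(1,2)]
    have "w t = y i + integral {\<tau> i..t} ?g" .
    also have "integral {\<tau> i..t} ?g = integral {\<tau> i..t} (G wT)"
    proof (rule Henstock_Kurzweil_Integration.integral_cong)
      fix s assume s: "s \<in> {\<tau> i..t}"
      have "hist r z s = hist r (Z wT) s" unfolding hist_def
        by (intro restrict_ext zZ) (use s t \<tau>0 in auto)
      then show "?g s = G wT s" by (simp add: G_def)
    qed
    finally show ?thesis .
  qed
qed

text \<open>The integral form of the predictor equation before time T, for a signal defined on the whole half-line.
  It is closed under continuation, which is why solutions are built in this form.\<close>

definition predicted :: "(nat \<Rightarrow> real) \<Rightarrow> (nat \<Rightarrow> 'y) \<Rightarrow> real \<Rightarrow> (real \<Rightarrow> 'y) \<Rightarrow> bool" where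
  "predicted \<tau> y T w \<longleftrightarrow> w \<in> Linf_loc UNIV \<and>
     (\<forall>i t. \<tau> i \<le> t \<and> t < \<tau> (Suc i) \<and> t < T \<longrightarrow> w t = y i + integral {\<tau> i..t} (G w))"

text \<open>T may lie strictly inside a sampling interval; the integral accumulated since \<open>\<tau> i\<close> then becomes the
  initial value of the continuation.\<close>

lemma predicted_extend:
  assumes samp: "sampling_sequence \<delta> \<tau>" and gain: "\<delta> * LR * \<gamma> \<le> 1 / 2"
    and w: "predicted \<tau> y T w" and T: "\<tau> i \<le> T" "T \<le> \<tau> (Suc i)"
  shows "\<exists>w'. predicted \<tau> y (\<tau> (Suc i)) w' \<and> (\<forall>t. 0 \<le> t \<and> t < T \<longrightarrow> w' t = w t)"
proof -
  have \<tau>0: "0 \<le> \<tau> i" by (rule sampling_nonneg[OF samp])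
  have wL: "w \<in> Linf_loc UNIV" using w by (simp add: predicted_def)
  have "(\<tau> (Suc i) - T) * (LR * \<gamma>) \<le> \<delta> * (LR * \<gamma>)"
    using sampling_basic(4)[OF samp, of i] T LR_pos \<gamma> by (intro mult_right_mono) auto
  then have gain': "(\<tau> (Suc i) - T) * LR * \<gamma> \<le> 1 / 2" using gain by (simp add: mult.assoc)
  define wT where "wT = y i + integral {\<tau> i..T} (G w)"
  from predictor_exists[OF wL _ T(2) gain', of wT] \<tau>0 T
  obtain w' where w'L: "w' \<in> Linf_loc UNIV" and past: "\<forall>t. 0 \<le> t \<and> t < T \<longrightarrow> w' t = w t"
    and eqn: "\<forall>t\<in>{T..\<tau> (Suc i)}. w' t = wT + integral {T..t} (G w')" by auto
  have Geq: "integral {a..b} (G w') = integral {a..b} (G w)" if "0 \<le> a" "b \<le> T" for a b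
    using that past by (intro Henstock_Kurzweil_Integration.integral_cong G_causal[OF wL w'L, of T]) auto
  have "w' t = y j + integral {\<tau> j..t} (G w')" if t: "\<tau> j \<le> t" "t < \<tau> (Suc j)" "t < \<tau> (Suc i)" for j t
  proof (cases "t < T")
    case True
    have "0 \<le> \<tau> j" by (rule sampling_nonneg[OF samp])
    then have "w' t = w t" using past True t by simp
    also have "\<dots> = y j + integral {\<tau> j..t} (G w)" using w True t by (simp add: predicted_def)
    finally show ?thesis using Geq[of "\<tau> j" t] True \<open>0 \<le> \<tau> j\<close> by simp
  next
    case False
    have "j \<le> i" "i \<le> j" using sampling_index_le[OF samp] t T False by (meson dual_order.trans not_le_imp_less less_imp_le)+
    then have ij: "j = i" by simp
    have "w' t = wT + integral {T..t} (G w')" using eqn False t by auto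
    also have "\<dots> = y i + (integral {\<tau> i..T} (G w') + integral {T..t} (G w'))"
      using Geq[of "\<tau> i" T] \<tau>0 by (simp add: wT_def)
    also have "integral {\<tau> i..T} (G w') + integral {T..t} (G w') = integral {\<tau> i..t} (G w')"
      using integral_split[OF G_continuous[OF w'L] \<tau>0 T(1), of t] False by simp
    finally show ?thesis by (simp add: ij)
  qed
  then have "predicted \<tau> y (\<tau> (Suc i)) w'" using w'L by (simp add: predicted_def)
  then show ?thesis using past by blast
qed

text \<open>Successive extensions over one sampling interval leave the earlier values unchanged, so they have a
  common limit.\<close>

lemma predicted_global:
  assumes samp: "sampling_sequence \<delta> \<tau>" and gain: "\<delta> * LR * \<gamma> \<le> 1 / 2"
    and w: "predicted \<tau> y T w" and T: "\<tau> i \<le> T" "T \<le> \<tau> (Suc i)"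
  shows "\<exists>w'. (\<forall>T'. predicted \<tau> y T' w') \<and> (\<forall>t. 0 \<le> t \<and> t < T \<longrightarrow> w' t = w t)"
proof -
  from predicted_extend[OF samp gain w T]
  obtain w1 where w1: "predicted \<tau> y (\<tau> (Suc i)) w1" "\<forall>t. 0 \<le> t \<and> t < T \<longrightarrow> w1 t = w t" by blast
  have "\<exists>W. \<forall>n. predicted \<tau> y (\<tau> (Suc i + n)) (W n) \<and> (n = 0 \<longrightarrow> W n = w1) \<and>
     (\<forall>t. 0 \<le> t \<and> t < \<tau> (Suc i + n) \<longrightarrow> W (Suc n) t = W n t)"
  proof -
    have "\<exists>W. \<forall>n. (predicted \<tau> y (\<tau> (Suc i + n)) (W n) \<and> (n = 0 \<longrightarrow> W n = w1)) \<and>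
       (\<forall>t. 0 \<le> t \<and> t < \<tau> (Suc i + n) \<longrightarrow> W (Suc n) t = W n t)"
    proof (rule dependent_nat_choice)
      show "\<exists>x. predicted \<tau> y (\<tau> (Suc i + 0)) x \<and> (0 = (0::nat) \<longrightarrow> x = w1)" using w1 by simp
      fix x n assume "predicted \<tau> y (\<tau> (Suc i + n)) x \<and> (n = 0 \<longrightarrow> x = w1)"
      then show "\<exists>x'. (predicted \<tau> y (\<tau> (Suc i + Suc n)) x' \<and> (Suc n = 0 \<longrightarrow> x' = w1)) \<and>
          (\<forall>t. 0 \<le> t \<and> t < \<tau> (Suc i + n) \<longrightarrow> x' t = x t)"
        using predicted_extend[OF samp gain, of y "\<tau> (Suc i + n)" x "Suc i + n"] sampling_basic(2)[OF samp, of "Suc i + n"] by auto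
    qed
    then show ?thesis by simp
  qed
  then obtain W where W: "\<And>n. predicted \<tau> y (\<tau> (Suc i + n)) (W n)" and W0: "W 0 = w1"
    and Wstep: "\<And>n t. 0 \<le> t \<Longrightarrow> t < \<tau> (Suc i + n) \<Longrightarrow> W (Suc n) t = W n t" by blast
  have WL: "W n \<in> Linf_loc UNIV" for n using W by (simp add: predicted_def)
  have Wag: "W m t = W n t" if "n \<le> m" "0 \<le> t" "t < \<tau> (Suc i + n)" for n m t
    using that(1)
  proof (induction m rule: dec_induct)
    case (step m)
    have "t < \<tau> (Suc i + m)" using that(3) sampling_mono[OF samp, of "Suc i + n" "Suc i + m"] step by auto
    then show ?case using Wstep[of t m] that(2) step by simp
  qed simp
  have ex: "\<exists>n. t < \<tau> (Suc i + n)" for t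
  proof -
    obtain N where "t < \<tau> N"
      using sampling_basic(3)[OF samp] by (auto simp: filterlim_at_top_dense eventually_sequentially)
    then have "t < \<tau> (Suc i + N)" using sampling_mono[OF samp, of N "Suc i + N"] by simp
    then show ?thesis by blast
  qed
  define w' where "w' t = W (LEAST n. t < \<tau> (Suc i + n)) t" for t
  have w'eq: "w' t = W n t" if "0 \<le> t" "t < \<tau> (Suc i + n)" for n t
    unfolding w'_def using Wag[OF Least_le[of "\<lambda>n. t < \<tau> (Suc i + n)", OF that(2)] that(1) LeastI[of "\<lambda>n. t < \<tau> (Suc i + n)", OF that(2)]] by simp
  have w'L: "w' \<in> Linf_loc UNIV"
  proof (rule Linf_piecewise[where v = "\<lambda>j. W j", OF sampling_basic(1-3)[OF samp] WL])
    fix j t assume t: "\<tau> j \<le> t" "t < \<tau> (Suc j)"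
    then have "t < \<tau> (Suc i + j)" using sampling_mono[OF samp, of "Suc j" "Suc i + j"] by simp
    then show "w' t = W j t" using w'eq[of t j] t sampling_nonneg[OF samp, of j] by simp
  qed
  have "predicted \<tau> y T' w'" for T'
    unfolding predicted_def
  proof (intro conjI allI impI w'L)
    fix j t assume t: "\<tau> j \<le> t \<and> t < \<tau> (Suc j) \<and> t < T'"
    obtain n where n: "t < \<tau> (Suc i + n)" using ex by blast
    have t0: "0 \<le> \<tau> j" by (rule sampling_nonneg[OF samp])
    then have "w' t = W n t" using w'eq n t by simp
    also have "\<dots> = y j + integral {\<tau> j..t} (G (W n))" using W[of n] n t by (simp add: predicted_def)
    also have "integral {\<tau> j..t} (G (W n)) = integral {\<tau> j..t} (G w')"
      using t t0 n w'eq[where n = n] by (intro Henstock_Kurzweil_Integration.integral_cong G_causal[OF w'L WL, of "\<tau> (Suc i + n)"]) auto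
    finally show "w' t = y j + integral {\<tau> j..t} (G w')" .
  qed
  moreover have "w' t = w t" if "0 \<le> t \<and> t < T" for t
    using w'eq[of t 0] w1(2) that T W0 by simp
  ultimately show ?thesis by blast
qed

lemma predicted_imp_solution:
  assumes samp: "sampling_sequence \<delta> \<tau>" and w: "\<And>T. predicted \<tau> y T w"
  shows "predictor_solution {0..} \<tau> y (Z w) w"
  unfolding predictor_solution_def
proof (intro conjI allI ballI impI)
  have wL: "w \<in> Linf_loc UNIV" using w by (simp add: predicted_def)
  show "delay_solution r {0..} z0 (\<lambda>t \<phi>. F \<phi> (w t) (u t)) (Z w)" by (rule Z_solution[OF wL])
  have eq: "w t = y i + integral {\<tau> i..t} (G w)" if "\<tau> i \<le> t" "t < \<tau> (Suc i)" for i t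
    using w[of "t + 1"] that by (simp add: predicted_def)
  show "w (\<tau> i) = y i" for i using eq[of i "\<tau> i"] sampling_basic(2)[OF samp] by simp
  fix i t assume t: "t \<in> {\<tau> i..<\<tau> (Suc i)} \<inter> {0..}"
  have "continuous_on {\<tau> i..\<tau> (Suc i)} (G w)"
    by (rule continuous_on_subset[OF G_continuous[OF wL]]) (use sampling_nonneg[OF samp, of i] in auto)
  from integral_has_vector_derivative[OF this, of t] t
  have "((\<lambda>t. y i + integral {\<tau> i..t} (G w)) has_vector_derivative 0 + G w t) (at t within {\<tau> i..\<tau> (Suc i)})"
    by (intro has_vector_derivative_add has_vector_derivative_const) auto
  then have "((\<lambda>t. y i + integral {\<tau> i..t} (G w)) has_vector_derivative G w t) (at t within {\<tau> i..<\<tau> (Suc i)} \<inter> {0..})"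
    by (auto intro: has_vector_derivative_within_subset)
  then have "(w has_vector_derivative G w t) (at t within {\<tau> i..<\<tau> (Suc i)} \<inter> {0..})"
    by (rule has_vector_derivative_transform[rotated 2]) (use t eq in auto)
  then show "(w has_vector_derivative M (f (\<Psi> (hist r (Z w) t)) (u t) 0)) (at t within {\<tau> i..<\<tau> (Suc i)} \<inter> {0..})"
    by (simp add: G_def)
qed

lemma predictor_solution_exists:
  assumes samp: "sampling_sequence \<delta> \<tau>" and gain: "\<delta> * LR * \<gamma> \<le> 1 / 2"
  shows "\<exists>z w. predictor_solution {0..} \<tau> y z w"
proof -
  have "predicted \<tau> y 0 (\<lambda>t. 0)"
    using sampling_nonneg[OF samp] zero_signal[of UNIV] by (auto simp: predicted_def) (meson less_le_trans not_le order_trans)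
  from predicted_global[OF samp gain this, of 0] sampling_basic(1)[OF samp] sampling_basic(2)[OF samp, of 0]
  obtain w where "\<And>T. predicted \<tau> y T w" by auto
  from predicted_imp_solution[OF samp this] show ?thesis by blast
qed

text \<open>By \<open>predictor_bound\<close> with \<open>\<epsilon> = 0\<close>, applied on \<open>[0, T']\<close> for every \<open>T' < T\<close>, the signal w stays bounded as
  time approaches T. Cut off at T it is an admissible input, from which the solution continues.\<close>

lemma predictor_solution_extend:
  assumes samp: "sampling_sequence \<delta> \<tau>" and gain: "\<delta> * LR * \<gamma> \<le> 1 / 2"
    and T: "0 < T" and ps: "predictor_solution {0..<T} \<tau> y z w"
  shows "\<exists>z' w'. predictor_solution {0..} \<tau> y z' w' \<and> (\<forall>t\<in>{0..<T}. z' t = z t \<and> w' t = w t)"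
proof -
  have I: "\<And>t. t \<in> {0..<T} \<Longrightarrow> 0 \<le> t \<and> {0..t} \<subseteq> {0..<T}" by auto
  note tr = predictor_solution_truncate[OF samp ps I]
  from sampling_left_interval[OF samp T] obtain i where i: "\<tau> i < T" "T \<le> \<tau> (Suc i)" by blast
  have \<tau>0: "0 \<le> \<tau> i" by (rule sampling_nonneg[OF samp])
  have \<tau>I: "\<tau> i \<in> {0..<T}" using \<tau>0 i by simp
  define wh where "wh t = (if t \<le> \<tau> i then w t else 0)" for t
  have wh: "wh \<in> Linf_loc UNIV" unfolding wh_def[abs_def] by (rule tr(1)) (use \<tau>I in auto)
  have "(\<tau> (Suc i) - \<tau> i) * (LR * \<gamma>) \<le> \<delta> * (LR * \<gamma>)"
    using sampling_basic(4)[OF samp, of i] LR_pos \<gamma> by (intro mult_right_mono) auto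
  then have gain': "(\<tau> (Suc i) - \<tau> i) * LR * \<gamma> \<le> 1 / 2" using gain by (simp add: mult.assoc)
  have le: "\<tau> i \<le> \<tau> (Suc i)" using sampling_basic(2)[OF samp, of i] by simp
  from predictor_bound[OF wh \<tau>0 le gain', of "y i"] obtain K where
    K: "\<forall>\<epsilon> T' w. 0 \<le> \<epsilon> \<and> \<epsilon> \<le> 1 \<and> \<tau> i \<le> T' \<and> T' \<le> \<tau> (Suc i) \<and> w \<in> Linf_loc UNIV \<and>
      (\<forall>t. 0 \<le> t \<and> t < \<tau> i \<longrightarrow> w t = wh t) \<and>
      (\<forall>t\<in>{\<tau> i..T'}. w t = y i + integral {\<tau> i..max (\<tau> i) (t - \<epsilon>)} (G w)) \<longrightarrow>
      (\<forall>t\<in>{0..T'}. norm (w t) \<le> K \<and> norm (G w t) \<le> K)" by (rule exE)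
  have wK: "norm (w t) \<le> K" if t: "t \<in> {0..<T}" for t
  proof -
    define T' where "T' = max t (\<tau> i)"
    have T': "T' \<in> {0..<T}" "\<tau> i \<le> T'" "t \<le> T'" using t i \<tau>0 by (auto simp: T'_def)
    define v where "v t = (if t \<le> T' then w t else 0)" for t
    have vL: "v \<in> Linf_loc UNIV" unfolding v_def[abs_def] by (rule tr(1)) (use T' in auto)
    have "v s = y i + integral {\<tau> i..max (\<tau> i) (s - 0)} (G v)" if s: "s \<in> {\<tau> i..T'}" for s
      using tr(3)[OF _ T'(1), of i s] s T' i by (auto simp: v_def[abs_def] max_absorb2)
    then have "norm (v t) \<le> K"
      using K[rule_format, of 0 T' v t] vL T' i t by (auto simp: v_def wh_def)
    then show ?thesis using T' by (simp add: v_def)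
  qed
  have K0: "0 \<le> K" using order_trans[OF norm_ge_zero wK[of 0]] T by simp
  define wt where "wt t = (if t < T then w t else 0)" for t
  have wtL: "wt \<in> Linf_loc UNIV"
  proof -
    \<comment> \<open>Measurability up to the open end point T is inherited from the truncations at \<open>Tn n\<close>, which increase to T.\<close>
    define Tn where "Tn n = T * (1 - inverse (real (Suc n)))" for n
    have inv: "0 < inverse (real (Suc n))" "inverse (real (Suc n)) \<le> 1" for n by (auto simp: inverse_le_1_iff)
    have Tn: "Tn n \<in> {0..<T}" for n using T inv[of n] by (auto simp: Tn_def algebra_simps)
    have Tlim: "Tn \<longlonglongrightarrow> T * (1 - 0)" unfolding Tn_def[abs_def] by (intro tendsto_intros LIMSEQ_inverse_real_of_nat)
    have "wt \<in> borel_measurable (lebesgue_on {0..})"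
    proof (rule borel_measurable_LIMSEQ_metric[where f = "\<lambda>n t. if t \<le> Tn n then w t else 0"])
      show "(\<lambda>t. if t \<le> Tn n then w t else 0) \<in> borel_measurable (lebesgue_on {0..})" for n
        using tr(1)[OF _ Tn[of n]] by (auto simp: Linf_loc_def)
      fix t :: real
      have "\<forall>\<^sub>F n in sequentially. (if t \<le> Tn n then w t else 0) = wt t"
      proof (cases "t < T")
        case True
        then have "\<forall>\<^sub>F n in sequentially. t < Tn n" using order_tendstoD(1)[OF Tlim, of t] by simp
        then show ?thesis by eventually_elim (use True in \<open>simp add: wt_def\<close>)
      next
        case False
        then have "\<not> t \<le> Tn n" for n using Tn[of n] by auto
        then show ?thesis using False by (simp add: wt_def)
      qed
      then show "(\<lambda>n. if t \<le> Tn n then w t else 0) \<longlonglongrightarrow> wt t" by (rule tendsto_eventually)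
    qed
    moreover have "bounded (wt ` {0..S})" for S
      by (rule boundedI[of _ K]) (use wK K0 in \<open>auto simp: wt_def\<close>)
    ultimately show ?thesis by (simp add: Linf_loc_def)
  qed
  have zZ: "z t = Z wt t" if t: "t \<in> {-r..<T}" for t
  proof -
    define T' where "T' = max t 0"
    have T': "0 \<le> T'" "T' < T" "t \<in> {-r..T'}" using t T by (auto simp: T'_def)
    have "delay_solution r {0..<T} z0 (\<lambda>t \<phi>. F \<phi> (w t) (u t)) z" using ps by (simp add: predictor_solution_def)
    then have "delay_solution r {0..T'} z0 (\<lambda>t \<phi>. F \<phi> (w t) (u t)) z" by (rule delay_solution_subset) (use T' in auto)
    from Z_unique[OF wtL T'(1) this _ T'(3)] show ?thesis using T' by (simp add: wt_def)
  qed
  have "predicted \<tau> y T wt"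
    unfolding predicted_def
  proof (intro conjI allI impI wtL)
    fix j t assume t: "\<tau> j \<le> t \<and> t < \<tau> (Suc j) \<and> t < T"
    have t0: "0 \<le> \<tau> j" by (rule sampling_nonneg[OF samp])
    have "wt t = y j + integral {\<tau> j..t} (\<lambda>s. M (f (\<Psi> (hist r z s)) (u s) 0))"
      using predictor_solution_integral[OF ps I, of t j] t t0 by (auto simp: wt_def)
    also have "integral {\<tau> j..t} (\<lambda>s. M (f (\<Psi> (hist r z s)) (u s) 0)) = integral {\<tau> j..t} (G wt)"
    proof (rule Henstock_Kurzweil_Integration.integral_cong)
      fix s assume s: "s \<in> {\<tau> j..t}"
      have "hist r z s = hist r (Z wt) s" unfolding hist_def
        by (intro restrict_ext zZ) (use s t t0 in auto)
      then show "M (f (\<Psi> (hist r z s)) (u s) 0) = G wt s" by (simp add: G_def)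
    qed
    finally show "wt t = y j + integral {\<tau> j..t} (G wt)" .
  qed
  from predicted_global[OF samp gain this less_imp_le[OF i(1)] i(2)]
  obtain w' where w': "\<And>T'. predicted \<tau> y T' w'" "\<And>t. 0 \<le> t \<Longrightarrow> t < T \<Longrightarrow> w' t = wt t" by blast
  have w'L: "w' \<in> Linf_loc UNIV" using w'(1) by (simp add: predicted_def)
  have "Z w' t = z t" if t: "t \<in> {0..<T}" for t
  proof -
    have "Z w' t = Z wt t" by (rule Z_causal[OF wtL w'L w'(2)]) (use t r in auto)
    then show ?thesis using zZ[of t] t r by auto
  qed
  then show ?thesis
    using predicted_imp_solution[OF samp w'(1)] w'(2) by (intro exI[of _ "Z w'"] exI[of _ w']) (auto simp: wt_def)
qed

end

section \<open>The small-gain estimate\<close>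

context driven_observer begin

lemma predictor_solution_Linf:
  assumes samp: "sampling_sequence \<delta> \<tau>" and ps: "predictor_solution {0..} \<tau> y z w"
  shows "w \<in> Linf_loc UNIV"
proof (rule Linf_piecewise[where v = "\<lambda>i t. if t \<le> \<tau> (Suc i) then w t else 0", OF sampling_basic(1-3)[OF samp]])
  have I: "\<And>t. t \<in> {0..} \<Longrightarrow> 0 \<le> (t::real) \<and> {0..t} \<subseteq> {0..}" by auto
  show "(\<lambda>t. if t \<le> \<tau> (Suc i) then w t else 0) \<in> Linf_loc UNIV" for i
    by (rule predictor_solution_truncate(1)[OF samp ps I]) (use sampling_nonneg[OF samp] in auto)
qed auto

text \<open>A small-gain argument in the norm with weight \<open>exp (- \<sigma> (t - s))\<close>. Let E be the weighted supremum of
  \<open>e = w - M x\<close> on \<open>[0, t]\<close>. Since the last sampling time, at which \<open>e = \<xi>\<close>, the error e has changed by the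
  integral of the difference of the rates, and that difference is at most \<open>LR\<close> times the estimation error, which
  in turn is bounded by \<open>\<gamma> E\<close> and a decaying term. Shifting the weight over one sampling interval costs at
  most \<open>exp \<sigma>\<close>, as \<open>\<delta> \<le> 1\<close>.\<close>

lemma predictor_estimate:
  assumes samp: "sampling_sequence \<delta> \<tau>" and \<delta>: "\<delta> \<le> 1" and gain: "\<delta> * LR * \<gamma> * exp \<sigma> \<le> 1 / 2"
    and x0: "x0 \<in> C0 {-r..0}" and x: "delay_solution r {0..} x0 (\<lambda>t \<phi>. f \<phi> (u t) 0) x"
    and \<xi>: "\<xi> \<in> Linf_loc UNIV"
    and ps: "predictor_solution {0..} \<tau> (\<lambda>i. \<xi> (\<tau> i) + M (x (\<tau> i))) z w" and t: "0 \<le> t"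
  shows "supnorm {-r..0} (\<lambda>\<theta>. \<Psi> (hist r z t) \<theta> - hist r x t \<theta>)
    \<le> exp (- \<sigma> * t) * (2 * a0 (supnorm {-r..0} x0 + supnorm {-r..0} z0))
      + 2 * \<gamma> * exp \<sigma> * (SUP s\<in>{0..t}. norm (\<xi> s) * exp (- \<sigma> * (t - s)))"
proof -
  have I: "\<And>t. t \<in> {0..} \<Longrightarrow> 0 \<le> (t::real) \<and> {0..t} \<subseteq> {0..}" by auto
  have wL: "w \<in> Linf_loc UNIV" by (rule predictor_solution_Linf[OF samp ps])
  have zs: "delay_solution r {0..} z0 (\<lambda>t \<phi>. F \<phi> (w t) (u t)) z" using ps by (simp add: predictor_solution_def)
  have zZ: "hist r z s = hist r (Z w) s" if "0 \<le> s" for s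
    unfolding hist_def
    by (intro restrict_ext Z_unique[OF wL that delay_solution_subset[OF zs]]) (use that in auto)
  define q where "q t = M (f (hist r x t) (u t) 0)" for t
  have cq: "continuous_on {0..} q" unfolding q_def[abs_def] by (rule output_rate_continuous[OF x])
  have qi: "q integrable_on {a..b}" if "0 \<le> a" for a b
    by (rule integrable_continuous_real[OF continuous_on_subset[OF cq]]) (use that in auto)
  define A where "A = a0 (supnorm {-r..0} x0 + supnorm {-r..0} z0)"
  have A: "0 \<le> A" unfolding A_def using x0 z0 r
    by (intro a0_nonneg add_nonneg_nonneg supnorm_nonneg) (auto simp: C0_iff)
  define e where "e s = w s - M (x s)" for s
  have eL: "e \<in> Linf_loc UNIV" unfolding e_def[abs_def] by (rule Linf_diff[OF wL output_Linf[OF x]])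
  have bdd: "bdd_above ((\<lambda>s. norm (v s) * exp (- \<sigma> * (t - s))) ` {0..t})" if v: "v \<in> Linf_loc UNIV" for v :: "real \<Rightarrow> 'y"
  proof -
    obtain B where B: "0 \<le> B" "\<And>s. s \<in> {0..t} \<Longrightarrow> norm (v s) \<le> B" using Linf_norm_bound[OF v] by metis
    have "norm (v s) * exp (- \<sigma> * (t - s)) \<le> B * 1" if "s \<in> {0..t}" for s
      using B that \<sigma> by (intro mult_mono) auto
    then show ?thesis by (rule bdd_aboveI2)
  qed
  define E where "E = (SUP s\<in>{0..t}. norm (e s) * exp (- \<sigma> * (t - s)))"
  define X where "X = (SUP s\<in>{0..t}. norm (\<xi> s) * exp (- \<sigma> * (t - s)))"
  have E: "norm (e s) * exp (- \<sigma> * (t - s)) \<le> E" if "s \<in> {0..t}" for s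
    unfolding E_def using that by (intro cSUP_upper bdd eL)
  have X: "norm (\<xi> s) * exp (- \<sigma> * (t - s)) \<le> X" if "s \<in> {0..t}" for s
    unfolding X_def using that by (intro cSUP_upper bdd \<xi>)
  have E0: "0 \<le> E" using order_trans[OF _ E[of 0]] t by simp
  have X0: "0 \<le> X" using order_trans[OF _ X[of 0]] t by simp
  \<comment> \<open>The bound for the weighted difference of the rates, with the weight taken relative to t.\<close>
  define D where "D = LR * (exp (- \<sigma> * t) * A + \<gamma> * E)"
  have D0: "0 \<le> D" using LR_pos A \<gamma> E0 by (simp add: D_def)
  have near: "norm (G w s - q s) \<le> exp (\<sigma> * (t - s)) * D" if s: "s \<in> {0..t}" for s
  proof -
    have "norm (w \<tau> - M (x \<tau>)) * exp (- \<sigma> * (s - \<tau>)) \<le> exp (\<sigma> * (t - s)) * E" if \<tau>: "\<tau> \<in> {0..s}" for \<tau>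
    proof -
      have "exp (- \<sigma> * (s - \<tau>)) = exp (\<sigma> * (t - s)) * exp (- \<sigma> * (t - \<tau>))"
        by (simp add: exp_add[symmetric] algebra_simps)
      then have "norm (w \<tau> - M (x \<tau>)) * exp (- \<sigma> * (s - \<tau>)) = exp (\<sigma> * (t - s)) * (norm (e \<tau>) * exp (- \<sigma> * (t - \<tau>)))"
        by (simp add: e_def)
      also have "\<dots> \<le> exp (\<sigma> * (t - s)) * E" using E[of \<tau>] \<tau> s by (intro mult_left_mono) auto
      finally show ?thesis .
    qed
    then have "norm (G w s - q s) \<le> LR * (exp (- \<sigma> * s) * A + \<gamma> * (exp (\<sigma> * (t - s)) * E))"
      unfolding q_def A_def using s by (intro G_near_output_rate[OF wL x0 x]) auto
    also have "exp (- \<sigma> * s) = exp (\<sigma> * (t - s)) * exp (- \<sigma> * t)"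
      by (simp add: exp_add[symmetric] algebra_simps)
    finally show ?thesis by (simp add: D_def algebra_simps)
  qed
  have main: "norm (e s) * exp (- \<sigma> * (t - s)) \<le> exp \<sigma> * X + exp (- \<sigma> * t) * A / (2 * \<gamma>) + E / 2" if s: "s \<in> {0..t}" for s
  proof -
    from sampling_interval_exists[OF sampling_basic(1,3)[OF samp], of s] s
    obtain i where i: "\<tau> i \<le> s" "s < \<tau> (Suc i)" by auto
    have \<tau>0: "0 \<le> \<tau> i" by (rule sampling_nonneg[OF samp])
    have gap: "s - \<tau> i \<le> \<delta>" "s - \<tau> i \<le> 1" using sampling_basic(4)[OF samp, of i] i \<delta> by auto
    have \<delta>0: "0 \<le> \<delta>" using gap i by simp
    have \<tau>t: "\<tau> i \<in> {0..t}" using \<tau>0 i s by auto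
    have "w s = \<xi> (\<tau> i) + M (x (\<tau> i)) + integral {\<tau> i..s} (\<lambda>\<tau>. M (f (\<Psi> (hist r z \<tau>)) (u \<tau>) 0))"
      by (rule predictor_solution_integral[OF ps I]) (use s \<tau>0 i in auto)
    also have "integral {\<tau> i..s} (\<lambda>\<tau>. M (f (\<Psi> (hist r z \<tau>)) (u \<tau>) 0)) = integral {\<tau> i..s} (G w)"
      using \<tau>0 zZ by (intro Henstock_Kurzweil_Integration.integral_cong) (simp add: G_def)
    finally have ws: "w s = \<xi> (\<tau> i) + M (x (\<tau> i)) + integral {\<tau> i..s} (G w)" .
    have "M (x s) = M (x (\<tau> i)) + integral {\<tau> i..s} q"
      unfolding q_def[abs_def] by (rule output_integral[OF x \<tau>0 i(1)])
    moreover have "integral {\<tau> i..s} (\<lambda>\<tau>. G w \<tau> - q \<tau>) = integral {\<tau> i..s} (G w) - integral {\<tau> i..s} q"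
      using \<tau>0 by (intro Henstock_Kurzweil_Integration.integral_diff G_integrable wL qi)
    ultimately have es: "e s = \<xi> (\<tau> i) + integral {\<tau> i..s} (\<lambda>\<tau>. G w \<tau> - q \<tau>)" unfolding e_def ws by simp
    have "norm (integral {\<tau> i..s} (\<lambda>\<tau>. G w \<tau> - q \<tau>)) \<le> (exp (\<sigma> * (t - \<tau> i)) * D) * (s - \<tau> i)"
    proof (rule norm_integral_le)
      show "(\<lambda>\<tau>. G w \<tau> - q \<tau>) integrable_on {\<tau> i..s}"
        using \<tau>0 by (intro Henstock_Kurzweil_Integration.integrable_diff G_integrable wL qi)
      fix \<tau>' assume \<tau>': "\<tau>' \<in> {\<tau> i..s}"
      have "norm (G w \<tau>' - q \<tau>') \<le> exp (\<sigma> * (t - \<tau>')) * D" using \<tau>' \<tau>0 s by (intro near) auto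
      also have "\<dots> \<le> exp (\<sigma> * (t - \<tau> i)) * D" using \<tau>' \<sigma> D0 by (intro mult_right_mono) auto
      finally show "norm (G w \<tau>' - q \<tau>') \<le> exp (\<sigma> * (t - \<tau> i)) * D" .
    qed (use i in auto)
    then have "norm (e s) \<le> norm (\<xi> (\<tau> i)) + (exp (\<sigma> * (t - \<tau> i)) * D) * (s - \<tau> i)"
      unfolding es by (rule order_trans[OF norm_triangle_ineq add_left_mono])
    then have "norm (e s) * exp (- \<sigma> * (t - s))
        \<le> (norm (\<xi> (\<tau> i)) + (exp (\<sigma> * (t - \<tau> i)) * D) * (s - \<tau> i)) * exp (- \<sigma> * (t - s))"
      by (rule mult_right_mono) simp
    also have "\<dots> = exp (\<sigma> * (s - \<tau> i)) * (norm (\<xi> (\<tau> i)) * exp (- \<sigma> * (t - \<tau> i))) + exp (\<sigma> * (s - \<tau> i)) * (s - \<tau> i) * D"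
    proof -
      have 1: "exp (- \<sigma> * (t - s)) = exp (\<sigma> * (s - \<tau> i)) * exp (- \<sigma> * (t - \<tau> i))"
        by (simp add: exp_add[symmetric] algebra_simps)
      have 2: "exp (\<sigma> * (t - \<tau> i)) * exp (- \<sigma> * (t - s)) = exp (\<sigma> * (s - \<tau> i))"
        by (simp add: exp_add[symmetric] algebra_simps)
      have "(norm (\<xi> (\<tau> i)) + (exp (\<sigma> * (t - \<tau> i)) * D) * (s - \<tau> i)) * exp (- \<sigma> * (t - s))
        = norm (\<xi> (\<tau> i)) * exp (- \<sigma> * (t - s)) + (exp (\<sigma> * (t - \<tau> i)) * exp (- \<sigma> * (t - s))) * (s - \<tau> i) * D"
        by (simp only: distrib_right) (simp only: mult_ac)
      then show ?thesis unfolding 2 by (simp only: 1 mult_ac)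
    qed
    also have "\<dots> \<le> exp \<sigma> * X + exp \<sigma> * \<delta> * D"
    proof (intro add_mono mult_mono X)
      have "\<sigma> * (s - \<tau> i) \<le> \<sigma> * 1" using gap(2) \<sigma> by (intro mult_left_mono) auto
      then show "exp (\<sigma> * (s - \<tau> i)) \<le> exp \<sigma>" "exp (\<sigma> * (s - \<tau> i)) \<le> exp \<sigma>" by auto
    qed (use \<tau>t gap i D0 X0 \<delta>0 in auto)
    also have "exp \<sigma> * \<delta> * D = (\<delta> * LR * \<gamma> * exp \<sigma>) * (exp (- \<sigma> * t) * A / \<gamma> + E)"
      using \<gamma> by (simp add: D_def field_simps)
    also have "\<dots> \<le> 1 / 2 * (exp (- \<sigma> * t) * A / \<gamma> + E)"
      using gain A \<gamma> E0 by (intro mult_right_mono) auto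
    finally show ?thesis by (simp add: field_simps)
  qed
  have "E \<le> exp \<sigma> * X + exp (- \<sigma> * t) * A / (2 * \<gamma>) + E / 2"
    unfolding E_def by (rule cSUP_least) (use main t in \<open>auto simp: E_def\<close>)
  then have "\<gamma> * E \<le> \<gamma> * (2 * (exp \<sigma> * X) + exp (- \<sigma> * t) * A / \<gamma>)"
    using \<gamma> by (intro mult_left_mono) (auto simp: field_simps)
  also have "\<dots> = 2 * \<gamma> * exp \<sigma> * X + exp (- \<sigma> * t) * A" using \<gamma> by (simp add: field_simps)
  finally have "\<gamma> * E \<le> 2 * \<gamma> * exp \<sigma> * X + exp (- \<sigma> * t) * A" .
  moreover have "supnorm {-r..0} (\<lambda>\<theta>. \<Psi> (hist r z t) \<theta> - hist r x t \<theta>) \<le> exp (- \<sigma> * t) * A + \<gamma> * E"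
    unfolding A_def E_def e_def by (rule observer_error_bound[OF u x0 z0 wL x zs t])
  ultimately show ?thesis unfolding A_def X_def by simp
qed

end

section \<open>Continuously differentiable functions on an interval\<close>

lemma C1_on_deriv01:
  assumes "C1_on {0..1} v"
  shows "\<And>z. z \<in> {0..1} \<Longrightarrow> (v has_vector_derivative deriv01 v z) (at z within {0..1})"
    and "continuous_on {0..1} (deriv01 v)"
proof -
  obtain v' :: "real \<Rightarrow> real \<Rightarrow>\<^sub>L real" where v': "\<forall>x\<in>{0..1}. (v has_derivative blinfun_apply (v' x)) (at x within {0..1})"
    and c: "continuous_on {0..1} v'" using assms unfolding C1_on_def by blast
  have d: "(v has_vector_derivative v' z 1) (at z within {0..1})" if "z \<in> {0..1}" for z
  proof -
    have "(v has_derivative (\<lambda>h. h *\<^sub>R v' z 1)) (at z within {0..1})"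
    proof (rule has_derivative_eq_rhs[OF v'[rule_format, OF that]], rule ext)
      show "blinfun_apply (v' z) h = h *\<^sub>R v' z 1" for h
        using blinfun.scaleR_right[of "v' z" h 1] by simp
    qed
    then show ?thesis by (simp add: has_vector_derivative_def)
  qed
  then have eq: "deriv01 v z = v' z 1" if "z \<in> {0..1}" for z
    using that by (intro vector_derivative_within_cbox[of 0 1, simplified]) auto
  show "(v has_vector_derivative deriv01 v z) (at z within {0..1})" if "z \<in> {0..1}" for z
    using d[OF that] eq[OF that] by simp
  show "continuous_on {0..1} (deriv01 v)"
    by (rule continuous_on_eq[of _ "\<lambda>z. v' z 1"]) (use eq c in \<open>auto intro!: continuous_intros\<close>)
qed

lemma C1_on_continuous: "C1_on S f \<Longrightarrow> continuous_on S f"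
  unfolding C1_on_def by (meson continuous_on_eq_continuous_within has_derivative_continuous)

lemma C1_on_partials:
  fixes f :: "real \<times> real \<Rightarrow> real"
  assumes d: "\<And>t z. (t, z) \<in> S \<Longrightarrow> (f has_derivative (\<lambda>(a, b). a * p t z + b * q t z)) (at (t, z) within S)"
    and p: "continuous_on S (\<lambda>(t, z). p t z)" and q: "continuous_on S (\<lambda>(t, z). q t z)"
  shows "C1_on S f"
proof -
  define D :: "real \<times> real \<Rightarrow> (real \<times> real) \<Rightarrow>\<^sub>L real" where
    "D x = p (fst x) (snd x) *\<^sub>R Blinfun fst + q (fst x) (snd x) *\<^sub>R Blinfun snd" for x
  have "blinfun_apply (D (t, z)) = (\<lambda>(a, b). a * p t z + b * q t z)" for t z
    by (auto simp: D_def fun_eq_iff blinfun.add_left blinfun.scaleR_left bounded_linear_Blinfun_apply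
        bounded_linear_fst bounded_linear_snd)
  then have "(f has_derivative blinfun_apply (D x)) (at x within S)" if "x \<in> S" for x
    using d that by (cases x) simp
  moreover have "continuous_on S D"
    unfolding D_def using p q by (intro continuous_intros) (simp_all add: split_beta)
  ultimately show ?thesis unfolding C1_on_def by blast
qed

text \<open>Used to extend a function linearly beyond the end points of \<open>[0, 1]\<close> (\<open>has_vector_derivative_extrapolation\<close>),
  so that it can be differentiated at every real point.\<close>

definition clamp01 :: "real \<Rightarrow> real" where "clamp01 y = min 1 (max 0 y)"

lemma clamp01_simps: "clamp01 y \<in> {0..1}" "y \<in> {0..1} \<Longrightarrow> clamp01 y = y" "y \<le> 0 \<Longrightarrow> clamp01 y = 0" "1 \<le> y \<Longrightarrow> clamp01 y = 1"
  by (auto simp: clamp01_def)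

lemma continuous_on_clamp01: "continuous_on A clamp01"
  unfolding clamp01_def[abs_def] by (intro continuous_intros)

lemma has_vector_derivative_extrapolation:
  fixes h h' :: "real \<Rightarrow> real"
  assumes h: "\<And>y. y \<in> {0..1} \<Longrightarrow> (h has_vector_derivative h' y) (at y within {0..1})"
  shows "((\<lambda>y. h (clamp01 y) + (y - clamp01 y) * h' (clamp01 y)) has_vector_derivative h' (clamp01 y)) (at y)"
proof -
  let ?e = "\<lambda>y. h (clamp01 y) + (y - clamp01 y) * h' (clamp01 y)"
  have lin: "((\<lambda>y. h a + (y - a) * h' a) has_vector_derivative h' a) (at y within A)" for a y A
    by (auto intro!: derivative_eq_intros simp flip: has_real_derivative_iff_has_vector_derivative)
  have left: "(?e has_vector_derivative h' 0) (at y within {..0})" if "y \<le> 0" for y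
    by (rule has_vector_derivative_transform[OF _ _ lin[of 0]]) (use that in \<open>auto simp: clamp01_simps\<close>)
  have right: "(?e has_vector_derivative h' 1) (at y within {1..})" if "1 \<le> y" for y
    by (rule has_vector_derivative_transform[OF _ _ lin[of 1]]) (use that in \<open>auto simp: clamp01_simps\<close>)
  have mid: "(?e has_vector_derivative h' y) (at y within {0..1})" if "y \<in> {0..1}" for y
    by (rule has_vector_derivative_transform[OF _ _ h]) (use that in \<open>auto simp: clamp01_simps\<close>)
  have Un: "(g has_vector_derivative D) (at y within A \<union> B)"
    if "(g has_vector_derivative D) (at y within A)" "(g has_vector_derivative D) (at y within B)" for g :: "real \<Rightarrow> real" and D A B y
    using that unfolding has_vector_derivative_def has_derivative_within by (auto intro: Lim_Un)
  have nhd: "(g has_vector_derivative D) (at y)"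
    if "(g has_vector_derivative D) (at y within A)" "y \<in> interior A" for g :: "real \<Rightarrow> real" and D A y
    using that(1) unfolding at_within_interior[OF that(2)] .
  consider "y < 0" | "y = 0" | "0 < y" "y < 1" | "y = 1" | "1 < y" by linarith
  then show ?thesis
  proof cases
    case 1 then show ?thesis using nhd[OF left] by (auto simp: clamp01_simps)
  next
    case 2
    have "(?e has_vector_derivative h' 0) (at 0 within {..0} \<union> {0..1})" by (rule Un[OF left mid]) auto
    moreover have "{..0} \<union> {0..1} = {..1::real}" by auto
    ultimately show ?thesis using 2 nhd[of ?e "h' 0" 0 "{..1}"] by (auto simp: clamp01_simps)
  next
    case 3 then show ?thesis using nhd[OF mid] by (auto simp: clamp01_simps)
  next
    case 4
    have "(?e has_vector_derivative h' 1) (at 1 within {0..1} \<union> {1..})" by (rule Un[OF mid right]) auto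
    moreover have "{0..1} \<union> {1..} = {0::real..}" by auto
    ultimately show ?thesis using 4 nhd[of ?e "h' 1" 1 "{0..}"] by (auto simp: clamp01_simps)
  next
    case 5 then show ?thesis using nhd[OF right] by (auto simp: clamp01_simps)
  qed
qed

text \<open>Leibniz' rule gives the partial derivative in the parameter, the fundamental theorem of calculus the one
  in the upper limit; the latter is jointly continuous, whence joint differentiability. As J has no largest
  element, a neighbourhood of s in J is contained in an interval \<open>[a, b]\<close> with \<open>s < b\<close>.\<close>

lemma has_derivative_integral_upper:
  fixes k k' :: "real \<Rightarrow> real \<Rightarrow> real"
  assumes J: "convex J" "a \<in> J" "\<And>s. s \<in> J \<Longrightarrow> a \<le> s" "\<And>s. s \<in> J \<Longrightarrow> \<exists>b\<in>J. s < b"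
    and k: "\<And>\<zeta> p. p \<in> J \<Longrightarrow> ((\<lambda>\<zeta>. k \<zeta> p) has_vector_derivative k' \<zeta> p) (at \<zeta>)"
    and ck: "continuous_on (UNIV \<times> J) (\<lambda>(\<zeta>, p). k \<zeta> p)" and ck': "continuous_on (UNIV \<times> J) (\<lambda>(\<zeta>, p). k' \<zeta> p)"
    and s: "s \<in> J"
  shows "((\<lambda>(\<zeta>, s). integral {a..s} (k \<zeta>)) has_derivative
      (\<lambda>(d\<zeta>, ds). d\<zeta> * integral {a..s} (k' \<zeta>) + ds * k \<zeta> s)) (at (\<zeta>, s) within UNIV \<times> J)"
proof -
  have sub: "{a..b} \<subseteq> J" if "b \<in> J" for b
    using J(1,2) that closed_segment_subset[of a J b] J(3)[OF that] by (simp add: closed_segment_eq_real_ivl)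
  have ckb: "continuous_on {a..b} (k \<zeta>)" if "b \<in> J" for b \<zeta>
    by (rule continuous_on_compose2[OF ck, of "{a..b}" "\<lambda>p. (\<zeta>, p)", unfolded prod.case])
       (use sub[OF that] in \<open>auto intro: continuous_on_Pair continuous_on_const continuous_on_id\<close>)
  have 1: "((\<lambda>\<zeta>. integral {a..s} (k \<zeta>)) has_derivative (\<lambda>h. h * integral {a..s} (k' \<zeta>))) (at \<zeta> within UNIV)"
  proof -
    have "((\<lambda>\<zeta>. integral (cbox a s) (k \<zeta>)) has_vector_derivative integral (cbox a s) (k' \<zeta>)) (at \<zeta> within UNIV)"
    proof (rule leibniz_rule_vector_derivative)
      show "((\<lambda>x. k x t) has_vector_derivative k' x t) (at x within UNIV)" if "t \<in> cbox a s" for x t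
        using k[of t x] sub[OF s] that by auto
      show "k x integrable_on cbox a s" for x
        using integrable_continuous_real[OF ckb[OF s]] by simp
      show "continuous_on (UNIV \<times> cbox a s) (\<lambda>(x, t). k' x t)"
        by (rule continuous_on_subset[OF ck']) (use sub[OF s] in auto)
    qed auto
    then show ?thesis by (simp add: has_vector_derivative_def)
  qed
  have 2: "((\<lambda>s. integral {a..s} (k \<zeta>)) has_derivative blinfun_apply (blinfun_scaleR_left (k \<zeta> s))) (at s within J)"
    if s: "s \<in> J" for \<zeta> s
  proof -
    obtain b where b: "b \<in> J" "s < b" using J(4)[OF s] by blast
    have "((\<lambda>s. integral {a..s} (k \<zeta>)) has_vector_derivative k \<zeta> s) (at s within {a..b})"
      by (rule integral_has_vector_derivative[OF ckb[OF b(1)]]) (use J(3)[OF s] b in auto)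
    moreover have "at s within J = at s within {a..b}"
      by (rule at_within_nhd[of s "{..<b}"]) (use b J(3) sub[OF b(1)] in auto)
    ultimately show ?thesis by (simp add: has_vector_derivative_def blinfun_scaleR_left.rep_eq)
  qed
  have 3: "continuous (at (\<zeta>, s) within UNIV \<times> J) (\<lambda>(\<zeta>, s). blinfun_scaleR_left (k \<zeta> s))"
  proof -
    have "continuous_on (UNIV \<times> J) (\<lambda>x. blinfun_scaleR_left (case x of (\<zeta>, s) \<Rightarrow> k \<zeta> s))"
      by (intro bounded_linear.continuous_on[OF bounded_linear_blinfun_scaleR_left] ck)
    then have "continuous_on (UNIV \<times> J) (\<lambda>(\<zeta>, s). blinfun_scaleR_left (k \<zeta> s))" by (simp add: split_beta)
    then show ?thesis using s unfolding continuous_on_eq_continuous_within by blast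
  qed
  from has_derivative_partialsI[OF 1 2 3 s J(1)]
  show ?thesis by (simp add: blinfun_scaleR_left.rep_eq)
qed

section \<open>The transport loop and its source term\<close>

lemma continuous_family_bounded:
  fixes b :: "nat \<Rightarrow> real \<Rightarrow> real"
  assumes "finite A" "\<And>i. i \<in> A \<Longrightarrow> continuous_on {0..1} (b i)"
  shows "\<exists>B\<ge>0. \<forall>i\<in>A. \<forall>z\<in>{0..1}. \<bar>b i z\<bar> \<le> B"
  using assms
proof (induction A)
  case empty then show ?case by auto
next
  case (insert a A)
  then obtain B where B: "B \<ge> 0" "\<forall>i\<in>A. \<forall>z\<in>{0..1}. \<bar>b i z\<bar> \<le> B" by auto
  have "bounded (b a ` {0..1})" using insert.prems by (intro compact_imp_bounded compact_continuous_image) auto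
  then obtain B' where B': "\<forall>y\<in>b a ` {0..1}. norm y \<le> B'" unfolding bounded_iff by blast
  show ?case
  proof (intro exI[of _ "max B B'"] conjI ballI)
    show "0 \<le> max B B'" using B by simp
    show "\<bar>b i z\<bar> \<le> max B B'" if "i \<in> insert a A" "z \<in> {0..1}" for i z
      using that B(2) B' by (cases "i = a") (auto simp: le_max_iff_disj)
  qed
qed

lemma continuous_on_compose_pair:
  assumes "continuous_on (A \<times> B) (\<lambda>(a, b). g a b)" "continuous_on T p" "continuous_on T q"
    "\<And>t. t \<in> T \<Longrightarrow> p t \<in> A" "\<And>t. t \<in> T \<Longrightarrow> q t \<in> B"
  shows "continuous_on T (\<lambda>t. g (p t) (q t))"
  by (rule continuous_on_compose2[OF assms(1) continuous_on_Pair[OF assms(2,3)], unfolded prod.case]) (use assms(4,5) in auto)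

locale pde_loop =
  fixes S :: "('b::finite, 'm::finite, 'k::finite, 'n::finite) pde_ode" and L :: real
  assumes data: "admissible_data S" and L_pos: "0 < L"
    and Ftil_cont: "continuous_map
          (prod_topology euclidean (prod_topology (C0top {0..1}) euclidean)) euclidean
          (\<lambda>(x, v, u). Ftil S x v u)"
    and g_C1: "C1_on ({0..1} \<times> UNIV) (\<lambda>(z, x). gsrc S z x)"
    and Ftil_Lip: "\<And>x y u v w. v \<in> C0 {0..1} \<Longrightarrow> w \<in> C0 {0..1} \<Longrightarrow> norm (Ftil S x v u - Ftil S y w u)
             \<le> L * supnorm {0..1} (\<lambda>z. v z - w z) + L * norm (x - y)"
    and g_Lip: "\<And>x y. supnorm {0..1} (\<lambda>z. gsrc S z x - gsrc S z y) \<le> L * norm (x - y)"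
    and dg_Lip: "\<And>x y. supnorm {0..1} (\<lambda>z. deriv01 (\<lambda>y'. gsrc S y' x) z - deriv01 (\<lambda>y'. gsrc S y' y) z)
            \<le> L * norm (x - y)"
begin

abbreviation c :: real where "c \<equiv> speed S"
abbreviation r :: real where "r \<equiv> delay S"
abbreviation dg :: "real \<Rightarrow> real ^ 'b \<Rightarrow> real" where "dg z x \<equiv> deriv01 (\<lambda>y. gsrc S y x) z"

lemma c_pos: "0 < c" and r_pos: "0 < r" and rc: "r * c = 1" "c * r = 1"
  using data by (auto simp: admissible_data_def delay_def)

lemma r0: "0 \<le> r" using r_pos by simp

lemma inj_lab: "bij_betw (lab S) (labels S) UNIV"
  using data by (simp add: admissible_data_def)

lemma coef_C1: "i \<in> {1..N1 S} \<Longrightarrow> C1_on {0..1} (bcoef S i)" "i \<in> {1..N2 S} \<Longrightarrow> C1_on {0..1} (betacoef S i)"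
  and gammaker_cont: "i \<in> {1..N2 S} \<Longrightarrow> continuous_on {0..1} (gammaker S i)"
  and zpt_mem: "i \<in> {1..N1 S} \<Longrightarrow> zpt S i \<in> {0..1}"
  and acoef_cont: "continuous_on {0..1} (acoef S)"
  using data unfolding admissible_data_def by (simp_all add: less_imp_le)

lemma xbar_of_tuple [simp]: "xbar_of S (tuple S xb \<eta> \<mu>) = xb"
  and eta_of_tuple: "i \<in> {1..N1 S} \<Longrightarrow> eta_of S (tuple S xb \<eta> \<mu>) i = \<eta> i"
  and lambda_of_tuple: "i \<in> {1..N2 S} \<Longrightarrow> lambda_of S (tuple S xb \<eta> \<mu>) i = \<mu> i"
  using bij_betw_inv_into_left[OF inj_lab]
  by (simp_all add: vec_eq_iff xbar_of_def eta_of_def lambda_of_def tuple_def labels_def Plus_def image_iff)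

lemma lab_cases:
  obtains (xbar) i where "j = lab S (Inl i)"
    | (eta) i where "i \<in> {1..N1 S}" "j = lab S (Inr (Inl i))"
    | (lambda) i where "i \<in> {1..N2 S}" "j = lab S (Inr (Inr i))"
proof -
  have "j \<in> lab S ` labels S" using inj_lab by (simp add: bij_betw_def)
  then show ?thesis using that by (auto simp: labels_def Plus_def)
qed

lemma state_eqI:
  assumes "xbar_of S x = xbar_of S y" "\<And>i. i \<in> {1..N1 S} \<Longrightarrow> eta_of S x i = eta_of S y i"
    "\<And>i. i \<in> {1..N2 S} \<Longrightarrow> lambda_of S x i = lambda_of S y i"
  shows "x = y"
  unfolding vec_eq_iff
proof
  fix j show "x $ j = y $ j"
    using assms by (cases j rule: lab_cases) (auto simp: xbar_of_def eta_of_def lambda_of_def vec_eq_iff)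
qed

lemma bounded_linear_xbar_of: "bounded_linear (xbar_of S)"
  by (intro linear_conv_bounded_linear[THEN iffD1] linearI) (auto simp: xbar_of_def vec_eq_iff)

lemma state_diff: "xbar_of S x - xbar_of S y = xbar_of S (x - y)" "eta_of S x i - eta_of S y i = eta_of S (x - y) i"
    "lambda_of S x i - lambda_of S y i = lambda_of S (x - y) i"
  by (auto simp: xbar_of_def eta_of_def lambda_of_def vec_eq_iff)

lemma state_bounds: "norm (xbar_of S x) \<le> CARD('b) * norm x" "\<bar>eta_of S x i\<bar> \<le> norm x" "\<bar>lambda_of S x i\<bar> \<le> norm x"
proof -
  have "norm (xbar_of S x) \<le> (\<Sum>i\<in>UNIV. \<bar>xbar_of S x $ i\<bar>)" by (rule norm_le_l1_cart)
  also have "\<dots> \<le> (\<Sum>i\<in>(UNIV::'b set). norm x)"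
    by (intro sum_mono) (simp add: xbar_of_def component_le_norm_cart)
  finally show "norm (xbar_of S x) \<le> CARD('b) * norm x" by simp
qed (simp_all add: eta_of_def lambda_of_def component_le_norm_cart)

lemma continuous_on_state:
  assumes "continuous_on A x"
  shows "continuous_on A (\<lambda>t. xbar_of S (x t))" "continuous_on A (\<lambda>t. eta_of S (x t) i)" "continuous_on A (\<lambda>t. lambda_of S (x t) i)"
  using assms by (auto simp: eta_of_def lambda_of_def intro!: continuous_intros bounded_linear.continuous_on[OF bounded_linear_xbar_of])

lemma affine_in_state_Lipschitz:
  fixes g0 :: "real \<Rightarrow> real ^ 'b \<Rightarrow> real" and b \<beta> :: "nat \<Rightarrow> real \<Rightarrow> real"
  assumes g0: "\<And>z x y. z \<in> {0..1} \<Longrightarrow> \<bar>g0 z x - g0 z y\<bar> \<le> L * norm (x - y)"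
    and b: "\<And>i. i \<in> {1..N1 S} \<Longrightarrow> continuous_on {0..1} (b i)" and \<beta>: "\<And>i. i \<in> {1..N2 S} \<Longrightarrow> continuous_on {0..1} (\<beta> i)"
  shows "\<exists>K\<ge>0. \<forall>z\<in>{0..1}. \<forall>x y.
    \<bar>(g0 z (xbar_of S x) + (\<Sum>i=1..N1 S. b i z * eta_of S x i) + (\<Sum>i=1..N2 S. \<beta> i z * lambda_of S x i))
     - (g0 z (xbar_of S y) + (\<Sum>i=1..N1 S. b i z * eta_of S y i) + (\<Sum>i=1..N2 S. \<beta> i z * lambda_of S y i))\<bar> \<le> K * norm (x - y)"
proof -
  obtain B where B: "0 \<le> B" "\<forall>i\<in>{1..N1 S}. \<forall>z\<in>{0..1}. \<bar>b i z\<bar> \<le> B" using continuous_family_bounded[of "{1..N1 S}" b] b by auto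
  obtain B' where B': "0 \<le> B'" "\<forall>i\<in>{1..N2 S}. \<forall>z\<in>{0..1}. \<bar>\<beta> i z\<bar> \<le> B'" using continuous_family_bounded[of "{1..N2 S}" \<beta>] \<beta> by auto
  show ?thesis
  proof (intro exI[of _ "L * CARD('b) + N1 S * B + N2 S * B'"] conjI ballI allI)
    show "0 \<le> L * CARD('b) + N1 S * B + N2 S * B'" using L_pos B B' by simp
    fix z x y assume z: "z \<in> {0..1::real}"
    have 1: "\<bar>g0 z (xbar_of S x) - g0 z (xbar_of S y)\<bar> \<le> L * CARD('b) * norm (x - y)"
    proof -
      have "L * norm (xbar_of S x - xbar_of S y) \<le> L * (CARD('b) * norm (x - y))"
        unfolding state_diff using L_pos by (intro mult_left_mono state_bounds) auto
      then show ?thesis using g0[OF z, of "xbar_of S x" "xbar_of S y"] by (simp add: mult.assoc)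
    qed
    have 2: "\<bar>\<Sum>i=1..N1 S. b i z * (eta_of S x i - eta_of S y i)\<bar> \<le> (\<Sum>i=1..N1 S. B * norm (x - y))"
      unfolding state_diff using B z
      by (intro order_trans[OF sum_abs] sum_mono) (auto simp: abs_mult intro!: mult_mono state_bounds)
    have 3: "\<bar>\<Sum>i=1..N2 S. \<beta> i z * (lambda_of S x i - lambda_of S y i)\<bar> \<le> (\<Sum>i=1..N2 S. B' * norm (x - y))"
      unfolding state_diff using B' z
      by (intro order_trans[OF sum_abs] sum_mono) (auto simp: abs_mult intro!: mult_mono state_bounds)
    have "(g0 z (xbar_of S x) + (\<Sum>i=1..N1 S. b i z * eta_of S x i) + (\<Sum>i=1..N2 S. \<beta> i z * lambda_of S x i))
     - (g0 z (xbar_of S y) + (\<Sum>i=1..N1 S. b i z * eta_of S y i) + (\<Sum>i=1..N2 S. \<beta> i z * lambda_of S y i))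
      = (g0 z (xbar_of S x) - g0 z (xbar_of S y)) + (\<Sum>i=1..N1 S. b i z * (eta_of S x i - eta_of S y i))
        + (\<Sum>i=1..N2 S. \<beta> i z * (lambda_of S x i - lambda_of S y i))"
      by (simp add: right_diff_distrib sum_subtractf)
    also have "\<bar>\<dots>\<bar> \<le> L * CARD('b) * norm (x - y) + (\<Sum>i=1..N1 S. B * norm (x - y)) + (\<Sum>i=1..N2 S. B' * norm (x - y))"
      using 1 2 3 by linarith
    also have "\<dots> = (L * CARD('b) + N1 S * B + N2 S * B') * norm (x - y)" by (simp add: algebra_simps)
    finally show "\<bar>(g0 z (xbar_of S x) + (\<Sum>i=1..N1 S. b i z * eta_of S x i) + (\<Sum>i=1..N2 S. \<beta> i z * lambda_of S x i))
     - (g0 z (xbar_of S y) + (\<Sum>i=1..N1 S. b i z * eta_of S y i) + (\<Sum>i=1..N2 S. \<beta> i z * lambda_of S y i))\<bar>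
      \<le> (L * CARD('b) + N1 S * B + N2 S * B') * norm (x - y)" .
  qed
qed

lemma affine_in_state_continuous:
  fixes g0 :: "real \<Rightarrow> real ^ 'b \<Rightarrow> real" and b \<beta> :: "nat \<Rightarrow> real \<Rightarrow> real"
  assumes g0: "continuous_on ({0..1} \<times> UNIV) (\<lambda>(z, x). g0 z x)"
    and b: "\<And>i. i \<in> {1..N1 S} \<Longrightarrow> continuous_on {0..1} (b i)" and \<beta>: "\<And>i. i \<in> {1..N2 S} \<Longrightarrow> continuous_on {0..1} (\<beta> i)"
  shows "continuous_on ({0..1} \<times> UNIV) (\<lambda>(z, x). g0 z (xbar_of S x) + (\<Sum>i=1..N1 S. b i z * eta_of S x i)
      + (\<Sum>i=1..N2 S. \<beta> i z * lambda_of S x i))"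
proof -
  have g: "continuous_on ({0..1} \<times> UNIV) (\<lambda>p. g0 (fst p) (xbar_of S (snd p)))"
    by (rule continuous_on_compose_pair[OF g0]) (auto intro!: continuous_intros continuous_on_state)
  have bb: "continuous_on ({0..1} \<times> UNIV) (\<lambda>p. b i (fst p))" if "i \<in> {1..N1 S}" for i
    by (rule continuous_on_compose2[OF b[OF that]]) (auto intro!: continuous_intros)
  have bb': "continuous_on ({0..1} \<times> UNIV) (\<lambda>p. \<beta> i (fst p))" if "i \<in> {1..N2 S}" for i
    by (rule continuous_on_compose2[OF \<beta>[OF that]]) (auto intro!: continuous_intros)
  show ?thesis unfolding split_beta
    by (intro continuous_on_add continuous_on_sum continuous_on_mult g bb bb' continuous_on_state continuous_on_snd continuous_on_id) auto
qed

lemma gsrc_continuous: "continuous_on ({0..1} \<times> UNIV) (\<lambda>(z, x). gsrc S z x)"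
  by (rule C1_on_continuous[OF g_C1])

text \<open>\<open>deriv01\<close> is a one-sided derivative at the end points; it agrees with the first component of the total
  derivative of the source, which is continuous.\<close>

lemma gsrc_deriv: "z \<in> {0..1} \<Longrightarrow> ((\<lambda>y. gsrc S y x) has_vector_derivative dg z x) (at z within {0..1})"
  and dg_continuous: "continuous_on ({0..1} \<times> UNIV) (\<lambda>(z, x). dg z x)"
proof -
  obtain g' :: "real \<times> (real ^ 'b) \<Rightarrow> (real \<times> (real ^ 'b)) \<Rightarrow>\<^sub>L real" where
    g': "\<And>p. p \<in> {0..1} \<times> UNIV \<Longrightarrow> ((\<lambda>(z, x). gsrc S z x) has_derivative blinfun_apply (g' p)) (at p within {0..1} \<times> UNIV)"
    and c: "continuous_on ({0..1} \<times> UNIV) g'" using g_C1 unfolding C1_on_def by blast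
  have d: "((\<lambda>y. gsrc S y x) has_vector_derivative g' (z, x) (1, 0)) (at z within {0..1})" if z: "z \<in> {0..1}" for z x
  proof -
    have 1: "((\<lambda>y. (y, x)) has_derivative (\<lambda>h. (h, 0))) (at z within {0..1})"
      by (auto intro!: derivative_eq_intros)
    have 2: "((\<lambda>(z, x). gsrc S z x) has_derivative blinfun_apply (g' (z, x))) (at (z, x) within (\<lambda>y. (y, x)) ` {0..1})"
      by (rule has_derivative_subset[OF g']) (use z in auto)
    have "((\<lambda>y. gsrc S y x) has_derivative (\<lambda>h. g' (z, x) (h, 0))) (at z within {0..1})"
      using has_derivative_in_compose[OF 1 2] by simp
    moreover have "(\<lambda>h. g' (z, x) (h, 0)) = (\<lambda>h. h *\<^sub>R g' (z, x) (1, 0))"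
    proof
      fix h :: real
      have "(h, 0) = h *\<^sub>R (1, 0 :: real ^ 'b)" by simp
      then show "g' (z, x) (h, 0) = h *\<^sub>R g' (z, x) (1, 0)" by (simp only: blinfun.scaleR_right)
    qed
    ultimately show ?thesis unfolding has_vector_derivative_def by (simp only:)
  qed
  then have eq: "dg z x = g' (z, x) (1, 0)" if "z \<in> {0..1}" for z x
    using that by (intro vector_derivative_within_cbox[of 0 1, simplified]) auto
  show "((\<lambda>y. gsrc S y x) has_vector_derivative dg z x) (at z within {0..1})" if "z \<in> {0..1}"
    unfolding eq[OF that] by (rule d[OF that])
  have "continuous_on ({0..1} \<times> UNIV) (\<lambda>p. g' p (1, 0))" using c by (intro continuous_intros)
  then show "continuous_on ({0..1} \<times> UNIV) (\<lambda>(z, x). dg z x)"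
    by (rule continuous_on_eq) (clarsimp simp: eq)
qed

lemma gsrc_Lip: "z \<in> {0..1} \<Longrightarrow> \<bar>gsrc S z x - gsrc S z y\<bar> \<le> L * norm (x - y)"
  and dg_Lip_pointwise: "z \<in> {0..1} \<Longrightarrow> \<bar>dg z x - dg z y\<bar> \<le> L * norm (x - y)"
proof -
  have 1: "continuous_on {0..1} (\<lambda>z. gsrc S z x)" for x
    by (rule continuous_on_compose_pair[OF gsrc_continuous]) (auto intro: continuous_on_const continuous_on_id)
  have 2: "continuous_on {0..1} (\<lambda>z. dg z x)" for x
    by (rule continuous_on_compose_pair[OF dg_continuous]) (auto intro: continuous_on_const continuous_on_id)
  assume z: "z \<in> {0..1}"
  show "\<bar>gsrc S z x - gsrc S z y\<bar> \<le> L * norm (x - y)"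
    using norm_le_supnorm[OF continuous_on_diff[OF 1[of x] 1[of y]] z] g_Lip[of x y] by simp
  show "\<bar>dg z x - dg z y\<bar> \<le> L * norm (x - y)"
    using norm_le_supnorm[OF continuous_on_diff[OF 2[of x] 2[of y]] z] dg_Lip[of x y] by simp
qed

text \<open>The z-derivative of \<open>gbar\<close>, see \<open>gbar_deriv\<close>.\<close>

definition dgbar :: "real \<Rightarrow> real ^ 'n \<Rightarrow> real" where
  "dgbar z x = dg z (xbar_of S x) + (\<Sum>i=1..N1 S. deriv01 (bcoef S i) z * eta_of S x i)
     + (\<Sum>i=1..N2 S. deriv01 (betacoef S i) z * lambda_of S x i)"

lemma gtil_eq: "gtil S z x = acoef S z * gbar S z x - c * dgbar z x"
  by (simp add: gtil_def gbar_def dgbar_def algebra_simps sum_distrib_left sum_subtractf)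

lemma gbar_continuous: "continuous_on ({0..1} \<times> UNIV) (\<lambda>(z, x). gbar S z x)"
  unfolding gbar_def by (rule affine_in_state_continuous[OF gsrc_continuous]) ((erule coef_C1[THEN C1_on_continuous] | assumption)+)

lemma dgbar_continuous: "continuous_on ({0..1} \<times> UNIV) (\<lambda>(z, x). dgbar z x)"
  unfolding dgbar_def by (rule affine_in_state_continuous[OF dg_continuous]) ((erule coef_C1[THEN C1_on_deriv01(2)] | assumption)+)

lemma gtil_continuous: "continuous_on ({0..1} \<times> UNIV) (\<lambda>(z, x). gtil S z x)"
proof -
  have "continuous_on ({0..1} \<times> UNIV) (\<lambda>p :: real \<times> (real ^ 'n). acoef S (fst p))"
    by (rule continuous_on_compose2[OF acoef_cont]) (auto intro!: continuous_intros)
  then show ?thesis unfolding gtil_eq split_beta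
    using gbar_continuous dgbar_continuous by (intro continuous_intros) (simp_all add: split_beta)
qed

lemma gbar_deriv:
  assumes z: "z \<in> {0..1}" shows "((\<lambda>z. gbar S z x) has_vector_derivative dgbar z x) (at z within {0..1})"
proof -
  have 1: "((\<lambda>z. bcoef S i z * eta_of S x i) has_vector_derivative deriv01 (bcoef S i) z * eta_of S x i) (at z within {0..1})"
    if "i \<in> {1..N1 S}" for i
    by (intro has_vector_derivative_mult_left C1_on_deriv01(1)[OF coef_C1(1)[OF that] z])
  have 2: "((\<lambda>z. betacoef S i z * lambda_of S x i) has_vector_derivative deriv01 (betacoef S i) z * lambda_of S x i) (at z within {0..1})"
    if "i \<in> {1..N2 S}" for i
    by (intro has_vector_derivative_mult_left C1_on_deriv01(1)[OF coef_C1(2)[OF that] z])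
  show ?thesis unfolding gbar_def dgbar_def
    by (intro has_vector_derivative_add has_vector_derivative_sum gsrc_deriv[OF z] 1 2)
qed

lemma gbar_Lipschitz: "\<exists>K\<ge>0. \<forall>z\<in>{0..1}. \<forall>x y. \<bar>gbar S z x - gbar S z y\<bar> \<le> K * norm (x - y)"
  unfolding gbar_def by (rule affine_in_state_Lipschitz[OF gsrc_Lip]) ((erule coef_C1[THEN C1_on_continuous] | assumption)+)

lemma gtil_Lipschitz: "\<exists>K\<ge>0. \<forall>z\<in>{0..1}. \<forall>x y. \<bar>gtil S z x - gtil S z y\<bar> \<le> K * norm (x - y)"
proof -
  obtain K1 where K1: "0 \<le> K1" "\<forall>z\<in>{0..1}. \<forall>x y. \<bar>gbar S z x - gbar S z y\<bar> \<le> K1 * norm (x - y)" using gbar_Lipschitz by blast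
  have "\<exists>K\<ge>0. \<forall>z\<in>{0..1}. \<forall>x y. \<bar>dgbar z x - dgbar z y\<bar> \<le> K * norm (x - y)"
    unfolding dgbar_def by (rule affine_in_state_Lipschitz[OF dg_Lip_pointwise]) ((erule coef_C1[THEN C1_on_deriv01(2)] | assumption)+)
  then obtain K2 where K2: "0 \<le> K2" "\<forall>z\<in>{0..1}. \<forall>x y. \<bar>dgbar z x - dgbar z y\<bar> \<le> K2 * norm (x - y)" by blast
  obtain Ba where Ba: "0 \<le> Ba" "\<forall>z\<in>{0..1}. \<bar>acoef S z\<bar> \<le> Ba" using continuous_family_bounded[of "{0}" "\<lambda>i. acoef S"] acoef_cont by auto
  show ?thesis
  proof (intro exI[of _ "Ba * K1 + c * K2"] conjI ballI allI)
    show "0 \<le> Ba * K1 + c * K2" using Ba K1 K2 c_pos by simp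
    fix z x y assume z: "z \<in> {0..1::real}"
    have "\<bar>acoef S z * (gbar S z x - gbar S z y)\<bar> \<le> Ba * (K1 * norm (x - y))"
      unfolding abs_mult using Ba K1 z by (intro mult_mono) auto
    moreover have "\<bar>c * (dgbar z x - dgbar z y)\<bar> \<le> c * (K2 * norm (x - y))"
      unfolding abs_mult using K2 z c_pos by (intro mult_mono) auto
    moreover have "gtil S z x - gtil S z y = acoef S z * (gbar S z x - gbar S z y) - c * (dgbar z x - dgbar z y)"
      by (simp add: gtil_eq algebra_simps)
    ultimately show "\<bar>gtil S z x - gtil S z y\<bar> \<le> (Ba * K1 + c * K2) * norm (x - y)"
      by (simp add: algebra_simps)
  qed
qed

lemma Cw_pos: "0 < Cw S z" and Cw_zero: "Cw S 0 = 1"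
  by (auto simp: Cw_def)

lemma Cw_deriv:
  assumes z: "z \<in> {0..1}" shows "(Cw S has_vector_derivative r * acoef S z * Cw S z) (at z within {0..1})"
proof -
  have "((\<lambda>z. integral {0..z} (acoef S)) has_vector_derivative acoef S z) (at z within {0..1})"
    by (rule integral_has_vector_derivative[OF acoef_cont z])
  then have "((\<lambda>z. exp (r * integral {0..z} (acoef S))) has_real_derivative exp (r * integral {0..z} (acoef S)) * (r * acoef S z)) (at z within {0..1})"
    unfolding has_real_derivative_iff_has_vector_derivative[symmetric] by (auto intro!: derivative_eq_intros)
  then show ?thesis by (simp add: Cw_def[abs_def] has_real_derivative_iff_has_vector_derivative mult_ac)
qed

lemma Cw_continuous: "continuous_on {0..1} (Cw S)"
  unfolding continuous_on_eq_continuous_within by (intro ballI has_vector_derivative_continuous[OF Cw_deriv])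

text \<open>\<open>\<phi>\<close> is the source of the transport equation for \<open>v / C\<close>, which has no term of order zero. Its
  z-derivative \<open>\<psi>\<close> is a multiple of \<open>gtil / C\<close>; this is where \<open>gtil\<close> comes from.\<close>

definition \<phi> :: "real \<Rightarrow> real ^ 'n \<Rightarrow> real" where "\<phi> z x = gbar S z x / Cw S z"
definition \<psi> :: "real \<Rightarrow> real ^ 'n \<Rightarrow> real" where "\<psi> z x = - r * gtil S z x / Cw S z"

lemma phi_deriv:
  assumes z: "z \<in> {0..1}" shows "((\<lambda>z. \<phi> z x) has_vector_derivative \<psi> z x) (at z within {0..1})"
proof -
  have "((\<lambda>z. gbar S z x / Cw S z) has_real_derivative
      (dgbar z x * Cw S z - gbar S z x * (r * acoef S z * Cw S z)) / (Cw S z * Cw S z)) (at z within {0..1})"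
    using gbar_deriv[OF z] Cw_deriv[OF z] Cw_pos[of z]
    unfolding has_real_derivative_iff_has_vector_derivative[symmetric] by (intro DERIV_divide) auto
  moreover have "(dgbar z x * Cw S z - gbar S z x * (r * acoef S z * Cw S z)) / (Cw S z * Cw S z) = \<psi> z x"
  proof -
    have "(dgbar z x * Cw S z - gbar S z x * (r * acoef S z * Cw S z)) / (Cw S z * Cw S z)
        = (dgbar z x - r * acoef S z * gbar S z x) * Cw S z / (Cw S z * Cw S z)" by (simp add: algebra_simps)
    also have "\<dots> = (dgbar z x - r * acoef S z * gbar S z x) / Cw S z" using Cw_pos[of z] by simp
    also have "dgbar z x - r * acoef S z * gbar S z x = - r * gtil S z x"
      using rc by (simp add: gtil_eq algebra_simps)
    finally show ?thesis by (simp add: \<psi>_def)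
  qed
  ultimately show ?thesis by (simp add: \<phi>_def[abs_def] has_real_derivative_iff_has_vector_derivative)
qed

lemma phi_psi_continuous: "continuous_on ({0..1} \<times> UNIV) (\<lambda>(z, x). \<phi> z x)" "continuous_on ({0..1} \<times> UNIV) (\<lambda>(z, x). \<psi> z x)"
proof -
  have "continuous_on ({0..1} \<times> UNIV) (\<lambda>p :: real \<times> (real ^ 'n). Cw S (fst p))"
    by (rule continuous_on_compose2[OF Cw_continuous]) (auto intro!: continuous_intros)
  moreover have "Cw S z \<noteq> 0" for z using Cw_pos[of z] by simp
  ultimately show "continuous_on ({0..1} \<times> UNIV) (\<lambda>(z, x). \<phi> z x)" "continuous_on ({0..1} \<times> UNIV) (\<lambda>(z, x). \<psi> z x)"
    using gbar_continuous gtil_continuous unfolding \<phi>_def \<psi>_def split_beta by (auto intro!: continuous_intros)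
qed

text \<open>The source continued to all real positions. A characteristic can then be varied freely, also when it
  reaches an end point of \<open>[0, 1]\<close>.\<close>

definition \<phi>e :: "real \<Rightarrow> real ^ 'n \<Rightarrow> real" where "\<phi>e y x = \<phi> (clamp01 y) x + (y - clamp01 y) * \<psi> (clamp01 y) x"
definition \<psi>e :: "real \<Rightarrow> real ^ 'n \<Rightarrow> real" where "\<psi>e y x = \<psi> (clamp01 y) x"

lemma phie_deriv: "((\<lambda>y. \<phi>e y x) has_vector_derivative \<psi>e y x) (at y)"
  unfolding \<phi>e_def \<psi>e_def by (rule has_vector_derivative_extrapolation[OF phi_deriv])

lemma phie_eq: "y \<in> {0..1} \<Longrightarrow> \<phi>e y x = \<phi> y x" "y \<in> {0..1} \<Longrightarrow> \<psi>e y x = \<psi> y x"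
  by (simp_all add: \<phi>e_def \<psi>e_def clamp01_simps)

lemma extension_continuous: "continuous_on UNIV (\<lambda>(y, x). \<phi>e y x)" "continuous_on UNIV (\<lambda>(y, x). \<psi>e y x)"
proof -
  have d: "continuous_on UNIV (\<lambda>p :: real \<times> (real ^ 'n). clamp01 (fst p))"
    by (intro continuous_on_compose2[OF continuous_on_clamp01[of UNIV]] continuous_intros) auto
  have a: "continuous_on UNIV (\<lambda>p :: real \<times> (real ^ 'n). \<phi> (clamp01 (fst p)) (snd p))"
    by (rule continuous_on_compose_pair[OF phi_psi_continuous(1) d]) (auto simp: clamp01_def intro: continuous_intros)
  have b: "continuous_on UNIV (\<lambda>p :: real \<times> (real ^ 'n). \<psi> (clamp01 (fst p)) (snd p))"
    by (rule continuous_on_compose_pair[OF phi_psi_continuous(2) d]) (auto simp: clamp01_def intro: continuous_intros)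
  show "continuous_on UNIV (\<lambda>(y, x). \<phi>e y x)" "continuous_on UNIV (\<lambda>(y, x). \<psi>e y x)"
    unfolding \<phi>e_def \<psi>e_def split_beta by (intro continuous_intros a b d)+
qed

end

section \<open>The profile generated by a trajectory\<close>

text \<open>Covers \<open>[0, \<infinity>)\<close> and \<open>[0, T)\<close>. Without a largest element, derivatives within I are uniquely determined at
  each of its points.\<close>

definition time_interval :: "real set \<Rightarrow> bool" where
  "time_interval I \<longleftrightarrow> 0 \<in> I \<and> (\<forall>t\<in>I. 0 \<le> t \<and> {0..t} \<subseteq> I) \<and> (\<forall>t\<in>I. \<exists>b\<in>I. t < b)"

lemma time_interval_atLeast: "time_interval {0..}"
proof -
  have "\<exists>b\<in>{0..}. t < b" if "t \<in> {0..}" for t :: real using that by (intro bexI[of _ "t + 1"]) auto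
  then show ?thesis by (auto simp: time_interval_def)
qed

lemma time_interval_atLeastLessThan: "0 < T \<Longrightarrow> time_interval {0..<T}"
proof -
  assume T: "0 < T"
  have "\<exists>b\<in>{0..<T}. t < b" if "t \<in> {0..<T}" for t using that dense[of t T] by auto
  then show ?thesis using T by (auto simp: time_interval_def)
qed

context pde_loop begin

abbreviation profile_of :: "(real \<Rightarrow> real ^ 'n) \<Rightarrow> real \<Rightarrow> real \<Rightarrow> real" where
  "profile_of x t z \<equiv> profile S (hist r x t) z"

text \<open>The time derivative of the profile (\<open>profile_of_time_deriv\<close>), a function of the history alone. The
  components \<open>f2\<close> and \<open>f3\<close> of the delay system are its values at the points \<open>z_i\<close> and its averages with the
  kernels \<open>\<gamma>_i\<close>.\<close>

definition profile_rate :: "(real \<Rightarrow> real ^ 'n) \<Rightarrow> real \<Rightarrow> real" where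
  "profile_rate h z = gbar S z (h 0) - Cw S z * gbar S 0 (h (- r * z))
     + integral {- r * z..0} (\<lambda>p. Cw S z / Cw S (z + c * p) * gtil S (z + c * p) (h p))"

lemma f2_eq: "f2 S h i = profile_rate h (zpt S i)"
  by (simp add: f2_def profile_rate_def)

lemma characteristic_range:
  assumes "z \<in> {0..1}" "p \<in> {- r * z..0}" shows "z + c * p \<in> {0..1}" "c * p + z \<in> {0..1}" "p \<in> {-r..0}"
proof -
  have "c * (- r * z) \<le> c * p" using assms c_pos by (intro mult_left_mono) auto
  then have "0 \<le> z + c * p" using rc by (simp add: mult.assoc[symmetric])
  moreover have "c * p \<le> 0" using assms c_pos by (simp add: mult_le_0_iff)
  ultimately show "z + c * p \<in> {0..1}" "c * p + z \<in> {0..1}" using assms by auto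
  have "r * z \<le> r * 1" using assms r_pos by (intro mult_left_mono) auto
  then show "p \<in> {-r..0}" using assms by auto
qed

context
  fixes I :: "real set" and x :: "real \<Rightarrow> real ^ 'n"
  assumes I: "time_interval I" and x: "continuous_on ({-r..0} \<union> I) x"
begin

abbreviation J :: "real set" where "J \<equiv> {-r..0} \<union> I"

lemma I_simps: "0 \<in> I" "t \<in> I \<Longrightarrow> 0 \<le> t" "t \<in> I \<Longrightarrow> s \<in> {0..t} \<Longrightarrow> s \<in> I" "t \<in> I \<Longrightarrow> \<exists>b\<in>I. t < b"
  using I unfolding time_interval_def by blast+

lemma J_simps: "-r \<in> J" "s \<in> J \<Longrightarrow> -r \<le> s" "s \<in> J \<Longrightarrow> \<exists>b\<in>J. s < b" "t \<in> J \<Longrightarrow> {-r..t} \<subseteq> J" "convex J"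
proof -
  show "-r \<in> J" using r0 by simp
  show lb: "-r \<le> s" if "s \<in> J" for s
  proof (cases "s \<in> I")
    case True then show ?thesis using I_simps(2)[OF True] r0 by simp
  qed (use that in auto)
  show "\<exists>b\<in>J. s < b" if "s \<in> J"
  proof (cases "s \<in> I")
    case True
    then show ?thesis using I_simps(4)[OF True] by blast
  next
    case False
    obtain b where "b \<in> I" "0 < b" using I_simps(4)[OF I_simps(1)] by blast
    then show ?thesis using that False by (intro bexI[of _ b]) auto
  qed
  show sub: "{-r..t} \<subseteq> J" if "t \<in> J" for t
  proof
    fix s assume s: "s \<in> {-r..t}"
    show "s \<in> J"
    proof (cases "s \<le> 0")
      case False
      then have "t \<in> I" using that s by auto
      from I_simps(3)[OF this, of s] show ?thesis using s False by simp
    qed (use s in simp)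
  qed
  show "convex J"
  proof (rule is_interval_convex, unfold is_interval_1, intro ballI allI impI)
    fix a b y assume h: "a \<in> J" "b \<in> J" "a \<le> y \<and> y \<le> b"
    then have "y \<in> {-r..b}" using lb[OF h(1)] by simp
    then show "y \<in> J" by (rule subsetD[OF sub[OF h(2)]])
  qed
qed

lemma delayed_in_J:
  assumes "t \<in> I" "z \<in> {0..1}" shows "t - r * z \<in> J" "-r \<le> t - r * z" "t - r * z \<le> t" "t \<in> J"
proof -
  have "r * z \<le> r * 1" "0 \<le> r * z" using assms r_pos by (auto intro: mult_left_mono)
  then show 1: "-r \<le> t - r * z" "t - r * z \<le> t" using I_simps(2)[OF assms(1)] by auto
  show "t \<in> J" using assms by simp
  show "t - r * z \<in> J" by (rule subsetD[OF J_simps(4)[OF \<open>t \<in> J\<close>]]) (use 1 in simp)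
qed

lemma history_integral_shift:
  assumes t: "t \<in> I" and z: "z \<in> {0..1}"
  shows "integral {- r * z..0} (\<lambda>p. k (z + c * p) (hist r x t p)) = integral {t - r * z..t} (\<lambda>q. k (z - c * t + c * q) (x q))"
proof -
  have "integral {- r * z..0} (\<lambda>p. k (z + c * p) (hist r x t p))
      = integral {- r * z..0} ((\<lambda>q. k (z - c * t + c * q) (x q)) \<circ> (+) t)"
    using characteristic_range(3)[OF z]
    by (intro Henstock_Kurzweil_Integration.integral_cong) (auto simp: hist_def algebra_simps)
  also have "\<dots> = integral {t - r * z..t} (\<lambda>q. k (z - c * t + c * q) (x q))"
    by (subst integral_shift_Icc_real) (simp add: algebra_simps)
  finally show ?thesis .
qed

text \<open>A characteristic is labelled by \<open>\<zeta> = z - c t\<close>, and \<open>K \<zeta> s\<close> is the source collected along it until time s.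
  The profile at \<open>(t, z)\<close> is, up to the factor \<open>C z\<close>, the difference of two values of K
  (\<open>profile_of_eq\<close>), and K is differentiable although x is only continuous: \<open>K'\<close> is its derivative in \<open>\<zeta>\<close>, and the
  upper limit is covered by the fundamental theorem of calculus.\<close>

definition K :: "real \<Rightarrow> real \<Rightarrow> real" where "K \<zeta> s = integral {-r..s} (\<lambda>p. \<phi>e (\<zeta> + c * p) (x p))"
definition K' :: "real \<Rightarrow> real \<Rightarrow> real" where "K' \<zeta> s = integral {-r..s} (\<lambda>p. \<psi>e (\<zeta> + c * p) (x p))"

lemma kernel_continuous:
  "continuous_on (UNIV \<times> J) (\<lambda>(\<zeta>, p). \<phi>e (\<zeta> + c * p) (x p))" "continuous_on (UNIV \<times> J) (\<lambda>(\<zeta>, p). \<psi>e (\<zeta> + c * p) (x p))"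
proof -
  have xs: "continuous_on (UNIV \<times> J) (\<lambda>p :: real \<times> real. x (snd p))"
    by (rule continuous_on_compose2[OF x]) (auto intro!: continuous_intros)
  have "continuous_on (UNIV \<times> UNIV) (\<lambda>(y, x). \<phi>e y x)" using extension_continuous(1) by simp
  then show "continuous_on (UNIV \<times> J) (\<lambda>(\<zeta>, p). \<phi>e (\<zeta> + c * p) (x p))" unfolding split_beta
    by (rule continuous_on_compose_pair[unfolded split_beta, OF _ _ xs]) (auto intro!: continuous_intros)
  have "continuous_on (UNIV \<times> UNIV) (\<lambda>(y, x). \<psi>e y x)" using extension_continuous(2) by simp
  then show "continuous_on (UNIV \<times> J) (\<lambda>(\<zeta>, p). \<psi>e (\<zeta> + c * p) (x p))" unfolding split_beta
    by (rule continuous_on_compose_pair[unfolded split_beta, OF _ _ xs]) (auto intro!: continuous_intros)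
qed

lemma kernel_integrable:
  assumes "b \<in> J" "-r \<le> a"
  shows "(\<lambda>p. \<phi>e (\<zeta> + c * p) (x p)) integrable_on {a..b}" "(\<lambda>p. \<psi>e (\<zeta> + c * p) (x p)) integrable_on {a..b}"
proof -
  have sub: "{a..b} \<subseteq> J"
    by (rule order_trans[OF _ J_simps(4)[OF assms(1)]]) (use assms(2) in simp)
  have 1: "continuous_on {a..b} (\<lambda>p. \<phi>e (\<zeta> + c * p) (x p))" 
    by (rule continuous_on_compose_pair[OF kernel_continuous(1), of _ "\<lambda>_. \<zeta>" "\<lambda>p. p"])
      (use subsetD[OF sub] in \<open>simp_all add: continuous_on_const continuous_on_id del: Un_iff\<close>)
  have 2: "continuous_on {a..b} (\<lambda>p. \<psi>e (\<zeta> + c * p) (x p))" 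
    by (rule continuous_on_compose_pair[OF kernel_continuous(2), of _ "\<lambda>_. \<zeta>" "\<lambda>p. p"])
      (use subsetD[OF sub] in \<open>simp_all add: continuous_on_const continuous_on_id del: Un_iff\<close>)
  show "(\<lambda>p. \<phi>e (\<zeta> + c * p) (x p)) integrable_on {a..b}" "(\<lambda>p. \<psi>e (\<zeta> + c * p) (x p)) integrable_on {a..b}"
    using 1 2 by (auto intro: integrable_continuous_real)
qed

lemma K_diff:
  assumes t: "t \<in> I" and z: "z \<in> {0..1}"
  shows "K \<zeta> t - K \<zeta> (t - r * z) = integral {t - r * z..t} (\<lambda>p. \<phi>e (\<zeta> + c * p) (x p))"
    "K' \<zeta> t - K' \<zeta> (t - r * z) = integral {t - r * z..t} (\<lambda>p. \<psi>e (\<zeta> + c * p) (x p))"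
proof -
  note d = delayed_in_J[OF t z]
  show "K \<zeta> t - K \<zeta> (t - r * z) = integral {t - r * z..t} (\<lambda>p. \<phi>e (\<zeta> + c * p) (x p))"
    using Henstock_Kurzweil_Integration.integral_combine[OF d(2,3) kernel_integrable(1)[OF d(4) order_refl, of \<zeta>]] by (simp add: K_def)
  show "K' \<zeta> t - K' \<zeta> (t - r * z) = integral {t - r * z..t} (\<lambda>p. \<psi>e (\<zeta> + c * p) (x p))"
    using Henstock_Kurzweil_Integration.integral_combine[OF d(2,3) kernel_integrable(2)[OF d(4) order_refl, of \<zeta>]] by (simp add: K'_def)
qed

lemma profile_of_eq:
  assumes t: "t \<in> I" and z: "z \<in> {0..1}"
  shows "profile_of x t z = Cw S z * (K (z - c * t) t - K (z - c * t) (t - r * z))"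
proof -
  have "profile_of x t z = integral {- r * z..0} (\<lambda>p. Cw S z * \<phi>e (z + c * p) (hist r x t p))"
    unfolding profile_def
  proof (rule Henstock_Kurzweil_Integration.integral_cong)
    fix p assume "p \<in> {- r * z..0}"
    from characteristic_range[OF z this]
    show "Cw S z / Cw S (c * p + z) * gbar S (c * p + z) (hist r x t p) = Cw S z * \<phi>e (z + c * p) (hist r x t p)"
      by (simp add: phie_eq \<phi>_def add.commute)
  qed
  also have "\<dots> = Cw S z * integral {t - r * z..t} (\<lambda>q. \<phi>e (z - c * t + c * q) (x q))"
    by (simp only: integral_mult_right history_integral_shift[OF t z, of \<phi>e])
  finally show ?thesis by (simp add: K_diff[OF t z])
qed

lemma profile_rate_eq:
  assumes t: "t \<in> I" and z: "z \<in> {0..1}"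
  shows "profile_rate (hist r x t) z
    = Cw S z * (\<phi> z (x t) - \<phi> 0 (x (t - r * z)) - c * (K' (z - c * t) t - K' (z - c * t) (t - r * z)))"
proof -
  have "integral {- r * z..0} (\<lambda>p. Cw S z / Cw S (z + c * p) * gtil S (z + c * p) (hist r x t p))
      = integral {- r * z..0} (\<lambda>p. - (c * Cw S z) * \<psi>e (z + c * p) (hist r x t p))"
  proof (rule Henstock_Kurzweil_Integration.integral_cong)
    fix p assume "p \<in> {- r * z..0}"
    from characteristic_range[OF z this] rc
    show "Cw S z / Cw S (z + c * p) * gtil S (z + c * p) (hist r x t p) = - (c * Cw S z) * \<psi>e (z + c * p) (hist r x t p)"
      by (simp add: phie_eq \<psi>_def field_simps)
  qed
  also have "\<dots> = - (c * Cw S z) * integral {t - r * z..t} (\<lambda>q. \<psi>e (z - c * t + c * q) (x q))"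
    by (simp only: integral_mult_right history_integral_shift[OF t z, of \<psi>e])
  finally have "integral {- r * z..0} (\<lambda>p. Cw S z / Cw S (z + c * p) * gtil S (z + c * p) (hist r x t p))
      = - (c * Cw S z) * (K' (z - c * t) t - K' (z - c * t) (t - r * z))"
    by (simp only: K_diff(2)[OF t z])
  moreover have "- r * z \<in> {-r..0}" using characteristic_range(3)[OF z, of "- r * z"] z r_pos by auto
  ultimately show ?thesis
    using r0 Cw_pos[of z] by (simp add: profile_rate_def hist_def \<phi>_def Cw_zero algebra_simps)
qed

text \<open>The z-derivative of the profile (\<open>profile_of_space_deriv\<close>).\<close>

definition profile_slope :: "real \<Rightarrow> real \<Rightarrow> real" where
  "profile_slope t z = r * acoef S z * profile_of x t z
     + Cw S z * ((K' (z - c * t) t - K' (z - c * t) (t - r * z)) + r * \<phi> 0 (x (t - r * z)))"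

text \<open>In the combination \<open>v_t + c v_z\<close> the values of \<open>K'\<close> and the inflow term at \<open>z = 0\<close> cancel.\<close>

lemma profile_transport:
  assumes t: "t \<in> I" and z: "z \<in> {0..1}"
  shows "profile_rate (hist r x t) z + c * profile_slope t z = acoef S z * profile_of x t z + gbar S z (x t)"
proof -
  have *: "c * (r * A) = A" for A using rc by (simp add: mult.assoc[symmetric])
  have "c * profile_slope t z = acoef S z * profile_of x t z
      + Cw S z * (c * (K' (z - c * t) t - K' (z - c * t) (t - r * z)) + \<phi> 0 (x (t - r * z)))"
    by (simp only: profile_slope_def distrib_left mult.assoc * mult.left_commute[of c "Cw S z"])
  moreover have "Cw S z * \<phi> z (x t) = gbar S z (x t)" using Cw_pos[of z] by (simp add: \<phi>_def)
  ultimately show ?thesis unfolding profile_rate_eq[OF t z] by (simp add: algebra_simps)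
qed

lemma profile_of_zero: "profile_of x t 0 = 0"
  by (simp add: profile_def)

lemma has_derivative_profile_of:
  assumes t: "t \<in> I" and z: "z \<in> {0..1}"
  shows "((\<lambda>(t, z). profile_of x t z) has_derivative
    (\<lambda>(a, b). a * profile_rate (hist r x t) z + b * profile_slope t z)) (at (t, z) within I \<times> {0..1})"
proof -
  let ?D = "I \<times> {0..1::real}"
  have Kd: "((\<lambda>(\<zeta>, s). K \<zeta> s) has_derivative (\<lambda>(d\<zeta>, ds). d\<zeta> * K' \<zeta> s + ds * \<phi>e (\<zeta> + c * s) (x s))) (at (\<zeta>, s) within UNIV \<times> J)"
    if s: "s \<in> J" for \<zeta> s
    unfolding K_def K'_def
  proof (rule has_derivative_integral_upper[OF J_simps(5,1,2,3) _ kernel_continuous s])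
    show "((\<lambda>\<zeta>. \<phi>e (\<zeta> + c * p) (x p)) has_vector_derivative \<psi>e (\<zeta> + c * p) (x p)) (at \<zeta>)" for \<zeta> p
    proof -
      have "((\<lambda>\<zeta>. \<zeta> + c * p) has_vector_derivative 1) (at \<zeta>)"
        by (auto intro!: derivative_eq_intros)
      from vector_diff_chain_at[OF this phie_deriv[of "x p" "\<zeta> + c * p"]] show ?thesis by (simp add: o_def)
    qed
  qed
  have m1: "((\<lambda>(t, z). (z - c * t, t)) has_derivative (\<lambda>(a, b). (b - c * a, a))) (at (t, z) within ?D)"
    unfolding split_beta by (auto intro!: derivative_eq_intros)
  have m2: "((\<lambda>(t, z). (z - c * t, t - r * z)) has_derivative (\<lambda>(a, b). (b - c * a, a - r * b))) (at (t, z) within ?D)"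
    unfolding split_beta by (auto intro!: derivative_eq_intros)
  \<comment> \<open>At the upper limits t and \<open>t - r z\<close> the characteristic is at the position z and at the inlet 0.\<close>
  have y0: "z - c * t + c * t = z" "z - c * t + c * (t - r * z) = 0"
    using rc by (auto simp: algebra_simps)
  have z0: "(0::real) \<in> {0..1}" by simp
  have k1: "((\<lambda>(t, z). K (z - c * t) t) has_derivative (\<lambda>(a, b). (b - c * a) * K' (z - c * t) t + a * \<phi> z (x t))) (at (t, z) within ?D)"
  proof -
    have "((\<lambda>(\<zeta>, s). K \<zeta> s) has_derivative (\<lambda>(d\<zeta>, ds). d\<zeta> * K' (z - c * t) t + ds * \<phi>e (z - c * t + c * t) (x t)))
        (at ((\<lambda>(t, z). (z - c * t, t)) (t, z)) within (\<lambda>(t, z). (z - c * t, t)) ` ?D)"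
      unfolding prod.case by (rule has_derivative_subset[OF Kd]) (use t in auto)
    from has_derivative_in_compose[OF m1 this] show ?thesis unfolding y0 phie_eq(1)[OF z] by (simp add: case_prod_unfold)
  qed
  have k2: "((\<lambda>(t, z). K (z - c * t) (t - r * z)) has_derivative
      (\<lambda>(a, b). (b - c * a) * K' (z - c * t) (t - r * z) + (a - r * b) * \<phi> 0 (x (t - r * z)))) (at (t, z) within ?D)"
  proof -
    have "((\<lambda>(\<zeta>, s). K \<zeta> s) has_derivative (\<lambda>(d\<zeta>, ds). d\<zeta> * K' (z - c * t) (t - r * z) + ds * \<phi>e (z - c * t + c * (t - r * z)) (x (t - r * z))))
        (at ((\<lambda>(t, z). (z - c * t, t - r * z)) (t, z)) within (\<lambda>(t, z). (z - c * t, t - r * z)) ` ?D)"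
      unfolding prod.case
    proof (rule has_derivative_subset[OF Kd[OF delayed_in_J(1)[OF t z]]])
      show "(\<lambda>(t, z). (z - c * t, t - r * z)) ` ?D \<subseteq> UNIV \<times> J" using delayed_in_J(1) by fastforce
    qed
    from has_derivative_in_compose[OF m2 this] show ?thesis unfolding y0 phie_eq(1)[OF z0] by (simp add: case_prod_unfold)
  qed
  have cz: "((\<lambda>(t, z). Cw S z) has_derivative (\<lambda>(a, b). b * (r * acoef S z * Cw S z))) (at (t, z) within ?D)"
  proof -
    have 1: "(snd has_derivative snd) (at (t, z) within ?D)" by (auto intro!: derivative_eq_intros)
    have 2: "(Cw S has_derivative (\<lambda>h. h * (r * acoef S z * Cw S z))) (at (snd (t, z)) within snd ` ?D)"
      using has_derivative_subset[OF Cw_deriv[OF z, unfolded has_vector_derivative_def], of "snd ` ?D"] by auto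
    from has_derivative_in_compose[OF 1 2] show ?thesis by (simp add: case_prod_unfold)
  qed
  have "((\<lambda>p. (case p of (t, z) \<Rightarrow> Cw S z) * ((case p of (t, z) \<Rightarrow> K (z - c * t) t) - (case p of (t, z) \<Rightarrow> K (z - c * t) (t - r * z)))) has_derivative
     (\<lambda>(a, b). a * profile_rate (hist r x t) z + b * profile_slope t z)) (at (t, z) within ?D)"
    by (rule has_derivative_eq_rhs[OF has_derivative_mult[OF cz has_derivative_diff[OF k1 k2]]])
      (auto simp: fun_eq_iff profile_rate_eq[OF t z] profile_slope_def profile_of_eq[OF t z] algebra_simps)
  then show ?thesis
    by (rule has_derivative_transform[rotated 2]) (use t z profile_of_eq in auto)
qed

lemma profile_partials_continuous:
  "continuous_on (I \<times> {0..1}) (\<lambda>(t, z). profile_rate (hist r x t) z)" "continuous_on (I \<times> {0..1}) (\<lambda>(t, z). profile_slope t z)"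
  "continuous_on (I \<times> {0..1}) (\<lambda>(t, z). profile_of x t z)"
proof -
  let ?D = "I \<times> {0..1::real}"
  show pc: "continuous_on ?D (\<lambda>(t, z). profile_of x t z)"
    using has_derivative_profile_of has_derivative_continuous by (fastforce simp: continuous_on_eq_continuous_within)
  have zc: "continuous_on ?D (\<lambda>p. Cw S (snd p))"
    by (rule continuous_on_compose2[OF Cw_continuous]) (auto intro!: continuous_intros)
  have ac: "continuous_on ?D (\<lambda>p. acoef S (snd p))"
    by (rule continuous_on_compose2[OF acoef_cont]) (auto intro!: continuous_intros)
  have x1: "continuous_on ?D (\<lambda>p. x (fst p))"
    by (rule continuous_on_compose2[OF x]) (auto intro!: continuous_intros)
  have x2: "continuous_on ?D (\<lambda>p. x (fst p - r * snd p))"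
  proof (rule continuous_on_compose2[OF x])
    show "(\<lambda>p. fst p - r * snd p) ` ?D \<subseteq> J" using delayed_in_J(1) by fastforce
  qed (intro continuous_intros)
  have p1: "continuous_on ?D (\<lambda>p. \<phi> (snd p) (x (fst p)))"
    by (rule continuous_on_compose_pair[OF phi_psi_continuous(1) _ x1]) (auto intro!: continuous_intros)
  have p2: "continuous_on ?D (\<lambda>p. \<phi> 0 (x (fst p - r * snd p)))"
    by (rule continuous_on_compose_pair[OF phi_psi_continuous(1) _ x2]) (auto intro!: continuous_intros)
  have "continuous_on ?D (\<lambda>p. integral {fst p - r * snd p..fst p} (\<lambda>q. \<psi>e (snd p - c * fst p + c * q) (x q)))"
  proof (rule continuous_on_integral_bounds)
    let ?E = "{(p, s). p \<in> ?D \<and> fst p - r * snd p \<le> s \<and> s \<le> fst p}"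
    have mem: "snd e \<in> J" if e: "e \<in> ?E" for e
    proof -
      have D: "fst (fst e) \<in> I" "snd (fst e) \<in> {0..1}" and q: "fst (fst e) - r * snd (fst e) \<le> snd e" "snd e \<le> fst (fst e)"
        using e by auto
      show ?thesis
        by (rule subsetD[OF J_simps(4)[OF delayed_in_J(4)[OF D]]]) (use delayed_in_J(2)[OF D] q in simp)
    qed
    show "continuous_on ?E (\<lambda>(p, q). \<psi>e (snd p - c * fst p + c * q) (x q))"
      unfolding split_beta
      by (rule continuous_on_compose_pair[OF kernel_continuous(2), of _ "\<lambda>p. snd (fst p) - c * fst (fst p)" "\<lambda>p. snd p"])
        ((rule mem, simp only: case_prod_unfold) | intro continuous_intros UNIV_I)+
  qed (use delayed_in_J in \<open>auto intro!: continuous_intros\<close>)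
  then have k: "continuous_on ?D (\<lambda>p. K' (snd p - c * fst p) (fst p) - K' (snd p - c * fst p) (fst p - r * snd p))"
    by (rule continuous_on_eq) (auto simp: K_diff(2))
  have "continuous_on ?D (\<lambda>p. Cw S (snd p) * (\<phi> (snd p) (x (fst p)) - \<phi> 0 (x (fst p - r * snd p))
      - c * (K' (snd p - c * fst p) (fst p) - K' (snd p - c * fst p) (fst p - r * snd p))))"
    by (intro continuous_intros zc p1 p2 k)
  then show "continuous_on ?D (\<lambda>(t, z). profile_rate (hist r x t) z)"
    by (rule continuous_on_eq) (auto simp: profile_rate_eq)
  show "continuous_on ?D (\<lambda>(t, z). profile_slope t z)"
    unfolding profile_slope_def split_beta using pc by (intro continuous_intros zc ac p2 k) (simp add: split_beta)
qed

lemma profile_of_time_deriv: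
  assumes t: "t \<in> I" and z: "z \<in> {0..1}"
  shows "((\<lambda>s. profile_of x s z) has_vector_derivative profile_rate (hist r x t) z) (at t within I)"
proof -
  have 1: "((\<lambda>s. (s, z)) has_derivative (\<lambda>h. (h, 0))) (at t within I)" by (auto intro!: derivative_eq_intros)
  have "((\<lambda>(t, z). profile_of x t z) has_derivative (\<lambda>(a, b). a * profile_rate (hist r x t) z + b * profile_slope t z))
     (at (t, z) within (\<lambda>s. (s, z)) ` I)"
    by (rule has_derivative_subset[OF has_derivative_profile_of[OF t z]]) (use z in auto)
  from has_derivative_in_compose[OF 1 this] show ?thesis by (simp add: has_vector_derivative_def)
qed

lemma profile_of_space_deriv:
  assumes t: "t \<in> I" and z: "z \<in> {0..1}"
  shows "((\<lambda>y. profile_of x t y) has_vector_derivative profile_slope t z) (at z within {0..1})"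
proof -
  have 1: "((\<lambda>y. (t, y)) has_derivative (\<lambda>h. (0, h))) (at z within {0..1})" by (auto intro!: derivative_eq_intros)
  have "((\<lambda>(t, z). profile_of x t z) has_derivative (\<lambda>(a, b). a * profile_rate (hist r x t) z + b * profile_slope t z))
     (at (t, z) within (\<lambda>y. (t, y)) ` {0..1})"
    by (rule has_derivative_subset[OF has_derivative_profile_of[OF t z]]) (use t in auto)
  from has_derivative_in_compose[OF 1 this] show ?thesis by (simp add: has_vector_derivative_def)
qed

end
end

section \<open>Lipschitz estimates for the delay system\<close>

context pde_loop begin

lemma profile_alt: "profile S h z = integral {- r * z..0} (\<lambda>p. Cw S z / Cw S (z + c * p) * gbar S (z + c * p) (h p))"
  by (simp add: profile_def add.commute)

lemma Cw_ratio_bounded: "\<exists>B\<ge>0. \<forall>z\<in>{0..1}. \<forall>y\<in>{0..1}. \<bar>Cw S z / Cw S y\<bar> \<le> B"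
proof -
  obtain B where B: "0 \<le> B" "\<forall>z\<in>{0..1}. \<bar>Cw S z\<bar> \<le> B" using continuous_family_bounded[of "{0}" "\<lambda>i. Cw S"] Cw_continuous by auto
  have "continuous_on {0..1} (\<lambda>z. 1 / Cw S z)"
    using Cw_pos by (intro continuous_intros Cw_continuous) (auto simp: less_imp_neq[symmetric])
  then obtain B' where B': "0 \<le> B'" "\<forall>z\<in>{0..1}. \<bar>1 / Cw S z\<bar> \<le> B'" using continuous_family_bounded[of "{0}" "\<lambda>i z. 1 / Cw S z"] by auto
  have "\<bar>Cw S z / Cw S y\<bar> \<le> B * B'" if "z \<in> {0..1}" "y \<in> {0..1}" for z y
  proof -
    have "\<bar>Cw S z / Cw S y\<bar> = \<bar>Cw S z\<bar> * \<bar>1 / Cw S y\<bar>" by (simp add: abs_mult[symmetric])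
    also have "\<dots> \<le> B * B'" using B B' that by (intro mult_mono) auto
    finally show ?thesis .
  qed
  then show ?thesis using B B' by (intro exI[of _ "B * B'"]) auto
qed

text \<open>Common to the profile and its rate: the two differ in the kernel k only.\<close>

lemma history_integral_Lipschitz:
  assumes kc: "continuous_on ({0..1} \<times> UNIV) (\<lambda>(z, x). k z x)"
    and kL: "\<exists>K\<ge>0. \<forall>z\<in>{0..1}. \<forall>x y :: real ^ 'n. \<bar>k z x - k z y\<bar> \<le> K * norm (x - y)"
  shows "\<exists>K\<ge>0. \<forall>z\<in>{0..1}. \<forall>g\<in>C0 {-r..0}. \<forall>h\<in>C0 {-r..0}.
    \<bar>integral {- r * z..0} (\<lambda>p. Cw S z / Cw S (z + c * p) * k (z + c * p) (g p))
     - integral {- r * z..0} (\<lambda>p. Cw S z / Cw S (z + c * p) * k (z + c * p) (h p))\<bar>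
    \<le> K * supnorm {-r..0} (\<lambda>\<theta>. g \<theta> - h \<theta>)"
proof -
  obtain B where B: "0 \<le> B" "\<forall>z\<in>{0..1}. \<forall>y\<in>{0..1}. \<bar>Cw S z / Cw S y\<bar> \<le> B" using Cw_ratio_bounded by blast
  obtain K where K: "0 \<le> K" "\<forall>z\<in>{0..1}. \<forall>x y. \<bar>k z x - k z y\<bar> \<le> K * norm (x - y)" using kL by blast
  show ?thesis
  proof (intro exI[of _ "B * K * r"] conjI ballI)
    show "0 \<le> B * K * r" using B K r0 by simp
    fix z :: real and g h :: "real \<Rightarrow> real ^ 'n" assume z: "z \<in> {0..1}" and g: "g \<in> C0 {-r..0}" and h: "h \<in> C0 {-r..0}"
    let ?s = "supnorm {-r..0} (\<lambda>\<theta>. g \<theta> - h \<theta>)"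
    have s0: "0 \<le> ?s" using C0_diff_supnorm_nonneg[OF _ g h] r0 by simp
    have int: "(\<lambda>p. Cw S z / Cw S (z + c * p) * k (z + c * p) (g p)) integrable_on {- r * z..0}" if g: "g \<in> C0 {-r..0}" for g
    proof (rule integrable_continuous_real, intro continuous_intros)
      have gc: "continuous_on {- r * z..0} g"
        using g characteristic_range(3)[OF z] by (auto simp: C0_iff elim!: continuous_on_subset)
      show "continuous_on {- r * z..0} (\<lambda>p. Cw S (z + c * p))"
        by (rule continuous_on_compose2[OF Cw_continuous]) (use characteristic_range(1)[OF z] in \<open>auto intro!: continuous_intros\<close>)
      show "continuous_on {- r * z..0} (\<lambda>p. k (z + c * p) (g p))"
        by (rule continuous_on_compose_pair[OF kc _ gc]) (use characteristic_range(1)[OF z] in \<open>auto intro!: continuous_intros\<close>)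
      show "\<forall>p\<in>{- r * z..0}. Cw S (z + c * p) \<noteq> 0" using Cw_pos by (metis less_irrefl)
    qed
    have "norm (integral {- r * z..0} (\<lambda>p. Cw S z / Cw S (z + c * p) * k (z + c * p) (g p) - Cw S z / Cw S (z + c * p) * k (z + c * p) (h p)))
      \<le> (B * (K * ?s)) * (0 - - r * z)"
    proof (rule norm_integral_le)
      show "- r * z \<le> 0" using z r0 by simp
      fix p assume p: "p \<in> {- r * z..0}"
      note cr = characteristic_range[OF z p]
      have "\<bar>k (z + c * p) (g p) - k (z + c * p) (h p)\<bar> \<le> K * norm (g p - h p)" using K cr by blast
      also have "\<dots> \<le> K * ?s" using K C0_diff_le_supnorm[OF g h cr(3)] by (intro mult_left_mono) auto
      finally have "\<bar>Cw S z / Cw S (z + c * p)\<bar> * \<bar>k (z + c * p) (g p) - k (z + c * p) (h p)\<bar> \<le> B * (K * ?s)"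
        using B z cr by (intro mult_mono) auto
      then show "norm (Cw S z / Cw S (z + c * p) * k (z + c * p) (g p) - Cw S z / Cw S (z + c * p) * k (z + c * p) (h p)) \<le> B * (K * ?s)"
        by (simp only: right_diff_distrib[symmetric] real_norm_def abs_mult)
    qed (intro Henstock_Kurzweil_Integration.integrable_diff int g h)
    also have "\<dots> \<le> (B * (K * ?s)) * r"
    proof (rule mult_left_mono)
      have "r * z \<le> r * 1" using z r0 by (intro mult_left_mono) auto
      then show "0 - - r * z \<le> r" by simp
      show "0 \<le> B * (K * ?s)" using B K s0 by simp
    qed
    finally show "\<bar>integral {- r * z..0} (\<lambda>p. Cw S z / Cw S (z + c * p) * k (z + c * p) (g p))
     - integral {- r * z..0} (\<lambda>p. Cw S z / Cw S (z + c * p) * k (z + c * p) (h p))\<bar> \<le> B * K * r * ?s"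
      unfolding Henstock_Kurzweil_Integration.integral_diff[OF int[OF g] int[OF h]] real_norm_def
      by (simp only: mult_ac)
  qed
qed

lemma profile_Lipschitz: "\<exists>K\<ge>0. \<forall>z\<in>{0..1}. \<forall>g\<in>C0 {-r..0}. \<forall>h\<in>C0 {-r..0}.
    \<bar>profile S g z - profile S h z\<bar> \<le> K * supnorm {-r..0} (\<lambda>\<theta>. g \<theta> - h \<theta>)"
  unfolding profile_alt by (rule history_integral_Lipschitz[OF gbar_continuous gbar_Lipschitz])

lemma profile_rate_Lipschitz: "\<exists>K\<ge>0. \<forall>z\<in>{0..1}. \<forall>g\<in>C0 {-r..0}. \<forall>h\<in>C0 {-r..0}.
    \<bar>profile_rate g z - profile_rate h z\<bar> \<le> K * supnorm {-r..0} (\<lambda>\<theta>. g \<theta> - h \<theta>)"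
proof -
  obtain K1 where K1: "0 \<le> K1" "\<forall>z\<in>{0..1}. \<forall>x y. \<bar>gbar S z x - gbar S z y\<bar> \<le> K1 * norm (x - y)" using gbar_Lipschitz by blast
  obtain B where B: "0 \<le> B" "\<forall>z\<in>{0..1}. \<bar>Cw S z\<bar> \<le> B" using continuous_family_bounded[of "{0}" "\<lambda>i. Cw S"] Cw_continuous by auto
  obtain K2 where K2: "0 \<le> K2" "\<forall>z\<in>{0..1}. \<forall>g\<in>C0 {-r..0}. \<forall>h\<in>C0 {-r..0}.
    \<bar>integral {- r * z..0} (\<lambda>p. Cw S z / Cw S (z + c * p) * gtil S (z + c * p) (g p))
     - integral {- r * z..0} (\<lambda>p. Cw S z / Cw S (z + c * p) * gtil S (z + c * p) (h p))\<bar>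
    \<le> K2 * supnorm {-r..0} (\<lambda>\<theta>. g \<theta> - h \<theta>)" using history_integral_Lipschitz[OF gtil_continuous gtil_Lipschitz] by blast
  show ?thesis
  proof (intro exI[of _ "K1 + B * K1 + K2"] conjI ballI)
    show "0 \<le> K1 + B * K1 + K2" using K1 B K2 by simp
    fix z :: real and g h :: "real \<Rightarrow> real ^ 'n" assume z: "z \<in> {0..1}" and g: "g \<in> C0 {-r..0}" and h: "h \<in> C0 {-r..0}"
    let ?s = "supnorm {-r..0} (\<lambda>\<theta>. g \<theta> - h \<theta>)"
    have s0: "0 \<le> ?s" using C0_diff_supnorm_nonneg[OF _ g h] r0 by simp
    have nb: "\<bar>gbar S y (g p) - gbar S y (h p)\<bar> \<le> K1 * ?s" if "y \<in> {0..1}" "p \<in> {-r..0}" for y p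
      using K1(2)[rule_format, OF that(1), of "g p" "h p"] mult_left_mono[OF C0_diff_le_supnorm[OF g h that(2)] K1(1)] by linarith
    have m: "0 \<in> {-r..0}" "- r * z \<in> {-r..0}" using r0 characteristic_range(3)[OF z, of "- r * z"] z by auto
    have 1: "\<bar>gbar S z (g 0) - gbar S z (h 0)\<bar> \<le> K1 * ?s" by (rule nb[OF z m(1)])
    have 2: "\<bar>Cw S z * (gbar S 0 (g (- r * z)) - gbar S 0 (h (- r * z)))\<bar> \<le> B * (K1 * ?s)"
      unfolding abs_mult using B z nb[OF _ m(2), of 0] by (intro mult_mono) auto
    have 3: "\<bar>integral {- r * z..0} (\<lambda>p. Cw S z / Cw S (z + c * p) * gtil S (z + c * p) (g p))
     - integral {- r * z..0} (\<lambda>p. Cw S z / Cw S (z + c * p) * gtil S (z + c * p) (h p))\<bar> \<le> K2 * ?s"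
      using K2 z g h by blast
    have "profile_rate g z - profile_rate h z = (gbar S z (g 0) - gbar S z (h 0))
        - Cw S z * (gbar S 0 (g (- r * z)) - gbar S 0 (h (- r * z)))
        + (integral {- r * z..0} (\<lambda>p. Cw S z / Cw S (z + c * p) * gtil S (z + c * p) (g p))
     - integral {- r * z..0} (\<lambda>p. Cw S z / Cw S (z + c * p) * gtil S (z + c * p) (h p)))"
      unfolding profile_rate_def by (simp only: right_diff_distrib)
    then have "\<bar>profile_rate g z - profile_rate h z\<bar> \<le> K1 * ?s + B * (K1 * ?s) + K2 * ?s" using 1 2 3 by linarith
    then show "\<bar>profile_rate g z - profile_rate h z\<bar> \<le> (K1 + B * K1 + K2) * ?s" by (simp add: algebra_simps)
  qed
qed

text \<open>A single history is the initial segment of the trajectory that is constant in positive time.\<close>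

lemma C0_as_hist:
  assumes h: "h \<in> C0 {-r..0}"
  shows "continuous_on ({-r..0} \<union> {0..}) (\<lambda>s. h (min s 0))" "hist r (\<lambda>s. h (min s 0)) 0 = h"
proof -
  have hc: "continuous_on {-r..0} h" and he: "h \<in> extensional {-r..0}" using h by (auto simp: C0_iff)
  show "continuous_on ({-r..0} \<union> {0..}) (\<lambda>s. h (min s 0))"
    by (rule continuous_on_compose2[OF hc]) (use r0 in \<open>auto intro!: continuous_intros\<close>)
  show "hist r (\<lambda>s. h (min s 0)) 0 = h"
    using he by (auto simp: hist_def fun_eq_iff extensional_def restrict_def)
qed

lemma profile_functionals_continuous:
  assumes h: "h \<in> C0 {-r..0}"
  shows "continuous_on {0..1} (profile S h)" "continuous_on {0..1} (profile_rate h)"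
proof -
  note cont = profile_partials_continuous[OF time_interval_atLeast C0_as_hist(1)[OF h]]
  have "continuous_on {0..1} (\<lambda>z. profile S (hist r (\<lambda>s. h (min s 0)) 0) z)"
    by (rule continuous_on_compose_pair[OF cont(3), of _ "\<lambda>_. 0" "\<lambda>z. z"]) (auto intro: continuous_intros)
  then show "continuous_on {0..1} (profile S h)" unfolding C0_as_hist(2)[OF h] .
  have "continuous_on {0..1} (\<lambda>z. profile_rate (hist r (\<lambda>s. h (min s 0)) 0) z)"
    by (rule continuous_on_compose_pair[OF cont(1), of _ "\<lambda>_. 0" "\<lambda>z. z"]) (auto intro: continuous_intros)
  then show "continuous_on {0..1} (profile_rate h)" unfolding C0_as_hist(2)[OF h] .
qed

lemma profile_C0: "h \<in> C0 {-r..0} \<Longrightarrow> (\<lambda>z\<in>{0..1}. profile S h z) \<in> C0 {0..1}"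
  by (intro restrict_in_C0 profile_functionals_continuous)

text \<open>Splits into the part of \<open>profile_rate\<close> given by boundary values and the integral part; each is integrable
  because it is continuous in z.\<close>

lemma f3_eq:
  assumes h: "h \<in> C0 {-r..0}" and i: "i \<in> {1..N2 S}"
  shows "f3 S h i = integral {0..1} (\<lambda>z. gammaker S i z * profile_rate h z)"
proof -
  define A where "A z = gbar S z (h 0) - Cw S z * gbar S 0 (h (- r * z))" for z
  define B where "B z = integral {- r * z..0} (\<lambda>p. Cw S z / Cw S (z + c * p) * gtil S (z + c * p) (h p))" for z
  have AB: "profile_rate h z = A z + B z" for z by (simp add: profile_rate_def A_def B_def)
  have hc: "continuous_on {-r..0} h" using h by (simp add: C0_iff)
  have hz: "continuous_on {0..1} (\<lambda>z. h (- r * z))"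
    by (rule continuous_on_compose2[OF hc]) (use r0 in \<open>auto intro!: continuous_intros simp: mult_left_le\<close>)
  have g1: "continuous_on {0..1} (\<lambda>z. gbar S z (h 0))"
    by (rule continuous_on_compose_pair[OF gbar_continuous]) (auto intro: continuous_intros)
  have g2: "continuous_on {0..1} (\<lambda>z. gbar S 0 (h (- r * z)))"
    by (rule continuous_on_compose_pair[OF gbar_continuous _ hz]) (auto intro: continuous_intros)
  have Ac: "continuous_on {0..1} A" unfolding A_def by (intro continuous_intros g1 g2 Cw_continuous)
  have Bc: "continuous_on {0..1} B"
    using continuous_on_diff[OF profile_functionals_continuous(2)[OF h] Ac] by (simp add: AB)
  have "f3 S h i = integral {0..1} (\<lambda>z. gammaker S i z * A z) + integral {0..1} (\<lambda>z. gammaker S i z * B z)"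
    unfolding f3_def A_def B_def by (simp add: integral_mult_right[symmetric] mult.assoc times_divide_eq_right[symmetric] del: times_divide_eq_right integral_mult_right)
  also have "\<dots> = integral {0..1} (\<lambda>z. gammaker S i z * A z + gammaker S i z * B z)"
    using gammaker_cont[OF i] Ac Bc
    by (intro Henstock_Kurzweil_Integration.integral_add[symmetric] integrable_continuous_real continuous_intros)
  finally show ?thesis by (simp add: AB distrib_left)
qed

lemma ffun_components:
  "ffun S h u d $ lab S (Inl i) = f1 S h u d $ i"
  "i' \<in> {1..N1 S} \<Longrightarrow> ffun S h u d $ lab S (Inr (Inl i')) = f2 S h i'"
  "i' \<in> {1..N2 S} \<Longrightarrow> ffun S h u d $ lab S (Inr (Inr i')) = f3 S h i'"
proof -
  have "xbar_of S (ffun S h u d) = f1 S h u d" by (simp add: ffun_def)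
  then show "ffun S h u d $ lab S (Inl i) = f1 S h u d $ i" by (simp add: xbar_of_def vec_eq_iff)
  show "i' \<in> {1..N1 S} \<Longrightarrow> ffun S h u d $ lab S (Inr (Inl i')) = f2 S h i'"
    using eta_of_tuple[of i'] by (simp add: ffun_def eta_of_def)
  show "i' \<in> {1..N2 S} \<Longrightarrow> ffun S h u d $ lab S (Inr (Inr i')) = f3 S h i'"
    using lambda_of_tuple[of i'] by (simp add: ffun_def lambda_of_def)
qed

lemma ffun_Lipschitz: "\<exists>K\<ge>0. \<forall>g\<in>C0 {-r..0}. \<forall>h\<in>C0 {-r..0}. \<forall>u.
    norm (ffun S g u 0 - ffun S h u 0) \<le> K * supnorm {-r..0} (\<lambda>\<theta>. g \<theta> - h \<theta>)"
proof -
  obtain Kp where Kp: "0 \<le> Kp" "\<forall>z\<in>{0..1}. \<forall>g\<in>C0 {-r..0}. \<forall>h\<in>C0 {-r..0}.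
    \<bar>profile S g z - profile S h z\<bar> \<le> Kp * supnorm {-r..0} (\<lambda>\<theta>. g \<theta> - h \<theta>)" using profile_Lipschitz by blast
  obtain Kr where Kr: "0 \<le> Kr" "\<forall>z\<in>{0..1}. \<forall>g\<in>C0 {-r..0}. \<forall>h\<in>C0 {-r..0}.
    \<bar>profile_rate g z - profile_rate h z\<bar> \<le> Kr * supnorm {-r..0} (\<lambda>\<theta>. g \<theta> - h \<theta>)" using profile_rate_Lipschitz by blast
  obtain Bg where Bg: "0 \<le> Bg" "\<forall>i\<in>{1..N2 S}. \<forall>z\<in>{0..1}. \<bar>gammaker S i z\<bar> \<le> Bg"
    using continuous_family_bounded[of "{1..N2 S}" "gammaker S"] gammaker_cont by auto
  define K1 where "K1 = L * Kp + L * CARD('b)"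
  define K where "K = K1 + Kr + Bg * Kr"
  have K1: "0 \<le> K1" using Kp L_pos by (simp add: K1_def)
  show ?thesis
  proof (intro exI[of _ "CARD('n) * K"] conjI ballI allI)
    show "0 \<le> CARD('n) * K" using K1 Kr Bg by (simp add: K_def)
    fix g h :: "real \<Rightarrow> real ^ 'n" and u assume g: "g \<in> C0 {-r..0}" and h: "h \<in> C0 {-r..0}"
    let ?s = "supnorm {-r..0} (\<lambda>\<theta>. g \<theta> - h \<theta>)"
    have s0: "0 \<le> ?s" using C0_diff_supnorm_nonneg[OF _ g h] r0 by simp
    have "norm (f1 S g u 0 - f1 S h u 0) \<le> K1 * ?s"
    proof -
      have "supnorm {0..1} (\<lambda>z. (\<lambda>z\<in>{0..1}. profile S g z) z - (\<lambda>z\<in>{0..1}. profile S h z) z) \<le> Kp * ?s"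
        using Kp g h by (intro supnorm_le) auto
      moreover have "norm (xbar_of S (g 0) - xbar_of S (h 0)) \<le> CARD('b) * ?s"
      proof -
        have "norm (xbar_of S (g 0) - xbar_of S (h 0)) \<le> CARD('b) * norm (g 0 - h 0)" unfolding state_diff by (rule state_bounds)
        also have "\<dots> \<le> CARD('b) * ?s" using C0_diff_le_supnorm[OF g h, of 0] r0 by (intro mult_left_mono) auto
        finally show ?thesis .
      qed
      ultimately have "L * supnorm {0..1} (\<lambda>z. (\<lambda>z\<in>{0..1}. profile S g z) z - (\<lambda>z\<in>{0..1}. profile S h z) z)
          + L * norm (xbar_of S (g 0) - xbar_of S (h 0)) \<le> L * (Kp * ?s) + L * (CARD('b) * ?s)"
        using L_pos by (intro add_mono mult_left_mono) auto
      then show ?thesis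
        using Ftil_Lip[OF profile_C0[OF g] profile_C0[OF h], of "xbar_of S (g 0)" u "xbar_of S (h 0)"]
        by (simp add: f1_def K1_def algebra_simps)
    qed
    then have c1: "\<bar>f1 S g u 0 $ i - f1 S h u 0 $ i\<bar> \<le> K1 * ?s" for i
      using component_le_norm_cart[of "f1 S g u 0 - f1 S h u 0" i] by simp
    have c2: "\<bar>f2 S g i - f2 S h i\<bar> \<le> Kr * ?s" if "i \<in> {1..N1 S}" for i
      using Kr zpt_mem[OF that] g h by (simp add: f2_eq)
    have c3: "\<bar>f3 S g i - f3 S h i\<bar> \<le> Bg * Kr * ?s" if i: "i \<in> {1..N2 S}" for i
    proof -
      have int: "(\<lambda>z. gammaker S i z * profile_rate h z) integrable_on {0..1}" if "h \<in> C0 {-r..0}" for h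
        using gammaker_cont[OF i] profile_functionals_continuous(2)[OF that]
        by (intro integrable_continuous_real continuous_intros)
      have "norm (integral {0..1} (\<lambda>z. gammaker S i z * profile_rate g z - gammaker S i z * profile_rate h z)) \<le> (Bg * (Kr * ?s)) * (1 - 0)"
      proof (rule norm_integral_le)
        fix z :: real assume z: "z \<in> {0..1}"
        have "\<bar>gammaker S i z\<bar> * \<bar>profile_rate g z - profile_rate h z\<bar> \<le> Bg * (Kr * ?s)"
          using Bg Kr i z g h by (intro mult_mono) auto
        then show "norm (gammaker S i z * profile_rate g z - gammaker S i z * profile_rate h z) \<le> Bg * (Kr * ?s)"
          by (simp only: right_diff_distrib[symmetric] real_norm_def abs_mult)
      qed (auto intro!: Henstock_Kurzweil_Integration.integrable_diff int g h)
      then show ?thesis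
        by (simp add: f3_eq[OF g i] f3_eq[OF h i] Henstock_Kurzweil_Integration.integral_diff[OF int[OF g] int[OF h]] mult.assoc)
    qed
    have "K1 * ?s \<le> K * ?s" "Kr * ?s \<le> K * ?s" "Bg * Kr * ?s \<le> K * ?s"
      using K1 Kr Bg s0 by (auto simp: K_def intro!: mult_right_mono)
    note le = this
    have "\<bar>(ffun S g u 0 - ffun S h u 0) $ j\<bar> \<le> K * ?s" for j
    proof (cases j rule: lab_cases)
      case (xbar i)
      then show ?thesis using c1[of i] le(1) by (simp add: ffun_components)
    next
      case (eta i)
      then show ?thesis using c2[of i] le(2) by (simp add: ffun_components)
    next
      case (lambda i)
      then show ?thesis using c3[of i] le(3) by (simp add: ffun_components)
    qed
    then have "(\<Sum>j\<in>UNIV. \<bar>(ffun S g u 0 - ffun S h u 0) $ j\<bar>) \<le> (\<Sum>j\<in>(UNIV :: 'n set). K * ?s)" by (intro sum_mono)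
    then show "norm (ffun S g u 0 - ffun S h u 0) \<le> CARD('n) * K * ?s"
      using norm_le_l1_cart[of "ffun S g u 0 - ffun S h u 0"] by simp
  qed
qed

lemma continuous_on_vecI:
  assumes "\<And>j. continuous_on A (\<lambda>t. g t $ j)" shows "continuous_on A (g :: _ \<Rightarrow> real ^ 'i::finite)"
proof -
  have "continuous_on A (\<lambda>t. \<chi> j. g t $ j)" by (rule continuous_on_vec_lambda[OF assms])
  then show ?thesis by simp
qed

lemma ffun_input_continuous:
  assumes h: "h \<in> C0 {-r..0}" shows "continuous_on UNIV (\<lambda>u. ffun S h u 0)"
proof (rule continuous_on_vecI)
  have "continuous_map euclidean (prod_topology euclidean (prod_topology (C0top {0..1}) euclidean))
      (\<lambda>u. (xbar_of S (h 0), (\<lambda>z\<in>{0..1}. profile S h z), u))"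
    using profile_C0[OF h] by (intro continuous_map_pairedI) auto
  from continuous_map_compose[OF this Ftil_cont] have "continuous_on UNIV (\<lambda>u. f1 S h u 0)"
    by (simp add: o_def f1_def)
  then show "continuous_on UNIV (\<lambda>u. ffun S h u 0 $ j)" for j
    by (cases j rule: lab_cases) (auto simp: ffun_components intro!: continuous_intros)
qed

text \<open>Both the output h and the functional R factor through this linear map: \<open>h(x) = M x(0)\<close> and \<open>R = M f\<close>.\<close>

definition outmap :: "real ^ 'n \<Rightarrow> real ^ 'k" where
  "outmap x = (\<chi> j. qvec S j \<bullet> xbar_of S x + (\<Sum>i=1..N1 S. bbar S j i * eta_of S x i)
     + (\<Sum>i=1..N2 S. betabar S j i * lambda_of S x i))"

lemma bounded_linear_outmap: "bounded_linear outmap"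
  by (intro linear_conv_bounded_linear[THEN iffD1] linearI)
    (auto simp: outmap_def vec_eq_iff eta_of_def lambda_of_def linear_add[OF bounded_linear.linear[OF bounded_linear_xbar_of]]
      linear_cmul[OF bounded_linear.linear[OF bounded_linear_xbar_of]] algebra_simps inner_add_right sum.distrib sum_distrib_left)

lemma hfun_eq: "hfun S h = outmap (h 0)" and Rfun_eq: "Rfun S h u d = outmap (ffun S h u d)"
  by (simp_all add: hfun_def outmap_def Rfun_def ffun_def eta_of_tuple lambda_of_tuple)

end

section \<open>From the loop to the delay system and back\<close>

lemma time_interval_downward:
  assumes "time_interval I" "t \<in> I" "0 \<le> s" "s \<le> t" shows "s \<in> I"
proof -
  have "{0..t} \<subseteq> I" using assms by (simp add: time_interval_def)
  then show ?thesis using assms(3,4) by auto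
qed

lemma blinfun_apply_axes:
  fixes T :: "(real \<times> real) \<Rightarrow>\<^sub>L real"
  shows "(\<lambda>h. T (h, 0)) = (\<lambda>h. h *\<^sub>R T (1, 0))" "(\<lambda>h. T (0, h)) = (\<lambda>h. h *\<^sub>R T (0, 1))"
proof -
  have *: "(h, 0) = h *\<^sub>R (1, 0 :: real)" "(0, h) = h *\<^sub>R (0 :: real, 1)" for h :: real by auto
  show "(\<lambda>h. T (h, 0)) = (\<lambda>h. h *\<^sub>R T (1, 0))" by (intro ext) (subst *(1), rule blinfun.scaleR_right)
  show "(\<lambda>h. T (0, h)) = (\<lambda>h. h *\<^sub>R T (0, 1))" by (intro ext) (subst *(2), rule blinfun.scaleR_right)
qed

context pde_loop begin

definition loop_state :: "(real \<Rightarrow> real ^ 'b) \<Rightarrow> (real \<Rightarrow> real \<Rightarrow> real) \<Rightarrow> real \<Rightarrow> real ^ 'n" where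
  "loop_state xb v t = tuple S (xb t) (\<lambda>i. v t (zpt S i)) (\<lambda>i. integral {0..1} (\<lambda>s. gammaker S i s * v t s))"

text \<open>Histories from which the initial data of the loop arise.\<close>

definition loop_history :: "(real \<Rightarrow> real) \<Rightarrow> real ^ 'b \<Rightarrow> (real \<Rightarrow> real ^ 'n) \<Rightarrow> bool" where
  "loop_history v0 xb0 x0 \<longleftrightarrow> x0 \<in> C0 {-r..0} \<and> xbar_of S (x0 0) = xb0 \<and>
     (\<forall>i\<in>{1..N1 S}. eta_of S (x0 0) i = v0 (zpt S i)) \<and>
     (\<forall>i\<in>{1..N2 S}. lambda_of S (x0 0) i = integral {0..1} (\<lambda>z. gammaker S i z * v0 z)) \<and>
     (\<forall>s\<in>{0..1}. v0 s = profile S x0 s)"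

lemma gbar_loop_state:
  "gbar S y (loop_state xb v t) = gsrc S y (xb t) + (\<Sum>i=1..N1 S. bcoef S i y * v t (zpt S i))
     + (\<Sum>i=1..N2 S. betacoef S i y * integral {0..1} (\<lambda>s. gammaker S i s * v t s))"
  by (simp add: gbar_def loop_state_def eta_of_tuple lambda_of_tuple)

context
  fixes I :: "real set" and x :: "real \<Rightarrow> real ^ 'n"
  assumes I: "time_interval I" and x: "continuous_on ({-r..0} \<union> I) x"
begin

lemma time_interval_convex: "convex I"
  unfolding is_interval_convex_1[symmetric] is_interval_1
proof (intro ballI allI impI)
  fix a b y assume "a \<in> I" "b \<in> I" "a \<le> y \<and> y \<le> b"
  then show "y \<in> I" using I_simps(2)[OF I x, of a] I_simps(3)[OF I x, of b y] by auto
qed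

text \<open>Leibniz' rule, followed by \<open>f3_eq\<close>.\<close>

lemma gammaker_profile_deriv:
  assumes t: "t \<in> I" and i: "i \<in> {1..N2 S}"
  shows "((\<lambda>t. integral {0..1} (\<lambda>z. gammaker S i z * profile_of x t z)) has_vector_derivative f3 S (hist r x t) i) (at t within I)"
proof -
  note pc = profile_partials_continuous[OF I x]
  have gc: "continuous_on (I \<times> {0..1}) (\<lambda>p. gammaker S i (snd p))"
    by (rule continuous_on_compose2[OF gammaker_cont[OF i]]) (auto intro!: continuous_intros)
  have "((\<lambda>t. integral (cbox 0 1) (\<lambda>z. gammaker S i z * profile_of x t z)) has_vector_derivative
      integral (cbox 0 1) (\<lambda>z. gammaker S i z * profile_rate (hist r x t) z)) (at t within I)"
  proof (rule leibniz_rule_vector_derivative[OF _ _ _ t time_interval_convex])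
    show "((\<lambda>s. gammaker S i z * profile_of x s z) has_vector_derivative gammaker S i z * profile_rate (hist r x s) z) (at s within I)"
      if "s \<in> I" "z \<in> cbox 0 1" for s z
      using that by (intro has_vector_derivative_mult_right profile_of_time_deriv[OF I x]) auto
    show "(\<lambda>z. gammaker S i z * profile_of x s z) integrable_on cbox 0 1" if s: "s \<in> I" for s
    proof -
      have "continuous_on {0..1} (\<lambda>z. profile_of x s z)"
        by (rule continuous_on_compose_pair[OF pc(3), of _ "\<lambda>_. s" "\<lambda>z. z"]) (use s in \<open>auto intro: continuous_intros\<close>)
      then have "(\<lambda>z. gammaker S i z * profile_of x s z) integrable_on {0..1}"
        by (intro integrable_continuous_real continuous_intros gammaker_cont[OF i])
      then show ?thesis by simp
    qed
    show "continuous_on (I \<times> cbox 0 1) (\<lambda>(s, z). gammaker S i z * profile_rate (hist r x s) z)"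
      unfolding split_beta using pc(1) gc by (intro continuous_intros) (simp_all add: split_beta)
  qed
  moreover have "hist r x t \<in> C0 {-r..0}"
  proof (rule hist_in_C0, rule continuous_on_subset[OF x])
    have "{t - r..t} \<subseteq> {-r..t}" using I_simps(2)[OF I x t] by auto
    also have "\<dots> \<subseteq> {-r..0} \<union> I" by (rule J_simps(4)[OF I x]) (use t in simp)
    finally show "{t - r..t} \<subseteq> {-r..0} \<union> I" .
  qed
  ultimately show ?thesis using f3_eq[OF _ i] by simp
qed

end

text \<open>The total derivative of v in the direction \<open>(1, c)\<close> is \<open>a v + gbar\<close>, and C satisfies \<open>c C' = a C\<close>; so
  the quotient \<open>v / C\<close> has the derivative \<open>\<phi>\<close> along a characteristic.\<close>

lemma loop_solution_along_characteristic:
  assumes I: "time_interval I" and sol: "loop_solution S I v0 xb0 u xb v"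
    and t: "t \<in> I" and ab: "0 \<le> a" "a \<le> t" and z: "z \<in> {0..1}" and y0: "0 \<le> z - c * (t - a)"
  shows "v t z / Cw S z - v a (z - c * (t - a)) / Cw S (z - c * (t - a))
    = integral {a..t} (\<lambda>s. \<phi> (z - c * t + c * s) (loop_state xb v s))"
proof -
  let ?y = "\<lambda>s. z - c * t + c * s"
  have sI: "s \<in> I" if "s \<in> {a..t}" for s
    by (rule time_interval_downward[OF I t]) (use that ab in auto)
  have y: "?y s \<in> {0..1}" if s: "s \<in> {a..t}" for s
  proof -
    have "c * (t - s) \<le> c * (t - a)" "0 \<le> c * (t - s)" using s c_pos by (auto intro: mult_left_mono)
    then show ?thesis using y0 z by (auto simp: algebra_simps)
  qed
  obtain v' :: "real \<times> real \<Rightarrow> (real \<times> real) \<Rightarrow>\<^sub>L real" where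
    v': "\<And>p. p \<in> I \<times> {0..1} \<Longrightarrow> ((\<lambda>(t, z). v t z) has_derivative blinfun_apply (v' p)) (at p within I \<times> {0..1})"
    using sol unfolding loop_solution_def C1_on_def by blast
  have nontriv: "at s within I \<noteq> bot" if s: "s \<in> I" for s
  proof -
    obtain b where b: "b \<in> I" "s < b" using I s by (auto simp: time_interval_def)
    have "0 \<le> s" using I s by (simp add: time_interval_def)
    then have "{s..b} \<subseteq> I" by (auto intro: time_interval_downward[OF I b(1)])
    moreover have "at s within {s..b} \<noteq> bot" using b by (simp add: trivial_limit_within islimpt_Icc)
    ultimately show ?thesis by (metis at_le bot.extremum_uniqueI)
  qed
  have part: "v' (s, y) (1, c) = acoef S y * v s y + gbar S y (loop_state xb v s)" if s: "s \<in> I" and y: "y \<in> {0..1}" for s y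
  proof -
    have p1: "((\<lambda>s. (s, y)) has_derivative (\<lambda>h. (h, 0))) (at s within I)" by (auto intro!: derivative_eq_intros)
    have "((\<lambda>(t, z). v t z) has_derivative blinfun_apply (v' (s, y))) (at (s, y) within (\<lambda>s. (s, y)) ` I)"
      by (rule has_derivative_subset[OF v']) (use s y in auto)
    from has_derivative_in_compose[OF p1 this] have "((\<lambda>s. v s y) has_derivative (\<lambda>h. v' (s, y) (h, 0))) (at s within I)" by simp
    then have d1: "vector_derivative (\<lambda>s. v s y) (at s within I) = v' (s, y) (1, 0)"
      by (intro vector_derivative_within[OF nontriv[OF s]]) (simp only: has_vector_derivative_def blinfun_apply_axes(1))
    have p2: "((\<lambda>y. (s, y)) has_derivative (\<lambda>h. (0, h))) (at y within {0..1})" by (auto intro!: derivative_eq_intros)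
    have "((\<lambda>(t, z). v t z) has_derivative blinfun_apply (v' (s, y))) (at (s, y) within (\<lambda>y. (s, y)) ` {0..1})"
      by (rule has_derivative_subset[OF v']) (use s y in auto)
    from has_derivative_in_compose[OF p2 this] have "((\<lambda>y. v s y) has_derivative (\<lambda>h. v' (s, y) (0, h))) (at y within {0..1})" by simp
    then have d2: "deriv01 (v s) y = v' (s, y) (0, 1)"
      using y by (intro vector_derivative_within_cbox[of 0 1, simplified]) (simp_all only: has_vector_derivative_def blinfun_apply_axes(2) atLeastAtMost_iff)
    have "((1::real), c) = (1, 0) + c *\<^sub>R (0, 1)" by simp
    then have "v' (s, y) (1, c) = v' (s, y) (1, 0) + c *\<^sub>R v' (s, y) (0, 1)" by (simp only: blinfun.add_right blinfun.scaleR_right)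
    also have "\<dots> = acoef S y * v s y + gbar S y (loop_state xb v s)"
      using sol s y unfolding loop_solution_def d1[symmetric] d2[symmetric] gbar_loop_state by simp
    finally show ?thesis .
  qed
  have "((\<lambda>s. \<phi> (?y s) (loop_state xb v s)) has_integral v t (?y t) / Cw S (?y t) - v a (?y a) / Cw S (?y a)) {a..t}"
  proof (rule fundamental_theorem_of_calculus[OF ab(2)])
    fix s assume s: "s \<in> {a..t}"
    have pd: "((\<lambda>s. (s, ?y s)) has_derivative (\<lambda>h. (h, c * h))) (at s within {a..t})" by (auto intro!: derivative_eq_intros)
    have "((\<lambda>(t, z). v t z) has_derivative blinfun_apply (v' (s, ?y s))) (at (s, ?y s) within (\<lambda>s. (s, ?y s)) ` {a..t})"
      by (rule has_derivative_subset[OF v']) (use sI y s in auto)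
    from has_derivative_in_compose[OF pd this]
    have "((\<lambda>s. v s (?y s)) has_derivative (\<lambda>h. v' (s, ?y s) (h, c * h))) (at s within {a..t})" by simp
    moreover have "(\<lambda>h. v' (s, ?y s) (h, c * h)) = (*) (v' (s, ?y s) (1, c))"
    proof
      fix h :: real
      have "(h, c * h) = h *\<^sub>R (1, c)" by simp
      then show "v' (s, ?y s) (h, c * h) = v' (s, ?y s) (1, c) * h" by (simp only: blinfun.scaleR_right) simp
    qed
    ultimately have dv: "((\<lambda>s. v s (?y s)) has_real_derivative acoef S (?y s) * v s (?y s) + gbar S (?y s) (loop_state xb v s)) (at s within {a..t})"
      using part[OF sI[OF s] y[OF s]] by (simp add: has_field_derivative_def)
    have "((\<lambda>s. Cw S (?y s)) has_real_derivative (r * acoef S (?y s) * Cw S (?y s)) * c) (at s within {a..t})"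
    proof -
      have 1: "(?y has_real_derivative c) (at s within {a..t})" by (auto intro!: derivative_eq_intros)
      have "(Cw S has_real_derivative r * acoef S (?y s) * Cw S (?y s)) (at (?y s) within ?y ` {a..t})"
        by (rule has_field_derivative_subset[OF Cw_deriv[OF y[OF s], folded has_real_derivative_iff_has_vector_derivative]])
          (intro image_subsetI y)
      from DERIV_image_chain[OF this 1] show ?thesis by (simp add: o_def)
    qed
    then have dC: "((\<lambda>s. Cw S (?y s)) has_real_derivative acoef S (?y s) * Cw S (?y s)) (at s within {a..t})"
    proof -
      have "(r * acoef S (?y s) * Cw S (?y s)) * c = (r * c) * (acoef S (?y s) * Cw S (?y s))" by (simp only: mult_ac)
      then have eq: "(r * acoef S (?y s) * Cw S (?y s)) * c = acoef S (?y s) * Cw S (?y s)" unfolding rc(1) by simp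
      show ?thesis using \<open>((\<lambda>s. Cw S (?y s)) has_real_derivative _) _\<close> unfolding eq .
    qed
    have nz: "Cw S w \<noteq> 0" for w using Cw_pos[of w] by simp
    have "((\<lambda>s. v s (?y s) / Cw S (?y s)) has_real_derivative
       ((acoef S (?y s) * v s (?y s) + gbar S (?y s) (loop_state xb v s)) * Cw S (?y s) - v s (?y s) * (acoef S (?y s) * Cw S (?y s)))
         / (Cw S (?y s) * Cw S (?y s))) (at s within {a..t})"
      by (rule DERIV_divide[OF dv dC nz])
    moreover have "((acoef S (?y s) * v s (?y s) + gbar S (?y s) (loop_state xb v s)) * Cw S (?y s) - v s (?y s) * (acoef S (?y s) * Cw S (?y s)))
         / (Cw S (?y s) * Cw S (?y s)) = \<phi> (?y s) (loop_state xb v s)"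
    proof -
      have "(acoef S (?y s) * v s (?y s) + gbar S (?y s) (loop_state xb v s)) * Cw S (?y s) - v s (?y s) * (acoef S (?y s) * Cw S (?y s))
          = gbar S (?y s) (loop_state xb v s) * Cw S (?y s)" by (simp add: algebra_simps)
      then show ?thesis using nz by (simp add: \<phi>_def)
    qed
    ultimately show "((\<lambda>s. v s (?y s) / Cw S (?y s)) has_vector_derivative \<phi> (?y s) (loop_state xb v s)) (at s within {a..t})"
      by (simp add: has_real_derivative_iff_has_vector_derivative)
  qed
  then have "integral {a..t} (\<lambda>s. \<phi> (?y s) (loop_state xb v s)) = v t (?y t) / Cw S (?y t) - v a (?y a) / Cw S (?y a)"
    by (rule integral_unique)
  moreover have "?y t = z" "?y a = z - c * (t - a)" by (auto simp: algebra_simps)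
  ultimately show ?thesis by simp
qed

text \<open>Follow the characteristic through \<open>(t, z)\<close> backwards. If it meets the inlet \<open>z = 0\<close> at a positive time, it starts
  there with the value zero. Otherwise it meets the initial profile, which is itself generated by the
  history \<open>x0\<close>, so that the collected source continues to negative times.\<close>

lemma loop_solution_state:
  assumes I: "time_interval I" and sol: "loop_solution S I v0 xb0 u xb v" and h: "loop_history v0 xb0 x0"
  defines "x \<equiv> (\<lambda>t. if t \<le> 0 then x0 t else loop_state xb v t)"
  shows "continuous_on ({-r..0} \<union> I) x" and "t \<in> I \<Longrightarrow> x t = loop_state xb v t"
    and "t \<in> I \<Longrightarrow> z \<in> {0..1} \<Longrightarrow> v t z = profile_of x t z"
proof -
  have I0: "0 \<in> I" and Inn: "\<And>t. t \<in> I \<Longrightarrow> 0 \<le> t" using I by (auto simp: time_interval_def)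
  have x0C: "x0 \<in> C0 {-r..0}" using h by (simp add: loop_history_def)
  have vC1: "C1_on (I \<times> {0..1}) (\<lambda>(t, z). v t z)" and xC1: "C1_on I xb" using sol by (auto simp: loop_solution_def)
  note vc = C1_on_continuous[OF vC1]
  have vz: "continuous_on I (\<lambda>t. v t y)" if "y \<in> {0..1}" for y
    by (rule continuous_on_compose_pair[OF vc, of _ "\<lambda>t. t" "\<lambda>_. y"]) (use that in \<open>auto intro: continuous_intros\<close>)
  have int0: "integral {0..1} (\<lambda>s. gammaker S i s * v 0 s) = integral {0..1} (\<lambda>z. gammaker S i z * v0 z)" for i
    using sol by (intro Henstock_Kurzweil_Integration.integral_cong) (auto simp: loop_solution_def)
  have st0: "loop_state xb v 0 = x0 0"
  proof (rule state_eqI)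
    show "xbar_of S (loop_state xb v 0) = xbar_of S (x0 0)" using sol h by (simp add: loop_state_def loop_solution_def loop_history_def)
    show "eta_of S (loop_state xb v 0) i = eta_of S (x0 0) i" if "i \<in> {1..N1 S}" for i
      using sol h that zpt_mem[OF that] eta_of_tuple[OF that] unfolding loop_state_def loop_solution_def loop_history_def by simp
    show "lambda_of S (loop_state xb v 0) i = lambda_of S (x0 0) i" if "i \<in> {1..N2 S}" for i
      using h that int0[of i] lambda_of_tuple[OF that] unfolding loop_state_def loop_history_def by simp
  qed
  show xI: "x t = loop_state xb v t" if "t \<in> I" for t
    using Inn[OF that] st0 by (cases "t = 0") (auto simp: x_def)
  have ls: "continuous_on I (loop_state xb v)"
  proof (rule continuous_on_vecI)
    fix j show "continuous_on I (\<lambda>t. loop_state xb v t $ j)"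
    proof (cases j rule: lab_cases)
      case (xbar i)
      have "loop_state xb v t $ j = xb t $ i" for t
        using xbar_of_tuple[of "xb t"] unfolding loop_state_def xbar by (simp add: xbar_of_def vec_eq_iff)
      then show ?thesis using C1_on_continuous[OF xC1] by (auto intro!: continuous_intros)
    next
      case (eta i)
      have "loop_state xb v t $ j = v t (zpt S i)" for t
        using eta_of_tuple[OF eta(1), of "xb t" "\<lambda>i. v t (zpt S i)"] unfolding loop_state_def eta(2) by (simp add: eta_of_def)
      then show ?thesis using vz[OF zpt_mem[OF eta(1)]] by simp
    next
      case (lambda i)
      have eq: "loop_state xb v t $ j = integral {0..1} (\<lambda>s. gammaker S i s * v t s)" for t
        using lambda_of_tuple[OF lambda(1), of "xb t"] unfolding loop_state_def lambda(2) by (simp add: lambda_of_def)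
      have gc: "continuous_on (I \<times> {0..1}) (\<lambda>p. gammaker S i (snd p))"
        by (rule continuous_on_compose2[OF gammaker_cont[OF lambda(1)]]) (auto intro!: continuous_intros)
      have "continuous_on (I \<times> cbox 0 1) (\<lambda>(t, s). gammaker S i s * v t s)"
        unfolding split_beta using vc gc by (intro continuous_intros) (simp_all add: split_beta)
      from integral_continuous_on_param[OF this] show ?thesis unfolding eq by simp
    qed
  qed
  show xc: "continuous_on ({-r..0} \<union> I) x"
    unfolding x_def
  proof (rule continuous_on_cases_le[where h = "\<lambda>t. t" and a = 0])
    have "{t \<in> {-r..0} \<union> I. t \<le> 0} \<subseteq> {-r..0}" using Inn r0 by force
    then show "continuous_on {t \<in> {-r..0} \<union> I. t \<le> 0} x0" using x0C by (auto simp: C0_iff elim: continuous_on_subset)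
    have "{t \<in> {-r..0} \<union> I. 0 \<le> t} \<subseteq> I" using I0 by auto
    then show "continuous_on {t \<in> {-r..0} \<union> I. 0 \<le> t} (loop_state xb v)" by (rule continuous_on_subset[OF ls])
  qed (use st0 in \<open>auto intro: continuous_intros\<close>)
  have h0: "hist r x 0 = x0"
    using x0C by (auto simp: hist_def x_def C0_iff fun_eq_iff extensional_def restrict_def)
  show "v t z = profile_of x t z" if t: "t \<in> I" and z: "z \<in> {0..1}" for t z
  proof -
    \<comment> \<open>The time at which the characteristic meets the line \<open>t = 0\<close> or the inlet.\<close>
    define a where "a = max 0 (t - r * z)"
    have cr: "c * (r * z) = z" using rc by (simp add: mult.assoc[symmetric])
    have rz: "0 \<le> r * z" using z r0 by simp
    have a: "0 \<le> a" "a \<le> t" "t - r * z \<le> a" using Inn[OF t] rz by (auto simp: a_def)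
    have aI: "a \<in> I" by (rule time_interval_downward[OF I t a(1,2)])
    have "c * (t - a) \<le> c * (r * z)" using a c_pos by (intro mult_left_mono) auto
    then have y0: "0 \<le> z - c * (t - a)" using cr by simp
    have y1: "z - c * (t - a) \<in> {0..1}" using y0 z a c_pos by (auto intro: order_trans[of _ z])
    have char: "v t z / Cw S z - v a (z - c * (t - a)) / Cw S (z - c * (t - a))
        = integral {a..t} (\<lambda>s. \<phi> (z - c * t + c * s) (loop_state xb v s))"
      by (rule loop_solution_along_characteristic[OF I sol t a(1,2) z y0])
    note Kd = K_diff[OF I xc]
    have tJ: "t \<in> {-r..0} \<union> I" using t by simp
    have ra: "-r \<le> a" using a r0 by simp
    have src: "integral {a..t} (\<lambda>s. \<phi> (z - c * t + c * s) (loop_state xb v s)) = integral {a..t} (\<lambda>s. \<phi>e (z - c * t + c * s) (x s))"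
    proof (rule Henstock_Kurzweil_Integration.integral_cong)
      fix s assume s: "s \<in> {a..t}"
      have "s \<in> I" by (rule time_interval_downward[OF I t]) (use a s in auto)
      moreover have "z - c * t + c * s \<in> {0..1}"
      proof -
        have "c * (t - s) \<le> c * (t - a)" "0 \<le> c * (t - s)" using s c_pos by (auto intro: mult_left_mono)
        then show ?thesis using y0 z by (auto simp: algebra_simps)
      qed
      ultimately show "\<phi> (z - c * t + c * s) (loop_state xb v s) = \<phi>e (z - c * t + c * s) (x s)"
        by (simp add: xI phie_eq)
    qed
    have start: "v a (z - c * (t - a)) / Cw S (z - c * (t - a)) = integral {t - r * z..a} (\<lambda>s. \<phi>e (z - c * t + c * s) (x s))"
    proof (cases "0 \<le> t - r * z")
      case True
      then have aeq: "a = t - r * z" by (simp add: a_def)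
      then have zc0: "z - c * (t - a) = 0" using cr by simp
      have v0a: "v a 0 = 0" using sol aI by (simp add: loop_solution_def)
      show ?thesis unfolding zc0 v0a using aeq by simp
    next
      case False
      then have aeq: "a = 0" by (simp add: a_def)
      define y where "y = z - c * t"
      have y: "y \<in> {0..1}" using y1 aeq by (simp add: y_def)
      have ry: "0 - r * y = t - r * z" using rc by (simp add: y_def algebra_simps)
      have "v 0 y = profile S x0 y" using sol h y by (simp add: loop_solution_def loop_history_def)
      also have "\<dots> = profile_of x 0 y" by (simp add: h0)
      also have "\<dots> = Cw S y * (K x (y - c * 0) 0 - K x (y - c * 0) (0 - r * y))" by (rule profile_of_eq[OF I xc I0 y])
      also have "\<dots> = Cw S y * integral {0 - r * y..0} (\<lambda>p. \<phi>e (y - c * 0 + c * p) (x p))"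
        by (simp only: Kd(1)[OF I0 y])
      finally have "v 0 y / Cw S y = integral {t - r * z..0} (\<lambda>p. \<phi>e (y + c * p) (x p))"
        using Cw_pos[of y] unfolding ry by simp
      then show ?thesis using aeq by (simp add: y_def)
    qed
    have "v t z / Cw S z = integral {t - r * z..a} (\<lambda>s. \<phi>e (z - c * t + c * s) (x s)) + integral {a..t} (\<lambda>s. \<phi>e (z - c * t + c * s) (x s))"
      using char start src by simp
    also have "\<dots> = integral {t - r * z..t} (\<lambda>s. \<phi>e (z - c * t + c * s) (x s))"
      by (rule Henstock_Kurzweil_Integration.integral_combine[OF a(3,2) kernel_integrable(1)[OF I xc tJ delayed_in_J(2)[OF I xc t z]]])
    also have "\<dots> = profile_of x t z / Cw S z"
      using Cw_pos[of z] unfolding profile_of_eq[OF I xc t z] Kd(1)[OF t z] by simp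
    finally show ?thesis using Cw_pos[of z] by simp
  qed
qed

end

context pde_loop begin

lemma ffun_along_continuous:
  assumes I: "time_interval I" and x: "continuous_on ({-r..0} \<union> I) x" and u: "continuous_on I u"
  shows "continuous_on I (\<lambda>t. ffun S (hist r x t) (u t) 0)"
proof -
  obtain K where K: "\<forall>g\<in>C0 {-r..0}. \<forall>h\<in>C0 {-r..0}. \<forall>u.
    norm (ffun S g u 0 - ffun S h u 0) \<le> K * supnorm {-r..0} (\<lambda>\<theta>. g \<theta> - h \<theta>)" using ffun_Lipschitz by blast
  have h: "continuous_map (top_of_set I) (C0top {-r..0}) (hist r x)"
  proof (rule continuous_map_hist[OF r0 x])
    fix t assume t: "t \<in> I"
    have "{t - r..t} \<subseteq> {-r..t}" using I_simps(2)[OF I x t] by auto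
    also have "\<dots> \<subseteq> {-r..0} \<union> I" by (rule J_simps(4)[OF I x]) (use t in simp)
    finally show "{t - r..t} \<subseteq> {-r..0} \<union> I" .
  qed
  show ?thesis
    by (rule Lipschitz_along_curve_continuous[OF _ h _ ffun_input_continuous u, where L = K]) (use K r0 in auto)
qed

text \<open>The components \<open>v(t, z_i)\<close> and \<open>\<integral> \<gamma>_i v\<close> of the state are functionals of the profile, hence their
  derivatives are \<open>f2\<close> and \<open>f3\<close>.\<close>

lemma loop_solution_imp_delay_solution:
  assumes I: "time_interval I" and sol: "loop_solution S I v0 xb0 u xb v" and h: "loop_history v0 xb0 x0"
    and u: "continuous_on I u"
  obtains x where "delay_solution r I x0 (\<lambda>t \<phi>. ffun S \<phi> (u t) 0) x"
    "\<And>t. t \<in> I \<Longrightarrow> x t = loop_state xb v t" "\<And>t z. t \<in> I \<Longrightarrow> z \<in> {0..1} \<Longrightarrow> v t z = profile_of x t z"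
proof -
  define x where "x t = (if t \<le> 0 then x0 t else loop_state xb v t)" for t
  have xc: "continuous_on ({-r..0} \<union> I) x" unfolding x_def[abs_def] by (rule loop_solution_state(1)[OF I sol h])
  have xs: "x t = loop_state xb v t" if "t \<in> I" for t unfolding x_def[abs_def] by (rule loop_solution_state(2)[OF I sol h that])
  have vp: "v t z = profile_of x t z" if "t \<in> I" "z \<in> {0..1}" for t z
    unfolding x_def[abs_def] by (rule loop_solution_state(3)[OF I sol h that])
  have I0: "0 \<in> I" using I by (simp add: time_interval_def)
  note fc = ffun_along_continuous[OF I xc u]
  let ?g = "\<lambda>t. ffun S (hist r x t) (u t) 0"
  have gi: "?g integrable_on {0..t}" "?g absolutely_integrable_on {0..t}" if t: "t \<in> I" for t
  proof -
    have sub: "{0..t} \<subseteq> I" using I t by (simp add: time_interval_def)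
    show "?g integrable_on {0..t}" "?g absolutely_integrable_on {0..t}"
      using continuous_on_subset[OF fc sub] by (auto intro: integrable_continuous_real absolutely_integrable_continuous_real)
  qed
  have deriv: "((\<lambda>t. loop_state xb v t $ j) has_vector_derivative ?g t $ j) (at t within I)" if t: "t \<in> I" for t j
  proof (cases j rule: lab_cases)
    case (xbar i)
    have 1: "loop_state xb v t $ j = xb t $ i" for t
      using xbar_of_tuple[of "xb t"] unfolding loop_state_def xbar by (simp add: xbar_of_def vec_eq_iff)
    have "?g t $ j = Ftil S (xbar_of S (x t)) (\<lambda>z\<in>{0..1}. profile_of x t z) (u t) $ i"
      using r0 by (simp add: xbar ffun_components f1_def hist_def)
    also have "(\<lambda>z\<in>{0..1}. profile_of x t z) = (\<lambda>z\<in>{0..1}. v t z)" using vp t by (intro restrict_ext) simp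
    also have "xbar_of S (x t) = xb t" using xs[OF t] by (simp add: loop_state_def)
    finally have 2: "?g t $ j = Ftil S (xb t) (\<lambda>z\<in>{0..1}. v t z) (u t) $ i" .
    have "(xb has_vector_derivative Ftil S (xb t) (\<lambda>z\<in>{0..1}. v t z) (u t)) (at t within I)"
      using sol t by (simp add: loop_solution_def)
    from bounded_linear.has_vector_derivative[OF bounded_linear_vec_nth this] show ?thesis unfolding 1 2 .
  next
    case (eta i)
    have 1: "loop_state xb v t $ j = v t (zpt S i)" for t
      using eta_of_tuple[OF eta(1), of "xb t" "\<lambda>i. v t (zpt S i)"] unfolding loop_state_def eta(2) by (simp add: eta_of_def)
    have 2: "?g t $ j = profile_rate (hist r x t) (zpt S i)" unfolding eta(2) ffun_components(2)[OF eta(1)] f2_eq ..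
    have "((\<lambda>t. profile_of x t (zpt S i)) has_vector_derivative profile_rate (hist r x t) (zpt S i)) (at t within I)"
      by (rule profile_of_time_deriv[OF I xc t zpt_mem[OF eta(1)]])
    then show ?thesis unfolding 1 2
      by (rule has_vector_derivative_transform[OF t, rotated]) (use vp zpt_mem[OF eta(1)] in auto)
  next
    case (lambda i)
    have 1: "loop_state xb v t $ j = integral {0..1} (\<lambda>s. gammaker S i s * v t s)" for t
      using lambda_of_tuple[OF lambda(1), of "xb t"] unfolding loop_state_def lambda(2) by (simp add: lambda_of_def)
    have 2: "?g t $ j = f3 S (hist r x t) i" unfolding lambda(2) ffun_components(3)[OF lambda(1)] ..
    show ?thesis unfolding 1 2
      by (rule has_vector_derivative_transform[OF t _ gammaker_profile_deriv[OF I xc t lambda(1)]])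
        (use vp in \<open>auto intro!: Henstock_Kurzweil_Integration.integral_cong\<close>)
  qed
  have eqn: "x t = x0 0 + integral {0..t} ?g" if t: "t \<in> I" for t
    unfolding vec_eq_iff
  proof
    fix j
    have sub: "{0..t} \<subseteq> I" and t0: "0 \<le> t" using I t by (auto simp: time_interval_def)
    have "((\<lambda>s. ?g s $ j) has_integral loop_state xb v t $ j - loop_state xb v 0 $ j) {0..t}"
      by (rule fundamental_theorem_of_calculus[OF t0], rule has_vector_derivative_within_subset[OF deriv sub]) (use sub in auto)
    then have "integral {0..t} (\<lambda>s. ?g s $ j) = x t $ j - x 0 $ j" by (simp add: xs[OF t] xs[OF I0] has_integral_iff)
    moreover have "integral {0..t} (\<lambda>s. ?g s $ j) = integral {0..t} ?g $ j" by (rule integral_component_eq_cart[OF gi(1)[OF t]])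
    ultimately show "x t $ j = (x0 0 + integral {0..t} ?g) $ j" by (simp add: x_def)
  qed
  have "delay_solution r I x0 (\<lambda>t \<phi>. ffun S \<phi> (u t) 0) x"
    unfolding delay_solution_def using xc eqn gi(2) by (auto simp: x_def)
  then show ?thesis using xs vp by (rule that)
qed

text \<open>The components \<open>\<eta>_i\<close> and \<open>\<lambda>_i\<close> of x are a priori unrelated to the profile of x. They have the same time
  derivatives as the values \<open>v(t, z_i)\<close> and the averages \<open>\<integral> \<gamma>_i v\<close> of the profile, and agree with them at time 0; so they agree
  forever, and the source term of the profile is that of the loop.\<close>

lemma delay_solution_imp_loop_solution:
  assumes x: "delay_solution r {0..} x0 (\<lambda>t \<phi>. ffun S \<phi> (u t) 0) x" and h: "loop_history v0 xb0 x0"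
    and u: "continuous_on {0..} u"
  shows "loop_solution S {0..} v0 xb0 u (\<lambda>t. xbar_of S (x t)) (profile_of x)"
    and "0 \<le> t \<Longrightarrow> x t = loop_state (\<lambda>t. xbar_of S (x t)) (profile_of x) t"
proof -
  note I = time_interval_atLeast
  have xc: "continuous_on ({-r..0} \<union> {0..}) x" using x by (simp add: delay_solution_def)
  have x0C: "x0 \<in> C0 {-r..0}" using h by (simp add: loop_history_def)
  let ?g = "\<lambda>t. ffun S (hist r x t) (u t) 0"
  have gc: "continuous_on {0..} ?g" by (rule ffun_along_continuous[OF I xc u])
  have h0: "hist r x 0 = x0"
    using x x0C by (auto simp: hist_def delay_solution_def C0_iff fun_eq_iff extensional_def restrict_def)
  have x00: "x 0 = x0 0" using x r0 by (simp add: delay_solution_def)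
  have gi: "?g integrable_on {0..t}" for t
    by (rule integrable_continuous_real[OF continuous_on_subset[OF gc]]) auto
  have xeq: "x t = x0 0 + integral {0..t} ?g" if "0 \<le> t" for t using x that by (simp add: delay_solution_def)
  have xd: "(x has_vector_derivative ?g t) (at t within {0..})" if t: "0 \<le> t" for t
  proof -
    have "((\<lambda>t. integral {0..t} ?g) has_vector_derivative ?g t) (at t within {0..t + 1})"
      by (rule integral_has_vector_derivative[OF continuous_on_subset[OF gc]]) (use t in auto)
    moreover have "at t within {0..} = at t within {0..t + 1}"
      by (rule at_within_nhd[of t "{..<t + 1}"]) auto
    ultimately have "((\<lambda>t. integral {0..t} ?g) has_vector_derivative ?g t) (at t within {0..})" by simp
    then have "((\<lambda>t. x0 0 + integral {0..t} ?g) has_vector_derivative 0 + ?g t) (at t within {0..})"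
      by (intro has_vector_derivative_add has_vector_derivative_const)
    then have "((\<lambda>t. x0 0 + integral {0..t} ?g) has_vector_derivative ?g t) (at t within {0..})" by simp
    then show ?thesis by (rule has_vector_derivative_transform[rotated 2]) (use t xeq in auto)
  qed
  have same: "a t = b t" if d: "\<And>s. 0 \<le> s \<Longrightarrow> (a has_vector_derivative k s) (at s within {0..})"
      "\<And>s. 0 \<le> s \<Longrightarrow> (b has_vector_derivative k s) (at s within {0..})" and s0: "a 0 = b 0" and t: "0 \<le> t"
    for a b k :: "real \<Rightarrow> real" and t
  proof -
    have "(k has_integral a t - a 0) {0..t}"
      by (rule fundamental_theorem_of_calculus[OF t], rule has_vector_derivative_within_subset[OF d(1)]) auto
    moreover have "(k has_integral b t - b 0) {0..t}"
      by (rule fundamental_theorem_of_calculus[OF t], rule has_vector_derivative_within_subset[OF d(2)]) auto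
    ultimately have "a t - a 0 = b t - b 0" by (rule has_integral_unique)
    then show ?thesis using s0 by simp
  qed
  have e: "eta_of S (x t) i = profile_of x t (zpt S i)" if i: "i \<in> {1..N1 S}" and t: "0 \<le> t" for t i
  proof (rule same[where a = "\<lambda>s. eta_of S (x s) i" and b = "\<lambda>s. profile_of x s (zpt S i)"
        and k = "\<lambda>s. profile_rate (hist r x s) (zpt S i)", OF _ _ _ t])
    fix s :: real assume s: "0 \<le> s"
    have "?g s $ lab S (Inr (Inl i)) = profile_rate (hist r x s) (zpt S i)" unfolding ffun_components(2)[OF i] f2_eq ..
    then show "((\<lambda>s. eta_of S (x s) i) has_vector_derivative profile_rate (hist r x s) (zpt S i)) (at s within {0..})"
      unfolding eta_of_def using bounded_linear.has_vector_derivative[OF bounded_linear_vec_nth xd[OF s], of "lab S (Inr (Inl i))"] by simp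
    show "((\<lambda>s. profile_of x s (zpt S i)) has_vector_derivative profile_rate (hist r x s) (zpt S i)) (at s within {0..})"
      using s zpt_mem[OF i] by (intro profile_of_time_deriv[OF I xc]) auto
  next
    show "eta_of S (x 0) i = profile_of x 0 (zpt S i)"
      using h i zpt_mem[OF i] unfolding x00 h0 loop_history_def by metis
  qed
  have l: "lambda_of S (x t) i = integral {0..1} (\<lambda>s. gammaker S i s * profile_of x t s)" if i: "i \<in> {1..N2 S}" and t: "0 \<le> t" for t i
  proof (rule same[where a = "\<lambda>s. lambda_of S (x s) i" and k = "\<lambda>s. f3 S (hist r x s) i"
        and b = "\<lambda>t. integral {0..1} (\<lambda>z. gammaker S i z * profile_of x t z)", OF _ _ _ t])
    fix s :: real assume s: "0 \<le> s"
    have "?g s $ lab S (Inr (Inr i)) = f3 S (hist r x s) i" unfolding ffun_components(3)[OF i] ..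
    then show "((\<lambda>s. lambda_of S (x s) i) has_vector_derivative f3 S (hist r x s) i) (at s within {0..})"
      unfolding lambda_of_def using bounded_linear.has_vector_derivative[OF bounded_linear_vec_nth xd[OF s], of "lab S (Inr (Inr i))"] by simp
    show "((\<lambda>t. integral {0..1} (\<lambda>z. gammaker S i z * profile_of x t z)) has_vector_derivative f3 S (hist r x s) i) (at s within {0..})"
      using s by (intro gammaker_profile_deriv[OF I xc _ i]) auto
  next
    have "lambda_of S (x0 0) i = integral {0..1} (\<lambda>z. gammaker S i z * v0 z)" using h i by (simp add: loop_history_def)
    also have "\<dots> = integral {0..1} (\<lambda>z. gammaker S i z * profile S x0 z)"
      using h by (intro Henstock_Kurzweil_Integration.integral_cong) (auto simp: loop_history_def)
    finally show "lambda_of S (x 0) i = integral {0..1} (\<lambda>z. gammaker S i z * profile_of x 0 z)" unfolding x00 h0 .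
  qed
  show st: "x t = loop_state (\<lambda>t. xbar_of S (x t)) (profile_of x) t" if t: "0 \<le> t" for t
    by (rule state_eqI) (use e[OF _ t] l[OF _ t] in \<open>simp_all only: loop_state_def xbar_of_tuple eta_of_tuple lambda_of_tuple\<close>)
  have xbd: "((\<lambda>t. xbar_of S (x t)) has_vector_derivative f1 S (hist r x t) (u t) 0) (at t within {0..})" if t: "0 \<le> t" for t
    using bounded_linear.has_vector_derivative[OF bounded_linear_xbar_of xd[OF t]] by (simp add: ffun_def)
  have f1c: "continuous_on {0..} (\<lambda>t. f1 S (hist r x t) (u t) 0)"
    using bounded_linear.continuous_on[OF bounded_linear_xbar_of gc] by (simp add: ffun_def)
  note pc = profile_partials_continuous[OF I xc]
  show "loop_solution S {0..} v0 xb0 u (\<lambda>t. xbar_of S (x t)) (profile_of x)"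
    unfolding loop_solution_def
  proof (intro conjI ballI)
    show "C1_on {0..} (\<lambda>t. xbar_of S (x t))"
      unfolding C1_on_def
    proof (intro exI conjI ballI)
      show "continuous_on {0..} (\<lambda>t. blinfun_scaleR_left (f1 S (hist r x t) (u t) 0))"
        by (rule bounded_linear.continuous_on[OF bounded_linear_blinfun_scaleR_left f1c])
      show "((\<lambda>t. xbar_of S (x t)) has_derivative blinfun_apply (blinfun_scaleR_left (f1 S (hist r x t) (u t) 0))) (at t within {0..})"
        if "t \<in> {0..}" for t using xbd[of t] that by (simp add: has_vector_derivative_def)
    qed
    show "C1_on ({0..} \<times> {0..1}) (\<lambda>(t, z). profile_of x t z)"
      by (rule C1_on_partials[OF _ pc(1,2)]) (auto intro!: has_derivative_profile_of[OF I xc])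
    show "xbar_of S (x 0) = xb0" using h x00 by (simp add: loop_history_def)
    show "profile_of x 0 z = v0 z" if "z \<in> {0..1}" for z using h that by (simp add: h0 loop_history_def)
    show "profile_of x t 0 = 0" if "t \<in> {0..}" for t using that by (intro profile_of_zero[OF I xc])
    show "((\<lambda>t. xbar_of S (x t)) has_vector_derivative Ftil S (xbar_of S (x t)) (\<lambda>z\<in>{0..1}. profile_of x t z) (u t)) (at t within {0..})"
      if "t \<in> {0..}" for t using xbd[of t] that r0 by (simp add: f1_def hist_def)
    fix t z :: real assume t: "t \<in> {0..}" and z: "z \<in> {0..1}"
    have "at t within {0..} \<noteq> bot"
    proof -
      have "at t within {0..} = at t within {0..t + 1}" by (rule at_within_nhd[of t "{..<t + 1}"]) auto
      then show ?thesis using t by (simp add: trivial_limit_within islimpt_Icc)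
    qed
    then have 1: "vector_derivative (\<lambda>s. profile_of x s z) (at t within {0..}) = profile_rate (hist r x t) z"
      using profile_of_time_deriv[OF I xc t z] by (rule vector_derivative_within)
    have 2: "deriv01 (profile_of x t) z = profile_slope x t z"
      by (rule vector_derivative_within_cbox[of 0 1, simplified]) (use z profile_of_space_deriv[OF I xc t z] in auto)
    have tr: "profile_rate (hist r x t) z + c * profile_slope x t z = acoef S z * profile_of x t z + gbar S z (x t)"
      by (rule profile_transport[OF I xc t z])
    have gb: "gbar S z (x t) = gsrc S z (xbar_of S (x t)) + (\<Sum>i=1..N1 S. bcoef S i z * profile_of x t (zpt S i))
          + (\<Sum>i=1..N2 S. betacoef S i z * integral {0..1} (\<lambda>s. gammaker S i s * profile_of x t s))"
      using t by (subst st) (simp_all only: gbar_loop_state atLeast_iff)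
    show "vector_derivative (\<lambda>s. profile_of x s z) (at t within {0..}) + c * deriv01 (profile_of x t) z
        = acoef S z * profile_of x t z + gsrc S z (xbar_of S (x t)) + (\<Sum>i=1..N1 S. bcoef S i z * profile_of x t (zpt S i))
          + (\<Sum>i=1..N2 S. betacoef S i z * integral {0..1} (\<lambda>s. gammaker S i s * profile_of x t s))"
      unfolding 1 2 tr gb by simp
  qed
qed

lemma outmap_loop_state:
  "outmap (loop_state xb v t) $ j = qvec S j \<bullet> xb t + (\<Sum>m=1..N1 S. bbar S j m * v t (zpt S m))
        + (\<Sum>m=1..N2 S. betabar S j m * integral {0..1} (\<lambda>s. gammaker S m s * v t s))"
  by (simp add: outmap_def loop_state_def eta_of_tuple lambda_of_tuple)

text \<open>The estimated profile is the profile generated by the estimated history.\<close>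

lemma vhat_eq: "z \<in> {0..1} \<Longrightarrow> vhat S \<Psi> y t z = profile S (\<Psi> (hist r y t)) z"
proof -
  let ?h = "\<Psi> (hist r y t)"
  have "profile S ?h z = integral {- r * z..0} ((\<lambda>p. Cw S z / Cw S (z - c * (t - p)) * gbar S (z - c * (t - p)) (?h (p - t))) \<circ> (+) t)"
    by (simp add: profile_alt o_def algebra_simps)
  also have "\<dots> = integral {- r * z + t..0 + t} (\<lambda>p. Cw S z / Cw S (z - c * (t - p)) * gbar S (z - c * (t - p)) (?h (p - t)))"
    by (rule integral_shift_Icc_real)
  finally show ?thesis by (simp add: vhat_def)
qed

end

section \<open>The sampled observer of the loop\<close>

lemma class_Kinf_scale:
  assumes "\<rho> \<in> class_Kinf" "0 < A" "0 < \<kappa>"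
  shows "(\<lambda>s. A * \<rho> (\<kappa> * s)) \<in> class_Kinf"
proof -
  have \<rho>: "continuous_on {0..} \<rho>" "strict_mono_on {0..} \<rho>" "\<rho> 0 = 0" "filterlim \<rho> at_top at_top"
    using assms(1) by (auto simp: class_Kinf_def class_K_def)
  have "continuous_on {0..} (\<lambda>s. A * \<rho> (\<kappa> * s))"
    by (intro continuous_intros continuous_on_compose2[OF \<rho>(1)]) (use assms in auto)
  moreover have "strict_mono_on {0..} (\<lambda>s. A * \<rho> (\<kappa> * s))"
    using \<rho>(2) assms by (auto simp: strict_mono_on_def)
  moreover have "filterlim (\<lambda>s. \<rho> (\<kappa> * s)) at_top at_top"
    by (rule filterlim_compose[OF \<rho>(4)], rule filterlim_tendsto_pos_mult_at_top[OF tendsto_const assms(3) filterlim_ident])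
  then have "filterlim (\<lambda>s. A * \<rho> (\<kappa> * s)) at_top at_top"
    by (rule filterlim_tendsto_pos_mult_at_top[OF tendsto_const assms(2)])
  ultimately show ?thesis using \<rho>(3) by (simp add: class_Kinf_def class_K_def)
qed

context pde_loop begin

lemma xbar_of_loop_state: "xbar_of S (loop_state xb v t) = xb t"
  by (simp add: loop_state_def)

lemma state_supnorm_le:
  assumes x: "continuous_on {-r..0} x"
  shows "supnorm {-r..0} x \<le> CARD('n) * (supnorm {-r..0} (\<lambda>p. xbar_of S (x p))
    + supnorm {-r..0} (\<lambda>p. L2_set (eta_of S (x p)) {1..N1 S}) + supnorm {-r..0} (\<lambda>p. L2_set (lambda_of S (x p)) {1..N2 S}))"
    (is "_ \<le> _ * (?a + ?b + ?d)")
proof (rule supnorm_le)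
  show "- r \<le> 0" using r0 by simp
  fix p assume p: "p \<in> {-r..0}"
  have cont: "continuous_on {-r..0} (\<lambda>p. L2_set (eta_of S (x p)) {1..N1 S})" "continuous_on {-r..0} (\<lambda>p. L2_set (lambda_of S (x p)) {1..N2 S})"
    unfolding L2_set_def by (intro continuous_intros continuous_on_state[OF x])+
  have a: "norm (xbar_of S (x p)) \<le> ?a" by (rule norm_le_supnorm[OF continuous_on_state(1)[OF x] p])
  have b: "L2_set (eta_of S (x p)) {1..N1 S} \<le> ?b" using norm_le_supnorm[OF cont(1) p] by simp
  have d: "L2_set (lambda_of S (x p)) {1..N2 S} \<le> ?d" using norm_le_supnorm[OF cont(2) p] by simp
  note nn = order_trans[OF norm_ge_zero a] order_trans[OF L2_set_nonneg b] order_trans[OF L2_set_nonneg d]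
  have "\<bar>x p $ j\<bar> \<le> ?a + ?b + ?d" for j
  proof (cases rule: lab_cases[of j])
    case (xbar i)
    have "\<bar>x p $ j\<bar> = \<bar>xbar_of S (x p) $ i\<bar>" by (simp add: xbar xbar_of_def)
    also have "\<dots> \<le> norm (xbar_of S (x p))" by (rule component_le_norm_cart)
    finally show ?thesis using a nn by linarith
  next
    case (eta i)
    have "\<bar>x p $ j\<bar> = sqrt ((eta_of S (x p) i)\<^sup>2)" by (simp add: eta(2) eta_of_def)
    also have "\<dots> \<le> L2_set (eta_of S (x p)) {1..N1 S}"
      unfolding L2_set_def by (intro real_sqrt_le_mono member_le_sum[OF eta(1)]) auto
    finally show ?thesis using b nn by linarith
  next
    case (lambda i)
    have "\<bar>x p $ j\<bar> = sqrt ((lambda_of S (x p) i)\<^sup>2)" by (simp add: lambda(2) lambda_of_def)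
    also have "\<dots> \<le> L2_set (lambda_of S (x p)) {1..N2 S}"
      unfolding L2_set_def by (intro real_sqrt_le_mono member_le_sum[OF lambda(1)]) auto
    finally show ?thesis using d nn by linarith
  qed
  then have "(\<Sum>j\<in>UNIV. \<bar>x p $ j\<bar>) \<le> of_nat CARD('n) * (?a + ?b + ?d)" by (intro sum_bounded_above)
  then show "norm (x p) \<le> CARD('n) * (?a + ?b + ?d)" by (rule order_trans[OF norm_le_l1_cart])
qed

text \<open>Once the loop is solved, the remaining equations are those of the predictor for the associated delay
  system, with the noisy samples of its output as reset values.\<close>

lemma sampled_solution_iff:
  assumes loop: "loop_solution S I v0 xb0 u xb v" and x: "\<And>t. t \<in> I \<Longrightarrow> x t = loop_state xb v t"
    and O: "driven_observer r (ffun S) outmap F \<Psi> \<gamma> \<sigma> g0 a0 Lf z0 u"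
  shows "sampled_solution S F \<Psi> I \<tau> v0 xb0 z0 u \<xi> xb v z w \<longleftrightarrow>
    driven_observer.predictor_solution r (ffun S) outmap F \<Psi> z0 u I \<tau> (\<lambda>i. \<xi> (\<tau> i) + outmap (x (\<tau> i))) z w"
proof -
  interpret driven_observer r "ffun S" outmap F \<Psi> \<gamma> \<sigma> g0 a0 Lf z0 u by (rule O)
  have "(\<forall>j. w (\<tau> i) $ j = \<xi> (\<tau> i) $ j + qvec S j \<bullet> xb (\<tau> i) + (\<Sum>m=1..N1 S. bbar S j m * v (\<tau> i) (zpt S m))
        + (\<Sum>m=1..N2 S. betabar S j m * integral {0..1} (\<lambda>s. gammaker S m s * v (\<tau> i) s)))
      \<longleftrightarrow> w (\<tau> i) = \<xi> (\<tau> i) + outmap (x (\<tau> i))" if "\<tau> i \<in> I" for i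
    unfolding vec_eq_iff x[OF that] vector_add_component outmap_loop_state by (simp add: add.assoc)
  then show ?thesis
    using loop unfolding sampled_solution_def predictor_solution_def Rfun_eq by blast
qed

end

theorem theorem3p2:
  fixes S :: "('b::finite, 'm::finite, 'k::finite, 'n::finite) pde_ode"
    and F :: "(real \<Rightarrow> real ^ 'l::finite) \<Rightarrow> real ^ 'k \<Rightarrow> real ^ 'm \<Rightarrow> real ^ 'l"
    and \<Psi> :: "(real \<Rightarrow> real ^ 'l) \<Rightarrow> (real \<Rightarrow> real ^ 'n)"
    and H :: "real ^ 'n ^ 'b"
    and r \<gamma> \<sigma> :: real and g0 a0 :: "real \<Rightarrow> real"
  assumes data: "admissible_data S"
    and r: "r = delay S"
    and H: "\<And>x. H *v x = xbar_of S x"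
    and Ftil_cont: "continuous_map
          (prod_topology euclidean (prod_topology (C0top {0..1}) euclidean)) euclidean
          (\<lambda>(x, v, u). Ftil S x v u)"
    and g_C1: "C1_on ({0..1} \<times> UNIV) (\<lambda>(z, x). gsrc S z x)"
    and Ftil_zero: "Ftil S 0 (\<lambda>z\<in>{0..1}. 0) 0 = 0"
    and g_zero: "\<And>z. z \<in> {0..1} \<Longrightarrow> gsrc S z 0 = 0"
    and Lipschitz: "\<exists>L>0.
          (\<forall>x y u. \<forall>v\<in>C0 {0..1}. \<forall>w\<in>C0 {0..1}. norm (Ftil S x v u - Ftil S y w u)
             \<le> L * supnorm {0..1} (\<lambda>z. v z - w z) + L * norm (x - y)) \<and>
          (\<forall>x y. supnorm {0..1} (\<lambda>z. gsrc S z x - gsrc S z y) \<le> L * norm (x - y))"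
    and history: "\<exists>G>0. \<forall>v0 xb0. compatible S v0 xb0 \<longrightarrow>
          (\<exists>x\<in>C0 {-r..0}.
             xbar_of S (x 0) = xb0 \<and>
             (\<forall>i\<in>{1..N1 S}. eta_of S (x 0) i = v0 (zpt S i)) \<and>
             (\<forall>i\<in>{1..N2 S}. lambda_of S (x 0) i = integral {0..1} (\<lambda>z. gammaker S i z * v0 z)) \<and>
             supnorm {-r..0} (\<lambda>p. xbar_of S (x p))
               + supnorm {-r..0} (\<lambda>p. L2_set (eta_of S (x p)) {1..N1 S})
               + supnorm {-r..0} (\<lambda>p. L2_set (lambda_of S (x p)) {1..N2 S})
             \<le> G * (supnorm {0..1} v0 + supnorm {0..1} (deriv01 v0) + norm xb0) \<and>
             (\<forall>s\<in>{0..1}. v0 s = profile S x s))"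
    and dg_Lipschitz: "\<exists>L>0. \<forall>x y.
          supnorm {0..1} (\<lambda>z. deriv01 (\<lambda>y'. gsrc S y' x) z - deriv01 (\<lambda>y'. gsrc S y' y) z)
            \<le> L * norm (x - y)"
    and observer: "REO r UNIV {0} (ffun S) (hfun S) F \<Psi> \<gamma> \<sigma> g0 a0"
    and R_Lipschitz: "\<And>B. B \<subseteq> C0 {-r..0} \<times> UNIV \<Longrightarrow>
          bounded ((\<lambda>(z, u). (supnorm {-r..0} z, u)) ` B) \<Longrightarrow>
          \<exists>L\<ge>0. \<forall>z z' u. (z, u) \<in> B \<and> (z', u) \<in> B \<longrightarrow>
            norm (Rfun S (\<Psi> z) u 0 - Rfun S (\<Psi> z') u 0)
              \<le> L * supnorm {-r..0} (\<lambda>\<theta>. z \<theta> - z' \<theta>)"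
  shows "\<exists>\<delta>>0. \<exists>P>0. \<exists>\<omega>>0. \<exists>abar\<in>class_Kinf.
    ((\<exists>\<kappa>. \<forall>s\<ge>0. a0 s = \<kappa> * s) \<longrightarrow> (\<exists>\<kappa>. \<forall>s\<ge>0. abar s = \<kappa> * s)) \<and>
    (\<forall>\<tau> v0 xb0 u. \<forall>z0\<in>C0 {-r..0}. \<forall>\<xi>\<in>Linf_loc UNIV.
       \<tau> 0 = 0 \<and> filterlim \<tau> at_top sequentially \<and>
       (\<forall>i. 0 < \<tau> (Suc i) - \<tau> i \<and> \<tau> (Suc i) - \<tau> i \<le> \<delta>) \<and>
       compatible S v0 xb0 \<and> continuous_on {0..} u \<longrightarrow>
       (\<exists>xb v z w. sampled_solution S F \<Psi> {0..} \<tau> v0 xb0 z0 u \<xi> xb v z w) \<and>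
       (\<forall>T>0. \<forall>xb v z w. sampled_solution S F \<Psi> {0..<T} \<tau> v0 xb0 z0 u \<xi> xb v z w \<longrightarrow>
          (\<exists>xb' v' z' w'. sampled_solution S F \<Psi> {0..} \<tau> v0 xb0 z0 u \<xi> xb' v' z' w' \<and>
             (\<forall>t\<in>{0..<T}. xb' t = xb t \<and> (\<forall>y\<in>{0..1}. v' t y = v t y) \<and> z' t = z t \<and> w' t = w t))) \<and>
       (\<forall>xb v z w. sampled_solution S F \<Psi> {0..} \<tau> v0 xb0 z0 u \<xi> xb v z w \<longrightarrow>
          (\<forall>t\<ge>0.
             norm (xb t - H *v (\<Psi> (hist r z t) 0))
               + supnorm {0..1} (\<lambda>y. v t y - vhat S \<Psi> z t y)
             \<le> exp (- \<omega> * t)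
                 * abar (supnorm {0..1} v0 + supnorm {0..1} (deriv01 v0) + norm xb0 + supnorm {-r..0} z0)
               + P * (SUP s\<in>{0..t}. norm (\<xi> s) * exp (- \<omega> * (t - s))))))"
proof -
  obtain L1 where L1: "L1 > 0"
    "\<And>x y u v w. v \<in> C0 {0..1} \<Longrightarrow> w \<in> C0 {0..1} \<Longrightarrow> norm (Ftil S x v u - Ftil S y w u)
       \<le> L1 * supnorm {0..1} (\<lambda>z. v z - w z) + L1 * norm (x - y)"
    "\<And>x y. supnorm {0..1} (\<lambda>z. gsrc S z x - gsrc S z y) \<le> L1 * norm (x - y)"
    using Lipschitz by blast
  obtain L2 where L2: "\<And>x y. supnorm {0..1} (\<lambda>z. deriv01 (\<lambda>y'. gsrc S y' x) z - deriv01 (\<lambda>y'. gsrc S y' y) z) \<le> L2 * norm (x - y)"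
    using dg_Lipschitz by blast
  define L where "L = max L1 L2"
  have L: "L1 \<le> L" "L2 \<le> L" by (auto simp: L_def)
  interpret pde_loop S L
  proof
    show "0 < L" using L L1(1) by simp
    show "norm (Ftil S x v u - Ftil S y w u) \<le> L * supnorm {0..1} (\<lambda>z. v z - w z) + L * norm (x - y)"
      if "v \<in> C0 {0..1}" "w \<in> C0 {0..1}" for x y u v w
      using order_trans[OF L1(2)[OF that] add_mono[OF mult_right_mono[OF L(1)] mult_right_mono[OF L(1)]]]
        C0_diff_supnorm_nonneg[OF _ that] by simp
    show "supnorm {0..1} (\<lambda>z. gsrc S z x - gsrc S z y) \<le> L * norm (x - y)" for x y
      by (rule order_trans[OF L1(3) mult_right_mono[OF L(1)]]) simp
    show "supnorm {0..1} (\<lambda>z. deriv01 (\<lambda>y'. gsrc S y' x) z - deriv01 (\<lambda>y'. gsrc S y' y) z) \<le> L * norm (x - y)" for x y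
      by (rule order_trans[OF L2 mult_right_mono[OF L(2)]]) simp
  qed (rule data Ftil_cont g_C1)+
  obtain Lf where Lf: "\<forall>g\<in>C0 {-r..0}. \<forall>h\<in>C0 {-r..0}. \<forall>u.
    norm (ffun S g u 0 - ffun S h u 0) \<le> Lf * supnorm {-r..0} (\<lambda>\<theta>. g \<theta> - h \<theta>)" using ffun_Lipschitz unfolding r by blast
  have hfun: "hfun S = (\<lambda>h. outmap (h 0))" by (rule ext) (rule hfun_eq)
  interpret D: observed_delay_system r "ffun S" outmap F \<Psi> \<gamma> \<sigma> g0 a0 Lf
  proof (rule observed_delay_system.intro)
    show "0 \<le> r" using r0 r by simp
    show "REO r UNIV {0} (ffun S) (\<lambda>\<phi>. outmap (\<phi> 0)) F \<Psi> \<gamma> \<sigma> g0 a0" using observer unfolding hfun .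
    show "bounded_linear outmap" by (rule bounded_linear_outmap)
    show "norm (ffun S \<phi> u 0 - ffun S \<psi> u 0) \<le> Lf * supnorm {-r..0} (\<lambda>\<theta>. \<phi> \<theta> - \<psi> \<theta>)"
      if "\<phi> \<in> C0 {-r..0}" "\<psi> \<in> C0 {-r..0}" for \<phi> \<psi> u using Lf that by blast
    show "continuous_on UNIV (\<lambda>u. ffun S \<phi> u 0)" if "\<phi> \<in> C0 {-r..0}" for \<phi>
      using ffun_input_continuous that unfolding r by blast
    show "\<exists>L\<ge>0. \<forall>z z' u. (z, u) \<in> B \<and> (z', u) \<in> B \<longrightarrow>
          norm (outmap (ffun S (\<Psi> z) u 0) - outmap (ffun S (\<Psi> z') u 0)) \<le> L * supnorm {-r..0} (\<lambda>\<theta>. z \<theta> - z' \<theta>)"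
      if "B \<subseteq> C0 {-r..0} \<times> UNIV" "bounded ((\<lambda>(z, u). (supnorm {-r..0} z, u)) ` B)" for B
      using R_Lipschitz[OF that] unfolding Rfun_eq .
  qed
  obtain Kp where Kp: "0 \<le> Kp" "\<forall>z\<in>{0..1}. \<forall>g\<in>C0 {-r..0}. \<forall>h\<in>C0 {-r..0}.
    \<bar>profile S g z - profile S h z\<bar> \<le> Kp * supnorm {-r..0} (\<lambda>\<theta>. g \<theta> - h \<theta>)" using profile_Lipschitz unfolding r by blast
  obtain G where G: "G > 0" and hist: "\<forall>v0 xb0. compatible S v0 xb0 \<longrightarrow>
          (\<exists>x\<in>C0 {-r..0}.
             xbar_of S (x 0) = xb0 \<and>
             (\<forall>i\<in>{1..N1 S}. eta_of S (x 0) i = v0 (zpt S i)) \<and>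
             (\<forall>i\<in>{1..N2 S}. lambda_of S (x 0) i = integral {0..1} (\<lambda>z. gammaker S i z * v0 z)) \<and>
             supnorm {-r..0} (\<lambda>p. xbar_of S (x p))
               + supnorm {-r..0} (\<lambda>p. L2_set (eta_of S (x p)) {1..N1 S})
               + supnorm {-r..0} (\<lambda>p. L2_set (lambda_of S (x p)) {1..N2 S})
             \<le> G * (supnorm {0..1} v0 + supnorm {0..1} (deriv01 v0) + norm xb0) \<and>
             (\<forall>s\<in>{0..1}. v0 s = profile S x s))"
    using history by (elim exE conjE)
  \<comment> \<open>The sampling period makes the gain \<open>\<delta> LR \<gamma> exp \<sigma>\<close> of the inter-sample error at most \<open>1 / 2\<close>.\<close>
  define q where "q = 2 * D.LR * \<gamma> * exp \<sigma>"
  have q: "0 < q" using D.LR_pos D.\<gamma> by (simp add: q_def)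
  define \<delta> where "\<delta> = min 1 (1 / q)"
  have \<delta>: "0 < \<delta>" "\<delta> \<le> 1" using q by (auto simp: \<delta>_def)
  have "\<delta> * q \<le> 1 / q * q" using q by (intro mult_right_mono) (auto simp: \<delta>_def)
  also have "\<dots> = 1" using q by simp
  finally have gain: "\<delta> * D.LR * \<gamma> * exp \<sigma> \<le> 1 / 2" using q by (simp add: q_def mult_ac)
  have "\<delta> * D.LR * \<gamma> * 1 \<le> \<delta> * D.LR * \<gamma> * exp \<sigma>"
    using \<delta> D.LR_pos D.\<gamma> D.\<sigma> by (intro mult_left_mono) auto
  then have gain': "\<delta> * D.LR * \<gamma> \<le> 1 / 2" using gain by simp
  \<comment> \<open>The state estimate and the profile estimate both depend Lipschitz continuously on the history; A adds the two constants.\<close>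
  define A where "A = CARD('b) + Kp"
  have A: "0 < A" using Kp by (simp add: A_def add_pos_nonneg)
  \<comment> \<open>Bounds the norm of the history x0 and of z0 in terms of the norms of the initial data.\<close>
  define \<kappa> where "\<kappa> = CARD('n) * G + 1"
  have \<kappa>: "1 \<le> \<kappa>" using G by (simp add: \<kappa>_def)
  define abar where "abar s = (2 * A) * a0 (\<kappa> * s)" for s
  have abar: "abar \<in> class_Kinf" unfolding abar_def[abs_def] using A \<kappa> by (intro class_Kinf_scale D.a0) auto
  have a0_mono: "a0 s \<le> a0 t" if "0 \<le> s" "s \<le> t" for s t
    using D.a0 that by (auto simp: class_Kinf_def class_K_def strict_mono_on_def less_eq_real_def)
  define P where "P = A * (2 * \<gamma> * exp \<sigma>)"
  have P: "0 < P" using A D.\<gamma> by (simp add: P_def)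
  have lin: "(\<exists>\<kappa>. \<forall>s\<ge>0. a0 s = \<kappa> * s) \<longrightarrow> (\<exists>\<kappa>. \<forall>s\<ge>0. abar s = \<kappa> * s)"
  proof
    assume "\<exists>\<kappa>. \<forall>s\<ge>0. a0 s = \<kappa> * s"
    then obtain k where k: "\<forall>s\<ge>0. a0 s = k * s" by blast
    have "abar s = (2 * A * k * \<kappa>) * s" if "0 \<le> s" for s
      using k[rule_format, of "\<kappa> * s"] that \<kappa> by (simp add: abar_def)
    then show "\<exists>\<kappa>. \<forall>s\<ge>0. abar s = \<kappa> * s" by blast
  qed
  show ?thesis
  proof (rule exI[of _ \<delta>], rule conjI[OF \<delta>(1)], rule exI[of _ P], rule conjI[OF P], rule exI[of _ \<sigma>], rule conjI[OF D.\<sigma>],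
      rule bexI[OF _ abar], rule conjI[OF lin], intro allI ballI impI, elim conjE)
    fix \<tau> :: "nat \<Rightarrow> real" and v0 :: "real \<Rightarrow> real" and xb0 :: "real ^ 'b" and u :: "real \<Rightarrow> real ^ 'm"
      and z0 :: "real \<Rightarrow> real ^ 'l" and \<xi> :: "real \<Rightarrow> real ^ 'k"
    assume z0: "z0 \<in> C0 {-r..0}" and \<xi>: "\<xi> \<in> Linf_loc UNIV"
      and "\<tau> 0 = 0" "filterlim \<tau> at_top sequentially" "\<forall>i. 0 < \<tau> (Suc i) - \<tau> i \<and> \<tau> (Suc i) - \<tau> i \<le> \<delta>"
      and compat: "compatible S v0 xb0" and u: "continuous_on {0..} u"
    then have samp: "sampling_sequence \<delta> \<tau>" by (auto simp: sampling_sequence_def)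
    interpret O: driven_observer r "ffun S" outmap F \<Psi> \<gamma> \<sigma> g0 a0 Lf z0 u
      by unfold_locales (rule z0 u)+
    have dO: "driven_observer (delay S) (ffun S) outmap F \<Psi> \<gamma> \<sigma> g0 a0 Lf z0 u"
      using O.driven_observer_axioms unfolding r .
    define N where "N = supnorm {0..1} v0 + supnorm {0..1} (deriv01 v0) + norm xb0"
    have v0: "C1_on {0..1} v0" using compat by (simp add: compatible_def)
    have N: "0 \<le> N" unfolding N_def
      using supnorm_nonneg[OF _ C1_on_continuous[OF v0]] supnorm_nonneg[OF _ C1_on_deriv01(2)[OF v0]] by simp
    obtain x0 where h: "loop_history v0 xb0 x0" and x0: "x0 \<in> C0 {-r..0}" and x0N: "supnorm {-r..0} x0 \<le> CARD('n) * (G * N)"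
    proof -
      obtain x0 where x0: "x0 \<in> C0 {-r..0}" "xbar_of S (x0 0) = xb0" "\<forall>i\<in>{1..N1 S}. eta_of S (x0 0) i = v0 (zpt S i)"
        "\<forall>i\<in>{1..N2 S}. lambda_of S (x0 0) i = integral {0..1} (\<lambda>z. gammaker S i z * v0 z)"
        "supnorm {-r..0} (\<lambda>p. xbar_of S (x0 p)) + supnorm {-r..0} (\<lambda>p. L2_set (eta_of S (x0 p)) {1..N1 S})
               + supnorm {-r..0} (\<lambda>p. L2_set (lambda_of S (x0 p)) {1..N2 S}) \<le> G * N"
        "\<forall>s\<in>{0..1}. v0 s = profile S x0 s"
        using hist[rule_format, OF compat] unfolding N_def by (elim bexE conjE)
      have "loop_history v0 xb0 x0" using x0 unfolding loop_history_def r by (intro conjI)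
      moreover have "supnorm {-r..0} x0 \<le> CARD('n) * (G * N)"
        using state_supnorm_le[of x0] x0(1,5) unfolding r C0_iff by (meson mult_left_mono of_nat_0_le_iff order_trans)
      ultimately show ?thesis using that x0(1) by blast
    qed
    obtain x where x: "delay_solution r {0..} x0 (\<lambda>t \<phi>. ffun S \<phi> (u t) 0) x"
      using D.plant_solution_exists[OF u x0] .
    define y where "y i = \<xi> (\<tau> i) + outmap (x (\<tau> i))" for i
    let ?xb = "\<lambda>t. xbar_of S (x t)" and ?v = "profile_of x"
    note loop = delay_solution_imp_loop_solution[OF x[unfolded r] h u]
    have glob: "sampled_solution S F \<Psi> {0..} \<tau> v0 xb0 z0 u \<xi> ?xb ?v z w \<longleftrightarrow> O.predictor_solution {0..} \<tau> y z w" for z w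
      unfolding y_def using sampled_solution_iff[OF loop(1) loop(2) dO, of \<tau> \<xi> z w] unfolding r by simp
    have A1: "\<exists>xb v z w. sampled_solution S F \<Psi> {0..} \<tau> v0 xb0 z0 u \<xi> xb v z w"
      using O.predictor_solution_exists[OF samp gain', of y] glob by blast
    have A2: "\<exists>xb' v' z' w'. sampled_solution S F \<Psi> {0..} \<tau> v0 xb0 z0 u \<xi> xb' v' z' w' \<and>
             (\<forall>t\<in>{0..<T}. xb' t = xb t \<and> (\<forall>y\<in>{0..1}. v' t y = v t y) \<and> z' t = z t \<and> w' t = w t)"
      if T: "0 < T" and s: "sampled_solution S F \<Psi> {0..<T} \<tau> v0 xb0 z0 u \<xi> xb v z w" for T xb v z w
    proof -
      have ls: "loop_solution S {0..<T} v0 xb0 u xb v" using s by (simp add: sampled_solution_def)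
      have uT: "continuous_on {0..<T} u" by (rule continuous_on_subset[OF u]) auto
      obtain x1 where x1: "delay_solution r {0..<T} x0 (\<lambda>t \<phi>. ffun S \<phi> (u t) 0) x1"
        "\<And>t. t \<in> {0..<T} \<Longrightarrow> x1 t = loop_state xb v t"
        "\<And>t z. t \<in> {0..<T} \<Longrightarrow> z \<in> {0..1} \<Longrightarrow> v t z = profile_of x1 t z"
        using loop_solution_imp_delay_solution[OF time_interval_atLeastLessThan[OF T] ls h uT] unfolding r by blast
      have xT: "delay_solution r {0..<T} x0 (\<lambda>t \<phi>. ffun S \<phi> (u t) 0) x"
        by (rule delay_solution_subset[OF x]) auto
      have xx: "x1 t = x t" if "t \<in> {-r..0} \<union> {0..<T}" for t
        by (rule D.plant_solution_unique[OF x1(1) xT _ that]) auto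
      have hh: "hist r x1 t = hist r x t" if t: "t \<in> {0..<T}" for t
        unfolding hist_def by (rule restrict_ext, rule xx) (use t in auto)
      have ps: "O.predictor_solution {0..<T} \<tau> (\<lambda>i. \<xi> (\<tau> i) + outmap (x1 (\<tau> i))) z w"
        using sampled_solution_iff[OF ls x1(2) dO, of \<tau> \<xi> z w] s unfolding r by simp
      have "O.predictor_solution {0..<T} \<tau> y z w"
        using ps xx unfolding O.predictor_solution_def y_def by auto
      then obtain z' w' where zw: "O.predictor_solution {0..} \<tau> y z' w'" "\<forall>t\<in>{0..<T}. z' t = z t \<and> w' t = w t"
        using O.predictor_solution_extend[OF samp gain' T] by blast
      have "?xb t = xb t" if t: "t \<in> {0..<T}" for t
        using xx[of t] t by (simp add: x1(2)[OF t] xbar_of_loop_state flip: xx[of t])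
      moreover have "?v t y = v t y" if t: "t \<in> {0..<T}" and y: "y \<in> {0..1}" for t y
        using x1(3)[OF t y] hh[OF t] unfolding r by simp
      ultimately show ?thesis using zw glob[of z' w'] by blast
    qed
    have A3: "norm (xb t - H *v (\<Psi> (hist r z t) 0)) + supnorm {0..1} (\<lambda>y. v t y - vhat S \<Psi> z t y)
             \<le> exp (- \<sigma> * t) * abar (N + supnorm {-r..0} z0) + P * (SUP s\<in>{0..t}. norm (\<xi> s) * exp (- \<sigma> * (t - s)))"
      if s: "sampled_solution S F \<Psi> {0..} \<tau> v0 xb0 z0 u \<xi> xb v z w" and t: "0 \<le> t" for xb v z w t
    proof -
      have ls: "loop_solution S {0..} v0 xb0 u xb v" using s by (simp add: sampled_solution_def)
      obtain x1 where x1: "delay_solution r {0..} x0 (\<lambda>t \<phi>. ffun S \<phi> (u t) 0) x1"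
        "\<And>t. t \<in> {0..} \<Longrightarrow> x1 t = loop_state xb v t"
        "\<And>t z. t \<in> {0..} \<Longrightarrow> z \<in> {0..1} \<Longrightarrow> v t z = profile_of x1 t z"
        using loop_solution_imp_delay_solution[OF time_interval_atLeast ls h u] unfolding r by blast
      have ps: "O.predictor_solution {0..} \<tau> (\<lambda>i. \<xi> (\<tau> i) + outmap (x1 (\<tau> i))) z w"
        using sampled_solution_iff[OF ls x1(2) dO, of \<tau> \<xi> z w] s unfolding r by simp
      define e where "e = supnorm {-r..0} (\<lambda>\<theta>. \<Psi> (hist r z t) \<theta> - hist r x1 t \<theta>)"
      define W where "W = (SUP s\<in>{0..t}. norm (\<xi> s) * exp (- \<sigma> * (t - s)))"
      have e: "e \<le> exp (- \<sigma> * t) * (2 * a0 (supnorm {-r..0} x0 + supnorm {-r..0} z0)) + 2 * \<gamma> * exp \<sigma> * W"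
        unfolding e_def W_def by (rule O.predictor_estimate[OF samp \<delta>(2) gain x0 x1(1) \<xi> ps t])
      have hx: "hist r x1 t \<in> C0 {-r..0}"
      proof -
        have "continuous_on ({-r..0} \<union> {0..}) x1" using x1(1) by (simp add: delay_solution_def)
        then show ?thesis using t by (intro hist_in_C0) (auto elim!: continuous_on_subset)
      qed
      have hz: "hist r z t \<in> C0 {-r..0}"
      proof -
        have "continuous_on ({-r..0} \<union> {0..}) z" using ps by (simp add: O.predictor_solution_def delay_solution_def)
        then show ?thesis using t by (intro hist_in_C0) (auto elim!: continuous_on_subset)
      qed
      have \<Psi>z: "\<Psi> (hist r z t) \<in> C0 {-r..0}" by (rule D.Psi_C0[OF hz])
      have 0: "0 \<in> {-r..0}" using D.r by simp
      have "xb t - H *v (\<Psi> (hist r z t) 0) = xbar_of S (hist r x1 t 0 - \<Psi> (hist r z t) 0)"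
        using t by (simp add: H x1(2) xbar_of_loop_state flip: state_diff(1))
      then have "norm (xb t - H *v (\<Psi> (hist r z t) 0)) \<le> CARD('b) * norm (\<Psi> (hist r z t) 0 - hist r x1 t 0)"
        using state_bounds(1)[of "hist r x1 t 0 - \<Psi> (hist r z t) 0"] by (simp only: norm_minus_commute)
      also have "\<dots> \<le> CARD('b) * e"
        unfolding e_def by (intro mult_left_mono C0_diff_le_supnorm[OF \<Psi>z hx 0]) simp
      finally have 1: "norm (xb t - H *v (\<Psi> (hist r z t) 0)) \<le> CARD('b) * e" .
      have 2: "supnorm {0..1} (\<lambda>y. v t y - vhat S \<Psi> z t y) \<le> Kp * e"
      proof (rule supnorm_le)
        fix y :: real assume y: "y \<in> {0..1}"
        have "v t y - vhat S \<Psi> z t y = - (profile S (\<Psi> (hist r z t)) y - profile S (hist r x1 t) y)"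
          using t by (simp add: x1(3)[OF _ y] vhat_eq[OF y] flip: r)
        then show "norm (v t y - vhat S \<Psi> z t y) \<le> Kp * e"
          unfolding e_def using Kp(2)[rule_format, OF y \<Psi>z hx] by (simp only: norm_minus_cancel real_norm_def)
      qed simp
      have "supnorm {-r..0} x0 + supnorm {-r..0} z0 \<le> \<kappa> * (N + supnorm {-r..0} z0)"
      proof -
        have z0n: "0 \<le> supnorm {-r..0} z0" using z0 D.r by (intro supnorm_nonneg) (auto simp: C0_iff)
        have "supnorm {-r..0} z0 \<le> \<kappa> * supnorm {-r..0} z0" using mult_right_mono[OF \<kappa> z0n] by simp
        moreover have "CARD('n) * (G * N) \<le> \<kappa> * N" using N by (simp add: \<kappa>_def algebra_simps)
        ultimately show ?thesis using x0N by (simp add: distrib_left)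
      qed
      moreover have "0 \<le> supnorm {-r..0} x0 + supnorm {-r..0} z0"
        using z0 x0 D.r by (intro add_nonneg_nonneg supnorm_nonneg) (auto simp: C0_iff)
      ultimately have a: "a0 (supnorm {-r..0} x0 + supnorm {-r..0} z0) \<le> a0 (\<kappa> * (N + supnorm {-r..0} z0))"
        by (intro a0_mono)
      have "norm (xb t - H *v (\<Psi> (hist r z t) 0)) + supnorm {0..1} (\<lambda>y. v t y - vhat S \<Psi> z t y) \<le> A * e"
        using 1 2 by (simp add: A_def distrib_right)
      also have "\<dots> \<le> A * (exp (- \<sigma> * t) * (2 * a0 (\<kappa> * (N + supnorm {-r..0} z0))) + 2 * \<gamma> * exp \<sigma> * W)"
        using A by (intro mult_left_mono order_trans[OF e] add_right_mono) (auto intro!: a)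
      also have "\<dots> = exp (- \<sigma> * t) * abar (N + supnorm {-r..0} z0) + P * W"
        by (simp add: abar_def P_def algebra_simps)
      finally show ?thesis unfolding W_def .
    qed
    show "(\<exists>xb v z w. sampled_solution S F \<Psi> {0..} \<tau> v0 xb0 z0 u \<xi> xb v z w) \<and>
       (\<forall>T>0. \<forall>xb v z w. sampled_solution S F \<Psi> {0..<T} \<tau> v0 xb0 z0 u \<xi> xb v z w \<longrightarrow>
          (\<exists>xb' v' z' w'. sampled_solution S F \<Psi> {0..} \<tau> v0 xb0 z0 u \<xi> xb' v' z' w' \<and>
             (\<forall>t\<in>{0..<T}. xb' t = xb t \<and> (\<forall>y\<in>{0..1}. v' t y = v t y) \<and> z' t = z t \<and> w' t = w t))) \<and>
       (\<forall>xb v z w. sampled_solution S F \<Psi> {0..} \<tau> v0 xb0 z0 u \<xi> xb v z w \<longrightarrow>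
          (\<forall>t\<ge>0.
             norm (xb t - H *v (\<Psi> (hist r z t) 0))
               + supnorm {0..1} (\<lambda>y. v t y - vhat S \<Psi> z t y)
             \<le> exp (- \<sigma> * t)
                 * abar (supnorm {0..1} v0 + supnorm {0..1} (deriv01 v0) + norm xb0 + supnorm {-r..0} z0)
               + P * (SUP s\<in>{0..t}. norm (\<xi> s) * exp (- \<sigma> * (t - s)))))"
      using A1 A2 A3 unfolding N_def by (intro conjI allI impI) simp_all
  qed
qed

end
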